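(* Let $n\ge 0$ and let $(X_t)_{t\in[0,T]}$ be an $(n+1)$-times $(W,t)$-differentiable process with expansion $X_t=\langle c,\widehat{\mathbb W}_t\rangle+\varepsilon_n(t)$, satisfying the moment condition (for some $\delta>0$ and $N\in\mathbb N$). Then for each $f\in C^{n+1}_p(\mathbb R)$ with $\sup_x|f'(x)|<\infty$, as $t\downarrow 0$, $$\mathbb E_0[f(X_t)]=f(X_0)+\sum_{\ell=1}^{\lceil n/2\rceil}\frac{1}{\ell!}\bigg(\sum_{k_1,\ldots,k_\ell=0}^{2} f^{(k_1+\cdots+k_\ell)}(X_0)\,\langle\emptyset,\mathcal G_{c,k_1,\ldots,k_\ell}(\emptyset)\rangle\bigg)t^\ell+o(t^{n/2}).$$
   Context: Setting: a filtered probability space $(\Omega,\mathcal F,(\mathcal F_t),P)$ carrying a $d$-dimensional standard Brownian motion $W=(W^1,\ldots,W^d)$; $\mathbb E_0$ denotes conditional expectation given $\mathcal F_0$. Set $\widehat W^0_t:=t$ and $\widehat W^i_t:=W^i_t$ for $i=1,\ldots,d$. Words: a word is $I=(i_1,\ldots,i_k)\in\{0,\ldots,d\}^k$, $k\ge0$ (the empty word is $\emptyset$); $|I|:=k$, $I':=(i_1,\ldots,i_{k-1})$ for $I\neq\emptyset$, and $\emptyset':=0$ (the zero vector). We work in the vector space of finite (real or complex) linear combinations of words; for such a combination $x=\sum_H x_H H$ and a letter $a$, $xa:=\sum_H x_H (H,a)$ (append the letter $a$), and $\langle\emptyset,x\rangle:=x_\emptyset$ is the coefficient of the empty word. Time-extended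 Itô signature: $\langle\emptyset,\widehat{\mathbb W}_t\rangle:=1$ and for $I\ne\emptyset$, $\langle I,\widehat{\mathbb W}_t\rangle:=\int_0^t\int_0^{t_k}\cdots\int_0^{t_2}1\,d\widehat W^{i_1}_{t_1}\cdots d\widehat W^{i_k}_{t_k}$ (iterated Itô integrals), i.e. $\langle I,\widehat{\mathbb W}_t\rangle=\int_0^t\langle I',\widehat{\mathbb W}_s\rangle d\widehat W^{i_k}_s$. For a finite family $c=(c_I)$ of ($\mathcal F_0$-measurable) coefficients, $\langle c,\widehat{\mathbb W}_t\rangle:=\sum_I c_I\langle I,\widehat{\mathbb W}_t\rangle$, extended linearly. Star product: with $\rho_{ij}:=1_{\{i=j>0\}}$, define recursively $\emptyset\star I=I\star\emptyset=I$ and, for nonempty $I,J$, $I\star J:=(I'\star J)i_{|I|}+(I\star J')j_{|J|}+\rho_{i_{|I|}j_{|J|}}(I'\star J')(0)$, where the last term appends the letter $0$; extend bilinearly. Operators: for a fixed finite coefficient family $c$ and a finite linear combination $d=\sum_H d_H H$, $\mathcal G_{c,0}(d):=\sum_H d_H 1_{\{h_{|H|}=0\}}H'$, $\mathcal G_{c,1}(d):=\sum_{I,H}c_Id_H\, I'\star\big(H1_{\{i_{|I|}=0\}}+\rho_{i_{|I|},h_{|H|}}H'\big)$, $\mathcal G_{c,2}(d):=\sum_{I,J,H}c_Ic_Jd_H\frac{\rho_{i_{|I|},j_{|J|}}}{2}I'\star J'\star H$ (terms involving the last letter of an empty word are zero), and $\mathcal G_{c,k_1,\ldots,k_n}:=\mathcal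 G_{c,k_n}\circ\mathcal G_{c,k_1,\ldots,k_{n-1}}$. Differentiability: a real process $X$ is $(n+1)$-times $(W,t)$-differentiable if there are processes $c_I(t)$ for words $1\le|I|\le n+1$ such that, with $c_\emptyset(t):=X_t$, for each word $J$ with $|J|\le n$, $c_J(t)=c_J(0)+\sum_{i=0}^d\int_0^tc_{iJ}(s)\,d\widehat W^i_s$, where $iJ:=(i,j_1,\ldots,j_{|J|})$. With $c_I:=c_I(0)$ for $|I|\le n$ (so $c_\emptyset=X_0$), this gives the expansion $X_t=\sum_{|I|\le n}c_I\langle I,\widehat{\mathbb W}_t\rangle+\varepsilon_n(t)=\langle c,\widehat{\mathbb W}_t\rangle+\varepsilon_n(t)$ with $\varepsilon_n(t)=\sum_{|I|=n+1}\int_0^t\int_0^{t_{n+1}}\cdots\int_0^{t_2}c_I(t_1)\,d\widehat W^{i_1}_{t_1}\cdots d\widehat W^{i_{n+1}}_{t_{n+1}}$. Moment condition: there are $\delta>0$ and $N\in\mathbb N$ such that for every word $I$ with $|I|=n+1$, $t\mapsto\mathbb E_0[c_I(t)^{2N}]$ is bounded on $[0,\delta]$. $C^k_p(\mathbb R):=\{f\in C^k(\mathbb R): |f^{(j)}(x)|\le C(1+|x|^p)$ for some $C>0$, $p\in\mathbb N$, all $j\le k\}$. *)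

theory Defs
  imports "HOL-Probability.Probability" "HOL-Library.Landau_Symbols"
begin

text \<open>Words are lists of letters (nat); a finite linear combination of words is a
  function nat list => real with finite support. The last letter of a word I is last I,
  and I' is butlast I.\<close>

definition word :: "nat list \<Rightarrow> nat list \<Rightarrow> real" where
  "word I = (\<lambda>K. if K = I then 1 else 0)"

definition app_letter :: "(nat list \<Rightarrow> real) \<Rightarrow> nat \<Rightarrow> nat list \<Rightarrow> real" where
  "app_letter x a = (\<lambda>K. if K \<noteq> [] \<and> last K = a then x (butlast K) else 0)"

definition rho :: "nat list \<Rightarrow> nat list \<Rightarrow> bool" where
  "rho I J \<longleftrightarrow> I \<noteq> [] \<and> J \<noteq> [] \<and> last I = last J \<and> last I > 0"

lemma star_term_aux:
  "I \<noteq> [] \<Longrightarrow> J \<noteq> [] \<Longrightarrow> length I - Suc 0 + (length J - Suc 0) < length I + length J"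
  by (cases I; cases J) auto

function star :: "nat list \<Rightarrow> nat list \<Rightarrow> nat list \<Rightarrow> real" where
  "star I J =
    (if I = [] then word J
     else if J = [] then word I
     else (\<lambda>K. app_letter (star (butlast I) J) (last I) K
              + app_letter (star I (butlast J)) (last J) K
              + (if rho I J then app_letter (star (butlast I) (butlast J)) 0 K else 0)))"
  by pat_completeness auto
termination
  by (relation "Wellfounded.measure (\<lambda>(I, J). length I + length J)")
     (simp_all add: star_term_aux)

definition supp :: "(nat list \<Rightarrow> real) \<Rightarrow> nat list set" where
  "supp x = {I. x I \<noteq> 0}"

definition lc_star :: "(nat list \<Rightarrow> real) \<Rightarrow> (nat list \<Rightarrow> real) \<Rightarrow> nat list \<Rightarrow> real" where
  "lc_star x y = (\<lambda>K. \<Sum>I\<in>supp x. \<Sum>J\<in>supp y. x I * y J * star I J K)"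

definition G0 :: "(nat list \<Rightarrow> real) \<Rightarrow> nat list \<Rightarrow> real" where
  "G0 x = (\<lambda>K. \<Sum>H\<in>supp x. x H * (if H \<noteq> [] \<and> last H = 0 then word (butlast H) K else 0))"

definition G1 :: "(nat list \<Rightarrow> real) \<Rightarrow> (nat list \<Rightarrow> real) \<Rightarrow> nat list \<Rightarrow> real" where
  "G1 c x = (\<lambda>K. \<Sum>I\<in>supp c. \<Sum>H\<in>supp x. c I * x H *
      (if I = [] then 0 else
        lc_star (word (butlast I))
          (\<lambda>L. (if last I = 0 then word H L else 0)
             + (if rho I H then word (butlast H) L else 0)) K))"

definition G2 :: "(nat list \<Rightarrow> real) \<Rightarrow> (nat list \<Rightarrow> real) \<Rightarrow> nat list \<Rightarrow> real" where
  "G2 c x = (\<lambda>K. \<Sum>I\<in>supp c. \<Sum>J\<in>supp c. \<Sum>H\<in>supp x. c I * c J * x H *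
      (if rho I J then 1/2 else 0) *
      lc_star (lc_star (word (butlast I)) (word (butlast J))) (word H) K)"

definition Gk :: "nat \<Rightarrow> (nat list \<Rightarrow> real) \<Rightarrow> (nat list \<Rightarrow> real) \<Rightarrow> nat list \<Rightarrow> real" where
  "Gk k c x = (if k = 0 then G0 x else if k = 1 then G1 c x else G2 c x)"

text \<open>G_{c,k1,...,kl} = G_{c,kl} o ... o G_{c,k1}: apply k1 first.\<close>
definition Gseq :: "(nat list \<Rightarrow> real) \<Rightarrow> nat list \<Rightarrow> (nat list \<Rightarrow> real) \<Rightarrow> nat list \<Rightarrow> real" where
  "Gseq c ks x = fold (\<lambda>k y. Gk k c y) ks x"

definition std_BM :: "'a measure \<Rightarrow> (real \<Rightarrow> 'a measure) \<Rightarrow> nat \<Rightarrow> (nat \<Rightarrow> real \<Rightarrow> 'a \<Rightarrow> real) \<Rightarrow> bool" where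
  "std_BM M F d W \<longleftrightarrow>
     (\<forall>i\<in>{1..d}. \<forall>t\<ge>0. W i t \<in> borel_measurable (F t)) \<and>
     (\<forall>i\<in>{1..d}. \<forall>\<omega>\<in>space M. W i 0 \<omega> = 0 \<and> continuous_on {0..} (\<lambda>t. W i t \<omega>)) \<and>
     (\<forall>s t. 0 \<le> s \<longrightarrow> s < t \<longrightarrow>
        (\<forall>A\<in>sets (F s). \<forall>B\<in>sets (PiM {1..d} (\<lambda>_. borel)).
           measure M (A \<inter> {\<omega>\<in>space M. (\<lambda>i\<in>{1..d}. W i t \<omega> - W i s \<omega>) \<in> B})
           = measure M A *
             measure (PiM {1..d} (\<lambda>_. density lborel (normal_density 0 (sqrt (t - s))))) B))"

definition progressive :: "(real \<Rightarrow> 'a measure) \<Rightarrow> (real \<Rightarrow> 'a \<Rightarrow> real) \<Rightarrow> bool" where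
  "progressive F H \<longleftrightarrow>
     (\<forall>t\<ge>0. (\<lambda>(u, \<omega>). H u \<omega>) \<in> borel_measurable (restrict_space lborel {0..t} \<Otimes>\<^sub>M F t))"

definition simple_adapted ::
  "(real \<Rightarrow> 'a measure) \<Rightarrow> nat \<Rightarrow> (nat \<Rightarrow> real) \<Rightarrow> (nat \<Rightarrow> 'a \<Rightarrow> real) \<Rightarrow> bool" where
  "simple_adapted F m s \<xi> \<longleftrightarrow> s 0 = 0 \<and> (\<forall>j<m. s j < s (Suc j)) \<and>
     (\<forall>j<m. \<xi> j \<in> borel_measurable (F (s j)))"

definition simple_val :: "nat \<Rightarrow> (nat \<Rightarrow> real) \<Rightarrow> (nat \<Rightarrow> 'a \<Rightarrow> real) \<Rightarrow> real \<Rightarrow> 'a \<Rightarrow> real" where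
  "simple_val m s \<xi> u \<omega> = (\<Sum>j<m. \<xi> j \<omega> * indicator {s j<..s (Suc j)} u)"

definition simple_int ::
  "(real \<Rightarrow> 'a \<Rightarrow> real) \<Rightarrow> nat \<Rightarrow> (nat \<Rightarrow> real) \<Rightarrow> (nat \<Rightarrow> 'a \<Rightarrow> real) \<Rightarrow> real \<Rightarrow> 'a \<Rightarrow> real" where
  "simple_int B m s \<xi> t \<omega> = (\<Sum>j<m. \<xi> j \<omega> * (B (min (s (Suc j)) t) \<omega> - B (min (s j) t) \<omega>))"

definition conv_in_prob :: "'a measure \<Rightarrow> (nat \<Rightarrow> 'a \<Rightarrow> real) \<Rightarrow> ('a \<Rightarrow> real) \<Rightarrow> bool" where
  "conv_in_prob M Y Z \<longleftrightarrow>
     (\<forall>e>0. (\<lambda>k. measure M {\<omega>\<in>space M. e < \<bar>Y k \<omega> - Z \<omega>\<bar>}) \<longlonglongrightarrow> 0)"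

definition approx_seq ::
  "'a measure \<Rightarrow> (real \<Rightarrow> 'a measure) \<Rightarrow> (real \<Rightarrow> 'a \<Rightarrow> real) \<Rightarrow> real \<Rightarrow>
   (nat \<Rightarrow> nat) \<Rightarrow> (nat \<Rightarrow> nat \<Rightarrow> real) \<Rightarrow> (nat \<Rightarrow> nat \<Rightarrow> 'a \<Rightarrow> real) \<Rightarrow> bool" where
  "approx_seq M F H t m s \<xi> \<longleftrightarrow> (\<forall>k. simple_adapted F (m k) (s k) (\<xi> k)) \<and>
     (\<forall>e>0. (\<lambda>k. measure M {\<omega>\<in>space M. ennreal e <
        (\<integral>\<^sup>+ u. ennreal ((simple_val (m k) (s k) (\<xi> k) u \<omega> - H u \<omega>)\<^sup>2)
             * indicator {0..t} u \<partial>lborel)}) \<longlonglongrightarrow> 0)"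

definition ito_integral ::
  "'a measure \<Rightarrow> (real \<Rightarrow> 'a measure) \<Rightarrow> (real \<Rightarrow> 'a \<Rightarrow> real) \<Rightarrow> (real \<Rightarrow> 'a \<Rightarrow> real) \<Rightarrow>
   real \<Rightarrow> ('a \<Rightarrow> real) \<Rightarrow> bool" where
  "ito_integral M F B H t Y \<longleftrightarrow> progressive F H \<and> Y \<in> borel_measurable M \<and>
     (\<exists>m s \<xi>. approx_seq M F H t m s \<xi>) \<and>
     (\<forall>m s \<xi>. approx_seq M F H t m s \<xi> \<longrightarrow>
        conv_in_prob M (\<lambda>k. simple_int B (m k) (s k) (\<xi> k) t) Y)"

definition time_integral ::
  "'a measure \<Rightarrow> (real \<Rightarrow> 'a measure) \<Rightarrow> (real \<Rightarrow> 'a \<Rightarrow> real) \<Rightarrow> real \<Rightarrow> ('a \<Rightarrow> real) \<Rightarrow> bool" where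
  "time_integral M F H t Y \<longleftrightarrow> progressive F H \<and>
     (AE \<omega> in M. set_integrable lborel {0..t} (\<lambda>u. H u \<omega>) \<and>
        Y \<omega> = set_lebesgue_integral lborel {0..t} (\<lambda>u. H u \<omega>))"

text \<open>int_0^t H d\<widehat>W^i, with \<widehat>W^0_t = t and \<widehat>W^i = W^i.\<close>
definition dW_integral ::
  "'a measure \<Rightarrow> (real \<Rightarrow> 'a measure) \<Rightarrow> (nat \<Rightarrow> real \<Rightarrow> 'a \<Rightarrow> real) \<Rightarrow> nat \<Rightarrow>
   (real \<Rightarrow> 'a \<Rightarrow> real) \<Rightarrow> real \<Rightarrow> ('a \<Rightarrow> real) \<Rightarrow> bool" where
  "dW_integral M F W i H t Y =
     (if i = 0 then time_integral M F H t Y else ito_integral M F (W i) H t Y)"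

definition Wt_differentiable ::
  "'a measure \<Rightarrow> (real \<Rightarrow> 'a measure) \<Rightarrow> (nat \<Rightarrow> real \<Rightarrow> 'a \<Rightarrow> real) \<Rightarrow> nat \<Rightarrow> real \<Rightarrow> nat \<Rightarrow>
   (real \<Rightarrow> 'a \<Rightarrow> real) \<Rightarrow> (nat list \<Rightarrow> real \<Rightarrow> 'a \<Rightarrow> real) \<Rightarrow> bool" where
  "Wt_differentiable M F W d T n X c \<longleftrightarrow> c [] = X \<and>
     (\<forall>J. length J \<le> n \<and> set J \<subseteq> {0..d} \<longrightarrow>
       (\<forall>t\<in>{0..T}. \<exists>Y::nat \<Rightarrow> 'a \<Rightarrow> real.
          (\<forall>i\<le>d. dW_integral M F W i (c (i # J)) t (Y i)) \<and>
          (AE \<omega> in M. c J t \<omega> = c J 0 \<omega> + (\<Sum>i\<le>d. Y i \<omega>))))"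

definition moment_condition ::
  "'a measure \<Rightarrow> (real \<Rightarrow> 'a measure) \<Rightarrow> nat \<Rightarrow> nat \<Rightarrow> (nat list \<Rightarrow> real \<Rightarrow> 'a \<Rightarrow> real) \<Rightarrow> bool" where
  "moment_condition M F d n c \<longleftrightarrow>
     (\<exists>\<delta>>0. \<exists>N::nat. N \<ge> 1 \<and>
       (\<forall>I. length I = Suc n \<and> set I \<subseteq> {0..d} \<longrightarrow>
          (\<exists>K \<in> borel_measurable (F 0). \<forall>t\<in>{0..\<delta>}.
             AE \<omega> in M. nn_cond_exp M (F 0) (\<lambda>x. ennreal (c I t x ^ (2 * N))) \<omega> \<le> ennreal (K \<omega>))))"

definition Cp :: "nat \<Rightarrow> (real \<Rightarrow> real) \<Rightarrow> bool" where
  "Cp k f \<longleftrightarrow>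
     (\<forall>j<k. \<forall>x. ((deriv ^^ j) f has_real_derivative (deriv ^^ Suc j) f x) (at x)) \<and>
     continuous_on UNIV ((deriv ^^ k) f) \<and>
     (\<exists>C>0. \<exists>p::nat. \<forall>j\<le>k. \<forall>x. \<bar>(deriv ^^ j) f x\<bar> \<le> C * (1 + \<bar>x\<bar> ^ p))"

text \<open>Y is a version of the (generalized) conditional expectation E[Z | G]
  = E[Z^+ | G] - E[Z^- | G].\<close>
definition cond_exp_version :: "'a measure \<Rightarrow> 'a measure \<Rightarrow> ('a \<Rightarrow> real) \<Rightarrow> ('a \<Rightarrow> real) \<Rightarrow> bool" where
  "cond_exp_version M G Z Y \<longleftrightarrow> Y \<in> borel_measurable G \<and>
     (AE \<omega> in M. Y \<omega> = enn2real (nn_cond_exp M G (\<lambda>x. ennreal (Z x)) \<omega>)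
                     - enn2real (nn_cond_exp M G (\<lambda>x. ennreal (- Z x)) \<omega>))"

definition coeffs :: "nat \<Rightarrow> nat \<Rightarrow> (nat list \<Rightarrow> real \<Rightarrow> 'a \<Rightarrow> real) \<Rightarrow> 'a \<Rightarrow> nat list \<Rightarrow> real" where
  "coeffs d n c \<omega> = (\<lambda>I. if length I \<le> n \<and> set I \<subseteq> {0..d} then c I 0 \<omega> else 0)"

definition expansion ::
  "(real \<Rightarrow> real) \<Rightarrow> nat \<Rightarrow> nat \<Rightarrow> (nat list \<Rightarrow> real \<Rightarrow> 'a \<Rightarrow> real) \<Rightarrow> 'a \<Rightarrow> real \<Rightarrow> real" where
  "expansion f d n c \<omega> t =
     f (c [] 0 \<omega>) +
     (\<Sum>l = 1..nat \<lceil>real n / 2\<rceil>. (1 / fact l) *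
        (\<Sum>ks\<in>{ks. length ks = l \<and> set ks \<subseteq> {0, 1, 2}}.
           (deriv ^^ sum_list ks) f (c [] 0 \<omega>) * Gseq (coeffs d n c \<omega>) ks (word []) [])
        * t ^ l)"

end

theory Submission
  imports Defs
begin

text \<open>
  Localise on \<open>F\<^sub>0\<close>-sets where the initial coefficients and the moment bound are bounded; conditioning
  on such a set preserves the Brownian motion, and it suffices to bound
  \<open>|E[f(X\<^sub>t)] - E[expansion at t]|\<close> by \<open>C t\<^bsup>(n+1)/2\<^esup>\<close> with \<open>C\<close> independent of the conditioning set.
  The signature is replaced by iterated sums over a grid of mesh \<open>t/N\<close>. For these the product of two words
  equals their star product up to an \<open>L\<^sup>2\<close>-error of order \<open>1/N\<close>, all moments are explicit, and the
  expectation of a word vanishes unless all of its letters are \<open>0\<close>. Hence the moments of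
  \<open>\<langle>c, W\<^sub>t\<rangle> - X\<^sub>0\<close> are, in the limit \<open>N \<rightarrow> \<infinity>\<close>, given by the coefficients at \<open>0\<^sup>l\<close> of star powers of \<open>c\<close>.
  Inserting them into the Taylor expansion of \<open>f\<close> at \<open>X\<^sub>0\<close>, and noting that removing a last letter \<open>0\<close>
  from a Taylor series in star powers is a chain rule whose three terms are the operators
  \<open>G\<^sub>0, G\<^sub>1, G\<^sub>2\<close>, gives the coefficients of the theorem.
\<close>

section \<open>The star product as a convolution of coefficient functions\<close>

text \<open>Two obstacles shape the argument. The hypotheses determine an Ito integral only as a
  limit in probability, and the iterated integrals of constants are not among the given objects. The
  iterated sums that replace them are polynomials in Gaussian increments, so no Ito formula is
  needed, and at fixed t the grid error disappears before t tends to 0. Second, the coefficients at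
  time 0 are random and unbounded, so \<open>f (X t)\<close> need not be integrable, and a constant
  in front of t^((n+1)/2) exists only on sets where they are bounded. A bound on the integral of
  \<open>f (X t)\<close> minus the expansion over \<open>A'\<close> by a constant times the
  probability of \<open>A'\<close>, valid for every \<open>F 0\<close>-set \<open>A'\<close> inside
  such a set, amounts to a pointwise bound on the conditional expectation there. This is why the
  constant must not depend on the conditioning set. The bounded derivative makes f Lipschitz, so the
  remainder of X has to be controlled in L2 only. The surplus factor t^(1/2) over t^(n/2) is what
  yields the little-o.\<close>

text \<open>Reading the recursion for \<open>\<star>\<close> backwards, from the last letter of the result, defines the product
  \<open>qs\<close> of arbitrary coefficient functions. In this form \<open>strip 0\<close> is a second-order and \<open>strip i\<close> for
  \<open>i > 0\<close> a first-order derivation, which makes commutativity and associativity immediate.\<close>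

definition strip :: "nat \<Rightarrow> (nat list \<Rightarrow> real) \<Rightarrow> nat list \<Rightarrow> real" where
  "strip a x = (\<lambda>K. x (K @ [a]))"

text \<open>The recursion runs over the reversed word because a list recursion removes the head,
  whereas the star product is governed by the last letter. The sum over i encodes
  \<open>rho\<close>: a final 0 may stem from two equal Brownian letters, one at the end of each
  factor. The parameter d bounds the letters that can be contracted in this way.\<close>

primrec qs_rev :: "nat \<Rightarrow> nat list \<Rightarrow> (nat list \<Rightarrow> real) \<Rightarrow> (nat list \<Rightarrow> real) \<Rightarrow> real" where
  "qs_rev d [] x y = x [] * y []"
| "qs_rev d (a # K) x y = qs_rev d K (strip a x) y + qs_rev d K x (strip a y)
     + (if a = 0 then \<Sum>i=1..d. qs_rev d K (strip i x) (strip i y) else 0)"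

definition qs :: "nat \<Rightarrow> (nat list \<Rightarrow> real) \<Rightarrow> (nat list \<Rightarrow> real) \<Rightarrow> nat list \<Rightarrow> real" where
  "qs d x y K = qs_rev d (rev K) x y"

lemma qs_Nil [simp]: "qs d x y [] = x [] * y []"
  by (simp add: qs_def)

lemma qs_snoc: "qs d x y (K @ [a]) = qs d (strip a x) y K + qs d x (strip a y) K
     + (if a = 0 then \<Sum>i=1..d. qs d (strip i x) (strip i y) K else 0)"
  by (simp add: qs_def)

lemma strip_qs: "strip a (qs d x y) = (\<lambda>K. qs d (strip a x) y K + qs d x (strip a y) K
     + (if a = 0 then \<Sum>i=1..d. qs d (strip i x) (strip i y) K else 0))"
  unfolding strip_def[of a "qs d x y"] by (simp only: qs_snoc)

lemma strip_add: "strip a (\<lambda>K. x K + y K) = (\<lambda>K. strip a x K + strip a y K)"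
  and strip_scale: "strip a (\<lambda>K. r * x K) = (\<lambda>K. r * strip a x K)"
  and strip_sum: "strip a (\<lambda>K. \<Sum>i\<in>A. z i K) = (\<lambda>K. \<Sum>i\<in>A. strip a (z i) K)"
  by (simp_all add: strip_def)

lemma qs_commute: "qs d x y = qs d y x"
proof
  fix K show "qs d x y K = qs d y x K"
    by (induction K arbitrary: x y rule: rev_induct) (simp_all add: qs_snoc)
qed

lemma qs_add_left: "qs d (\<lambda>K. x K + y K) z = (\<lambda>K. qs d x z K + qs d y z K)"
proof
  fix K show "qs d (\<lambda>K. x K + y K) z K = qs d x z K + qs d y z K"
    by (induction K arbitrary: x y z rule: rev_induct)
       (simp_all add: qs_snoc strip_add sum.distrib algebra_simps)
qed

lemma qs_scale_left: "qs d (\<lambda>K. r * x K) z = (\<lambda>K. r * qs d x z K)"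
proof
  fix K show "qs d (\<lambda>K. r * x K) z K = r * qs d x z K"
    by (induction K arbitrary: x z rule: rev_induct)
       (simp_all add: qs_snoc strip_scale sum_distrib_left algebra_simps)
qed

lemma qs_zero_left [simp]: "qs d (\<lambda>K. 0) z = (\<lambda>K. 0)"
  using qs_scale_left[of d 0 "\<lambda>K. 0" z] by simp

lemma qs_sum_left: "qs d (\<lambda>K. \<Sum>i\<in>A. x i K) z = (\<lambda>K. \<Sum>i\<in>A. qs d (x i) z K)"
proof (cases "finite A")
  case True
  then show ?thesis by (induction A rule: finite_induct) (simp_all add: qs_add_left)
qed simp

lemma qs_add_right: "qs d z (\<lambda>K. x K + y K) = (\<lambda>K. qs d z x K + qs d z y K)"
  and qs_scale_right: "qs d z (\<lambda>K. r * x K) = (\<lambda>K. r * qs d z x K)"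
  and qs_zero_right [simp]: "qs d z (\<lambda>K. 0) = (\<lambda>K. 0)"
  and qs_sum_right: "qs d z (\<lambda>K. \<Sum>i\<in>A. u i K) = (\<lambda>K. \<Sum>i\<in>A. qs d z (u i) K)"
  using qs_add_left[of d x y z] qs_scale_left[of d r x z] qs_zero_left[of d z] qs_sum_left[of d u A z]
  by (simp_all add: qs_commute[of d z])

lemma qs_assoc: "qs d (qs d x y) z = qs d x (qs d y z)"
proof
  fix K show "qs d (qs d x y) z K = qs d x (qs d y z) K"
  proof (induction K arbitrary: x y z rule: rev_induct)
    case (snoc a K)
    show ?case
      by (cases "a = 0")
        (simp_all add: qs_snoc strip_qs qs_add_left qs_add_right qs_sum_left qs_sum_right snoc.IH
          sum.distrib)
  qed simp
qed

lemma qs_left_commute: "qs d x (qs d y z) = qs d y (qs d x z)"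
  by (metis qs_assoc qs_commute)

lemma strip_word: "strip a (word I) = (if I \<noteq> [] \<and> last I = a then word (butlast I) else (\<lambda>K. 0))"
  by (cases I rule: rev_cases) (auto simp: strip_def word_def fun_eq_iff)

lemma qs_word_Nil_left [simp]: "qs d (word []) z = z"
proof
  fix K show "qs d (word []) z K = z K"
    by (induction K arbitrary: z rule: rev_induct)
       (simp_all add: qs_snoc strip_word, simp_all add: word_def strip_def)
qed

lemma qs_word_Nil_right [simp]: "qs d z (word []) = z"
  by (subst qs_commute) simp

declare star.simps [simp del]

lemma star_Nil [simp]: "star [] J = word J" "star I [] = word I"
  by (simp_all add: star.simps)

lemma star_Nil_at: "I \<noteq> [] \<Longrightarrow> J \<noteq> [] \<Longrightarrow> star I J [] = 0"
  by (simp add: star.simps app_letter_def)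

lemma star_snoc_snoc: "star (I @ [a]) (J @ [b]) = (\<lambda>K. app_letter (star I (J @ [b])) a K
    + app_letter (star (I @ [a]) J) b K
    + (if a = b \<and> a > 0 then app_letter (star I J) 0 K else 0))"
  by (subst star.simps) (auto simp: rho_def)

text \<open>Both sides satisfy one recursion in the last letter of the result: the three summands of
  \<open>star_snoc_snoc\<close> end in a, b and 0, and stripping a letter selects those that end in
  it. The letters must lie in 0..d because \<open>qs\<close> contracts only the letters
  1..d.\<close>

lemma star_eq_qs:
  "set I \<subseteq> {0..d} \<Longrightarrow> set J \<subseteq> {0..d} \<Longrightarrow> star I J = qs d (word I) (word J)"
proof (induction I J rule: star.induct)
  case (1 I J)
  show ?case
  proof (cases "I = [] \<or> J = []")
    case False
    then obtain I' a J' b where I: "I = I' @ [a]" and J: "J = J' @ [b]"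
      by (metis rev_exhaust)
    have ab: "a \<le> d" "b \<le> d" "set I' \<subseteq> {0..d}" "set J' \<subseteq> {0..d}" using 1(4,5) I J by auto
    have IH: "star I' J = qs d (word I') (word J)" "star I J' = qs d (word I) (word J')"
      "a = b \<Longrightarrow> a > 0 \<Longrightarrow> star I' J' = qs d (word I') (word J')"
      using 1(1)[OF _ _] 1(2)[OF _ _] 1(3)[OF _ _] 1(4,5) False ab by (auto simp: I J rho_def)
    show ?thesis
    proof
      fix K show "star I J K = qs d (word I) (word J) K"
      proof (cases K rule: rev_cases)
        case Nil
        then show ?thesis using False by (auto simp: star_Nil_at word_def)
      next
        case (snoc K' e)
        \<comment> \<open>Only the index i = a = b can contribute, and it belongs to 1..d exactly
          when a > 0, which is the condition in \<open>rho\<close>.\<close>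
        have s: "(\<Sum>i=1..d. qs d (strip i (word I)) (strip i (word J)) K')
          = (if a = b \<and> a > 0 then qs d (word I') (word J') K' else 0)"
        proof -
          have "(\<Sum>i=1..d. qs d (strip i (word I)) (strip i (word J)) K')
             = (\<Sum>i=1..d. if i = a then (if a = b then qs d (word I') (word J') K' else 0) else 0)"
            by (rule sum.cong) (auto simp: strip_word I J)
          also have "\<dots> = (if a = b \<and> a > 0 then qs d (word I') (word J') K' else 0)"
            using ab by (subst sum.delta) auto
          finally show ?thesis .
        qed
        show ?thesis unfolding snoc I J star_snoc_snoc
          using IH s by (auto simp: qs_snoc app_letter_def strip_word I J)
      qed
    qed
  qed auto
qed

section \<open>Linear combinations supported on words of bounded length\<close>

definition words :: "nat \<Rightarrow> nat \<Rightarrow> nat list set" where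
  "words d L = {K. set K \<subseteq> {0..d} \<and> length K \<le> L}"

lemma finite_words [simp]: "finite (words d L)"
  unfolding words_def by (rule finite_lists_length_le) simp

lemma words_letters: "K \<in> words d L \<Longrightarrow> set K \<subseteq> {0..d}"
  by (simp add: words_def)

lemma sum_swap3: "(\<Sum>I\<in>A. \<Sum>H\<in>B. \<Sum>i\<in>C. g I H i) = (\<Sum>i\<in>C. \<Sum>I\<in>A. \<Sum>H\<in>B. g I H i)"
  by (rule trans, rule sum.cong[OF refl], rule sum.swap, rule sum.swap)

lemma fun_eq_sum_word:
  assumes "finite A" "supp x \<subseteq> A"
  shows "x = (\<lambda>K. \<Sum>I\<in>A. x I * word I K)"
proof
  fix K
  have "(\<Sum>I\<in>A. x I * word I K) = (\<Sum>I\<in>A. if I = K then x K else 0)"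
    by (rule sum.cong) (auto simp: word_def)
  also have "\<dots> = x K" using assms by (auto simp: sum.delta supp_def)
  finally show "x K = (\<Sum>I\<in>A. x I * word I K)" by simp
qed

lemma supp_word [simp]: "supp (word I) = {I}"
  by (auto simp: supp_def word_def)

lemma qs_eq_sum_words:
  assumes "supp x \<subseteq> words d L" "supp y \<subseteq> words d L'"
  shows "qs d x y K = (\<Sum>I\<in>words d L. \<Sum>J\<in>words d L'. x I * y J * qs d (word I) (word J) K)"
proof -
  have "qs d x y = qs d (\<lambda>K. \<Sum>I\<in>words d L. x I * word I K) (\<lambda>K. \<Sum>J\<in>words d L'. y J * word J K)"
    by (simp flip: fun_eq_sum_word[OF finite_words assms(1)] fun_eq_sum_word[OF finite_words assms(2)])
  then show ?thesis
    by (simp add: qs_sum_left qs_sum_right qs_scale_left qs_scale_right sum_distrib_left algebra_simps)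
qed

text \<open>\<open>lc_star\<close> sums over supports while \<open>qs\<close> refers to none; finite
  support lets both be expanded bilinearly over words, where \<open>star_eq_qs\<close>
  applies.\<close>

lemma lc_star_eq_qs:
  assumes x: "supp x \<subseteq> words d L" and y: "supp y \<subseteq> words d L'"
  shows "lc_star x y = qs d x y"
proof
  fix K
  have fin: "finite (supp x)" "finite (supp y)"
    using x y by (auto intro: finite_subset[OF _ finite_words])
  have "lc_star x y K = (\<Sum>I\<in>supp x. \<Sum>J\<in>supp y. x I * y J * qs d (word I) (word J) K)"
    unfolding lc_star_def
    by (intro sum.cong refl arg_cong2[where f="(*)"] fun_cong[OF star_eq_qs]
        words_letters[OF subsetD[OF x]] words_letters[OF subsetD[OF y]])
  also have "\<dots> = qs d (\<lambda>K. \<Sum>I\<in>supp x. x I * word I K) (\<lambda>K. \<Sum>J\<in>supp y. y J * word J K) K"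
    by (simp only: qs_sum_left qs_sum_right qs_scale_left qs_scale_right sum_distrib_left mult.assoc)
  also have "\<dots> = qs d x y K"
    by (simp flip: fun_eq_sum_word[OF fin(1), of x] fun_eq_sum_word[OF fin(2), of y])
  finally show "lc_star x y K = qs d x y K" .
qed

lemma supp_strip:
  assumes "supp x \<subseteq> words d L"
  shows "supp (strip a x) \<subseteq> words d (L - 1)"
proof
  fix K assume "K \<in> supp (strip a x)"
  then have "K @ [a] \<in> words d L" using assms by (auto simp: supp_def strip_def)
  then show "K \<in> words d (L - 1)" by (auto simp: words_def)
qed

lemma words_mono: "L \<le> L' \<Longrightarrow> words d L \<subseteq> words d L'"
  by (auto simp: words_def)

lemma supp_add_subset: "supp x \<subseteq> A \<Longrightarrow> supp y \<subseteq> A \<Longrightarrow> supp (\<lambda>K. x K + y K) \<subseteq> A"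
  unfolding supp_def subset_iff mem_Collect_eq by (metis add_0)

lemma supp_scale_subset: "supp x \<subseteq> A \<Longrightarrow> supp (\<lambda>K. r * x K) \<subseteq> A"
  unfolding supp_def subset_iff mem_Collect_eq by fastforce

lemma supp_sum_subset: "(\<And>i. i \<in> B \<Longrightarrow> supp (u i) \<subseteq> A) \<Longrightarrow> supp (\<lambda>K. \<Sum>i\<in>B. u i K) \<subseteq> A"
  unfolding supp_def subset_iff mem_Collect_eq by (metis (mono_tags, lifting) sum.neutral)

lemma strip_eq_zero: "supp x \<subseteq> words d L \<Longrightarrow> a > d \<or> L = 0 \<Longrightarrow> strip a x = (\<lambda>K. 0)"
proof
  fix K assume x: "supp x \<subseteq> words d L" and "a > d \<or> L = 0"
  then have "K @ [a] \<notin> words d L" by (auto simp: words_def)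
  then show "strip a x K = 0" using x by (auto simp: supp_def strip_def)
qed

text \<open>Each letter of the result is paid for by a letter of at least one factor. The cases
  \<open>L = 0\<close> and \<open>L' = 0\<close> are separated because \<open>L - 1\<close> is
  truncated there; a combination supported on the empty word vanishes once it is stripped.\<close>

lemma supp_qs:
  assumes "supp x \<subseteq> words d L" "supp y \<subseteq> words d L'"
  shows "supp (qs d x y) \<subseteq> words d (L + L')"
proof -
  have "qs d x y K = 0" if "K \<notin> words d (L + L')" for K
    using assms that
  proof (induction K arbitrary: x y L L' rule: rev_induct)
    case Nil
    then show ?case by (auto simp: words_def)
  next
    case (snoc a K)
    note sx = supp_strip[OF snoc.prems(1)] and sy = supp_strip[OF snoc.prems(2)]
    show ?case
    proof (cases "a > d")
      case True
      then show ?thesis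
        using strip_eq_zero[OF snoc.prems(1)] strip_eq_zero[OF snoc.prems(2)]
        by (simp add: qs_snoc)
    next
      case False
      have 1: "qs d (strip a x) y K = 0"
      proof (cases "L = 0")
        case True then show ?thesis using strip_eq_zero[OF snoc.prems(1)] by simp
      next
        case L: False
        show ?thesis
          by (rule snoc.IH[OF sx snoc.prems(2)]) (use snoc.prems(3) False L in \<open>auto simp: words_def\<close>)
      qed
      have 2: "qs d x (strip a y) K = 0"
      proof (cases "L' = 0")
        case True then show ?thesis using strip_eq_zero[OF snoc.prems(2)] by simp
      next
        case L: False
        show ?thesis
          by (rule snoc.IH[OF snoc.prems(1) sy]) (use snoc.prems(3) False L in \<open>auto simp: words_def\<close>)
      qed
      have 3: "qs d (strip i x) (strip i y) K = 0" for i
      proof (cases "L = 0 \<or> L' = 0")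
        case True then show ?thesis
          using strip_eq_zero[OF snoc.prems(1)] strip_eq_zero[OF snoc.prems(2)] by auto
      next
        case L: False
        show ?thesis
          by (rule snoc.IH[OF supp_strip[OF snoc.prems(1)] supp_strip[OF snoc.prems(2)]])
             (use snoc.prems(3) False L in \<open>auto simp: words_def\<close>)
      qed
      show ?thesis using 1 2 3 by (simp add: qs_snoc)
    qed
  qed
  then show ?thesis by (auto simp: supp_def)
qed

section \<open>The operators in terms of stripping\<close>

lemma G0_eq:
  assumes "finite (supp x)"
  shows "G0 x = strip 0 x"
proof
  fix K
  have "strip 0 x = strip 0 (\<lambda>K. \<Sum>I\<in>supp x. x I * word I K)"
    by (simp flip: fun_eq_sum_word[OF assms])
  also have "\<dots> = (\<lambda>K. \<Sum>I\<in>supp x. x I * strip 0 (word I) K)"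
    by (simp add: strip_def)
  finally have "strip 0 x K = (\<Sum>I\<in>supp x. x I * strip 0 (word I) K)" by simp
  then show "G0 x K = strip 0 x K"
    unfolding G0_def by (simp add: strip_word if_distrib[where f="\<lambda>g. g _"] cong: if_cong)
qed

text \<open>Bilinearity reduces the identity to words. There the condition on a final 0 is
  \<open>strip 0 (word I)\<close>, and \<open>rho\<close> selects the only index i for which both
  \<open>strip i (word I)\<close> and \<open>strip i (word H)\<close> are nonzero.\<close>

lemma G1_eq:
  assumes c: "supp c \<subseteq> words d L" and x: "supp x \<subseteq> words d L'"
  shows "G1 c x = (\<lambda>K. qs d (strip 0 c) x K + (\<Sum>i=1..d. qs d (strip i c) (strip i x) K))"
proof
  fix K
  have fin: "finite (supp c)" "finite (supp x)"
    using c x by (auto intro: finite_subset[OF _ finite_words])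
  have term_eq: "(if I = [] then 0 else lc_star (word (butlast I))
          (\<lambda>L. (if last I = 0 then word H L else 0) + (if rho I H then word (butlast H) L else 0)) K)
     = qs d (strip 0 (word I)) (word H) K + (\<Sum>i=1..d. qs d (strip i (word I)) (strip i (word H)) K)"
    if I: "I \<in> supp c" and H: "H \<in> supp x" for I H
  proof (cases "I = []")
    case True then show ?thesis by (simp add: strip_word)
  next
    case False
    have IH: "set I \<subseteq> {0..d}" "set H \<subseteq> {0..d}" using I H c x by (auto simp: words_def)
    have bI: "butlast I \<in> words d (length I)" "H \<in> words d (length H)" "butlast H \<in> words d (length H)"
      using IH by (auto simp: words_def dest: in_set_butlastD)
    have lastI: "last I \<le> d" using IH False by (meson atLeastAtMost_iff last_in_set subsetD)
    have su: "supp (\<lambda>L. (if last I = 0 then word H L else 0) + (if rho I H then word (butlast H) L else 0))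
       \<subseteq> words d (length H)"
      using bI by (intro supp_add_subset) (auto simp: supp_def word_def split: if_splits)
    have s: "(\<Sum>i=1..d. qs d (strip i (word I)) (strip i (word H)) K)
       = (if rho I H then qs d (word (butlast I)) (word (butlast H)) K else 0)"
    proof -
      have "(\<Sum>i=1..d. qs d (strip i (word I)) (strip i (word H)) K)
         = (\<Sum>i=1..d. if i = last I then (if H \<noteq> [] \<and> last H = last I
              then qs d (word (butlast I)) (word (butlast H)) K else 0) else 0)"
        by (rule sum.cong) (auto simp: strip_word False)
      also have "\<dots> = (if rho I H then qs d (word (butlast I)) (word (butlast H)) K else 0)"
        using lastI False by (subst sum.delta) (auto simp: rho_def)
      finally show ?thesis .
    qed
    have "lc_star (word (butlast I))
          (\<lambda>L. (if last I = 0 then word H L else 0) + (if rho I H then word (butlast H) L else 0)) K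
      = qs d (word (butlast I)) (\<lambda>L. (if last I = 0 then word H L else 0)
          + (if rho I H then word (butlast H) L else 0)) K"
      using lc_star_eq_qs[OF _ su, of "word (butlast I)" "length I"] bI by simp
    also have "\<dots> = (if last I = 0 then qs d (word (butlast I)) (word H) K else 0)
         + (if rho I H then qs d (word (butlast I)) (word (butlast H)) K else 0)"
      by (auto simp: qs_add_right)
    finally show ?thesis using False s by (simp add: strip_word)
  qed
  have "G1 c x K = (\<Sum>I\<in>supp c. \<Sum>H\<in>supp x. c I * x H *
      (qs d (strip 0 (word I)) (word H) K + (\<Sum>i=1..d. qs d (strip i (word I)) (strip i (word H)) K)))"
    unfolding G1_def by (intro sum.cong refl) (simp add: term_eq)
  also have "\<dots> = (\<Sum>I\<in>supp c. \<Sum>H\<in>supp x. c I * x H * qs d (strip 0 (word I)) (word H) K) +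
     (\<Sum>i=1..d. \<Sum>I\<in>supp c. \<Sum>H\<in>supp x. c I * x H * qs d (strip i (word I)) (strip i (word H)) K)"
    unfolding distrib_left sum.distrib sum_distrib_left by (subst sum_swap3) (rule refl)
  also have "(\<Sum>I\<in>supp c. \<Sum>H\<in>supp x. c I * x H * qs d (strip 0 (word I)) (word H) K)
     = qs d (strip 0 (\<lambda>K. \<Sum>I\<in>supp c. c I * word I K)) (\<lambda>K. \<Sum>I\<in>supp x. x I * word I K) K"
    by (simp add: strip_sum strip_scale qs_sum_left qs_sum_right qs_scale_left qs_scale_right
        sum_distrib_left algebra_simps)
  also have "\<dots> = qs d (strip 0 c) x K"
    by (simp flip: fun_eq_sum_word[OF fin(1), of c] fun_eq_sum_word[OF fin(2), of x])
  also have "(\<lambda>i. \<Sum>I\<in>supp c. \<Sum>H\<in>supp x. c I * x H * qs d (strip i (word I)) (strip i (word H)) K)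
    = (\<lambda>i. qs d (strip i (\<lambda>K. \<Sum>I\<in>supp c. c I * word I K)) (strip i (\<lambda>K. \<Sum>I\<in>supp x. x I * word I K)) K)"
    by (simp add: strip_sum strip_scale qs_sum_left qs_sum_right qs_scale_left qs_scale_right
        sum_distrib_left algebra_simps)
  also have "\<dots> = (\<lambda>i. qs d (strip i c) (strip i x) K)"
    by (simp flip: fun_eq_sum_word[OF fin(1), of c] fun_eq_sum_word[OF fin(2), of x])
  finally show "G1 c x K = qs d (strip 0 c) x K + (\<Sum>i=1..d. qs d (strip i c) (strip i x) K)" .
qed

text \<open>The coefficients are paired with themselves along the Brownian letters, which is the
  quadratic variation term of the Ito formula with its usual factor 1/2.\<close>

lemma G2_eq:
  assumes c: "supp c \<subseteq> words d L" and x: "supp x \<subseteq> words d L'"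
  shows "G2 c x = (\<lambda>K. (1/2) * (\<Sum>i=1..d. qs d (qs d (strip i c) (strip i c)) x K))"
proof
  fix K
  have fin: "finite (supp c)" "finite (supp x)"
    using c x by (auto intro: finite_subset[OF _ finite_words])
  have term_eq: "(if rho I J then 1/2 else 0) *
      lc_star (lc_star (word (butlast I)) (word (butlast J))) (word H) K
     = (1/2) * (\<Sum>i=1..d. qs d (qs d (strip i (word I)) (strip i (word J))) (word H) K)"
    if I: "I \<in> supp c" and J: "J \<in> supp c" and H: "H \<in> supp x" for I J H
  proof -
    have IJH: "set I \<subseteq> {0..d}" "set J \<subseteq> {0..d}" "set H \<subseteq> {0..d}"
      using I J H c x by (auto simp: words_def)
    have s: "(\<Sum>i=1..d. qs d (qs d (strip i (word I)) (strip i (word J))) (word H) K)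
       = (if rho I J then qs d (qs d (word (butlast I)) (word (butlast J))) (word H) K else 0)"
    proof (cases "I = []")
      case False
      have lastI: "last I \<le> d" using IJH False by (meson atLeastAtMost_iff last_in_set subsetD)
      have "(\<Sum>i=1..d. qs d (qs d (strip i (word I)) (strip i (word J))) (word H) K)
         = (\<Sum>i=1..d. if i = last I then (if J \<noteq> [] \<and> last J = last I
              then qs d (qs d (word (butlast I)) (word (butlast J))) (word H) K else 0) else 0)"
        by (rule sum.cong) (auto simp: strip_word False)
      also have "\<dots> = (if rho I J then qs d (qs d (word (butlast I)) (word (butlast J))) (word H) K else 0)"
        using lastI False by (subst sum.delta) (auto simp: rho_def)
      finally show ?thesis .
    qed (simp add: strip_word rho_def)
    have w: "supp (word (butlast I)) \<subseteq> words d (length I)" "supp (word (butlast J)) \<subseteq> words d (length J)"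
      "supp (word H) \<subseteq> words d (length H)"
      using IJH by (auto simp: words_def dest: in_set_butlastD)
    show ?thesis unfolding s
      by (simp add: lc_star_eq_qs[OF w(1,2)] lc_star_eq_qs[OF supp_qs[OF w(1,2)] w(3)])
  qed
  have "G2 c x K = (\<Sum>I\<in>supp c. \<Sum>J\<in>supp c. \<Sum>H\<in>supp x. c I * c J * x H *
      ((1/2) * (\<Sum>i=1..d. qs d (qs d (strip i (word I)) (strip i (word J))) (word H) K)))"
    unfolding G2_def using term_eq by (intro sum.cong refl) (simp only: mult.assoc)
  also have "\<dots> = (1/2) * (\<Sum>i=1..d. \<Sum>I\<in>supp c. \<Sum>J\<in>supp c. \<Sum>H\<in>supp x. c I * c J * x H *
      qs d (qs d (strip i (word I)) (strip i (word J))) (word H) K)"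
    unfolding sum_distrib_left
    by (rule trans, rule sum.cong[OF refl], rule sum_swap3, subst sum.swap, intro sum.cong refl) simp
  also have "(\<lambda>i. \<Sum>I\<in>supp c. \<Sum>J\<in>supp c. \<Sum>H\<in>supp x. c I * c J * x H *
      qs d (qs d (strip i (word I)) (strip i (word J))) (word H) K)
    = (\<lambda>i. qs d (qs d (strip i (\<lambda>K. \<Sum>I\<in>supp c. c I * word I K)) (strip i (\<lambda>K. \<Sum>I\<in>supp c. c I * word I K)))
         (\<lambda>K. \<Sum>I\<in>supp x. x I * word I K) K)"
    by (simp add: strip_sum strip_scale qs_sum_left qs_sum_right qs_scale_left qs_scale_right
        sum_distrib_left algebra_simps)
  also have "\<dots> = (\<lambda>i. qs d (qs d (strip i c) (strip i c)) x K)"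
    by (simp flip: fun_eq_sum_word[OF fin(1), of c] fun_eq_sum_word[OF fin(2), of x])
  finally show "G2 c x K = (1/2) * (\<Sum>i=1..d. qs d (qs d (strip i c) (strip i c)) x K)" .
qed

section \<open>Star powers and Taylor series in them\<close>

primrec qs_pow :: "nat \<Rightarrow> (nat list \<Rightarrow> real) \<Rightarrow> nat \<Rightarrow> nat list \<Rightarrow> real" where
  "qs_pow d c 0 = word []"
| "qs_pow d c (Suc k) = qs d c (qs_pow d c k)"

lemma strip_word_Nil [simp]: "strip a (word []) = (\<lambda>K. 0)"
  by (simp add: strip_word)

text \<open>The power rule of the derivation \<open>strip i\<close>. For k = 0 the exponent k - 1 is
  truncated, but the factor \<open>real k\<close> removes the term.\<close>

lemma strip_qs_pow:
  assumes "i > 0"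
  shows "strip i (qs_pow d c k) = (\<lambda>K. real k * qs d (strip i c) (qs_pow d c (k - 1)) K)"
proof (induction k)
  case (Suc k)
  have h: "real k * qs d c (qs d (strip i c) (qs_pow d c (k - 1))) K = real k * qs d (strip i c) (qs_pow d c k) K" for K
    by (cases k) (simp_all add: qs_left_commute)
  show ?case
  proof
    fix K
    have "strip i (qs_pow d c (Suc k)) K
      = qs d (strip i c) (qs_pow d c k) K + real k * qs d c (qs d (strip i c) (qs_pow d c (k - 1))) K"
      using assms Suc by (simp add: strip_qs qs_scale_right)
    then show "strip i (qs_pow d c (Suc k)) K = real (Suc k) * qs d (strip i c) (qs_pow d c (Suc k - 1)) K"
      unfolding h by (simp add: algebra_simps)
  qed
qed simp

text \<open>\<open>strip 0\<close> obeys a second-order Leibniz rule whose extra term pairs the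
  \<open>strip i\<close>. For powers this gives the algebraic form of Ito's formula: k x^(k-1) times
  the drift plus k(k-1)/2 x^(k-2) times the quadratic variation.\<close>

lemma strip_0_qs_pow:
  "strip 0 (qs_pow d c k) = (\<lambda>K. real k * qs d (strip 0 c) (qs_pow d c (k - 1)) K
     + real k * (real k - 1) / 2 * (\<Sum>i=1..d. qs d (qs d (strip i c) (strip i c)) (qs_pow d c (k - 2)) K))"
proof (induction k)
  case (Suc k)
  have 1: "real k * qs d c (qs d (strip 0 c) (qs_pow d c (k - 1))) K = real k * qs d (strip 0 c) (qs_pow d c k) K" for K
    by (cases k) (simp_all add: qs_left_commute)
  \<comment> \<open>Peeling one factor off the power needs k >= 2; for smaller k the subtraction k -
    2 is truncated, and the coefficient is 0.\<close>
  have 2: "real k * (real k - 1) / 2 * qs d c (qs d u (qs_pow d c (k - 2))) K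
      = real k * (real k - 1) / 2 * qs d u (qs_pow d c (k - 1)) K" for K u
  proof (cases "k \<ge> 2")
    case True
    then obtain j where "k = Suc (Suc j)" by (metis add_2_eq_Suc le_Suc_ex)
    then show ?thesis by (simp add: qs_left_commute)
  next
    case False
    then have "k = 0 \<or> k = 1" by linarith
    then show ?thesis by auto
  qed
  have 3: "qs d (strip i c) (strip i (qs_pow d c k)) K
      = real k * qs d (qs d (strip i c) (strip i c)) (qs_pow d c (k - 1)) K" if "i \<in> {1..d}" for i K
    using that by (simp add: strip_qs_pow qs_scale_right qs_assoc)
  show ?case
  proof
    fix K
    have "strip 0 (qs_pow d c (Suc k)) K = qs d (strip 0 c) (qs_pow d c k) K
       + qs d c (strip 0 (qs_pow d c k)) K
       + (\<Sum>i=1..d. qs d (strip i c) (strip i (qs_pow d c k)) K)"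
      by (simp add: strip_qs)
    also have "(\<Sum>i=1..d. qs d (strip i c) (strip i (qs_pow d c k)) K)
       = real k * (\<Sum>i=1..d. qs d (qs d (strip i c) (strip i c)) (qs_pow d c (k - 1)) K)"
      using 3 by (simp add: sum_distrib_left)
    also have "qs d c (strip 0 (qs_pow d c k)) K = real k * qs d c (qs d (strip 0 c) (qs_pow d c (k - 1))) K
       + (\<Sum>i=1..d. real k * (real k - 1) / 2 * qs d c (qs d (qs d (strip i c) (strip i c)) (qs_pow d c (k - 2))) K)"
      unfolding Suc by (simp only: qs_add_right qs_scale_right qs_sum_right sum_distrib_left)
    also have "\<dots> = real k * qs d (strip 0 c) (qs_pow d c k) K
       + real k * (real k - 1) / 2 * (\<Sum>i=1..d. qs d (qs d (strip i c) (strip i c)) (qs_pow d c (k - 1)) K)"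
      unfolding 1 2 by (simp add: sum_distrib_left)
    finally show "strip 0 (qs_pow d c (Suc k)) K = real (Suc k) * qs d (strip 0 c) (qs_pow d c (Suc k - 1)) K
     + real (Suc k) * (real (Suc k) - 1) / 2 * (\<Sum>i=1..d. qs d (qs d (strip i c) (strip i c)) (qs_pow d c (Suc k - 2)) K)"
      by (simp add: field_simps)
  qed
qed simp

text \<open>Cancelling k against k! shifts the index by one. The shifted sum has a top term with
  \<open>a (Suc L)\<close>; its vanishing keeps the range of summation unchanged, so that the lemma
  can be applied repeatedly.\<close>

lemma taylor_sum_shift:
  fixes a u :: "nat \<Rightarrow> real"
  assumes "a (Suc L) = 0"
  shows "(\<Sum>k\<le>L. a k / fact k * (real k * u (k - 1))) = (\<Sum>k\<le>L. a (Suc k) / fact k * u k)"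
proof -
  have "(\<Sum>k\<le>L. a k / fact k * (real k * u (k - 1))) = (\<Sum>k\<le>Suc L. a k / fact k * (real k * u (k - 1)))"
    using assms by simp
  also have "\<dots> = (\<Sum>k\<le>L. a (Suc k) / fact (Suc k) * (real (Suc k) * u k))"
    by (subst sum.atMost_Suc_shift) simp
  also have "\<dots> = (\<Sum>k\<le>L. a (Suc k) / fact k * u k)"
    by (intro sum.cong refl) (simp add: field_simps del: of_nat_Suc)
  finally show ?thesis .
qed

text \<open>The polynomial with derivatives a k at the base point, evaluated in the star algebra at
  c and multiplied by z. With a k the k-th derivative of f at X_0 and the constant term removed from
  c, it represents the product of f along the signature expansion and the functional z. The sequence
  a is kept abstract so that differentiating f becomes a shift of a.\<close>

definition taylor_lc :: "nat \<Rightarrow> nat \<Rightarrow> (nat list \<Rightarrow> real) \<Rightarrow> (nat \<Rightarrow> real) \<Rightarrow> (nat list \<Rightarrow> real) \<Rightarrow> nat list \<Rightarrow> real" where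
  "taylor_lc d L c a z K = (\<Sum>k\<le>L. a k / fact k * qs d (qs_pow d c k) z K)"

lemma strip_upd_Nil [simp]: "strip i (c([] := r)) = strip i c"
  by (simp add: strip_def)

text \<open>The chain rule. An operator with index k consumes k derivatives of f, visible as a
  k-fold shift of a. Passing from c to \<open>c([] := 0)\<close> does not affect the operators,
  because stripping never reads the coefficient of the empty word.\<close>

lemma strip_0_taylor_lc:
  assumes c: "supp c \<subseteq> words d L1" and z: "supp z \<subseteq> words d L2"
    and a: "\<And>k. k > L \<Longrightarrow> a k = 0"
  shows "strip 0 (taylor_lc d L (c([] := 0)) a z) K =
     taylor_lc d L (c([] := 0)) a (G0 z) K + taylor_lc d L (c([] := 0)) (\<lambda>k. a (Suc k)) (G1 c z) K
     + taylor_lc d L (c([] := 0)) (\<lambda>k. a (Suc (Suc k))) (G2 c z) K"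
proof -
  let ?c = "c([] := 0)" and ?p = "qs_pow d (c([] := 0))"
  have fz: "finite (supp z)" using z by (rule finite_subset) simp
  have k: "strip 0 (qs d (?p k) z) K = qs d (?p k) (G0 z) K + real k * qs d (?p (k - 1)) (G1 c z) K
      + real k * (real (k - 1) * qs d (?p (k - 1 - 1)) (G2 c z) K)" for k
  proof -
    have ac: "qs d (qs d u p) w = qs d p (qs d u w)" for u p w
      by (metis qs_assoc qs_commute)
    have e: "real k * real (k - 1) = real k * (real k - 1)" by (cases k) auto
    have "strip 0 (qs d (?p k) z) K = qs d (strip 0 (?p k)) z K + qs d (?p k) (strip 0 z) K
       + (\<Sum>i=1..d. qs d (strip i (?p k)) (strip i z) K)"
      by (simp add: strip_qs)
    also have "(\<Sum>i=1..d. qs d (strip i (?p k)) (strip i z) K)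
       = real k * qs d (?p (k - 1)) (\<lambda>K. \<Sum>i=1..d. qs d (strip i c) (strip i z) K) K"
      unfolding qs_sum_right sum_distrib_left
    proof (rule sum.cong[OF refl])
      fix i assume "i \<in> {1..d}"
      then show "qs d (strip i (?p k)) (strip i z) K
        = real k * qs d (?p (k - 1)) (qs d (strip i c) (strip i z)) K"
        by (simp add: strip_qs_pow qs_scale_left ac)
    qed
    also have "qs d (strip 0 (?p k)) z K = real k * qs d (?p (k - 1)) (qs d (strip 0 c) z) K
       + real k * (real k - 1) * qs d (?p (k - 2)) (\<lambda>K. (1/2) * (\<Sum>i=1..d. qs d (qs d (strip i c) (strip i c)) z K)) K"
      unfolding strip_0_qs_pow qs_add_left qs_scale_left qs_sum_left qs_sum_right qs_scale_right ac
      by simp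
    finally show ?thesis
      unfolding G0_eq[OF fz] G1_eq[OF c z] G2_eq[OF c z] mult.assoc[symmetric] e
      by (simp add: qs_add_right distrib_left numeral_2_eq_2 fun_upd_def)
  qed
  have "strip 0 (taylor_lc d L ?c a z) K = (\<Sum>k\<le>L. a k / fact k * strip 0 (qs d (?p k) z) K)"
    by (simp add: taylor_lc_def strip_def)
  also have "\<dots> = (\<Sum>k\<le>L. a k / fact k * qs d (?p k) (G0 z) K)
     + (\<Sum>k\<le>L. a k / fact k * (real k * qs d (?p (k - 1)) (G1 c z) K))
     + (\<Sum>k\<le>L. a k / fact k * (real k * (real (k - 1) * qs d (?p (k - 1 - 1)) (G2 c z) K)))"
    unfolding k by (simp add: distrib_left sum.distrib)
  also have "(\<Sum>k\<le>L. a k / fact k * (real k * qs d (?p (k - 1)) (G1 c z) K))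
     = (\<Sum>k\<le>L. a (Suc k) / fact k * qs d (?p k) (G1 c z) K)"
    by (rule taylor_sum_shift[of a L "\<lambda>k. qs d (?p k) (G1 c z) K"]) (simp add: a)
  also have "(\<Sum>k\<le>L. a k / fact k * (real k * (real (k - 1) * qs d (?p (k - 1 - 1)) (G2 c z) K)))
     = (\<Sum>k\<le>L. a (Suc k) / fact k * (real k * qs d (?p (k - 1)) (G2 c z) K))"
    by (rule taylor_sum_shift[of a L "\<lambda>k. real k * qs d (?p (k - 1)) (G2 c z) K"]) (simp add: a)
  also have "\<dots> = (\<Sum>k\<le>L. a (Suc (Suc k)) / fact k * qs d (?p k) (G2 c z) K)"
    by (rule taylor_sum_shift[of "\<lambda>k. a (Suc k)" L "\<lambda>k. qs d (?p k) (G2 c z) K"]) (simp add: a)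
  finally show ?thesis by (simp add: taylor_lc_def[abs_def] fun_upd_def)
qed

lemma supp_Gk:
  assumes c: "supp c \<subseteq> words d L1" and z: "supp z \<subseteq> words d L2"
  shows "supp (Gk k c z) \<subseteq> words d (L1 + L1 + L2)"
proof -
  have m: "A \<subseteq> words d L \<Longrightarrow> L \<le> L1 + L1 + L2 \<Longrightarrow> A \<subseteq> words d (L1 + L1 + L2)" for A L
    using words_mono by blast
  note sc = supp_strip[OF c] and sz = supp_strip[OF z]
  have "supp (G0 z) \<subseteq> words d (L1 + L1 + L2)"
    by (subst G0_eq, rule finite_subset[OF z], simp, rule m[OF sz]) simp
  moreover have "supp (G1 c z) \<subseteq> words d (L1 + L1 + L2)"
    unfolding G1_eq[OF c z]
    by (intro supp_add_subset supp_sum_subset m[OF supp_qs[OF sc z]] m[OF supp_qs[OF sc sz]]) auto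
  moreover have "supp (G2 c z) \<subseteq> words d (L1 + L1 + L2)"
    unfolding G2_eq[OF c z]
    by (intro supp_scale_subset supp_sum_subset m[OF supp_qs[OF supp_qs[OF sc sc] z]]) auto
  ultimately show ?thesis by (simp add: Gk_def)
qed

lemma qs_pow_Nil_at: "qs_pow d c k [] = c [] ^ k"
  by (induction k) (simp_all add: word_def)

lemma sum_lists_length_Suc:
  fixes g :: "nat list \<Rightarrow> real"
  shows "(\<Sum>ks\<in>{ks. length ks = Suc l \<and> set ks \<subseteq> {0, 1, 2}}. g ks)
    = (\<Sum>k\<in>{0, 1, 2}. \<Sum>ks\<in>{ks. length ks = l \<and> set ks \<subseteq> {0, 1, 2}}. g (k # ks))"
proof -
  let ?B = "{ks. length ks = l \<and> set ks \<subseteq> {0, 1, 2::nat}}"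
  have "{ks. length ks = Suc l \<and> set ks \<subseteq> {0, 1, 2::nat}} = (\<lambda>(k, ks). k # ks) ` ({0, 1, 2} \<times> ?B)"
    by (auto simp: length_Suc_conv image_iff)
  then have "(\<Sum>ks\<in>{ks. length ks = Suc l \<and> set ks \<subseteq> {0, 1, 2}}. g ks)
     = (\<Sum>p\<in>{0, 1, 2} \<times> ?B. g (fst p # snd p))"
    by (simp only:) (subst sum.reindex, auto simp: inj_on_def split_def)
  also have "\<dots> = (\<Sum>k\<in>{0, 1, 2}. \<Sum>ks\<in>?B. g (k # ks))"
    by (subst sum.cartesian_product) (simp add: split_def)
  finally show ?thesis .
qed

text \<open>Every final 0 that is removed chooses one of the three operators, so l removals produce
  a sum over index lists, and the shifts accumulate to \<open>sum_list ks\<close>. What remains is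
  evaluated at the empty word, where only the power k = 0 survives because the argument has no
  constant term.\<close>

lemma taylor_lc_replicate_0:
  assumes c: "supp c \<subseteq> words d L1" and z: "supp z \<subseteq> words d L2"
    and a: "\<And>k. k > L \<Longrightarrow> a k = 0"
  shows "taylor_lc d L (c([] := 0)) a z (replicate l 0)
    = (\<Sum>ks\<in>{ks. length ks = l \<and> set ks \<subseteq> {0, 1, 2}}. a (sum_list ks) * Gseq c ks z [])"
  using z a
proof (induction l arbitrary: a z L2)
  case 0
  have "taylor_lc d L (c([] := 0)) a z [] = (\<Sum>k\<le>L. if k = 0 then a 0 * z [] else 0)"
    unfolding taylor_lc_def by (intro sum.cong refl) (auto simp: qs_pow_Nil_at)
  also have "\<dots> = a 0 * z []" by (subst sum.delta) auto
  moreover have "{ks :: nat list. length ks = 0 \<and> set ks \<subseteq> {0, 1, 2}} = {[]}" by auto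
  ultimately show ?case unfolding replicate.simps by (simp add: Gseq_def del: fun_upd_apply)
next
  case (Suc l)
  have r: "replicate (Suc l) 0 = replicate l (0::nat) @ [0]" by (simp add: replicate_append_same)
  note IH = Suc.IH[OF supp_Gk[OF c Suc.prems(1)]]
  have "taylor_lc d L (c([] := 0)) a z (replicate (Suc l) 0)
     = strip 0 (taylor_lc d L (c([] := 0)) a z) (replicate l 0)"
    by (simp only: r strip_def)
  also have "\<dots> = taylor_lc d L (c([] := 0)) a (Gk 0 c z) (replicate l 0)
     + taylor_lc d L (c([] := 0)) (\<lambda>k. a (Suc k)) (Gk 1 c z) (replicate l 0)
     + taylor_lc d L (c([] := 0)) (\<lambda>k. a (Suc (Suc k))) (Gk 2 c z) (replicate l 0)"
    by (subst strip_0_taylor_lc[OF c Suc.prems]) (simp_all add: Gk_def)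
  also have "\<dots> = (\<Sum>k\<in>{0, 1, 2}. \<Sum>ks\<in>{ks. length ks = l \<and> set ks \<subseteq> {0, 1, 2}}.
       a (sum_list (k # ks)) * Gseq c (k # ks) z [])"
    by (subst (1 2 3) IH) (simp_all add: Suc.prems(2) Gseq_def)
  finally show ?case by (simp only: sum_lists_length_Suc)
qed

section \<open>Brownian increments and the Ito isometry\<close>

text \<open>The measure is a parameter of its own: the locale is interpreted both in the original
  measure and in its conditioned versions, with the same filtration and the same W.\<close>

locale brownian = prob_space Q
  for Q :: "'a measure" and F :: "real \<Rightarrow> 'a measure" and W :: "nat \<Rightarrow> real \<Rightarrow> 'a \<Rightarrow> real" and d :: nat +
  assumes filt: "filtration (space Q) F"
    and subalg: "\<And>t. subalgebra Q (F t)"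
    and BM: "std_BM Q F d W"
begin

lemma space_F [simp]: "space (F t) = space Q"
  using filtration.space_F[OF filt] .

lemma measurable_F_mono: "f \<in> measurable (F s) N \<Longrightarrow> s \<le> t \<Longrightarrow> f \<in> measurable (F t) N"
  using filtration.sets_F_mono[OF filt, of s t] by (auto simp: measurable_def)

lemma measurable_F_Q: "f \<in> measurable (F s) N \<Longrightarrow> f \<in> measurable Q N"
  using measurable_from_subalg[OF subalg] .

lemma W_adapted: "i \<in> {1..d} \<Longrightarrow> 0 \<le> t \<Longrightarrow> W i t \<in> borel_measurable (F t)"
  using BM by (auto simp: std_BM_def)

lemma W_measurable: "i \<in> {1..d} \<Longrightarrow> 0 \<le> t \<Longrightarrow> W i t \<in> borel_measurable Q"
  by (rule measurable_F_Q[OF W_adapted])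

definition Pd :: "(nat \<Rightarrow> real) measure" where
  "Pd = PiM {1..d} (\<lambda>_. borel)"

lemma Pd_component [measurable]: "i \<in> {1..d} \<Longrightarrow> (\<lambda>x. x i) \<in> borel_measurable Pd"
  unfolding Pd_def by (rule measurable_component_singleton)

definition incr :: "real \<Rightarrow> real \<Rightarrow> 'a \<Rightarrow> nat \<Rightarrow> real" where
  "incr s t \<omega> = (\<lambda>i\<in>{1..d}. W i t \<omega> - W i s \<omega>)"

definition gauss :: "real \<Rightarrow> (nat \<Rightarrow> real) measure" where
  "gauss h = PiM {1..d} (\<lambda>_. density lborel (normal_density 0 (sqrt h)))"

lemma sets_gauss [measurable_cong]: "sets (gauss h) = sets Pd"
  unfolding gauss_def Pd_def by (rule sets_PiM_cong) auto

lemma prob_space_gauss: "h > 0 \<Longrightarrow> prob_space (gauss h)"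
  unfolding gauss_def by (intro prob_space_PiM prob_space_normal_density) simp

lemma incr_measurable [measurable]:
  "0 \<le> s \<Longrightarrow> 0 \<le> t \<Longrightarrow> incr s t \<in> measurable Q Pd"
  unfolding incr_def Pd_def by (intro measurable_restrict borel_measurable_diff W_measurable) auto

lemma incr_indep_measure:
  assumes "0 \<le> s" "s < t" "A \<in> sets (F s)" "B \<in> sets Pd"
  shows "prob (A \<inter> (incr s t -` B \<inter> space Q)) = prob A * measure (gauss (t - s)) B"
proof -
  have "A \<subseteq> space Q" using assms(3) sets.sets_into_space[of A "F s"] by simp
  then have "A \<inter> (incr s t -` B \<inter> space Q) = A \<inter> {\<omega> \<in> space Q. (\<lambda>i\<in>{1..d}. W i t \<omega> - W i s \<omega>) \<in> B}"
    by (auto simp: incr_def)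
  then show ?thesis using BM assms by (simp add: std_BM_def gauss_def Pd_def)
qed

lemma distr_incr:
  assumes "0 \<le> s" "s < t"
  shows "distr Q Pd (incr s t) = gauss (t - s)"
proof (rule measure_eqI)
  fix B assume "B \<in> sets (distr Q Pd (incr s t))"
  then have B: "B \<in> sets Pd" by simp
  interpret G: prob_space "gauss (t - s)" using assms by (intro prob_space_gauss) simp
  have "prob (incr s t -` B \<inter> space Q) = measure (gauss (t - s)) B"
    using incr_indep_measure[OF assms _ B, of "space Q"] sets.top[of "F s"]
    by (simp add: prob_space Int_absorb1)
  then show "emeasure (distr Q Pd (incr s t)) B = emeasure (gauss (t - s)) B"
    using assms B by (simp add: emeasure_distr emeasure_eq_measure G.emeasure_eq_measure)
qed (simp add: sets_gauss)

text \<open>\<open>std_BM\<close> states independence as a product formula for sets. The preimages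
  under U and under a function of the increment are intersection-stable families, so the formula
  extends to the generated sigma-algebras.\<close>

lemma indep_incr:
  assumes st: "0 \<le> s" "s < t" and U: "U \<in> measurable (F s) N" and \<phi>: "\<phi> \<in> measurable Pd N'"
  shows "indep_var N U N' (\<lambda>\<omega>. \<phi> (incr s t \<omega>))"
proof -
  have i: "incr s t \<in> measurable Q Pd" using st by simp
  have m: "(\<lambda>\<omega>. \<phi> (incr s t \<omega>)) \<in> measurable Q N'"
    by (rule measurable_compose[OF i \<phi>])
  have U': "U \<in> measurable Q N" by (rule measurable_F_Q[OF U])
  show ?thesis
    unfolding indep_var_eq
  proof (intro conjI indep_set_sigma_sets U' m)
    show "indep_set {U -` A \<inter> space Q |A. A \<in> sets N} {(\<lambda>\<omega>. \<phi> (incr s t \<omega>)) -` A \<inter> space Q |A. A \<in> sets N'}"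
    proof (safe intro!: indep_setI)
      fix A assume A: "A \<in> sets N"
      show "U -` A \<inter> space Q \<in> events" by (rule measurable_sets[OF U' A])
    next
      fix B assume B: "B \<in> sets N'"
      show "(\<lambda>\<omega>. \<phi> (incr s t \<omega>)) -` B \<inter> space Q \<in> events" by (rule measurable_sets[OF m B])
    next
      fix A B assume A: "A \<in> sets N" and B: "B \<in> sets N'"
      have UA: "U -` A \<inter> space Q \<in> sets (F s)" using measurable_sets[OF U A] by simp
      have B': "\<phi> -` B \<inter> space Pd \<in> sets Pd" by (rule measurable_sets[OF \<phi> B])
      have e: "(\<lambda>\<omega>. \<phi> (incr s t \<omega>)) -` B \<inter> space Q = incr s t -` (\<phi> -` B \<inter> space Pd) \<inter> space Q"
        using measurable_space[OF i] by auto
      have "space Q \<in> sets (F s)" using sets.top[of "F s"] by simp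
      then have e2: "prob (incr s t -` (\<phi> -` B \<inter> space Pd) \<inter> space Q) = measure (gauss (t - s)) (\<phi> -` B \<inter> space Pd)"
        using incr_indep_measure[OF st _ B', of "space Q"] by (simp add: prob_space Int_absorb1)
      show "prob (U -` A \<inter> space Q \<inter> ((\<lambda>\<omega>. \<phi> (incr s t \<omega>)) -` B \<inter> space Q))
         = prob (U -` A \<inter> space Q) * prob ((\<lambda>\<omega>. \<phi> (incr s t \<omega>)) -` B \<inter> space Q)"
        unfolding e e2 by (rule incr_indep_measure[OF st UA B'])
    qed
    show "Int_stable {U -` A \<inter> space Q |A. A \<in> sets N}"
    proof (safe intro!: Int_stableI)
      fix A B assume "A \<in> sets N" "B \<in> sets N"
      then show "\<exists>C. U -` A \<inter> space Q \<inter> (U -` B \<inter> space Q) = U -` C \<inter> space Q \<and> C \<in> sets N"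
        by (intro exI[of _ "A \<inter> B"]) auto
    qed
    show "Int_stable {(\<lambda>\<omega>. \<phi> (incr s t \<omega>)) -` A \<inter> space Q |A. A \<in> sets N'}"
    proof (safe intro!: Int_stableI)
      fix A B assume "A \<in> sets N'" "B \<in> sets N'"
      then show "\<exists>C. (\<lambda>\<omega>. \<phi> (incr s t \<omega>)) -` A \<inter> space Q \<inter> ((\<lambda>\<omega>. \<phi> (incr s t \<omega>)) -` B \<inter> space Q)
         = (\<lambda>\<omega>. \<phi> (incr s t \<omega>)) -` C \<inter> space Q \<and> C \<in> sets N'"
        by (intro exI[of _ "A \<inter> B"]) auto
    qed
  qed
qed

lemma incr_lebesgue_integral:
  fixes \<phi> :: "(nat \<Rightarrow> real) \<Rightarrow> real"
  assumes st: "0 \<le> s" "s < t" and U: "U \<in> borel_measurable (F s)" "integrable Q U"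
    and \<phi>: "integrable (gauss (t - s)) \<phi>"
  shows "integrable Q (\<lambda>\<omega>. U \<omega> * \<phi> (incr s t \<omega>))"
    and "(\<integral>\<omega>. U \<omega> * \<phi> (incr s t \<omega>) \<partial>Q) = (\<integral>\<omega>. U \<omega> \<partial>Q) * (\<integral>x. \<phi> x \<partial>gauss (t - s))"
proof -
  have \<phi>m: "\<phi> \<in> borel_measurable Pd"
    using borel_measurable_integrable[OF \<phi>] by (simp add: measurable_cong_sets[OF sets_gauss refl])
  have im: "incr s t \<in> measurable Q Pd" using st by simp
  note ind = indep_incr[OF st U(1) \<phi>m]
  have i: "integrable Q (\<lambda>\<omega>. \<phi> (incr s t \<omega>))"
    using \<phi> unfolding distr_incr[OF st, symmetric] integrable_distr_eq[OF im \<phi>m] .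
  have e: "(\<integral>\<omega>. \<phi> (incr s t \<omega>) \<partial>Q) = (\<integral>x. \<phi> x \<partial>gauss (t - s))"
    unfolding distr_incr[OF st, symmetric] integral_distr[OF im \<phi>m] ..
  show "integrable Q (\<lambda>\<omega>. U \<omega> * \<phi> (incr s t \<omega>))"
    using indep_var_integrable[OF ind U(2) i] .
  show "(\<integral>\<omega>. U \<omega> * \<phi> (incr s t \<omega>) \<partial>Q) = (\<integral>\<omega>. U \<omega> \<partial>Q) * (\<integral>x. \<phi> x \<partial>gauss (t - s))"
    using indep_var_lebesgue_integral[OF ind U(2) i] e by simp
qed

text \<open>The version without integrability: second moments can then be compared before they are
  known to be finite.\<close>

lemma incr_nn_integral:
  fixes \<phi> :: "(nat \<Rightarrow> real) \<Rightarrow> ennreal" and U :: "'a \<Rightarrow> ennreal"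
  assumes st: "0 \<le> s" "s < t" and U: "U \<in> borel_measurable (F s)" and \<phi>: "\<phi> \<in> borel_measurable Pd"
  shows "(\<integral>\<^sup>+\<omega>. U \<omega> * \<phi> (incr s t \<omega>) \<partial>Q) = (\<integral>\<^sup>+\<omega>. U \<omega> \<partial>Q) * (\<integral>\<^sup>+x. \<phi> x \<partial>gauss (t - s))"
proof -
  have im: "incr s t \<in> measurable Q Pd" using st by simp
  have U' [measurable]: "U \<in> borel_measurable Q" by (rule measurable_F_Q[OF U])
  have V [measurable]: "(\<lambda>\<omega>. \<phi> (incr s t \<omega>)) \<in> borel_measurable Q"
    by (rule measurable_compose[OF im \<phi>])
  let ?V = "\<lambda>\<omega>. \<phi> (incr s t \<omega>)"
  interpret D: prob_space "distr Q borel ?V" by (rule prob_space_distr) simp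
  have eq: "distr Q borel U \<Otimes>\<^sub>M distr Q borel ?V = distr Q (borel \<Otimes>\<^sub>M borel) (\<lambda>x. (U x, ?V x))"
    using indep_incr[OF st U \<phi>] unfolding indep_var_distribution_eq by simp
  have "(\<integral>\<^sup>+\<omega>. U \<omega> * ?V \<omega> \<partial>Q)
     = (\<integral>\<^sup>+p. fst p * snd p \<partial>distr Q (borel \<Otimes>\<^sub>M borel) (\<lambda>x. (U x, ?V x)))"
    by (subst nn_integral_distr) auto
  also have "\<dots> = (\<integral>\<^sup>+p. fst p * snd p \<partial>(distr Q borel U \<Otimes>\<^sub>M distr Q borel ?V))"
    by (simp only: eq)
  also have "\<dots> = (\<integral>\<^sup>+x. \<integral>\<^sup>+y. x * y \<partial>distr Q borel ?V \<partial>distr Q borel U)"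
    by (subst D.nn_integral_fst[symmetric]) auto
  also have "\<dots> = (\<integral>\<^sup>+x. x * (\<integral>\<^sup>+y. y \<partial>distr Q borel ?V) \<partial>distr Q borel U)"
    by (intro nn_integral_cong nn_integral_cmult) auto
  also have "\<dots> = (\<integral>\<^sup>+x. x \<partial>distr Q borel U) * (\<integral>\<^sup>+y. y \<partial>distr Q borel ?V)"
    by (intro nn_integral_multc) auto
  also have "\<dots> = (\<integral>\<^sup>+\<omega>. U \<omega> \<partial>Q) * (\<integral>\<^sup>+\<omega>. ?V \<omega> \<partial>Q)"
    by (simp add: nn_integral_distr)
  also have "(\<integral>\<^sup>+\<omega>. ?V \<omega> \<partial>Q) = (\<integral>\<^sup>+x. \<phi> x \<partial>gauss (t - s))"
    unfolding distr_incr[OF st, symmetric] by (subst nn_integral_distr[OF im]) (use \<phi> in auto)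
  finally show ?thesis .
qed

section \<open>Gaussian moments and martingale increments\<close>

lemma gauss_component:
  assumes "h > 0" "i \<in> {1..d}"
  shows "distr (gauss h) borel (\<lambda>x. x i) = density lborel (normal_density 0 (sqrt h))"
proof -
  have "distr (gauss h) (density lborel (normal_density 0 (sqrt h))) (\<lambda>x. x i)
     = density lborel (normal_density 0 (sqrt h))"
    unfolding gauss_def using assms
    by (intro distr_PiM_component prob_space_normal_density) auto
  then show ?thesis by (simp cong: distr_cong)
qed

text \<open>The double factorial (2q-1)!!, the 2q-th moment of a standard normal variable.\<close>

definition gmom :: "nat \<Rightarrow> real" where "gmom q = fact (2 * q) / (2 ^ q * fact q)"

lemma gmom_nonneg: "0 \<le> gmom q" by (simp add: gmom_def)

lemma gauss_moment_even:
  assumes h: "h > 0" "i \<in> {1..d}"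
  shows "integrable (gauss h) (\<lambda>x. x i ^ (2 * q))" "(\<integral>x. x i ^ (2 * q) \<partial>gauss h) = gmom q * h ^ q"
proof -
  have m: "(\<lambda>x. x i) \<in> borel_measurable (gauss h)" using h(2) by measurable
  have I: "has_bochner_integral lborel (\<lambda>x. normal_density 0 (sqrt h) x * x ^ (2 * q)) (gmom q * h ^ q)"
    using normal_moment_even[of "sqrt h" 0 q] h by (simp add: gmom_def power_divide field_simps)
  have I2: "integrable (density lborel (normal_density 0 (sqrt h))) (\<lambda>x::real. x ^ (2 * q))"
    by (subst integrable_density) (use I in \<open>auto simp: has_bochner_integral_iff\<close>)
  show "integrable (gauss h) (\<lambda>x. x i ^ (2 * q))"
    using I2 unfolding gauss_component[OF h, symmetric] by (subst (asm) integrable_distr_eq) (use m in auto)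
  have "(\<integral>x. x i ^ (2 * q) \<partial>gauss h) = (\<integral>x. x ^ (2 * q) \<partial>distr (gauss h) borel (\<lambda>x. x i))"
    by (subst integral_distr) (use m in auto)
  also have "\<dots> = gmom q * h ^ q"
    unfolding gauss_component[OF h]
    by (subst integral_density) (use I in \<open>auto simp: has_bochner_integral_iff\<close>)
  finally show "(\<integral>x. x i ^ (2 * q) \<partial>gauss h) = gmom q * h ^ q" .
qed

lemma gauss_moment_1:
  assumes h: "h > 0" "i \<in> {1..d}"
  shows "integrable (gauss h) (\<lambda>x. x i)" "(\<integral>x. x i \<partial>gauss h) = 0"
proof -
  have m: "(\<lambda>x. x i) \<in> borel_measurable (gauss h)" using h(2) by measurable
  have I: "has_bochner_integral lborel (\<lambda>x. normal_density 0 (sqrt h) x * x) 0"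
    using normal_moment_odd[of "sqrt h" 0 0] h by simp
  have I2: "integrable (density lborel (normal_density 0 (sqrt h))) (\<lambda>x::real. x)"
    by (subst integrable_density) (use I in \<open>auto simp: has_bochner_integral_iff\<close>)
  show "integrable (gauss h) (\<lambda>x. x i)"
    using I2 unfolding gauss_component[OF h, symmetric] by (subst (asm) integrable_distr_eq) (use m in auto)
  have "(\<integral>x. x i \<partial>gauss h) = (\<integral>x. x \<partial>distr (gauss h) borel (\<lambda>x. x i))"
    by (subst integral_distr) (use m in auto)
  also have "\<dots> = 0"
    unfolding gauss_component[OF h]
    by (subst integral_density) (use I in \<open>auto simp: has_bochner_integral_iff\<close>)
  finally show "(\<integral>x. x i \<partial>gauss h) = 0" .
qed

lemma gauss_moment_mixed:
  assumes h: "h > 0" and ij: "i \<in> {1..d}" "j \<in> {1..d}" "i \<noteq> j"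
  shows "integrable (gauss h) (\<lambda>x. x i * x j)" "(\<integral>x. x i * x j \<partial>gauss h) = 0"
proof -
  let ?g = "density lborel (normal_density 0 (sqrt h)) :: real measure"
  interpret g: prob_space ?g using h by (intro prob_space_normal_density) simp
  interpret P: product_sigma_finite "\<lambda>_::nat. ?g" by standard
  have I: "has_bochner_integral lborel (\<lambda>x. normal_density 0 (sqrt h) x * x) 0"
    using normal_moment_odd[of "sqrt h" 0 0] h by simp
  have I1: "integrable ?g (\<lambda>x::real. x)"
    by (subst integrable_density) (use I in \<open>auto simp: has_bochner_integral_iff\<close>)
  have I2: "(\<integral>x. x \<partial>?g) = 0"
    by (subst integral_density) (use I in \<open>auto simp: has_bochner_integral_iff\<close>)
  \<comment> \<open>Factors 1 in all other coordinates turn \<open>x i * x j\<close> into a full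
    product over 1..d, to which the product rule for independent coordinates applies.\<close>
  let ?f = "\<lambda>k::nat. \<lambda>x::real. if k = i \<or> k = j then x else 1"
  have "(\<Prod>k\<in>{1..d}. if k = i \<or> k = j then x k else 1) = (\<Prod>k\<in>{i, j}. x k)" for x :: "nat \<Rightarrow> real"
    by (rule prod.mono_neutral_cong_right) (use ij in auto)
  then have eq: "(\<Prod>k\<in>{1..d}. ?f k (x k)) = x i * x j" for x :: "nat \<Rightarrow> real" using ij by simp
  have If: "integrable ?g (?f k)" for k using I1 by (cases "k = i \<or> k = j") auto
  show "integrable (gauss h) (\<lambda>x. x i * x j)"
    using P.product_integrable_prod[of "{1..d}" ?f] If unfolding eq gauss_def by simp
  have "(\<integral>x. x i * x j \<partial>gauss h) = (\<Prod>k\<in>{1..d}. integral\<^sup>L ?g (?f k))"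
    using P.product_integral_prod[of "{1..d}" ?f] If unfolding eq gauss_def by simp
  also have "\<dots> = 0" using ij(1) I2 by (intro prod_zero bexI[of _ i]) auto
  finally show "(\<integral>x. x i * x j \<partial>gauss h) = 0" .
qed

text \<open>Conditional mean 0 and conditional variance at most v given \<open>F s\<close>,
  expressed by testing against \<open>F s\<close>-measurable U instead of by conditional
  expectations. The variance clause uses nonnegative integrals, so U may have infinite second
  moment.\<close>

definition centred :: "real \<Rightarrow> real \<Rightarrow> ('a \<Rightarrow> real) \<Rightarrow> bool" where
  "centred s v \<eta> \<longleftrightarrow> \<eta> \<in> borel_measurable Q \<and>
     (\<forall>U\<in>borel_measurable (F s). integrable Q U \<longrightarrow>
        integrable Q (\<lambda>\<omega>. U \<omega> * \<eta> \<omega>) \<and> (\<integral>\<omega>. U \<omega> * \<eta> \<omega> \<partial>Q) = 0) \<and>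
     (\<forall>U\<in>borel_measurable (F s).
        (\<integral>\<^sup>+\<omega>. ennreal ((U \<omega> * \<eta> \<omega>)\<^sup>2) \<partial>Q) \<le> ennreal v * (\<integral>\<^sup>+\<omega>. ennreal ((U \<omega>)\<^sup>2) \<partial>Q))"

lemma centred_incrI:
  fixes \<phi> :: "(nat \<Rightarrow> real) \<Rightarrow> real"
  assumes st: "0 \<le> s" "s < t" and \<phi>: "integrable (gauss (t - s)) \<phi>" "(\<integral>x. \<phi> x \<partial>gauss (t - s)) = 0"
    and v: "integrable (gauss (t - s)) (\<lambda>x. (\<phi> x)\<^sup>2)" "(\<integral>x. (\<phi> x)\<^sup>2 \<partial>gauss (t - s)) \<le> v"
  shows "centred s v (\<lambda>\<omega>. \<phi> (incr s t \<omega>))"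
  unfolding centred_def
proof (intro conjI ballI impI)
  have \<phi>m: "\<phi> \<in> borel_measurable Pd"
    using borel_measurable_integrable[OF \<phi>(1)] by (simp add: measurable_cong_sets[OF sets_gauss refl])
  show "(\<lambda>\<omega>. \<phi> (incr s t \<omega>)) \<in> borel_measurable Q"
    using measurable_compose[OF incr_measurable \<phi>m] st by simp
  fix U :: "'a \<Rightarrow> real" assume U: "U \<in> borel_measurable (F s)"
  {
    assume "integrable Q U"
    from incr_lebesgue_integral[OF st U this \<phi>(1)]
    show "integrable Q (\<lambda>\<omega>. U \<omega> * \<phi> (incr s t \<omega>))" "(\<integral>\<omega>. U \<omega> * \<phi> (incr s t \<omega>) \<partial>Q) = 0"
      using \<phi>(2) by auto
  }
  have "(\<integral>\<^sup>+x. ennreal ((\<phi> x)\<^sup>2) \<partial>gauss (t - s)) \<le> ennreal v"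
    using v by (subst nn_integral_eq_integral) (auto intro: ennreal_leI)
  then have "(\<integral>\<^sup>+\<omega>. ennreal ((U \<omega>)\<^sup>2) * ennreal ((\<phi> (incr s t \<omega>))\<^sup>2) \<partial>Q)
     \<le> (\<integral>\<^sup>+\<omega>. ennreal ((U \<omega>)\<^sup>2) \<partial>Q) * ennreal v"
    using U \<phi>m by (subst incr_nn_integral[OF st]) (auto intro!: mult_left_mono)
  then show "(\<integral>\<^sup>+\<omega>. ennreal ((U \<omega> * \<phi> (incr s t \<omega>))\<^sup>2) \<partial>Q) \<le> ennreal v * (\<integral>\<^sup>+\<omega>. ennreal ((U \<omega>)\<^sup>2) \<partial>Q)"
    by (simp add: power_mult_distrib ennreal_mult' mult.commute)
qed

lemma centred_W:
  assumes st: "0 \<le> s" "s < t" and i: "i \<in> {1..d}"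
  shows "centred s (t - s) (\<lambda>\<omega>. W i t \<omega> - W i s \<omega>)"
proof -
  have "centred s (t - s) (\<lambda>\<omega>. (\<lambda>x. x i) (incr s t \<omega>))"
    using gauss_moment_1[of "t - s" i] gauss_moment_even[of "t - s" i 1] st i
    by (intro centred_incrI[OF st]) (auto simp: gmom_def)
  then show ?thesis using i by (simp add: incr_def)
qed

text \<open>The constant 8 is 3 + 3 + 2: the square is dominated by the two fourth powers, each of
  expectation 3 h^2, and by 2 h^2 from the compensator.\<close>

lemma centred_WW:
  assumes st: "0 \<le> s" "s < t" and ij: "i \<in> {1..d}" "j \<in> {1..d}"
  shows "centred s (8 * (t - s)\<^sup>2) (\<lambda>\<omega>. (W i t \<omega> - W i s \<omega>) * (W j t \<omega> - W j s \<omega>) - (if i = j then t - s else 0))"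
proof -
  let ?h = "t - s" let ?r = "if i = j then ?h else 0"
  have h: "?h > 0" using st by simp
  interpret G: prob_space "gauss ?h" using h by (rule prob_space_gauss)
  have I: "integrable (gauss ?h) (\<lambda>x. x i * x j)" "(\<integral>x. x i * x j \<partial>gauss ?h) = ?r"
    using gauss_moment_mixed[OF h ij] gauss_moment_even[OF h ij(1), of 1]
    by (cases "i = j"; simp add: power2_eq_square gmom_def)+
  have m: "(\<lambda>x. x i) \<in> borel_measurable (gauss ?h)" "(\<lambda>x. x j) \<in> borel_measurable (gauss ?h)"
    using ij by measurable
  have le: "(x i * x j - ?r)\<^sup>2 \<le> x i ^ 4 + x j ^ 4 + 2 * ?h\<^sup>2" for x :: "nat \<Rightarrow> real"
  proof -
    have "(x i * x j - ?r)\<^sup>2 \<le> 2 * (x i * x j)\<^sup>2 + 2 * ?r\<^sup>2"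
      using zero_le_power2[of "x i * x j + ?r"] by (simp add: power2_eq_square algebra_simps)
    moreover have "2 * (x i * x j)\<^sup>2 \<le> x i ^ 4 + x j ^ 4"
      using zero_le_power2[of "(x i)\<^sup>2 - (x j)\<^sup>2"] by (simp add: power2_eq_square power4_eq_xxxx algebra_simps)
    moreover have "?r\<^sup>2 \<le> ?h\<^sup>2" by simp
    ultimately show ?thesis by linarith
  qed
  have I4: "integrable (gauss ?h) (\<lambda>x. x i ^ 4)" "integrable (gauss ?h) (\<lambda>x. x j ^ 4)"
    "(\<integral>x. x i ^ 4 \<partial>gauss ?h) = 3 * ?h\<^sup>2" "(\<integral>x. x j ^ 4 \<partial>gauss ?h) = 3 * ?h\<^sup>2"
    using gauss_moment_even[OF h ij(1), of 2] gauss_moment_even[OF h ij(2), of 2]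
    by (auto simp: gmom_def fact_numeral)
  have Ib: "integrable (gauss ?h) (\<lambda>x. x i ^ 4 + x j ^ 4 + 2 * ?h\<^sup>2)" using I4 by simp
  have Is: "integrable (gauss ?h) (\<lambda>x. (x i * x j - ?r)\<^sup>2)"
    by (rule Bochner_Integration.integrable_bound[OF Ib]) (use m le in \<open>auto intro!: order_trans[OF le]\<close>)
  have "centred s (8 * ?h\<^sup>2) (\<lambda>\<omega>. (\<lambda>x. x i * x j - ?r) (incr s t \<omega>))"
  proof (rule centred_incrI[OF st _ _ Is])
    show "integrable (gauss ?h) (\<lambda>x. x i * x j - ?r)" using I by simp
    show "(\<integral>x. x i * x j - ?r \<partial>gauss ?h) = 0" using I by (simp add: G.prob_space)
    have "(\<integral>x. (x i * x j - ?r)\<^sup>2 \<partial>gauss ?h) \<le> (\<integral>x. x i ^ 4 + x j ^ 4 + 2 * ?h\<^sup>2 \<partial>gauss ?h)"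
      by (rule integral_mono[OF Is Ib le])
    also have "\<dots> = 8 * ?h\<^sup>2" using I4 by (simp add: G.prob_space)
    finally show "(\<integral>x. (x i * x j - ?r)\<^sup>2 \<partial>gauss ?h) \<le> 8 * ?h\<^sup>2" .
  qed
  then show ?thesis using ij by (simp add: incr_def)
qed

section \<open>The L2-norm and orthogonal sums\<close>

declare Pd_component [measurable del]

text \<open>The squared L2-norm with values in \<open>ennreal\<close>, so that estimates can be
  chained without integrability conditions.\<close>

abbreviation n2 :: "('a \<Rightarrow> real) \<Rightarrow> ennreal" where
  "n2 f \<equiv> (\<integral>\<^sup>+\<omega>. ennreal ((f \<omega>)\<^sup>2) \<partial>Q)"

lemma integrable_mult_n2:
  assumes [measurable]: "f \<in> borel_measurable Q" "g \<in> borel_measurable Q" and "n2 f < \<infinity>" "n2 g < \<infinity>"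
  shows "integrable Q (\<lambda>\<omega>. f \<omega> * g \<omega>)"
proof (rule integrableI_bounded)
  have "(\<integral>\<^sup>+\<omega>. ennreal (norm (f \<omega> * g \<omega>)) \<partial>Q) \<le> (\<integral>\<^sup>+\<omega>. ennreal ((f \<omega>)\<^sup>2) + ennreal ((g \<omega>)\<^sup>2) \<partial>Q)"
  proof (intro nn_integral_mono)
    fix \<omega>
    have "2 * \<bar>f \<omega> * g \<omega>\<bar> \<le> (f \<omega>)\<^sup>2 + (g \<omega>)\<^sup>2"
      using sum_squares_bound[of "\<bar>f \<omega>\<bar>" "\<bar>g \<omega>\<bar>"] by (simp add: abs_mult)
    then show "ennreal (norm (f \<omega> * g \<omega>)) \<le> ennreal ((f \<omega>)\<^sup>2) + ennreal ((g \<omega>)\<^sup>2)"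
      by (simp flip: ennreal_plus add: ennreal_leI)
  qed
  also have "\<dots> < \<infinity>" using assms by (subst nn_integral_add) (auto simp: less_top)
  finally show "(\<integral>\<^sup>+\<omega>. ennreal (norm (f \<omega> * g \<omega>)) \<partial>Q) < \<infinity>" .
qed simp

text \<open>Pythagoras: if both norms are finite, \<open>V * U\<close> is an integrable
  \<open>F s\<close>-measurable test function, so the cross term with the centred \<eta>
  vanishes.\<close>

lemma n2_orthogonal_add:
  assumes c: "centred s v \<eta>" and V: "V \<in> borel_measurable (F s)" and U: "U \<in> borel_measurable (F s)"
  shows "n2 (\<lambda>\<omega>. V \<omega> + U \<omega> * \<eta> \<omega>) \<le> n2 V + ennreal v * n2 U"
proof (cases "n2 V < \<infinity> \<and> n2 U < \<infinity>")
  case True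
  have [measurable]: "V \<in> borel_measurable Q" "U \<in> borel_measurable Q" "\<eta> \<in> borel_measurable Q"
    using measurable_F_Q V U c by (auto simp: centred_def)
  have UE: "n2 (\<lambda>\<omega>. U \<omega> * \<eta> \<omega>) \<le> ennreal v * n2 U" using c U by (auto simp: centred_def)
  have fin: "n2 (\<lambda>\<omega>. U \<omega> * \<eta> \<omega>) < \<infinity>"
    using UE True by (auto simp: ennreal_mult_less_top intro: le_less_trans)
  have VU: "integrable Q (\<lambda>\<omega>. V \<omega> * U \<omega>)" using True by (intro integrable_mult_n2) auto
  have "(\<lambda>\<omega>. V \<omega> * U \<omega>) \<in> borel_measurable (F s)" using V U by simp
  then have 0: "integrable Q (\<lambda>\<omega>. V \<omega> * U \<omega> * \<eta> \<omega>)" "(\<integral>\<omega>. V \<omega> * U \<omega> * \<eta> \<omega> \<partial>Q) = 0"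
    using c VU unfolding centred_def by blast+
  have i1: "integrable Q (\<lambda>\<omega>. (V \<omega>)\<^sup>2)" using integrable_mult_n2[of V V] True by (simp add: power2_eq_square)
  have i2: "integrable Q (\<lambda>\<omega>. (U \<omega> * \<eta> \<omega>)\<^sup>2)"
    using integrable_mult_n2[of "\<lambda>\<omega>. U \<omega> * \<eta> \<omega>" "\<lambda>\<omega>. U \<omega> * \<eta> \<omega>"] fin by (simp add: power2_eq_square)
  have sq: "(V \<omega> + U \<omega> * \<eta> \<omega>)\<^sup>2 = (V \<omega>)\<^sup>2 + 2 * (V \<omega> * U \<omega> * \<eta> \<omega>) + (U \<omega> * \<eta> \<omega>)\<^sup>2" for \<omega>
    by (simp add: power2_eq_square algebra_simps)
  have isq: "integrable Q (\<lambda>\<omega>. (V \<omega> + U \<omega> * \<eta> \<omega>)\<^sup>2)"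
    unfolding sq using i1 i2 0 by simp
  have "n2 (\<lambda>\<omega>. V \<omega> + U \<omega> * \<eta> \<omega>) = ennreal (\<integral>\<omega>. (V \<omega> + U \<omega> * \<eta> \<omega>)\<^sup>2 \<partial>Q)"
    using isq by (intro nn_integral_eq_integral) auto
  also have "(\<integral>\<omega>. (V \<omega> + U \<omega> * \<eta> \<omega>)\<^sup>2 \<partial>Q) = (\<integral>\<omega>. (V \<omega>)\<^sup>2 \<partial>Q) + (\<integral>\<omega>. (U \<omega> * \<eta> \<omega>)\<^sup>2 \<partial>Q)"
    unfolding sq using i1 i2 0 by simp
  also have "ennreal \<dots> = n2 V + n2 (\<lambda>\<omega>. U \<omega> * \<eta> \<omega>)"
    using i1 i2 by (simp add: ennreal_plus nn_integral_eq_integral)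
  finally show ?thesis using UE by (simp add: add_left_mono)
next
  case False
  then consider "n2 V = \<infinity>" | "n2 U = \<infinity>" by (metis infinity_ennreal_def top.not_eq_extremum)
  then show ?thesis
  proof cases
    case 2
    show ?thesis
    proof (cases "v > 0")
      case True
      then show ?thesis using 2 by (simp add: ennreal_mult_top)
    next
      case F: False
      \<comment> \<open>Here \<open>ennreal v\<close> is 0 and the product with an infinite
        \<open>n2 U\<close> is 0 as well, so the right-hand side does not become infinite. Testing
        the variance clause with the constant 1 shows instead that \<eta> is 0 almost
        surely.\<close>
      have [measurable]: "U \<in> borel_measurable Q" "\<eta> \<in> borel_measurable Q"
        using measurable_F_Q U c by (auto simp: centred_def)
      have "\<forall>U\<in>borel_measurable (F s). n2 (\<lambda>\<omega>. U \<omega> * \<eta> \<omega>) \<le> ennreal v * n2 U"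
        using c unfolding centred_def by blast
      from bspec[OF this borel_measurable_const[of "1::real"]]
      have "n2 \<eta> = 0" using F by (simp add: ennreal_neg)
      then have "AE \<omega> in Q. \<eta> \<omega> = 0" by (subst (asm) nn_integral_0_iff_AE) auto
      then have "n2 (\<lambda>\<omega>. V \<omega> + U \<omega> * \<eta> \<omega>) = n2 V" by (intro nn_integral_cong_AE) auto
      then show ?thesis by simp
    qed
  qed simp
qed

text \<open>The discrete Ito isometry, as an inequality: each new increment is centred given
  everything that the preceding partial sum depends on.\<close>

lemma n2_orthogonal_sum:
  assumes c: "\<And>j. j < m \<Longrightarrow> centred (\<sigma> j) (v j) (\<eta> j)"
    and mono: "\<And>j. j < m \<Longrightarrow> \<sigma> j \<le> \<sigma> (Suc j)"
    and \<eta>: "\<And>j. j < m \<Longrightarrow> \<eta> j \<in> borel_measurable (F (\<sigma> (Suc j)))"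
    and U: "\<And>j. j < m \<Longrightarrow> U j \<in> borel_measurable (F (\<sigma> j))"
  shows "(\<lambda>\<omega>. \<Sum>j<m. U j \<omega> * \<eta> j \<omega>) \<in> borel_measurable (F (\<sigma> m)) \<and>
    n2 (\<lambda>\<omega>. \<Sum>j<m. U j \<omega> * \<eta> j \<omega>) \<le> (\<Sum>j<m. ennreal (v j) * n2 (U j))"
  using assms
proof (induction m)
  case (Suc m)
  have IH: "(\<lambda>\<omega>. \<Sum>j<m. U j \<omega> * \<eta> j \<omega>) \<in> borel_measurable (F (\<sigma> m))"
    "n2 (\<lambda>\<omega>. \<Sum>j<m. U j \<omega> * \<eta> j \<omega>) \<le> (\<Sum>j<m. ennreal (v j) * n2 (U j))"
    using Suc.IH[OF Suc.prems(1)[OF less_SucI] Suc.prems(2)[OF less_SucI] Suc.prems(3)[OF less_SucI]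
        Suc.prems(4)[OF less_SucI]] by blast+
  have mm: "f \<in> borel_measurable (F (\<sigma> m)) \<Longrightarrow> f \<in> borel_measurable (F (\<sigma> (Suc m)))" for f :: "'a \<Rightarrow> real"
    by (rule measurable_F_mono[OF _ Suc.prems(2)[OF lessI]])
  have 1: "(\<lambda>\<omega>. \<Sum>j<Suc m. U j \<omega> * \<eta> j \<omega>) \<in> borel_measurable (F (\<sigma> (Suc m)))"
    using mm[OF IH(1)] mm[OF Suc.prems(4)[OF lessI]] Suc.prems(3)[OF lessI] by simp
  have "n2 (\<lambda>\<omega>. \<Sum>j<Suc m. U j \<omega> * \<eta> j \<omega>) \<le> n2 (\<lambda>\<omega>. \<Sum>j<m. U j \<omega> * \<eta> j \<omega>) + ennreal (v m) * n2 (U m)"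
    using n2_orthogonal_add[OF Suc.prems(1)[OF lessI] IH(1) Suc.prems(4)[OF lessI]] by simp
  also have "\<dots> \<le> (\<Sum>j<Suc m. ennreal (v j) * n2 (U j))"
    using IH(2) by (simp add: add_right_mono)
  finally show ?case using 1 by blast
qed simp

end

section \<open>Partitions and simple integrands\<close>

definition partition_of :: "(nat \<Rightarrow> real) \<Rightarrow> nat \<Rightarrow> real \<Rightarrow> real \<Rightarrow> bool" where
  "partition_of p r s t \<longleftrightarrow> p 0 = s \<and> p r = t \<and> (\<forall>j<r. p j < p (Suc j))"

lemma partition_of_less:
  assumes "partition_of p r s t" "i < j" "j \<le> r"
  shows "p i < p j"
  using assms(2,3)
proof (induction j)
  case (Suc j)
  have "p j < p (Suc j)" using assms(1) Suc.prems by (simp add: partition_of_def)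
  then show ?case using Suc by (cases "i = j") auto
qed simp

lemma partition_of_le:
  assumes "partition_of p r s t" "i \<le> j" "j \<le> r"
  shows "p i \<le> p j"
  using partition_of_less[OF assms(1), of i j] assms by (cases "i = j") auto

lemma partition_of_bounds:
  assumes "partition_of p r s t" "j \<le> r"
  shows "s \<le> p j" "p j \<le> t"
  using partition_of_le[OF assms(1), of 0 j] partition_of_le[OF assms(1), of j r] assms
  by (auto simp: partition_of_def)

lemma ex_partition_of:
  assumes "finite P" "s \<in> P" "t \<in> P" "P \<subseteq> {s..t}"
  shows "\<exists>p r. partition_of p r s t \<and> P = p ` {..r}"
proof -
  define xs where "xs = sorted_list_of_set P"
  have xs: "set xs = P" "sorted_wrt (<) xs" "xs \<noteq> []"
    using assms by (auto simp: xs_def)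
  define r where "r = length xs - 1"
  have len: "length xs = Suc r" using xs(3) by (simp add: r_def)
  have lt: "i < j \<Longrightarrow> j \<le> r \<Longrightarrow> xs ! i < xs ! j" for i j
    using xs(2) len by (simp add: sorted_wrt_iff_nth_less)
  have im: "P = (!) xs ` {..r}"
    using xs(1) len by (auto simp: set_conv_nth less_Suc_eq_le)
  obtain i where i: "i \<le> r" "xs ! i = s" using im assms(2) by auto
  obtain j where j: "j \<le> r" "xs ! j = t" using im assms(3) by auto
  have "xs ! 0 \<in> P" "xs ! r \<in> P" using im by auto
  then have b: "s \<le> xs ! 0" "xs ! r \<le> t" using assms(4) by auto
  have "xs ! 0 = s" using lt[of 0 i] i b by (cases "i = 0") auto
  moreover have "xs ! r = t" using lt[of j r] j b by (cases "j = r") auto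
  ultimately have "partition_of ((!) xs) r s t" using lt by (simp add: partition_of_def)
  then show ?thesis using im by blast
qed

text \<open>The projection of a breakpoint to [s, t]. Breakpoints outside the interval collapse to
  an end point, so a partition of [s, t] refines a simple process as soon as it contains the
  projected breakpoints.\<close>

definition clip :: "real \<Rightarrow> real \<Rightarrow> real \<Rightarrow> real" where
  "clip s t x = max s (min x t)"

text \<open>On a left-open cell of the partition, lying beyond the breakpoint x is a property of the
  cell alone. Hence indicators of left-open intervals with such end points are constant on
  cells.\<close>

lemma partition_less_iff:
  assumes p: "partition_of p r s t" and j: "j < r" and u: "p j < u" "u \<le> p (Suc j)"
    and k: "k \<le> r" "p k = clip s t x"
  shows "x < u \<longleftrightarrow> k \<le> j"
proof -
  have st: "s \<le> p j" "p (Suc j) \<le> t" using partition_of_bounds[OF p] j by auto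
  show ?thesis
  proof
    assume "x < u"
    show "k \<le> j"
    proof (rule ccontr)
      assume "\<not> k \<le> j"
      then have "p (Suc j) \<le> p k" using partition_of_le[OF p, of "Suc j" k] k by simp
      then show False using k u st \<open>x < u\<close> by (auto simp: clip_def)
    qed
  next
    assume "k \<le> j"
    then have 1: "p k \<le> p j" using partition_of_le[OF p, of k j] j by simp
    have "x \<le> t \<or> p k = t" using k st u by (auto simp: clip_def min_def max_def)
    then show "x < u" using 1 u st k by (auto simp: clip_def)
  qed
qed

lemma partition_telescope:
  fixes g :: "real \<Rightarrow> real"
  assumes p: "partition_of p r s t" and ab: "a \<le> b"
    and P: "clip s t a \<in> p ` {..r}" "clip s t b \<in> p ` {..r}"
  shows "(\<Sum>j<r. indicator {a<..b} (p (Suc j)) * (g (p (Suc j)) - g (p j))) = g (clip s t b) - g (clip s t a)"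
proof -
  obtain ka where ka: "ka \<le> r" "p ka = clip s t a" using P(1) by force
  obtain kb where kb: "kb \<le> r" "p kb = clip s t b" using P(2) by force
  have "p ka \<le> p kb" using ka kb ab by (auto simp: clip_def)
  then have le: "ka \<le> kb" using partition_of_less[OF p, of kb ka] ka by (meson leD leI)
  have ind: "indicator {a<..b} (p (Suc j)) = (if j \<in> {ka..<kb} then 1 else (0::real))" if "j < r" for j
  proof -
    have "p j < p (Suc j)" using p that by (simp add: partition_of_def)
    then show ?thesis
      using partition_less_iff[OF p that _ order.refl ka] partition_less_iff[OF p that _ order.refl kb]
      by (auto simp: indicator_def)
  qed
  have "(\<Sum>j<r. indicator {a<..b} (p (Suc j)) * (g (p (Suc j)) - g (p j)))
     = (\<Sum>j<r. if j \<in> {ka..<kb} then g (p (Suc j)) - g (p j) else 0)"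
    by (intro sum.cong refl) (simp add: ind)
  also have "\<dots> = (\<Sum>j\<in>{ka..<kb}. g (p (Suc j)) - g (p j))"
    using kb by (intro sum.mono_neutral_cong_right) auto
  also have "\<dots> = g (p kb) - g (p ka)" using sum_Suc_diff'[OF le, of "\<lambda>j. g (p j)"] .
  finally show ?thesis using ka kb by simp
qed

text \<open>Two simple processes with different breakpoints can thus be integrated over the same
  increments and subtracted cell by cell. The integrand is read at the right end of a cell because
  its intervals are closed on the right.\<close>

lemma simple_int_refine:
  assumes p: "partition_of p r s t" and st: "s \<le> t"
    and inc: "\<And>j. j < m \<Longrightarrow> \<sigma> j < \<sigma> (Suc j)" and P: "clip s t ` \<sigma> ` {..m} \<subseteq> p ` {..r}"
  shows "simple_int B m \<sigma> \<xi> t \<omega> - simple_int B m \<sigma> \<xi> s \<omega>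
     = (\<Sum>j<r. simple_val m \<sigma> \<xi> (p (Suc j)) \<omega> * (B (p (Suc j)) \<omega> - B (p j) \<omega>))"
proof -
  let ?g = "\<lambda>u. B u \<omega>"
  have g: "?g (min x t) - ?g (min x s) = ?g (clip s t x) - ?g s" for x
    using st by (cases "x \<le> s") (auto simp: clip_def min_def max_def)
  have "simple_int B m \<sigma> \<xi> t \<omega> - simple_int B m \<sigma> \<xi> s \<omega>
     = (\<Sum>i<m. \<xi> i \<omega> * ((?g (min (\<sigma> (Suc i)) t) - ?g (min (\<sigma> (Suc i)) s)) - (?g (min (\<sigma> i) t) - ?g (min (\<sigma> i) s))))"
    by (simp add: simple_int_def sum_subtractf[symmetric] algebra_simps)
  also have "\<dots> = (\<Sum>i<m. \<xi> i \<omega> * (?g (clip s t (\<sigma> (Suc i))) - ?g (clip s t (\<sigma> i))))"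
    unfolding g by simp
  also have "\<dots> = (\<Sum>i<m. \<xi> i \<omega> * (\<Sum>j<r. indicator {\<sigma> i<..\<sigma> (Suc i)} (p (Suc j)) * (?g (p (Suc j)) - ?g (p j))))"
  proof (intro sum.cong refl arg_cong2[where f="(*)"])
    fix i assume "i \<in> {..<m}"
    then have "clip s t (\<sigma> i) \<in> p ` {..r}" "clip s t (\<sigma> (Suc i)) \<in> p ` {..r}" using P by auto
    from partition_telescope[OF p _ this, of ?g] inc[of i] \<open>i \<in> {..<m}\<close>
    show "?g (clip s t (\<sigma> (Suc i))) - ?g (clip s t (\<sigma> i))
      = (\<Sum>j<r. indicator {\<sigma> i<..\<sigma> (Suc i)} (p (Suc j)) * (?g (p (Suc j)) - ?g (p j)))" by simp
  qed
  also have "\<dots> = (\<Sum>j<r. simple_val m \<sigma> \<xi> (p (Suc j)) \<omega> * (?g (p (Suc j)) - ?g (p j)))"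
    unfolding simple_val_def sum_distrib_left sum_distrib_right
    by (subst sum.swap) (intro sum.cong refl, simp)
  finally show ?thesis .
qed

lemma simple_val_refine:
  assumes p: "partition_of p r s t" and P: "clip s t ` \<sigma> ` {..m} \<subseteq> p ` {..r}"
    and j: "j < r" and u: "p j < u" "u \<le> p (Suc j)"
  shows "simple_val m \<sigma> \<xi> u \<omega> = simple_val m \<sigma> \<xi> (p (Suc j)) \<omega>"
  unfolding simple_val_def
proof (intro sum.cong refl arg_cong2[where f="(*)"])
  fix i assume "i \<in> {..<m}"
  then have "clip s t (\<sigma> i) \<in> p ` {..r}" "clip s t (\<sigma> (Suc i)) \<in> p ` {..r}" using P by auto
  then obtain k k' where k: "k \<le> r" "p k = clip s t (\<sigma> i)" "k' \<le> r" "p k' = clip s t (\<sigma> (Suc i))"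
    by force
  have lt: "p j < p (Suc j)" using u by simp
  show "indicator {\<sigma> i<..\<sigma> (Suc i)} u = (indicator {\<sigma> i<..\<sigma> (Suc i)} (p (Suc j)) :: real)"
    using partition_less_iff[OF p j u k(1,2)] partition_less_iff[OF p j u k(3,4)]
      partition_less_iff[OF p j lt order.refl k(1,2)] partition_less_iff[OF p j lt order.refl k(3,4)]
    by (auto simp: indicator_def)
qed

text \<open>Although read at the right end, the value is known at the left end: an interval of the
  simple process that meets the cell must have started no later than \<open>p j\<close>.\<close>

lemma (in brownian) simple_val_measurable_refine:
  assumes p: "partition_of p r s t" and P: "clip s t ` \<sigma> ` {..m} \<subseteq> p ` {..r}"
    and \<xi>: "\<And>i. i < m \<Longrightarrow> \<xi> i \<in> borel_measurable (F (\<sigma> i))" and j: "j < r"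
  shows "simple_val m \<sigma> \<xi> (p (Suc j)) \<in> borel_measurable (F (p j))"
proof -
  have "(\<lambda>\<omega>. \<xi> i \<omega> * indicator {\<sigma> i<..\<sigma> (Suc i)} (p (Suc j))) \<in> borel_measurable (F (p j))" if i: "i < m" for i
  proof (cases "\<sigma> i < p (Suc j)")
    case True
    have "clip s t (\<sigma> i) \<in> p ` {..r}" using P i by auto
    then obtain k where k: "k \<le> r" "p k = clip s t (\<sigma> i)" by force
    have lt: "p j < p (Suc j)" using p j by (simp add: partition_of_def)
    have "k \<le> j" using partition_less_iff[OF p j lt order.refl k] True by simp
    then have "p k \<le> p j" using partition_of_le[OF p, of k j] j by simp
    moreover have "p (Suc j) \<le> t" using partition_of_bounds[OF p, of "Suc j"] j by simp
    ultimately have "\<sigma> i \<le> p j" using k True by (auto simp: clip_def)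
    then show ?thesis using measurable_F_mono[OF \<xi>[OF i]] by simp
  qed simp
  then show ?thesis unfolding simple_val_def[abs_def] by (intro borel_measurable_sum) auto
qed

lemma nn_integral_partition:
  fixes g :: "real \<Rightarrow> real"
  assumes p: "partition_of p r s t" and g: "\<And>j u. j < r \<Longrightarrow> p j < u \<Longrightarrow> u \<le> p (Suc j) \<Longrightarrow> g u = v j"
    and v: "\<And>j. j < r \<Longrightarrow> 0 \<le> v j"
  shows "(\<integral>\<^sup>+u. ennreal (g u) * indicator {s<..t} u \<partial>lborel) = ennreal (\<Sum>j<r. v j * (p (Suc j) - p j))"
  using assms
proof (induction r arbitrary: t)
  case 0
  then show ?case by (simp add: partition_of_def)
next
  case (Suc r)
  have p': "partition_of p r s (p r)" using Suc.prems(1) by (simp add: partition_of_def)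
  have t: "t = p (Suc r)" and lt: "p r < p (Suc r)" using Suc.prems(1) by (auto simp: partition_of_def)
  have spr: "s \<le> p r" using partition_of_bounds[OF p', of r] by simp
  have IH: "(\<integral>\<^sup>+u. ennreal (g u) * indicator {s<..p r} u \<partial>lborel) = ennreal (\<Sum>j<r. v j * (p (Suc j) - p j))"
    by (rule Suc.IH[OF p']) (use Suc.prems(2,3) in auto)
  have "(\<integral>\<^sup>+u. ennreal (g u) * indicator {s<..t} u \<partial>lborel)
     = (\<integral>\<^sup>+u. ennreal (g u) * indicator {s<..p r} u + ennreal (v r) * indicator {p r<..p (Suc r)} u \<partial>lborel)"
    using spr lt t Suc.prems(2)[of r] by (intro nn_integral_cong) (auto simp: indicator_def)
  also have "\<dots> = (\<integral>\<^sup>+u. ennreal (g u) * indicator {s<..p r} u \<partial>lborel)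
      + (\<integral>\<^sup>+u. ennreal (v r) * indicator {p r<..p (Suc r)} u \<partial>lborel)"
  proof (rule nn_integral_add)
    have "(\<lambda>u. ennreal (g u) * indicator {s<..p r} u) = (\<lambda>u. \<Sum>j<r. ennreal (v j) * indicator {p j<..p (Suc j)} u)"
    proof
      fix u
      have tel: "indicator {s<..p r} u = (\<Sum>j<r. indicator {p j<..p (Suc j)} u :: ennreal)"
        using p'
      proof (induction r)
        case 0 then show ?case by (simp add: partition_of_def)
      next
        case (Suc r)
        have "partition_of p r s (p r)" using Suc.prems by (simp add: partition_of_def)
        with Suc.IH partition_of_bounds(1)[OF this, of r]
        show ?case using Suc.prems by (auto simp: partition_of_def indicator_def)
      qed
      have "ennreal (g u) * indicator {p j<..p (Suc j)} u = ennreal (v j) * indicator {p j<..p (Suc j)} u" if "j < r" for j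
        using Suc.prems(2)[of j u] that by (auto simp: indicator_def)
      then show "ennreal (g u) * indicator {s<..p r} u = (\<Sum>j<r. ennreal (v j) * indicator {p j<..p (Suc j)} u)"
        unfolding tel sum_distrib_left by (intro sum.cong) auto
    qed
    then show "(\<lambda>u. ennreal (g u) * indicator {s<..p r} u) \<in> borel_measurable lborel" by (simp only:) measurable
  qed simp
  also have "(\<integral>\<^sup>+u. ennreal (v r) * indicator {p r<..p (Suc r)} u \<partial>lborel) = ennreal (v r * (p (Suc r) - p r))"
    using lt Suc.prems(3)[of r] by (simp add: nn_integral_cmult ennreal_mult)
  finally have eq: "(\<integral>\<^sup>+u. ennreal (g u) * indicator {s<..t} u \<partial>lborel)
     = ennreal (\<Sum>j<r. v j * (p (Suc j) - p j)) + ennreal (v r * (p (Suc r) - p r))" unfolding IH .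
  have "0 \<le> (\<Sum>j<r. v j * (p (Suc j) - p j))"
    using Suc.prems(1,3) by (intro sum_nonneg mult_nonneg_nonneg) (auto simp: partition_of_def less_imp_le)
  moreover have "0 \<le> v r * (p (Suc r) - p r)" using Suc.prems(3)[of r] lt by simp
  ultimately show ?case unfolding eq by (simp add: ennreal_plus)
qed

text \<open>Partial sums of nonnegative terms increase, so the terms that are kept form an initial
  segment, and the total of that segment is at most R.\<close>

lemma truncated_sum_le:
  fixes a :: "nat \<Rightarrow> real"
  assumes "\<And>j. j < r \<Longrightarrow> 0 \<le> a j" "0 \<le> R"
  shows "(\<Sum>j<r. if (\<Sum>i\<le>j. a i) \<le> R then a j else 0) \<le> min R (\<Sum>j<r. a j)"
  using assms
proof (induction r)
  case (Suc r)
  have IH: "(\<Sum>j<r. if (\<Sum>i\<le>j. a i) \<le> R then a j else 0) \<le> min R (\<Sum>j<r. a j)"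
    using Suc.IH Suc.prems by simp
  have "(\<Sum>i\<le>r. a i) = (\<Sum>i<r. a i) + a r" by (simp add: lessThan_Suc_atMost[symmetric])
  then show ?case using IH Suc.prems(1)[of r] by auto
qed simp

section \<open>Stochastic and time integrals: comparison with simple processes\<close>

context brownian begin

lemma id_measurable_F: "(\<lambda>x. x) \<in> measurable Q (F t)"
  using measurable_F_Q[OF measurable_ident, of t] by (simp add: id_def)

text \<open>Progressive measurability concerns [0, t] only. Clipping the time argument gives a
  jointly measurable function on the whole line, to which Fubini applies, without changing the
  values on [0, t].\<close>

lemma progressive_measurable:
  assumes H: "progressive F H" and t: "0 \<le> t"
  shows "(\<lambda>p. H (max 0 (min (snd p) t)) (fst p)) \<in> borel_measurable (Q \<Otimes>\<^sub>M lborel)"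
proof -
  have 1: "(\<lambda>u. max 0 (min u t)) \<in> measurable lborel (restrict_space lborel {0..t})"
    using t by (intro measurable_restrict_space2) auto
  have "(\<lambda>p. (max 0 (min (snd p) t), fst p)) \<in> measurable (Q \<Otimes>\<^sub>M lborel) (restrict_space lborel {0..t} \<Otimes>\<^sub>M F t)"
    by (rule measurable_Pair[OF measurable_compose[OF measurable_snd 1] measurable_compose[OF measurable_fst id_measurable_F]])
  from measurable_compose[OF this H[unfolded progressive_def, rule_format, OF t]]
  show ?thesis by simp
qed

lemma progressive_section:
  assumes H: "progressive F H" and t: "0 \<le> t"
  shows "H t \<in> borel_measurable (F t)"
proof -
  have "(\<lambda>\<omega>. (t, \<omega>)) \<in> measurable (F t) (restrict_space lborel {0..t} \<Otimes>\<^sub>M F t)"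
    using t by (intro measurable_Pair measurable_const) (auto simp: space_restrict_space)
  from measurable_compose[OF this H[unfolded progressive_def, rule_format, OF t]]
  show ?thesis by simp
qed

lemma simple_val_measurable:
  assumes "simple_adapted F m \<sigma> \<xi>"
  shows "(\<lambda>p. simple_val m \<sigma> \<xi> (snd p) (fst p)) \<in> borel_measurable (Q \<Otimes>\<^sub>M lborel)"
  unfolding simple_val_def
proof (intro borel_measurable_sum borel_measurable_times)
  fix j assume "j \<in> {..<m}"
  then have "\<xi> j \<in> borel_measurable (F (\<sigma> j))" using assms by (simp add: simple_adapted_def)
  then have "\<xi> j \<in> borel_measurable Q" by (rule measurable_F_Q)
  then show "(\<lambda>p. \<xi> j (fst p)) \<in> borel_measurable (Q \<Otimes>\<^sub>M lborel)" by measurable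
  show "(\<lambda>p. indicator {\<sigma> j<..\<sigma> (Suc j)} (snd p) :: real) \<in> borel_measurable (Q \<Otimes>\<^sub>M lborel)" by measurable
qed

definition l2_dist :: "real \<Rightarrow> real \<Rightarrow> (real \<Rightarrow> 'a \<Rightarrow> real) \<Rightarrow> (real \<Rightarrow> 'a \<Rightarrow> real) \<Rightarrow> 'a \<Rightarrow> ennreal" where
  "l2_dist s t H G \<omega> = (\<integral>\<^sup>+u. ennreal ((H u \<omega> - G u \<omega>)\<^sup>2) * indicator {s..t} u \<partial>lborel)"

lemma l2_dist_clip:
  assumes "0 \<le> s" "s \<le> t"
  shows "l2_dist s t H G \<omega> = (\<integral>\<^sup>+u. ennreal ((H (max 0 (min u t)) \<omega> - G u \<omega>)\<^sup>2) * indicator {s..t} u \<partial>lborel)"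
  unfolding l2_dist_def using assms by (intro nn_integral_cong) (auto simp: indicator_def max_def min_def)

lemma l2_dist_measurable:
  assumes "progressive F H" "simple_adapted F m \<sigma> \<xi>" "0 \<le> s" "s \<le> t"
  shows "l2_dist s t H (simple_val m \<sigma> \<xi>) \<in> borel_measurable Q"
proof -
  have t: "0 \<le> t" using assms by simp
  note [measurable] = progressive_measurable[OF assms(1) t] simple_val_measurable[OF assms(2)]
  have "(\<lambda>p. ennreal ((H (max 0 (min (snd p) t)) (fst p) - simple_val m \<sigma> \<xi> (snd p) (fst p))\<^sup>2) * indicator {s..t} (snd p))
     \<in> borel_measurable (Q \<Otimes>\<^sub>M lborel)"
    by measurable
  then have "(\<lambda>\<omega>. \<integral>\<^sup>+u. ennreal ((H (max 0 (min u t)) \<omega> - simple_val m \<sigma> \<xi> u \<omega>)\<^sup>2) * indicator {s..t} u \<partial>lborel) \<in> borel_measurable Q"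
    using lborel.borel_measurable_nn_integral[of "\<lambda>\<omega> u. ennreal ((H (max 0 (min u t)) \<omega> - simple_val m \<sigma> \<xi> u \<omega>)\<^sup>2) * indicator {s..t} u" Q]
    by (simp add: split_def)
  then show ?thesis using l2_dist_clip[OF assms(3,4)] by (simp cong: measurable_cong)
qed

text \<open>Young's inequality with weights 1 + e and 1 + 1/e. The first factor can be brought
  arbitrarily close to 1, which preserves the constant 1 in the isometry; the second multiplies a
  distance that tends to 0.\<close>

lemma l2_dist_triangle:
  assumes H: "progressive F H" and G: "simple_adapted F m \<sigma> \<xi>" and G': "simple_adapted F m' \<sigma>' \<xi>'"
    and st: "0 \<le> s" "s \<le> t" and e: "0 < e" and \<omega>: "\<omega> \<in> space Q"
  shows "(\<integral>\<^sup>+u. ennreal ((simple_val m' \<sigma>' \<xi>' u \<omega> - simple_val m \<sigma> \<xi> u \<omega>)\<^sup>2) * indicator {s<..t} u \<partial>lborel)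
    \<le> ennreal (1 + e) * l2_dist s t H (simple_val m \<sigma> \<xi>) \<omega> + ennreal (1 + 1 / e) * l2_dist 0 t (simple_val m' \<sigma>' \<xi>') H \<omega>"
proof -
  let ?h = "\<lambda>u. H (max 0 (min u t)) \<omega>" and ?g = "\<lambda>u. simple_val m \<sigma> \<xi> u \<omega>" and ?g' = "\<lambda>u. simple_val m' \<sigma>' \<xi>' u \<omega>"
  have t: "0 \<le> t" using st by simp
  have m: "?h \<in> borel_measurable lborel" "?g \<in> borel_measurable lborel" "?g' \<in> borel_measurable lborel"
    using measurable_Pair2[OF progressive_measurable[OF H t] \<omega>]
      measurable_Pair2[OF simple_val_measurable[OF G] \<omega>] measurable_Pair2[OF simple_val_measurable[OF G'] \<omega>] by simp_all
  note [measurable] = m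
  have pt: "(b - a)\<^sup>2 \<le> (1 + e) * (h - a)\<^sup>2 + (1 + 1 / e) * (b - h)\<^sup>2" for a b h :: real
  proof -
    have "0 \<le> (e * (h - a) - (b - h))\<^sup>2 / e" using e by simp
    also have "\<dots> = (1 + e) * (h - a)\<^sup>2 + (1 + 1 / e) * (b - h)\<^sup>2 - (b - a)\<^sup>2"
      using e by (simp add: field_simps power2_eq_square)
    finally show ?thesis by simp
  qed
  have "(\<integral>\<^sup>+u. ennreal ((?g' u - ?g u)\<^sup>2) * indicator {s<..t} u \<partial>lborel)
    \<le> (\<integral>\<^sup>+u. ennreal (1 + e) * (ennreal ((?h u - ?g u)\<^sup>2) * indicator {s..t} u)
       + ennreal (1 + 1 / e) * (ennreal ((?g' u - ?h u)\<^sup>2) * indicator {0..t} u) \<partial>lborel)"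
  proof (intro nn_integral_mono)
    fix u
    have "ennreal ((?g' u - ?g u)\<^sup>2) \<le> ennreal ((1 + e) * (?h u - ?g u)\<^sup>2 + (1 + 1 / e) * (?g' u - ?h u)\<^sup>2)"
      by (rule ennreal_leI[OF pt])
    also have "\<dots> = ennreal (1 + e) * ennreal ((?h u - ?g u)\<^sup>2) + ennreal (1 + 1 / e) * ennreal ((?g' u - ?h u)\<^sup>2)"
      using e by (subst ennreal_plus) (auto simp: ennreal_mult)
    finally show "ennreal ((?g' u - ?g u)\<^sup>2) * indicator {s<..t} u \<le>
        ennreal (1 + e) * (ennreal ((?h u - ?g u)\<^sup>2) * indicator {s..t} u)
       + ennreal (1 + 1 / e) * (ennreal ((?g' u - ?h u)\<^sup>2) * indicator {0..t} u)"
      using st by (auto simp: indicator_def)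
  qed
  also have "\<dots> = ennreal (1 + e) * (\<integral>\<^sup>+u. ennreal ((?h u - ?g u)\<^sup>2) * indicator {s..t} u \<partial>lborel)
     + ennreal (1 + 1 / e) * (\<integral>\<^sup>+u. ennreal ((?g' u - ?h u)\<^sup>2) * indicator {0..t} u \<partial>lborel)"
    by (subst nn_integral_add) (auto simp: nn_integral_cmult)
  also have "(\<integral>\<^sup>+u. ennreal ((?g' u - ?h u)\<^sup>2) * indicator {0..t} u \<partial>lborel) = l2_dist 0 t (simple_val m' \<sigma>' \<xi>') H \<omega>"
    unfolding l2_dist_def by (intro nn_integral_cong) (auto simp: indicator_def max_def min_def)
  finally show ?thesis using l2_dist_clip[OF st] by simp
qed

text \<open>Stopping the integrand once its accumulated square exceeds \<open>R\<close> keeps it adapted to the same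
  partition, so no density argument for progressive integrands is needed.\<close>

lemma truncated_simple_integral:
  assumes i: "i \<in> {1..d}" and s: "0 \<le> s" and p: "partition_of p r s t"
    and v: "\<And>j. j < r \<Longrightarrow> v j \<in> borel_measurable (F (p j))" and R: "0 \<le> R"
  shows "\<exists>J. J \<in> borel_measurable Q \<and>
     (\<forall>\<omega>\<in>space Q. (\<Sum>j<r. (v j \<omega>)\<^sup>2 * (p (Suc j) - p j)) \<le> R \<longrightarrow>
        J \<omega> = (\<Sum>j<r. v j \<omega> * (W i (p (Suc j)) \<omega> - W i (p j) \<omega>))) \<and>
     n2 J \<le> (\<integral>\<^sup>+\<omega>. ennreal (min R (\<Sum>j<r. (v j \<omega>)\<^sup>2 * (p (Suc j) - p j))) \<partial>Q)"
proof -
  define a where "a j \<omega> = (v j \<omega>)\<^sup>2 * (p (Suc j) - p j)" for j \<omega>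
  \<comment> \<open>The partial sum includes the current term and is known at time
    \<open>p j\<close>, because the integrand of the cell is. Hence the kept terms never exceed R in
    total, and \<open>U j\<close> is known before its increment starts.\<close>
  define U where "U j \<omega> = (if (\<Sum>i\<le>j. a i \<omega>) \<le> R then v j \<omega> else 0)" for j \<omega>
  define J where "J \<omega> = (\<Sum>j<r. U j \<omega> * (W i (p (Suc j)) \<omega> - W i (p j) \<omega>))" for \<omega>
  have inc: "p j < p (Suc j)" if "j < r" for j using p that by (simp add: partition_of_def)
  have p0: "0 \<le> p j" if "j \<le> r" for j using partition_of_bounds(1)[OF p that] s by simp
  have a0: "0 \<le> a j \<omega>" if "j < r" for j \<omega> using inc[OF that] by (simp add: a_def)
  have Um: "U j \<in> borel_measurable (F (p j))" if j: "j < r" for j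
  proof -
    have v': "v k \<in> borel_measurable (F (p j))" if "k \<le> j" for k
      by (rule measurable_F_mono[OF v]) (use j that partition_of_le[OF p, of k j] in auto)
    have "(\<lambda>\<omega>. \<Sum>i\<le>j. a i \<omega>) \<in> borel_measurable (F (p j))"
      unfolding a_def using v' by (intro borel_measurable_sum borel_measurable_times borel_measurable_power) auto
    moreover have "v j \<in> borel_measurable (F (p j))" by (rule v[OF j])
    ultimately show ?thesis unfolding U_def[abs_def] by measurable
  qed
  have UQ: "U j \<in> borel_measurable Q" if "j < r" for j by (rule measurable_F_Q[OF Um[OF that]])
  have orth: "J \<in> borel_measurable (F (p r)) \<and> n2 J \<le> (\<Sum>j<r. ennreal (p (Suc j) - p j) * n2 (U j))"
    unfolding J_def[abs_def]
  proof (rule n2_orthogonal_sum)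
    fix j assume j: "j < r"
    show "centred (p j) (p (Suc j) - p j) (\<lambda>\<omega>. W i (p (Suc j)) \<omega> - W i (p j) \<omega>)"
      using p0[of j] inc[OF j] i j by (intro centred_W) auto
    show "p j \<le> p (Suc j)" using inc[OF j] by simp
    show "(\<lambda>\<omega>. W i (p (Suc j)) \<omega> - W i (p j) \<omega>) \<in> borel_measurable (F (p (Suc j)))"
      using W_adapted[OF i p0[of "Suc j"]] measurable_F_mono[OF W_adapted[OF i p0[of j]], of "p (Suc j)"] inc[OF j] j
      by (intro borel_measurable_diff) auto
    show "U j \<in> borel_measurable (F (p j))" by (rule Um[OF j])
  qed
  have "(\<Sum>j<r. ennreal (p (Suc j) - p j) * n2 (U j)) = (\<integral>\<^sup>+\<omega>. (\<Sum>j<r. ennreal (p (Suc j) - p j) * ennreal ((U j \<omega>)\<^sup>2)) \<partial>Q)"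
    using UQ by (subst nn_integral_sum) (auto simp: nn_integral_cmult)
  also have "\<dots> \<le> (\<integral>\<^sup>+\<omega>. ennreal (min R (\<Sum>j<r. a j \<omega>)) \<partial>Q)"
  proof (intro nn_integral_mono)
    fix \<omega>
    have "(\<Sum>j<r. ennreal (p (Suc j) - p j) * ennreal ((U j \<omega>)\<^sup>2)) = ennreal (\<Sum>j<r. if (\<Sum>i\<le>j. a i \<omega>) \<le> R then a j \<omega> else 0)"
      using inc by (subst sum_ennreal[symmetric])
        (auto intro!: sum.cong simp: U_def a_def ennreal_mult[symmetric] less_imp_le mult.commute a0[unfolded a_def])
    also have "\<dots> \<le> ennreal (min R (\<Sum>j<r. a j \<omega>))"
      using truncated_sum_le[of r "\<lambda>j. a j \<omega>" R] a0 R by (intro ennreal_leI) auto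
    finally show "(\<Sum>j<r. ennreal (p (Suc j) - p j) * ennreal ((U j \<omega>)\<^sup>2)) \<le> ennreal (min R (\<Sum>j<r. a j \<omega>))" .
  qed
  finally have n2J: "n2 J \<le> (\<integral>\<^sup>+\<omega>. ennreal (min R (\<Sum>j<r. a j \<omega>)) \<partial>Q)" using orth by (meson order_trans)
  have "J \<omega> = (\<Sum>j<r. v j \<omega> * (W i (p (Suc j)) \<omega> - W i (p j) \<omega>))" if "(\<Sum>j<r. a j \<omega>) \<le> R" for \<omega>
    unfolding J_def
  proof (intro sum.cong refl arg_cong2[where f="(*)"])
    fix j assume j: "j \<in> {..<r}"
    have "(\<Sum>i\<le>j. a i \<omega>) \<le> (\<Sum>j<r. a j \<omega>)" using j a0 by (intro sum_mono2) auto
    then show "U j \<omega> = v j \<omega>" using that by (simp add: U_def)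
  qed
  then show ?thesis using n2J measurable_F_Q[OF conjunct1[OF orth]]
    unfolding a_def by (intro exI[of _ J] conjI ballI impI)
qed

lemma simple_int_measurable:
  assumes i: "i \<in> {1..d}" and G: "simple_adapted F m \<sigma> \<xi>" and t: "0 \<le> t"
  shows "simple_int (W i) m \<sigma> \<xi> t \<in> borel_measurable Q"
proof -
  have pos: "0 \<le> \<sigma> j" if "j \<le> m" for j
    using that
  proof (induction j)
    case 0 then show ?case using G by (simp add: simple_adapted_def)
  next
    case (Suc j)
    have "\<sigma> j < \<sigma> (Suc j)" using G Suc.prems by (simp add: simple_adapted_def)
    then show ?case using Suc by simp
  qed
  show ?thesis
    unfolding simple_int_def[abs_def]
  proof (intro borel_measurable_sum borel_measurable_times borel_measurable_diff)
    fix j assume j: "j \<in> {..<m}"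
    have "\<xi> j \<in> borel_measurable (F (\<sigma> j))" using G j by (simp add: simple_adapted_def)
    then show "\<xi> j \<in> borel_measurable Q" by (rule measurable_F_Q)
    show "W i (min (\<sigma> (Suc j)) t) \<in> borel_measurable Q" "W i (min (\<sigma> j) t) \<in> borel_measurable Q"
      using pos[of j] pos[of "Suc j"] j t by (auto intro!: W_measurable[OF i])
  qed
qed

lemma l2_dist_commute: "l2_dist s t H G = l2_dist s t G H"
  by (simp add: l2_dist_def fun_eq_iff power2_commute)

lemma clip_mem: "s \<le> t \<Longrightarrow> clip s t x \<in> {s..t}"
  by (auto simp: clip_def)

text \<open>Convergence in probability carries no moments, so the approximating integrals are
  stopped at level R before their second moments are compared. Fatou's lemma along almost surely
  convergent stopped integrals gives the estimate on the set where stopping has no effect, and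
  monotone convergence in R removes the restriction. The comparison with an arbitrary simple
  process, rather than with 0, is what later controls Riemann sums.\<close>

lemma ito_isometry_le:
  assumes i: "i \<in> {1..d}" and st: "0 \<le> s" "s \<le> t" and H: "progressive F H"
    and ap: "approx_seq Q F H t m \<sigma> \<xi>"
    and cv: "conv_in_prob Q (\<lambda>k \<omega>. simple_int (W i) (m k) (\<sigma> k) (\<xi> k) t \<omega>
        - simple_int (W i) (m k) (\<sigma> k) (\<xi> k) s \<omega>) Z"
    and Z: "Z \<in> borel_measurable Q" and G: "simple_adapted F m' \<sigma>' \<xi>'"
  shows "n2 (\<lambda>\<omega>. Z \<omega> - (simple_int (W i) m' \<sigma>' \<xi>' t \<omega> - simple_int (W i) m' \<sigma>' \<xi>' s \<omega>))
     \<le> (\<integral>\<^sup>+\<omega>. l2_dist s t H (simple_val m' \<sigma>' \<xi>') \<omega> \<partial>Q)"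
proof -
  have t0: "0 \<le> t" using st by simp
  define V where "V = l2_dist s t H (simple_val m' \<sigma>' \<xi>')"
  define GI where "GI \<omega> = simple_int (W i) m' \<sigma>' \<xi>' t \<omega> - simple_int (W i) m' \<sigma>' \<xi>' s \<omega>" for \<omega>
  define Y where "Y \<omega> = Z \<omega> - GI \<omega>" for \<omega>
  define S where "S k \<omega> = simple_int (W i) (m k) (\<sigma> k) (\<xi> k) t \<omega> - simple_int (W i) (m k) (\<sigma> k) (\<xi> k) s \<omega>" for k \<omega>
  define \<eta> where "\<eta> k = l2_dist 0 t (simple_val (m k) (\<sigma> k) (\<xi> k)) H" for k
  have Gk: "simple_adapted F (m k) (\<sigma> k) (\<xi> k)" for k using ap by (simp add: approx_seq_def)
  have [measurable]: "V \<in> borel_measurable Q" unfolding V_def by (rule l2_dist_measurable[OF H G st])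
  have [measurable]: "\<eta> k \<in> borel_measurable Q" for k
    unfolding \<eta>_def using l2_dist_measurable[OF H Gk order.refl t0] by (subst l2_dist_commute)
  have [measurable]: "S k \<in> borel_measurable Q" for k
    unfolding S_def[abs_def] using simple_int_measurable[OF i Gk] st t0 by (intro borel_measurable_diff) auto
  have [measurable]: "GI \<in> borel_measurable Q"
    unfolding GI_def[abs_def] using simple_int_measurable[OF i G] st t0 by (intro borel_measurable_diff) auto
  note [measurable] = Z
  have [measurable]: "Y \<in> borel_measurable Q" unfolding Y_def[abs_def] by measurable
  have "\<exists>p r. partition_of p r s t \<and> clip s t ` \<sigma> k ` {..m k} \<subseteq> p ` {..r} \<and> clip s t ` \<sigma>' ` {..m'} \<subseteq> p ` {..r}" for k
  proof -
    let ?P = "insert s (insert t (clip s t ` \<sigma> k ` {..m k} \<union> clip s t ` \<sigma>' ` {..m'}))"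
    have "\<exists>p r. partition_of p r s t \<and> ?P = p ` {..r}"
      by (rule ex_partition_of) (use st clip_mem in auto)
    then obtain p r where pr: "partition_of p r s t" "?P = p ` {..r}" by blast
    have "clip s t ` \<sigma> k ` {..m k} \<subseteq> ?P" "clip s t ` \<sigma>' ` {..m'} \<subseteq> ?P" by auto
    then show ?thesis using pr(1) unfolding pr(2) by blast
  qed
  then obtain p r where p: "\<And>k. partition_of (p k) (r k) s t"
    and P: "\<And>k. clip s t ` \<sigma> k ` {..m k} \<subseteq> p k ` {..r k}" and P': "\<And>k. clip s t ` \<sigma>' ` {..m'} \<subseteq> p k ` {..r k}"
    by metis
  define v where "v k j \<omega> = simple_val (m k) (\<sigma> k) (\<xi> k) (p k (Suc j)) \<omega> - simple_val m' \<sigma>' \<xi>' (p k (Suc j)) \<omega>" for k j \<omega>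
  define q where "q k \<omega> = (\<Sum>j<r k. (v k j \<omega>)\<^sup>2 * (p k (Suc j) - p k j))" for k \<omega>
  have vm: "v k j \<in> borel_measurable (F (p k j))" if "j < r k" for k j
    unfolding v_def[abs_def] using Gk[of k] G that
    by (intro borel_measurable_diff simple_val_measurable_refine[OF p P] simple_val_measurable_refine[OF p P'])
       (auto simp: simple_adapted_def)
  have I: "(\<Sum>j<r k. v k j \<omega> * (W i (p k (Suc j)) \<omega> - W i (p k j) \<omega>)) = S k \<omega> - GI \<omega>" for k \<omega>
  proof -
    have 1: "S k \<omega> = (\<Sum>j<r k. simple_val (m k) (\<sigma> k) (\<xi> k) (p k (Suc j)) \<omega> * (W i (p k (Suc j)) \<omega> - W i (p k j) \<omega>))"
      unfolding S_def by (rule simple_int_refine[OF p st(2) _ P]) (use Gk[of k] in \<open>auto simp: simple_adapted_def\<close>)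
    have 2: "GI \<omega> = (\<Sum>j<r k. simple_val m' \<sigma>' \<xi>' (p k (Suc j)) \<omega> * (W i (p k (Suc j)) \<omega> - W i (p k j) \<omega>))"
      unfolding GI_def by (rule simple_int_refine[OF p st(2) _ P']) (use G in \<open>auto simp: simple_adapted_def\<close>)
    show ?thesis unfolding 1 2 v_def by (simp add: sum_subtractf left_diff_distrib)
  qed
  have q_le: "ennreal (q k \<omega>) \<le> ennreal (1 + e) * V \<omega> + ennreal (1 + 1 / e) * \<eta> k \<omega>" if "\<omega> \<in> space Q" "0 < e" for k \<omega> e
  proof -
    have "ennreal (q k \<omega>) = (\<integral>\<^sup>+u. ennreal ((simple_val (m k) (\<sigma> k) (\<xi> k) u \<omega> - simple_val m' \<sigma>' \<xi>' u \<omega>)\<^sup>2) * indicator {s<..t} u \<partial>lborel)"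
      unfolding q_def
    proof (rule nn_integral_partition[OF p[of k], where v="\<lambda>j. (v k j \<omega>)\<^sup>2", symmetric])
      fix j u assume h: "j < r k" "p k j < u" "u \<le> p k (Suc j)"
      show "(simple_val (m k) (\<sigma> k) (\<xi> k) u \<omega> - simple_val m' \<sigma>' \<xi>' u \<omega>)\<^sup>2 = (v k j \<omega>)\<^sup>2"
        unfolding v_def
        by (simp only: simple_val_refine[OF p[of k] P[of k] h] simple_val_refine[OF p[of k] P'[of k] h])
    qed simp
    also have "\<dots> \<le> ennreal (1 + e) * V \<omega> + ennreal (1 + 1 / e) * \<eta> k \<omega>"
      unfolding V_def \<eta>_def by (rule l2_dist_triangle[OF H G Gk st that(2,1)])
    finally show ?thesis .
  qed
  \<comment> \<open>\<open>x l\<close> is both the weight e in the triangle inequality and the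
    square root of the tolerated distance. The unfavourable factor is then harmless, since (1 + 1/x)
    x^2 = x^2 + x still tends to 0.\<close>
  define x where "x l = inverse (real (Suc l))" for l
  have x: "0 < x l" "x l \<le> 1" for l by (auto simp: x_def field_simps)
  have x0: "x \<longlonglongrightarrow> 0" unfolding x_def[abs_def] by (rule LIMSEQ_inverse_real_of_nat)
  \<comment> \<open>One index per l makes both the integrands and the integrals close, outside sets
    whose probabilities are summable, as Borel-Cantelli requires.\<close>
  have "\<exists>k. prob {\<omega>\<in>space Q. ennreal ((x l)\<^sup>2) < \<eta> k \<omega>} < (1/2)^l \<and> prob {\<omega>\<in>space Q. (1/2)^l < \<bar>S k \<omega> - Z \<omega>\<bar>} < (1/2)^l" for l
  proof -
    have "(\<lambda>k. prob {\<omega>\<in>space Q. ennreal ((x l)\<^sup>2) < \<eta> k \<omega>}) \<longlonglongrightarrow> 0"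
      using ap x(1)[of l] unfolding approx_seq_def \<eta>_def l2_dist_def by simp
    moreover have "(\<lambda>k. prob {\<omega>\<in>space Q. (1/2)^l < \<bar>S k \<omega> - Z \<omega>\<bar>}) \<longlonglongrightarrow> 0"
      using cv unfolding conv_in_prob_def S_def by simp
    ultimately have "eventually (\<lambda>k. prob {\<omega>\<in>space Q. ennreal ((x l)\<^sup>2) < \<eta> k \<omega>} < (1/2)^l \<and> prob {\<omega>\<in>space Q. (1/2)^l < \<bar>S k \<omega> - Z \<omega>\<bar>} < (1/2)^l) sequentially"
      by (intro eventually_conj order_tendstoD(2)) auto
    then show ?thesis using eventually_happens' sequentially_bot by blast
  qed
  then have "\<exists>\<kappa>. \<forall>l. prob {\<omega>\<in>space Q. ennreal ((x l)\<^sup>2) < \<eta> (\<kappa> l) \<omega>} < (1/2)^l \<and>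
      prob {\<omega>\<in>space Q. (1/2)^l < \<bar>S (\<kappa> l) \<omega> - Z \<omega>\<bar>} < (1/2)^l"
    by (intro choice allI)
  then obtain \<kappa> where \<kappa>': "\<forall>l. prob {\<omega>\<in>space Q. ennreal ((x l)\<^sup>2) < \<eta> (\<kappa> l) \<omega>} < (1/2)^l \<and>
      prob {\<omega>\<in>space Q. (1/2)^l < \<bar>S (\<kappa> l) \<omega> - Z \<omega>\<bar>} < (1/2)^l" ..
  note \<kappa> = conjunct1[OF spec[OF \<kappa>']] conjunct2[OF spec[OF \<kappa>']]
  define A where "A l = {\<omega>\<in>space Q. ennreal ((x l)\<^sup>2) < \<eta> (\<kappa> l) \<omega>} \<union> {\<omega>\<in>space Q. (1/2)^l < \<bar>S (\<kappa> l) \<omega> - Z \<omega>\<bar>}" for l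
  have As [measurable]: "A l \<in> sets Q" for l unfolding A_def by measurable
  have Ap: "prob (A l) \<le> 2 * (1/2)^l" for l
  proof -
    have "prob (A l) \<le> prob {\<omega>\<in>space Q. ennreal ((x l)\<^sup>2) < \<eta> (\<kappa> l) \<omega>} + prob {\<omega>\<in>space Q. (1/2)^l < \<bar>S (\<kappa> l) \<omega> - Z \<omega>\<bar>}"
      unfolding A_def by (rule measure_Un_le) measurable
    then show ?thesis using \<kappa>[of l] by linarith
  qed
  have "summable (\<lambda>l. prob (A l))"
    by (rule summable_comparison_test'[where g="\<lambda>l. 2 * (1/2)^l" and N=0])
       (use Ap in \<open>auto intro!: summable_mult summable_geometric\<close>)
  then have BC: "AE \<omega> in Q. eventually (\<lambda>l. \<omega> \<in> space Q - A l) sequentially"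
    by (intro borel_cantelli_AE1) (auto simp: emeasure_eq_measure)
  show ?thesis
  proof (cases "(\<integral>\<^sup>+\<omega>. V \<omega> \<partial>Q) < \<infinity>")
    case False
    then show ?thesis unfolding V_def by (metis infinity_ennreal_def top.not_eq_extremum top_greatest)
  next
    case True
    then obtain ev where ev: "(\<integral>\<^sup>+\<omega>. V \<omega> \<partial>Q) = ennreal ev" "0 \<le> ev"
      by (cases "\<integral>\<^sup>+\<omega>. V \<omega> \<partial>Q") auto
    \<comment> \<open>On \<open>B R\<close> and outside \<open>A l\<close>, the accumulated square
      is at most (1 + x) V + x^2 + x <= 2 V + 2 <= R, so the stopped and the original integral
      agree.\<close>
    define B where "B R = {\<omega>\<in>space Q. 2 * V \<omega> + 2 \<le> ennreal (real R)}" for R :: nat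
    have [measurable]: "B R \<in> sets Q" for R unfolding B_def by measurable
    have main: "(\<integral>\<^sup>+\<omega>. ennreal ((Y \<omega>)\<^sup>2) * indicator (B R) \<omega> \<partial>Q) \<le> (\<integral>\<^sup>+\<omega>. V \<omega> \<partial>Q)" for R
    proof -
      have "\<exists>J. J \<in> borel_measurable Q \<and>
         (\<forall>\<omega>\<in>space Q. q (\<kappa> l) \<omega> \<le> real R \<longrightarrow> J \<omega> = S (\<kappa> l) \<omega> - GI \<omega>) \<and>
         n2 J \<le> (\<integral>\<^sup>+\<omega>. ennreal (min (real R) (q (\<kappa> l) \<omega>)) \<partial>Q)" for l
      proof -
        have "v (\<kappa> l) j \<in> borel_measurable (F (p (\<kappa> l) j))" if "j < r (\<kappa> l)" for j by (rule vm[OF that])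
        from truncated_simple_integral[OF i st(1) p[of "\<kappa> l"] this, of "real R"]
        show ?thesis unfolding I q_def by simp
      qed
      then have "\<exists>J. \<forall>l. J l \<in> borel_measurable Q \<and>
         (\<forall>\<omega>\<in>space Q. q (\<kappa> l) \<omega> \<le> real R \<longrightarrow> J l \<omega> = S (\<kappa> l) \<omega> - GI \<omega>) \<and>
         n2 (J l) \<le> (\<integral>\<^sup>+\<omega>. ennreal (min (real R) (q (\<kappa> l) \<omega>)) \<partial>Q)"
        by (intro choice allI)
      then obtain J where Jm [measurable]: "\<And>l. J l \<in> borel_measurable Q"
        and JI: "\<And>l \<omega>. \<omega> \<in> space Q \<Longrightarrow> q (\<kappa> l) \<omega> \<le> real R \<Longrightarrow> J l \<omega> = S (\<kappa> l) \<omega> - GI \<omega>"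
        and Jn: "\<And>l. n2 (J l) \<le> (\<integral>\<^sup>+\<omega>. ennreal (min (real R) (q (\<kappa> l) \<omega>)) \<partial>Q)"
        by blast
      have qA: "ennreal (q (\<kappa> l) \<omega>) \<le> ennreal (1 + x l) * V \<omega> + ennreal ((x l)\<^sup>2 + x l)" if "\<omega> \<in> space Q - A l" for l \<omega>
      proof -
        have "ennreal (q (\<kappa> l) \<omega>) \<le> ennreal (1 + x l) * V \<omega> + ennreal (1 + 1 / x l) * \<eta> (\<kappa> l) \<omega>"
          using q_le[of \<omega> "x l"] that x by blast
        also have "\<eta> (\<kappa> l) \<omega> \<le> ennreal ((x l)\<^sup>2)" using that by (auto simp: A_def)
        also have "ennreal (1 + 1 / x l) * ennreal ((x l)\<^sup>2) = ennreal ((x l)\<^sup>2 + x l)"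
        proof -
          have "(1 + 1 / x l) * (x l)\<^sup>2 = (x l)\<^sup>2 + x l"
            using x[of l] by (simp add: field_simps power2_eq_square)
          moreover have "ennreal (1 + 1 / x l) * ennreal ((x l)\<^sup>2) = ennreal ((1 + 1 / x l) * (x l)\<^sup>2)"
            using x[of l] by (intro ennreal_mult[symmetric]) auto
          ultimately show ?thesis by simp
        qed
        finally show ?thesis by (simp add: add_left_mono mult_left_mono)
      qed
      \<comment> \<open>On the exceptional set \<open>A l\<close> only the truncation bound R is
        available. Its contribution is R times the probability of \<open>A l\<close>, which vanishes
        in the limit because R is fixed.\<close>
      have Jb: "n2 (J l) \<le> ennreal ((1 + x l) * ev + ((x l)\<^sup>2 + x l) + real R * (2 * (1/2)^l))" for l
      proof -
        have "n2 (J l) \<le> (\<integral>\<^sup>+\<omega>. ennreal (min (real R) (q (\<kappa> l) \<omega>)) \<partial>Q)" by (rule Jn)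
        also have "\<dots> \<le> (\<integral>\<^sup>+\<omega>. (ennreal (1 + x l) * V \<omega> + ennreal ((x l)\<^sup>2 + x l)) + ennreal (real R) * indicator (A l) \<omega> \<partial>Q)"
        proof (rule nn_integral_mono)
          fix \<omega> assume \<omega>: "\<omega> \<in> space Q"
          show "ennreal (min (real R) (q (\<kappa> l) \<omega>)) \<le> (ennreal (1 + x l) * V \<omega> + ennreal ((x l)\<^sup>2 + x l)) + ennreal (real R) * indicator (A l) \<omega>"
          proof (cases "\<omega> \<in> A l")
            case True
            have "ennreal (min (real R) (q (\<kappa> l) \<omega>)) \<le> ennreal (real R)" by (rule ennreal_leI) simp
            then show ?thesis using True by (simp add: add_increasing)
          next
            case False
            have "ennreal (min (real R) (q (\<kappa> l) \<omega>)) \<le> ennreal (q (\<kappa> l) \<omega>)" by (rule ennreal_leI) simp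
            then show ?thesis using False qA[of \<omega> l] \<omega> by simp
          qed
        qed
        also have "\<dots> = ennreal (1 + x l) * ennreal ev + ennreal ((x l)\<^sup>2 + x l) + ennreal (real R) * ennreal (prob (A l))"
          by (subst nn_integral_add, simp, simp, subst nn_integral_add, simp, simp)
             (simp add: nn_integral_cmult ev emeasure_space_1 emeasure_eq_measure prob_space)
        also have "\<dots> = ennreal ((1 + x l) * ev + ((x l)\<^sup>2 + x l) + real R * prob (A l))"
          using x[of l] ev by (simp add: ennreal_mult ennreal_plus)
        also have "\<dots> \<le> ennreal ((1 + x l) * ev + ((x l)\<^sup>2 + x l) + real R * (2 * (1/2)^l))"
          by (intro ennreal_leI add_left_mono mult_left_mono Ap) simp
        finally show ?thesis .
      qed
      have AEl: "AE \<omega> in Q. ennreal ((Y \<omega>)\<^sup>2) * indicator (B R) \<omega> \<le> liminf (\<lambda>l. ennreal ((J l \<omega>)\<^sup>2))"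
        using BC
      proof eventually_elim
        case (elim \<omega>)
        show ?case
        proof (cases "\<omega> \<in> B R")
          case True
          then have \<omega>: "\<omega> \<in> space Q" and VR: "2 * V \<omega> + 2 \<le> ennreal (real R)" by (auto simp: B_def)
          have ev1: "eventually (\<lambda>l. \<bar>J l \<omega> - Y \<omega>\<bar> \<le> (1/2)^l) sequentially"
            using elim
          proof eventually_elim
            case (elim l)
            have "ennreal (q (\<kappa> l) \<omega>) \<le> ennreal (1 + x l) * V \<omega> + ennreal ((x l)\<^sup>2 + x l)" by (rule qA[OF elim])
            also have "\<dots> \<le> ennreal 2 * V \<omega> + ennreal 2"
              using x[of l] by (intro add_mono mult_right_mono ennreal_leI) (auto simp: power2_eq_square intro!: order_trans[OF add_mono[OF mult_mono[of "x l" 1 "x l" 1]]])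
            finally have "ennreal (q (\<kappa> l) \<omega>) \<le> 2 * V \<omega> + 2" by simp
            from order_trans[OF this VR] have "ennreal (q (\<kappa> l) \<omega>) \<le> ennreal (real R)" .
            then have "q (\<kappa> l) \<omega> \<le> real R" by (simp add: ennreal_le_iff)
            then have "J l \<omega> = S (\<kappa> l) \<omega> - GI \<omega>" by (rule JI[OF \<omega>])
            moreover have "\<bar>S (\<kappa> l) \<omega> - Z \<omega>\<bar> \<le> (1/2)^l" using elim by (auto simp: A_def not_less)
            ultimately show ?case by (simp add: Y_def)
          qed
          have "(\<lambda>l. J l \<omega> - Y \<omega>) \<longlonglongrightarrow> 0"
            by (rule Lim_null_comparison[where g="\<lambda>l. (1/2)^l"])
               (use ev1 in \<open>auto intro!: LIMSEQ_realpow_zero\<close>)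
          then have "(\<lambda>l. J l \<omega>) \<longlonglongrightarrow> Y \<omega>" by (simp add: LIM_zero_iff)
          then have "(\<lambda>l. ennreal ((J l \<omega>)\<^sup>2)) \<longlonglongrightarrow> ennreal ((Y \<omega>)\<^sup>2)"
            by (intro tendsto_ennrealI tendsto_power)
          then have "liminf (\<lambda>l. ennreal ((J l \<omega>)\<^sup>2)) = ennreal ((Y \<omega>)\<^sup>2)"
            by (intro lim_imp_Liminf) auto
          then show ?thesis using True by simp
        qed simp
      qed
      have "(\<integral>\<^sup>+\<omega>. ennreal ((Y \<omega>)\<^sup>2) * indicator (B R) \<omega> \<partial>Q) \<le> (\<integral>\<^sup>+\<omega>. liminf (\<lambda>l. ennreal ((J l \<omega>)\<^sup>2)) \<partial>Q)"
        by (rule nn_integral_mono_AE[OF AEl])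
      also have "\<dots> \<le> liminf (\<lambda>l. n2 (J l))"
        by (rule nn_integral_liminf) simp
      also have "\<dots> \<le> liminf (\<lambda>l. ennreal ((1 + x l) * ev + ((x l)\<^sup>2 + x l) + real R * (2 * (1/2)^l)))"
        using Jb by (intro Liminf_mono always_eventually) auto
      also have "\<dots> = ennreal ((1 + 0) * ev + (0\<^sup>2 + 0) + real R * (2 * 0))"
        by (intro lim_imp_Liminf tendsto_ennrealI tendsto_intros x0 LIMSEQ_realpow_zero) auto
      finally show ?thesis using ev by simp
    qed
    have incB: "R \<le> R' \<Longrightarrow> B R \<subseteq> B R'" for R R'
      unfolding B_def by (auto intro: order_trans ennreal_leI)
    have AEV: "AE \<omega> in Q. V \<omega> \<noteq> \<infinity>" using True by (intro nn_integral_PInf_AE) auto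
    have "n2 Y \<le> (\<integral>\<^sup>+\<omega>. (SUP R. ennreal ((Y \<omega>)\<^sup>2) * indicator (B R) \<omega>) \<partial>Q)"
    proof (rule nn_integral_mono_AE)
      show "AE \<omega> in Q. ennreal ((Y \<omega>)\<^sup>2) \<le> (SUP R. ennreal ((Y \<omega>)\<^sup>2) * indicator (B R) \<omega>)"
        using AEV AE_space
      proof eventually_elim
        case (elim \<omega>)
        then obtain vv where vv: "V \<omega> = ennreal vv" "0 \<le> vv" by (cases "V \<omega>") auto
        obtain R :: nat where R: "2 * vv + 2 \<le> real R" using real_arch_simple by blast
        have "2 * V \<omega> + 2 = ennreal (2 * vv + 2)" using vv by (simp add: ennreal_plus ennreal_mult)
        then have "\<omega> \<in> B R" using elim R by (simp add: B_def ennreal_leI)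
        then show ?case by (intro SUP_upper2[of R]) auto
      qed
    qed
    also have "\<dots> = (SUP R. \<integral>\<^sup>+\<omega>. ennreal ((Y \<omega>)\<^sup>2) * indicator (B R) \<omega> \<partial>Q)"
    proof (rule nn_integral_monotone_convergence_SUP)
      show "incseq (\<lambda>R \<omega>. ennreal ((Y \<omega>)\<^sup>2) * indicator (B R) \<omega>)"
        using incB[OF le_SucI[OF order.refl]]
        by (intro incseq_SucI le_funI mult_left_mono) (auto simp: indicator_def)
    qed simp
    also have "\<dots> \<le> (\<integral>\<^sup>+\<omega>. V \<omega> \<partial>Q)" by (rule SUP_least) (rule main)
    finally show ?thesis by (simp add: Y_def GI_def V_def)
  qed
qed

end

text \<open>Cauchy-Schwarz on an interval, from the nonnegative integral of the squared deviation of
  the integrand from its mean c.\<close>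

lemma set_integral_square_le:
  fixes f :: "real \<Rightarrow> real"
  assumes f: "set_integrable lborel {s<..t} f" and st: "s \<le> t"
  shows "ennreal ((LINT u:{s<..t}|lborel. f u)\<^sup>2) \<le> ennreal (t - s) * (\<integral>\<^sup>+u. ennreal ((f u)\<^sup>2) * indicator {s<..t} u \<partial>lborel)"
proof (cases "s = t")
  case True
  then show ?thesis by (simp add: set_lebesgue_integral_def)
next
  case False
  then have lt: "s < t" using st by simp
  define g where "g u = indicator {s<..t} u * f u" for u
  have gi: "integrable lborel g" using f by (simp add: set_integrable_def g_def[abs_def])
  have gm [measurable]: "g \<in> borel_measurable lborel" using gi by auto
  have eq: "(\<integral>\<^sup>+u. ennreal ((f u)\<^sup>2) * indicator {s<..t} u \<partial>lborel) = (\<integral>\<^sup>+u. ennreal ((g u)\<^sup>2) \<partial>lborel)"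
    by (intro nn_integral_cong) (auto simp: g_def indicator_def)
  show ?thesis
  proof (cases "(\<integral>\<^sup>+u. ennreal ((g u)\<^sup>2) \<partial>lborel) < \<infinity>")
    case F: False
    then show ?thesis using lt unfolding eq by (simp add: ennreal_mult_top less_top[symmetric])
  next
    case True
    have g2: "integrable lborel (\<lambda>u. (g u)\<^sup>2)" by (rule integrableI_bounded) (use True in auto)
    define a where "a = (\<integral>u. g u \<partial>lborel)"
    define c where "c = a / (t - s)"
    have "0 \<le> (\<integral>u. (g u)\<^sup>2 - 2 * c * g u + c\<^sup>2 * indicator {s<..t} u \<partial>lborel)"
    proof (rule integral_nonneg_AE, rule AE_I2)
      fix u
      have "(g u)\<^sup>2 - 2 * c * g u + c\<^sup>2 * indicator {s<..t} u = (if u \<in> {s<..t} then (g u - c)\<^sup>2 else 0)"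
        by (auto simp: g_def indicator_def power2_eq_square algebra_simps)
      then show "0 \<le> (g u)\<^sup>2 - 2 * c * g u + c\<^sup>2 * indicator {s<..t} u" by simp
    qed
    also have "\<dots> = (\<integral>u. (g u)\<^sup>2 \<partial>lborel) - 2 * c * a + c\<^sup>2 * (t - s)"
      using g2 gi lt by (simp add: a_def)
    finally have "0 \<le> (\<integral>u. (g u)\<^sup>2 \<partial>lborel) - 2 * c * a + c * (c * (t - s))"
      by (simp add: power2_eq_square mult.assoc)
    moreover have ca: "c * (t - s) = a" using lt by (simp add: c_def)
    ultimately have "0 \<le> (\<integral>u. (g u)\<^sup>2 \<partial>lborel) - c * a" by (simp add: mult.commute)
    then have "0 \<le> (t - s) * ((\<integral>u. (g u)\<^sup>2 \<partial>lborel) - c * a)" using lt by simp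
    also have "\<dots> = (t - s) * (\<integral>u. (g u)\<^sup>2 \<partial>lborel) - (c * (t - s)) * a" by (simp add: algebra_simps)
    finally have "a\<^sup>2 \<le> (t - s) * (\<integral>u. (g u)\<^sup>2 \<partial>lborel)" by (simp add: ca power2_eq_square)
    then have "ennreal (a\<^sup>2) \<le> ennreal ((t - s) * (\<integral>u. (g u)\<^sup>2 \<partial>lborel))" by (rule ennreal_leI)
    also have "\<dots> = ennreal (t - s) * (\<integral>\<^sup>+u. ennreal ((g u)\<^sup>2) \<partial>lborel)"
      using lt g2 by (simp add: ennreal_mult nn_integral_eq_integral)
    finally show ?thesis unfolding eq by (simp add: a_def g_def set_lebesgue_integral_def)
  qed
qed

lemma set_integral_simple_val:
  assumes st: "s \<le> t" and inc: "\<And>j. j < m \<Longrightarrow> \<sigma> j < \<sigma> (Suc j)"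
  shows "set_integrable lborel {s<..t} (\<lambda>u. simple_val m \<sigma> \<xi> u \<omega>)"
    and "(LINT u:{s<..t}|lborel. simple_val m \<sigma> \<xi> u \<omega>)
      = simple_int (\<lambda>u \<omega>. u) m \<sigma> \<xi> t \<omega> - simple_int (\<lambda>u \<omega>. u) m \<sigma> \<xi> s \<omega>"
proof -
  have fin: "emeasure lborel {a<..b} < \<infinity>" and meas: "measure lborel {a<..b} = max 0 (b - a)" for a b :: real
    by (cases "a \<le> b"; simp)+
  have e: "indicator {s<..t} u *\<^sub>R simple_val m \<sigma> \<xi> u \<omega>
     = (\<Sum>j<m. \<xi> j \<omega> * indicator {max (\<sigma> j) s<..min (\<sigma> (Suc j)) t} u)" for u
    by (auto simp: simple_val_def sum_distrib_left indicator_def intro!: sum.cong)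
  show "set_integrable lborel {s<..t} (\<lambda>u. simple_val m \<sigma> \<xi> u \<omega>)"
    unfolding set_integrable_def e by (intro Bochner_Integration.integrable_sum integrable_mult_right) (use fin in auto)
  have "(LINT u:{s<..t}|lborel. simple_val m \<sigma> \<xi> u \<omega>)
     = (\<Sum>j<m. \<xi> j \<omega> * measure lborel {max (\<sigma> j) s<..min (\<sigma> (Suc j)) t})"
    unfolding set_lebesgue_integral_def e by (subst Bochner_Integration.integral_sum) (use fin in auto)
  also have "\<dots> = simple_int (\<lambda>u \<omega>. u) m \<sigma> \<xi> t \<omega> - simple_int (\<lambda>u \<omega>. u) m \<sigma> \<xi> s \<omega>"
    unfolding simple_int_def sum_subtractf[symmetric] right_diff_distrib[symmetric]
  proof (intro sum.cong refl arg_cong2[where f="(*)"])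
    fix j assume "j \<in> {..<m}"
    then have "\<sigma> j < \<sigma> (Suc j)" using inc by simp
    then show "measure lborel {max (\<sigma> j) s<..min (\<sigma> (Suc j)) t}
       = min (\<sigma> (Suc j)) t - min (\<sigma> j) t - (min (\<sigma> (Suc j)) s - min (\<sigma> j) s)"
      using st by (auto simp: meas min_def max_def)
  qed
  finally show "(LINT u:{s<..t}|lborel. simple_val m \<sigma> \<xi> u \<omega>)
      = simple_int (\<lambda>u \<omega>. u) m \<sigma> \<xi> t \<omega> - simple_int (\<lambda>u \<omega>. u) m \<sigma> \<xi> s \<omega>" .
qed

context brownian begin

text \<open>The counterpart for the letter 0, with the same right-hand side as for Brownian letters,
  so that all letters can be treated alike. The factor t - s from Cauchy-Schwarz is absorbed because
  it is at most 1.\<close>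

lemma time_isometry_le:
  assumes st: "0 \<le> s" "s \<le> t" "t - s \<le> 1" and G: "simple_adapted F m' \<sigma>' \<xi>'"
    and Ys: "time_integral Q F H s Ys" and Yt: "time_integral Q F H t Yt"
  shows "n2 (\<lambda>\<omega>. (Yt \<omega> - Ys \<omega>) - (simple_int (\<lambda>u \<omega>. u) m' \<sigma>' \<xi>' t \<omega> - simple_int (\<lambda>u \<omega>. u) m' \<sigma>' \<xi>' s \<omega>))
     \<le> (\<integral>\<^sup>+\<omega>. l2_dist s t H (simple_val m' \<sigma>' \<xi>') \<omega> \<partial>Q)"
proof (rule nn_integral_mono_AE)
  have inc: "\<sigma>' j < \<sigma>' (Suc j)" if "j < m'" for j using G that by (simp add: simple_adapted_def)
  have "AE \<omega> in Q. set_integrable lborel {0..t} (\<lambda>u. H u \<omega>) \<and> Yt \<omega> = (LINT u:{0..t}|lborel. H u \<omega>)"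
    "AE \<omega> in Q. set_integrable lborel {0..s} (\<lambda>u. H u \<omega>) \<and> Ys \<omega> = (LINT u:{0..s}|lborel. H u \<omega>)"
    using Ys Yt by (auto simp: time_integral_def)
  then show "AE \<omega> in Q. ennreal (((Yt \<omega> - Ys \<omega>) - (simple_int (\<lambda>u \<omega>. u) m' \<sigma>' \<xi>' t \<omega> - simple_int (\<lambda>u \<omega>. u) m' \<sigma>' \<xi>' s \<omega>))\<^sup>2)
     \<le> l2_dist s t H (simple_val m' \<sigma>' \<xi>') \<omega>"
  proof eventually_elim
    case (elim \<omega>)
    let ?g = "\<lambda>u. simple_val m' \<sigma>' \<xi>' u \<omega>"
    note si = set_integral_simple_val[of s t m' \<sigma>' \<xi>' \<omega>, OF st(2) inc]
    have Hi: "set_integrable lborel {s<..t} (\<lambda>u. H u \<omega>)"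
      by (rule set_integrable_subset[OF conjunct1[OF elim(1)]]) (use st in auto)
    have "{0..t} = {0..s} \<union> {s<..t}" using st by auto
    then have "Yt \<omega> = Ys \<omega> + (LINT u:{s<..t}|lborel. H u \<omega>)"
      using elim Hi by (simp only:) (subst set_integral_Un, auto)
    then have "(Yt \<omega> - Ys \<omega>) - (simple_int (\<lambda>u \<omega>. u) m' \<sigma>' \<xi>' t \<omega> - simple_int (\<lambda>u \<omega>. u) m' \<sigma>' \<xi>' s \<omega>)
       = (LINT u:{s<..t}|lborel. H u \<omega> - ?g u)"
      using si Hi by (simp add: set_integral_diff)
    also have "ennreal (\<dots>\<^sup>2) \<le> ennreal (t - s) * (\<integral>\<^sup>+u. ennreal ((H u \<omega> - ?g u)\<^sup>2) * indicator {s<..t} u \<partial>lborel)"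
      by (rule set_integral_square_le[OF set_integral_diff(1)[OF Hi si(1)] st(2)])
    also have "\<dots> \<le> 1 * l2_dist s t H (simple_val m' \<sigma>' \<xi>') \<omega>"
      unfolding l2_dist_def using st
      by (intro mult_mono nn_integral_mono) (auto simp: indicator_def)
    finally show ?case by simp
  qed
qed

end

section \<open>The discretised signature\<close>

lemma power_interp_le:
  fixes u v :: real
  assumes "0 \<le> u" "0 \<le> v" "r \<le> n"
  shows "u ^ (n - r) * v ^ r \<le> u ^ n + v ^ n"
proof (cases "u \<le> v")
  case True
  have "u ^ (n - r) * v ^ r \<le> v ^ (n - r) * v ^ r"
    using assms True by (intro mult_right_mono power_mono) auto
  also have "\<dots> = v ^ n" using assms by (simp flip: power_add)
  finally show ?thesis using assms by (simp add: add_increasing)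
next
  case False
  have "u ^ (n - r) * v ^ r \<le> u ^ (n - r) * u ^ r"
    using assms False by (intro mult_left_mono power_mono) auto
  also have "\<dots> = u ^ n" using assms by (simp flip: power_add)
  finally show ?thesis using assms by (simp add: add_increasing2)
qed

text \<open>The linear term of the binomial expansion is kept exact because it integrates to 0
  against a Brownian increment. The remaining terms interpolate between exponents 2 and 2q of z, and
  4^q bounds the sum of their binomial coefficients.\<close>

lemma power_add_even_le:
  fixes x z :: real
  assumes q: "q \<ge> 1"
  shows "(x + z) ^ (2 * q) \<le> x ^ (2 * q) + 2 * real q * (x ^ (2 * q - 1) * z) + 4 ^ q * (x ^ (2 * q - 2) * z\<^sup>2 + z ^ (2 * q))"
proof -
  let ?n = "2 * q"
  have split: "{..?n} = insert 0 (insert 1 {2..?n})" using q by auto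
  have "(x + z) ^ ?n = (\<Sum>r\<le>?n. real (?n choose r) * (z ^ r * x ^ (?n - r)))"
    by (subst add.commute) (simp only: binomial_ring mult.assoc)
  also have "\<dots> = x ^ ?n + 2 * real q * (x ^ (?n - 1) * z) + (\<Sum>r=2..?n. real (?n choose r) * (z ^ r * x ^ (?n - r)))"
    unfolding split by (simp add: algebra_simps)
  also have "(\<Sum>r=2..?n. real (?n choose r) * (z ^ r * x ^ (?n - r)))
     \<le> (\<Sum>r=2..?n. real (?n choose r) * (x ^ (?n - 2) * z\<^sup>2 + z ^ ?n))"
  proof (intro sum_mono mult_left_mono)
    fix r assume r: "r \<in> {2..?n}"
    have "z ^ r * x ^ (?n - r) \<le> \<bar>z ^ r * x ^ (?n - r)\<bar>" by simp
    also have "\<dots> = z\<^sup>2 * (\<bar>x\<bar> ^ ((?n - 2) - (r - 2)) * \<bar>z\<bar> ^ (r - 2))"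
    proof -
      have "r = 2 + (r - 2)" using r by auto
      then have "\<bar>z\<bar> ^ r = \<bar>z\<bar> ^ 2 * \<bar>z\<bar> ^ (r - 2)" by (metis power_add)
      moreover have "(?n - 2) - (r - 2) = ?n - r" using r by auto
      ultimately show ?thesis by (simp add: abs_mult power_abs)
    qed
    also have "\<dots> \<le> z\<^sup>2 * (\<bar>x\<bar> ^ (?n - 2) + \<bar>z\<bar> ^ (?n - 2))"
      using r by (intro mult_left_mono power_interp_le) auto
    also have "\<dots> = x ^ (?n - 2) * z\<^sup>2 + z ^ ?n"
    proof -
      have "\<bar>x\<bar> ^ (?n - 2) = x ^ (?n - 2)" "\<bar>z\<bar> ^ (?n - 2) = z ^ (?n - 2)"
        using q by (auto simp: power_even_abs)
      moreover have "2 + (?n - 2) = ?n" using q by simp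
      then have "z\<^sup>2 * z ^ (?n - 2) = z ^ ?n" by (metis power_add)
      ultimately show ?thesis by (simp add: algebra_simps)
    qed
    finally show "z ^ r * x ^ (?n - r) \<le> x ^ (?n - 2) * z\<^sup>2 + z ^ ?n" .
  qed simp
  also have "\<dots> = (\<Sum>r=2..?n. real (?n choose r)) * (x ^ (?n - 2) * z\<^sup>2 + z ^ ?n)"
    by (simp add: sum_distrib_right)
  also have "\<dots> \<le> 4 ^ q * (x ^ (?n - 2) * z\<^sup>2 + z ^ ?n)"
  proof (rule mult_right_mono)
    have "(\<Sum>r=2..?n. real (?n choose r)) \<le> (\<Sum>r\<le>?n. real (?n choose r))" by (intro sum_mono2) auto
    also have "\<dots> = real (\<Sum>r\<le>?n. ?n choose r)" by simp
    also have "\<dots> = 4 ^ q" by (simp only: choose_row_sum) (simp add: power_mult)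
    finally show "(\<Sum>r=2..?n. real (?n choose r)) \<le> 4 ^ q" .
    show "0 \<le> x ^ (?n - 2) * z\<^sup>2 + z ^ ?n"
      by (intro add_nonneg_nonneg mult_nonneg_nonneg zero_le_even_power) auto
  qed
  finally show ?thesis by simp
qed

context brownian begin

definition dW :: "real \<Rightarrow> nat \<Rightarrow> nat \<Rightarrow> 'a \<Rightarrow> real" where
  "dW h a j \<omega> = (if a = 0 then h else W a (real (Suc j) * h) \<omega> - W a (real j * h) \<omega>)"

text \<open>The outermost integral belongs to the last letter, hence the reversed word. The inner
  value is taken at the left end of the step, as in Ito sums, which makes it independent of the
  increment it multiplies.\<close>

primrec sig_rev :: "real \<Rightarrow> nat list \<Rightarrow> nat \<Rightarrow> 'a \<Rightarrow> real" where
  "sig_rev h [] m \<omega> = 1"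
| "sig_rev h (a # K) m \<omega> = (\<Sum>j<m. sig_rev h K j \<omega> * dW h a j \<omega>)"

definition sig :: "real \<Rightarrow> nat list \<Rightarrow> nat \<Rightarrow> 'a \<Rightarrow> real" where
  "sig h K = sig_rev h (rev K)"

lemma sig_Nil [simp]: "sig h [] m \<omega> = 1"
  by (simp add: sig_def)

lemma sig_snoc: "sig h (K @ [a]) m \<omega> = (\<Sum>j<m. sig h K j \<omega> * dW h a j \<omega>)"
  by (simp add: sig_def)

lemma sig_snoc_Suc: "sig h (K @ [a]) (Suc m) \<omega> = sig h (K @ [a]) m \<omega> + sig h K m \<omega> * dW h a m \<omega>"
  by (simp add: sig_snoc)

lemma sig_0: "K \<noteq> [] \<Longrightarrow> sig h K 0 \<omega> = 0"
  by (cases K rule: rev_cases) (auto simp: sig_snoc)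

lemma dW_measurable:
  assumes h: "0 < h" and a: "a \<le> d"
  shows "dW h a j \<in> borel_measurable (F (real (Suc j) * h))"
proof (cases "a = 0")
  case False
  then have a': "a \<in> {1..d}" using a by auto
  have "W a (real j * h) \<in> borel_measurable (F (real (Suc j) * h))"
    by (rule measurable_F_mono[OF W_adapted[OF a']]) (use h in auto)
  moreover have "W a (real (Suc j) * h) \<in> borel_measurable (F (real (Suc j) * h))"
    using h by (intro W_adapted[OF a']) auto
  ultimately show ?thesis using False by (simp add: dW_def[abs_def])
qed (simp add: dW_def[abs_def])

lemma sig_measurable:
  assumes h: "0 < h"
  shows "set K \<subseteq> {0..d} \<Longrightarrow> sig h K m \<in> borel_measurable (F (real m * h))"
proof (induction K arbitrary: m rule: rev_induct)
  case Nil
  then show ?case by (simp add: sig_def)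
next
  case (snoc a K)
  have "(\<lambda>\<omega>. sig h K j \<omega> * dW h a j \<omega>) \<in> borel_measurable (F (real m * h))" if "j < m" for j
  proof (rule borel_measurable_times)
    show "sig h K j \<in> borel_measurable (F (real m * h))"
      by (rule measurable_F_mono[OF snoc.IH]) (use snoc.prems that h in auto)
    have "real (Suc j) * h \<le> real m * h" using that h by (intro mult_right_mono) auto
    then show "dW h a j \<in> borel_measurable (F (real m * h))"
      using measurable_F_mono[OF dW_measurable[OF h]] snoc.prems by auto
  qed
  then show ?case unfolding sig_snoc[abs_def] by (intro borel_measurable_sum) auto
qed

lemma sig_measurable_Q: "0 < h \<Longrightarrow> set K \<subseteq> {0..d} \<Longrightarrow> sig h K m \<in> borel_measurable Q"
  by (rule measurable_F_Q[OF sig_measurable])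

lemma centred_dW:
  assumes h: "0 < h" and a: "a \<in> {1..d}"
  shows "centred (real j * h) h (dW h a j)"
proof -
  have "centred (real j * h) (real (Suc j) * h - real j * h) (\<lambda>\<omega>. W a (real (Suc j) * h) \<omega> - W a (real j * h) \<omega>)"
    by (rule centred_W) (use h a in \<open>auto simp: algebra_simps\<close>)
  moreover have "real (Suc j) * h - real j * h = h" by (simp add: algebra_simps)
  ultimately show ?thesis using a by (simp add: dW_def[abs_def])
qed

lemma sum_square_le: "(\<Sum>j\<in>A. u j)\<^sup>2 \<le> real (card A) * (\<Sum>j\<in>A. (u j)\<^sup>2)" for u :: "'b \<Rightarrow> real"
  using Cauchy_Schwarz_ineq_sum[of "\<lambda>_. 1" u A] by simp

lemma n2_sum_le:
  assumes "finite A" "\<And>j. j \<in> A \<Longrightarrow> u j \<in> borel_measurable Q"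
  shows "n2 (\<lambda>\<omega>. \<Sum>j\<in>A. u j \<omega>) \<le> ennreal (real (card A)) * (\<Sum>j\<in>A. n2 (u j))"
proof -
  have "n2 (\<lambda>\<omega>. \<Sum>j\<in>A. u j \<omega>) \<le> (\<integral>\<^sup>+\<omega>. ennreal (real (card A)) * (\<Sum>j\<in>A. ennreal ((u j \<omega>)\<^sup>2)) \<partial>Q)"
    by (intro nn_integral_mono) (auto simp: sum_ennreal ennreal_mult[symmetric] sum_nonneg intro!: ennreal_leI sum_square_le)
  also have "\<dots> = ennreal (real (card A)) * (\<Sum>j\<in>A. n2 (u j))"
    using assms by (subst nn_integral_cmult) (auto simp: nn_integral_sum simp del: sum_ennreal)
  finally show ?thesis .
qed

lemma n2_cmult: "f \<in> borel_measurable Q \<Longrightarrow> n2 (\<lambda>\<omega>. r * f \<omega>) = ennreal (r\<^sup>2) * n2 f"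
  by (simp add: power_mult_distrib ennreal_mult nn_integral_cmult)

text \<open>One bound for all letters. For a Brownian letter it is orthogonality; for the letter 0
  Cauchy-Schwarz gives the factor m h^2, which is at most h because m h <= 1.\<close>

lemma n2_dW_sum:
  assumes h: "0 < h" "real m * h \<le> 1" and a: "a \<le> d"
    and U: "\<And>j. j < m \<Longrightarrow> U j \<in> borel_measurable (F (real j * h))"
  shows "n2 (\<lambda>\<omega>. \<Sum>j<m. U j \<omega> * dW h a j \<omega>) \<le> ennreal h * (\<Sum>j<m. n2 (U j))"
proof (cases "a = 0")
  case True
  have UQ: "U j \<in> borel_measurable Q" if "j < m" for j by (rule measurable_F_Q[OF U[OF that]])
  have "n2 (\<lambda>\<omega>. \<Sum>j<m. U j \<omega> * dW h a j \<omega>) \<le> ennreal (real m) * (\<Sum>j<m. n2 (\<lambda>\<omega>. h * U j \<omega>))"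
    using n2_sum_le[of "{..<m}" "\<lambda>j \<omega>. h * U j \<omega>"] UQ True by (simp add: dW_def mult.commute)
  also have "\<dots> = ennreal (real m * h\<^sup>2) * (\<Sum>j<m. n2 (U j))"
    using UQ by (simp add: n2_cmult ennreal_mult mult.assoc flip: sum_distrib_left)
  also have "\<dots> \<le> ennreal h * (\<Sum>j<m. n2 (U j))"
    using mult_right_mono[OF h(2), of h] h(1) by (intro mult_right_mono ennreal_leI) (auto simp: power2_eq_square)
  finally show ?thesis .
next
  case False
  then have a': "a \<in> {1..d}" using a by auto
  have "n2 (\<lambda>\<omega>. \<Sum>j<m. U j \<omega> * dW h a j \<omega>) \<le> (\<Sum>j<m. ennreal h * n2 (U j))"
    by (rule conjunct2[OF n2_orthogonal_sum[where \<sigma>="\<lambda>j. real j * h"]])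
       (use h a a' U centred_dW dW_measurable in \<open>auto simp: mult_right_mono\<close>)
  then show ?thesis by (simp add: sum_distrib_left)
qed

lemma W_power_integral:
  assumes st: "0 \<le> s" "s < t" and i: "i \<in> {1..d}" and U: "U \<in> borel_measurable (F s)" "integrable Q U"
  shows "integrable Q (\<lambda>\<omega>. U \<omega> * (W i t \<omega> - W i s \<omega>) ^ (2 * q))"
    and "(\<integral>\<omega>. U \<omega> * (W i t \<omega> - W i s \<omega>) ^ (2 * q) \<partial>Q) = (\<integral>\<omega>. U \<omega> \<partial>Q) * (gmom q * (t - s) ^ q)"
proof -
  have h: "0 < t - s" using st by simp
  note g = gauss_moment_even[OF h i, of q]
  from incr_lebesgue_integral[OF st U g(1)] i
  show "integrable Q (\<lambda>\<omega>. U \<omega> * (W i t \<omega> - W i s \<omega>) ^ (2 * q))"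
    "(\<integral>\<omega>. U \<omega> * (W i t \<omega> - W i s \<omega>) ^ (2 * q) \<partial>Q) = (\<integral>\<omega>. U \<omega> \<partial>Q) * (gmom q * (t - s) ^ q)"
    by (simp_all add: incr_def g(2))
qed

text \<open>The constant collected in one step of the binomial estimate: 2q from the linear term,
  and 4^q times 1 and 1 + \<open>gmom q\<close> from the two others.\<close>

definition mconst :: "nat \<Rightarrow> real" where
  "mconst q = 2 * real q + 4 ^ q * (2 + gmom q)"

lemma mconst_nonneg: "0 \<le> mconst q"
  unfolding mconst_def using gmom_nonneg[of q] by (intro add_nonneg_nonneg mult_nonneg_nonneg) auto

text \<open>A single grid step, where x is the value of a word with a final letter a and y that of
  the word without it. The increase is of order 1/N, so N steps multiply by a bounded factor, and
  the weight t^q in front of y records the order in t gained by one letter.\<close>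

lemma moment_step:
  assumes q: "q \<ge> 1" and N: "N > 0" and t: "0 < t" "t \<le> 1" and h: "h = t / real N" and a: "a \<le> d"
    and x: "x \<in> borel_measurable (F (real m * h))" "integrable Q (\<lambda>\<omega>. x \<omega> ^ (2 * q))"
    and y: "y \<in> borel_measurable (F (real m * h))" "integrable Q (\<lambda>\<omega>. y \<omega> ^ (2 * q))"
  shows "integrable Q (\<lambda>\<omega>. (x \<omega> + y \<omega> * dW h a m \<omega>) ^ (2 * q))"
    and "(\<integral>\<omega>. (x \<omega> + y \<omega> * dW h a m \<omega>) ^ (2 * q) \<partial>Q)
       \<le> (1 + mconst q / real N) * (\<integral>\<omega>. x \<omega> ^ (2 * q) \<partial>Q) + mconst q / real N * (t ^ q * (\<integral>\<omega>. y \<omega> ^ (2 * q) \<partial>Q))"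
proof -
  let ?D = "dW h a m"
  have N1: "1 \<le> real N" using N by simp
  have h0: "0 < h" using t N h by simp
  have ht: "h \<le> t" unfolding h using N1 t by (simp add: divide_le_eq mult_le_cancel_left1)
  have [measurable]: "x \<in> borel_measurable Q" "y \<in> borel_measurable Q" "?D \<in> borel_measurable Q"
    using measurable_F_Q[OF x(1)] measurable_F_Q[OF y(1)] measurable_F_Q[OF dW_measurable[OF h0 a]] by auto
  have n2: "2 * q - 1 \<le> 2 * q" "2 * q - 2 \<le> 2 * q" using q by auto
  have i1: "integrable Q (\<lambda>\<omega>. x \<omega> ^ (2 * q - 1) * y \<omega>)"
  proof (rule Bochner_Integration.integrable_bound[OF Bochner_Integration.integrable_add[OF x(2) y(2)]])
    have "\<bar>x \<omega> ^ (2 * q - 1) * y \<omega>\<bar> \<le> x \<omega> ^ (2 * q) + y \<omega> ^ (2 * q)" for \<omega>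
      using power_interp_le[of "\<bar>x \<omega>\<bar>" "\<bar>y \<omega>\<bar>" 1 "2 * q"] q by (simp add: abs_mult power_abs power_even_abs)
    then show "AE \<omega> in Q. norm (x \<omega> ^ (2 * q - 1) * y \<omega>) \<le> norm (x \<omega> ^ (2 * q) + y \<omega> ^ (2 * q))"
      by (intro AE_I2) (simp add: order_trans[OF _ abs_ge_self])
  qed simp
  \<comment> \<open>Interpolation between x^(2q) and the 2q-th power of sqrt r times y. The value r
    = 1 yields integrability, r = t yields the moment estimate.\<close>
  have le2: "x \<omega> ^ (2 * q - 2) * (y \<omega>)\<^sup>2 * r \<le> x \<omega> ^ (2 * q) + r ^ q * y \<omega> ^ (2 * q)" if r: "0 \<le> r" for r \<omega>
  proof -
    have "\<bar>x \<omega>\<bar> ^ (2 * q - 2) * (sqrt r * \<bar>y \<omega>\<bar>) ^ 2 \<le> \<bar>x \<omega>\<bar> ^ (2 * q) + (sqrt r * \<bar>y \<omega>\<bar>) ^ (2 * q)"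
      using q r by (intro power_interp_le) auto
    moreover have "\<bar>x \<omega>\<bar> ^ (2 * q - 2) = x \<omega> ^ (2 * q - 2)" "\<bar>x \<omega>\<bar> ^ (2 * q) = x \<omega> ^ (2 * q)"
      using q by (simp_all add: power_even_abs)
    moreover have "(sqrt r * \<bar>y \<omega>\<bar>) ^ 2 = (y \<omega>)\<^sup>2 * r" using r by (simp add: power_mult_distrib)
    moreover have "(sqrt r * \<bar>y \<omega>\<bar>) ^ (2 * q) = r ^ q * y \<omega> ^ (2 * q)"
      unfolding power_mult_distrib using r by (simp add: power_even_abs) (simp add: power_mult)
    ultimately show ?thesis by (simp add: mult.assoc)
  qed
  have i2: "integrable Q (\<lambda>\<omega>. x \<omega> ^ (2 * q - 2) * (y \<omega>)\<^sup>2)"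
  proof (rule Bochner_Integration.integrable_bound[OF Bochner_Integration.integrable_add[OF x(2) y(2)]])
    have "norm (x \<omega> ^ (2 * q - 2) * (y \<omega>)\<^sup>2) \<le> norm (x \<omega> ^ (2 * q) + y \<omega> ^ (2 * q))" for \<omega>
    proof -
      have "0 \<le> x \<omega> ^ (2 * q - 2) * (y \<omega>)\<^sup>2" using q by (intro mult_nonneg_nonneg zero_le_even_power) auto
      then show ?thesis using le2[of 1 \<omega>] by simp
    qed
    then show "AE \<omega> in Q. norm (x \<omega> ^ (2 * q - 2) * (y \<omega>)\<^sup>2) \<le> norm (x \<omega> ^ (2 * q) + y \<omega> ^ (2 * q))" by simp
  qed simp
  define mx where "mx = (\<integral>\<omega>. x \<omega> ^ (2 * q) \<partial>Q)"
  define my where "my = (\<integral>\<omega>. y \<omega> ^ (2 * q) \<partial>Q)"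
  have mxy: "0 \<le> mx" "0 \<le> my" unfolding mx_def my_def by (auto intro!: integral_nonneg_AE zero_le_even_power)
  have hq: "h ^ q \<le> t ^ q / real N"
  proof -
    have "h ^ q = t ^ q / real N ^ q" by (simp add: h power_divide)
    also have "\<dots> \<le> t ^ q / real N" using t N1 q self_le_power[of "real N" q] by (intro divide_left_mono) auto
    finally show ?thesis .
  qed
  have E2: "h * (\<integral>\<omega>. x \<omega> ^ (2 * q - 2) * (y \<omega>)\<^sup>2 \<partial>Q) \<le> (mx + t ^ q * my) / real N"
  proof -
    have "t * (\<integral>\<omega>. x \<omega> ^ (2 * q - 2) * (y \<omega>)\<^sup>2 \<partial>Q) = (\<integral>\<omega>. x \<omega> ^ (2 * q - 2) * (y \<omega>)\<^sup>2 * t \<partial>Q)"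
      by (simp add: mult.commute)
    also have "\<dots> \<le> (\<integral>\<omega>. x \<omega> ^ (2 * q) + t ^ q * y \<omega> ^ (2 * q) \<partial>Q)"
      using i2 x(2) y(2) le2[of t] t by (intro integral_mono) auto
    also have "\<dots> = mx + t ^ q * my" using x(2) y(2) by (simp add: mx_def my_def)
    finally show ?thesis unfolding h using N by (simp add: field_simps)
  qed
  \<comment> \<open>The three mixed moments are brought into a form common to both kinds of letters.
    For a Brownian letter the first one is 0, and the others factor by independence; for the letter
    0 the increment is the constant h.\<close>
  have main: "integrable Q (\<lambda>\<omega>. x \<omega> ^ (2 * q - 1) * y \<omega> * ?D \<omega>) \<and>
     integrable Q (\<lambda>\<omega>. x \<omega> ^ (2 * q - 2) * (y \<omega>)\<^sup>2 * ?D \<omega> ^ 2) \<and> integrable Q (\<lambda>\<omega>. y \<omega> ^ (2 * q) * ?D \<omega> ^ (2 * q)) \<and>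
     (\<integral>\<omega>. x \<omega> ^ (2 * q - 1) * y \<omega> * ?D \<omega> \<partial>Q) \<le> (mx + t ^ q * my) / real N \<and>
     (\<integral>\<omega>. x \<omega> ^ (2 * q - 2) * (y \<omega>)\<^sup>2 * ?D \<omega> ^ 2 \<partial>Q) \<le> (mx + t ^ q * my) / real N \<and>
     (\<integral>\<omega>. y \<omega> ^ (2 * q) * ?D \<omega> ^ (2 * q) \<partial>Q) \<le> (1 + gmom q) * (t ^ q * my) / real N"
  proof (cases "a = 0")
    case True
    then have D: "?D \<omega> = h" for \<omega> by (simp add: dW_def)
    have e1: "h * (\<integral>\<omega>. x \<omega> ^ (2 * q - 1) * y \<omega> \<partial>Q) \<le> (mx + t ^ q * my) / real N"
    proof -
      have "t * (\<integral>\<omega>. x \<omega> ^ (2 * q - 1) * y \<omega> \<partial>Q) = (\<integral>\<omega>. x \<omega> ^ (2 * q - 1) * (t * y \<omega>) \<partial>Q)"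
        by (simp add: mult.left_commute)
      also have "\<dots> \<le> (\<integral>\<omega>. x \<omega> ^ (2 * q) + t ^ q * y \<omega> ^ (2 * q) \<partial>Q)"
      proof (rule integral_mono)
        show "integrable Q (\<lambda>\<omega>. x \<omega> ^ (2 * q - 1) * (t * y \<omega>))" using i1 by (simp add: mult.left_commute)
        show "integrable Q (\<lambda>\<omega>. x \<omega> ^ (2 * q) + t ^ q * y \<omega> ^ (2 * q))" using x(2) y(2) by simp
        fix \<omega>
        have "x \<omega> ^ (2 * q - 1) * (t * y \<omega>) \<le> \<bar>x \<omega>\<bar> ^ (2 * q - 1) * (t * \<bar>y \<omega>\<bar>) ^ 1"
          using t by (simp add: abs_mult power_abs[symmetric] order_trans[OF abs_ge_self])
        also have "\<dots> \<le> \<bar>x \<omega>\<bar> ^ (2 * q) + (t * \<bar>y \<omega>\<bar>) ^ (2 * q)" using q t by (intro power_interp_le) auto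
        also have "\<dots> = x \<omega> ^ (2 * q) + t ^ (2 * q) * y \<omega> ^ (2 * q)" by (simp add: power_even_abs power_mult_distrib)
        also have "\<dots> \<le> x \<omega> ^ (2 * q) + t ^ q * y \<omega> ^ (2 * q)"
          using t power_decreasing[of q "2 * q" t] by (intro add_left_mono mult_right_mono zero_le_even_power) auto
        finally show "x \<omega> ^ (2 * q - 1) * (t * y \<omega>) \<le> x \<omega> ^ (2 * q) + t ^ q * y \<omega> ^ (2 * q)" .
      qed
      also have "\<dots> = mx + t ^ q * my" using x(2) y(2) by (simp add: mx_def my_def)
      finally show ?thesis unfolding h using N by (simp add: field_simps)
    qed
    have h1: "h \<le> 1" using ht t by simp
    have nn: "0 \<le> (\<integral>\<omega>. x \<omega> ^ (2 * q - 2) * (y \<omega>)\<^sup>2 \<partial>Q)"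
      using q by (intro integral_nonneg_AE AE_I2 mult_nonneg_nonneg zero_le_even_power) auto
    have e2: "h ^ 2 * (\<integral>\<omega>. x \<omega> ^ (2 * q - 2) * (y \<omega>)\<^sup>2 \<partial>Q) \<le> (mx + t ^ q * my) / real N"
      using E2 mult_right_mono[OF power_decreasing[of 1 2 h] nn] h0 h1 by simp
    have e3: "h ^ (2 * q) * my \<le> (1 + gmom q) * (t ^ q * my) / real N"
    proof -
      have "h ^ (2 * q) * my \<le> h ^ q * my" using h0 h1 mxy by (intro mult_right_mono power_decreasing) auto
      also have "\<dots> \<le> t ^ q / real N * my" using hq mxy by (intro mult_right_mono)
      also have "\<dots> \<le> (1 + gmom q) * (t ^ q * my) / real N"
        using gmom_nonneg[of q] mxy t N1 by (simp add: divide_simps distrib_right)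
      finally show ?thesis .
    qed
    show ?thesis unfolding D using i1 i2 y(2) e1 e2 e3 by (simp add: mult.commute my_def)
  next
    case False
    then have a': "a \<in> {1..d}" using a by auto
    have st: "0 \<le> real m * h" "real m * h < real (Suc m) * h" using h0 by (auto simp: algebra_simps)
    have sth: "real (Suc m) * h - real m * h = h" by (simp add: algebra_simps)
    have D: "?D = (\<lambda>\<omega>. W a (real (Suc m) * h) \<omega> - W a (real m * h) \<omega>)" using False by (simp add: dW_def[abs_def])
    have m1: "(\<lambda>\<omega>. x \<omega> ^ (2 * q - 1) * y \<omega>) \<in> borel_measurable (F (real m * h))"
      "(\<lambda>\<omega>. x \<omega> ^ (2 * q - 2) * (y \<omega>)\<^sup>2) \<in> borel_measurable (F (real m * h))"
      "(\<lambda>\<omega>. y \<omega> ^ (2 * q)) \<in> borel_measurable (F (real m * h))"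
      using x(1) y(1) by simp_all
    have c1: "integrable Q (\<lambda>\<omega>. x \<omega> ^ (2 * q - 1) * y \<omega> * ?D \<omega>) \<and> (\<integral>\<omega>. x \<omega> ^ (2 * q - 1) * y \<omega> * ?D \<omega> \<partial>Q) = 0"
      using centred_dW[OF h0 a', of m] m1(1) i1 unfolding centred_def by blast
    note c2 = W_power_integral[OF st a' m1(2) i2, of 1, unfolded sth]
    note c3 = W_power_integral[OF st a' m1(3) y(2), of q, unfolded sth]
    have g1: "gmom 1 = 1" by (simp add: gmom_def)
    have "my * (gmom q * h ^ q) \<le> my * (gmom q * (t ^ q / real N))"
      using hq mxy gmom_nonneg[of q] by (intro mult_left_mono) auto
    also have "\<dots> \<le> (1 + gmom q) * (t ^ q * my) / real N"
      using gmom_nonneg[of q] mxy t N1 by (simp add: divide_simps algebra_simps)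
    finally have e3: "my * (gmom q * h ^ q) \<le> (1 + gmom q) * (t ^ q * my) / real N" .
    have "0 \<le> (mx + t ^ q * my) / real N" using mxy t by simp
    then show ?thesis
      using c1 c2 c3 E2 e3 unfolding D[symmetric] g1 D[THEN fun_cong, symmetric] by (simp add: my_def mult.commute)
  qed
  let ?B = "\<lambda>\<omega>. x \<omega> ^ (2 * q) + 2 * real q * (x \<omega> ^ (2 * q - 1) * (y \<omega> * ?D \<omega>))
     + 4 ^ q * (x \<omega> ^ (2 * q - 2) * (y \<omega> * ?D \<omega>)\<^sup>2 + (y \<omega> * ?D \<omega>) ^ (2 * q))"
  have Beq: "?B = (\<lambda>\<omega>. x \<omega> ^ (2 * q) + 2 * real q * (x \<omega> ^ (2 * q - 1) * y \<omega> * ?D \<omega>)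
     + 4 ^ q * (x \<omega> ^ (2 * q - 2) * (y \<omega>)\<^sup>2 * ?D \<omega> ^ 2 + y \<omega> ^ (2 * q) * ?D \<omega> ^ (2 * q)))"
    by (simp add: power_mult_distrib mult.assoc)
  have Bi: "integrable Q ?B" unfolding Beq using main x(2) by simp
  have le: "(x \<omega> + y \<omega> * ?D \<omega>) ^ (2 * q) \<le> ?B \<omega>" for \<omega> by (rule power_add_even_le[OF q])
  show int: "integrable Q (\<lambda>\<omega>. (x \<omega> + y \<omega> * ?D \<omega>) ^ (2 * q))"
  proof (rule Bochner_Integration.integrable_bound[OF Bi])
    show "AE \<omega> in Q. norm ((x \<omega> + y \<omega> * ?D \<omega>) ^ (2 * q)) \<le> norm (?B \<omega>)"
    proof (rule AE_I2)
      fix \<omega>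
      have "norm ((x \<omega> + y \<omega> * ?D \<omega>) ^ (2 * q)) = (x \<omega> + y \<omega> * ?D \<omega>) ^ (2 * q)" by (simp add: power_even_abs)
      also have "\<dots> \<le> ?B \<omega>" by (rule le)
      also have "\<dots> \<le> norm (?B \<omega>)" by simp
      finally show "norm ((x \<omega> + y \<omega> * ?D \<omega>) ^ (2 * q)) \<le> norm (?B \<omega>)" .
    qed
  qed simp
  have "(\<integral>\<omega>. (x \<omega> + y \<omega> * ?D \<omega>) ^ (2 * q) \<partial>Q) \<le> (\<integral>\<omega>. ?B \<omega> \<partial>Q)"
    by (rule integral_mono[OF int Bi le])
  also have "\<dots> = mx + 2 * real q * (\<integral>\<omega>. x \<omega> ^ (2 * q - 1) * y \<omega> * ?D \<omega> \<partial>Q)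
     + 4 ^ q * ((\<integral>\<omega>. x \<omega> ^ (2 * q - 2) * (y \<omega>)\<^sup>2 * ?D \<omega> ^ 2 \<partial>Q) + (\<integral>\<omega>. y \<omega> ^ (2 * q) * ?D \<omega> ^ (2 * q) \<partial>Q))"
    unfolding Beq using main x(2) by (simp add: mx_def)
  also have "\<dots> \<le> mx + 2 * real q * ((mx + t ^ q * my) / real N)
     + 4 ^ q * ((mx + t ^ q * my) / real N + (1 + gmom q) * (t ^ q * my) / real N)"
    using main by (intro add_mono mult_left_mono) auto
  also have "\<dots> \<le> mx + 2 * real q * ((mx + t ^ q * my) / real N)
     + 4 ^ q * ((mx + t ^ q * my) / real N + (1 + gmom q) * (mx + t ^ q * my) / real N)"
    using t mxy gmom_nonneg[of q] by (intro add_mono mult_left_mono divide_right_mono) auto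
  also have "\<dots> = (1 + mconst q / real N) * mx + mconst q / real N * (t ^ q * my)"
    using N by (simp add: mconst_def field_simps)
  finally show "(\<integral>\<omega>. (x \<omega> + y \<omega> * ?D \<omega>) ^ (2 * q) \<partial>Q)
       \<le> (1 + mconst q / real N) * (\<integral>\<omega>. x \<omega> ^ (2 * q) \<partial>Q) + mconst q / real N * (t ^ q * (\<integral>\<omega>. y \<omega> ^ (2 * q) \<partial>Q))"
    by (simp add: mx_def my_def)
qed

text \<open>An outer induction on the word and an inner one on the grid index. The inner recursion
  u(m+1) <= (1 + C) u(m) + C b with u(0) = 0 has the bound ((1 + C)^m - 1) b, and C =
  \<open>mconst q\<close> / N keeps this below exp(\<open>mconst q\<close>) b, uniformly in
  N.\<close>

lemma sig_moment:
  assumes q: "q \<ge> 1" and N: "N > 0" and t: "0 < t" "t \<le> 1" and h: "h = t / real N"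
  shows "set K \<subseteq> {0..d} \<Longrightarrow> m \<le> N \<Longrightarrow> integrable Q (\<lambda>\<omega>. sig h K m \<omega> ^ (2 * q)) \<and>
     (\<integral>\<omega>. sig h K m \<omega> ^ (2 * q) \<partial>Q) \<le> (exp (mconst q) * t ^ q) ^ length K"
proof (induction K arbitrary: m rule: rev_induct)
  case Nil
  then show ?case by (simp add: prob_space)
next
  case (snoc a K)
  have h0: "0 < h" using t N h by simp
  define b where "b = (exp (mconst q) * t ^ q) ^ length K"
  define C where "C = mconst q / real N"
  have b0: "0 \<le> b" using t by (simp add: b_def)
  have C0: "0 \<le> C" using mconst_nonneg[of q] by (simp add: C_def)
  have K: "set K \<subseteq> {0..d}" "a \<le> d" using snoc.prems by auto
  have *: "integrable Q (\<lambda>\<omega>. sig h (K @ [a]) m \<omega> ^ (2 * q)) \<and>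
     (\<integral>\<omega>. sig h (K @ [a]) m \<omega> ^ (2 * q) \<partial>Q) \<le> ((1 + C) ^ m - 1) * (t ^ q * b)" if "m \<le> N" for m
    using that
  proof (induction m)
    case 0
    then show ?case using q by (simp add: sig_0 power_0_left)
  next
    case (Suc m)
    have IH: "integrable Q (\<lambda>\<omega>. sig h (K @ [a]) m \<omega> ^ (2 * q))"
      "(\<integral>\<omega>. sig h (K @ [a]) m \<omega> ^ (2 * q) \<partial>Q) \<le> ((1 + C) ^ m - 1) * (t ^ q * b)" using Suc by auto
    have IK: "integrable Q (\<lambda>\<omega>. sig h K m \<omega> ^ (2 * q))" "(\<integral>\<omega>. sig h K m \<omega> ^ (2 * q) \<partial>Q) \<le> b"
      using snoc.IH[OF K(1), of m] Suc.prems by (auto simp: b_def)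
    note st = moment_step[OF q N t h K(2) sig_measurable[OF h0] IH(1) sig_measurable[OF h0 K(1)] IK(1)]
    have "(\<integral>\<omega>. sig h (K @ [a]) (Suc m) \<omega> ^ (2 * q) \<partial>Q)
       \<le> (1 + C) * (\<integral>\<omega>. sig h (K @ [a]) m \<omega> ^ (2 * q) \<partial>Q) + C * (t ^ q * (\<integral>\<omega>. sig h K m \<omega> ^ (2 * q) \<partial>Q))"
      using st(2) snoc.prems(1) unfolding C_def sig_snoc_Suc by simp
    also have "\<dots> \<le> (1 + C) * (((1 + C) ^ m - 1) * (t ^ q * b)) + C * (t ^ q * b)"
      using IH(2) IK(2) C0 t by (intro add_mono mult_left_mono) auto
    also have "\<dots> = ((1 + C) ^ Suc m - 1) * (t ^ q * b)" by (simp add: algebra_simps)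
    finally show ?case using st(1) snoc.prems(1) unfolding sig_snoc_Suc by simp
  qed
  have "(1 + C) ^ m \<le> (1 + C) ^ N" using C0 snoc.prems(2) by (intro power_increasing) auto
  also have "\<dots> \<le> exp C ^ N" using C0 by (intro power_mono) auto
  also have "\<dots> = exp (mconst q)" using N by (simp add: C_def flip: exp_of_nat_mult)
  finally have "((1 + C) ^ m - 1) * (t ^ q * b) \<le> exp (mconst q) * (t ^ q * b)"
    using b0 t by (intro mult_right_mono) auto
  also have "\<dots> = (exp (mconst q) * t ^ q) ^ length (K @ [a])" by (simp add: b_def)
  finally show ?case using *[OF snoc.prems(2)] by auto
qed

end

section \<open>Products of words and their star product on the grid\<close>

lemma supp_star:
  assumes "set I \<subseteq> {0..d}" "set J \<subseteq> {0..d}"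
  shows "supp (star I J) \<subseteq> words d (length I + length J)"
  unfolding star_eq_qs[OF assms] using assms by (intro supp_qs) (auto simp: words_def)

lemma supp_app_letter: "supp (app_letter x a) = (\<lambda>K. K @ [a]) ` supp x"
proof (rule set_eqI)
  fix K show "K \<in> supp (app_letter x a) \<longleftrightarrow> K \<in> (\<lambda>K. K @ [a]) ` supp x"
    by (cases K rule: rev_cases) (auto simp: supp_def app_letter_def)
qed

context brownian begin

definition lin :: "real \<Rightarrow> (nat list \<Rightarrow> real) \<Rightarrow> nat \<Rightarrow> 'a \<Rightarrow> real" where
  "lin h x m \<omega> = (\<Sum>K\<in>supp x. x K * sig h K m \<omega>)"

lemma lin_eq: "finite A \<Longrightarrow> supp x \<subseteq> A \<Longrightarrow> lin h x m \<omega> = (\<Sum>K\<in>A. x K * sig h K m \<omega>)"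
  unfolding lin_def by (rule sum.mono_neutral_left) (auto simp: supp_def)

lemma lin_word: "lin h (word I) m \<omega> = sig h I m \<omega>"
  by (simp add: lin_def) (simp add: word_def)

lemma lin_add:
  assumes "finite (supp x)" "finite (supp y)"
  shows "lin h (\<lambda>K. x K + y K) m \<omega> = lin h x m \<omega> + lin h y m \<omega>"
proof -
  have f: "finite (supp x \<union> supp y)" using assms by simp
  have "supp (\<lambda>K. x K + y K) \<subseteq> supp x \<union> supp y" by (rule supp_add_subset) auto
  then have "lin h (\<lambda>K. x K + y K) m \<omega> = (\<Sum>K\<in>supp x \<union> supp y. (x K + y K) * sig h K m \<omega>)"
    by (rule lin_eq[OF f])
  also have "\<dots> = lin h x m \<omega> + lin h y m \<omega>"
    using lin_eq[OF f, of x] lin_eq[OF f, of y] by (simp add: distrib_right sum.distrib)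
  finally show ?thesis .
qed

lemma lin_app_letter: "lin h (app_letter x a) m \<omega> = (\<Sum>K\<in>supp x. x K * sig h (K @ [a]) m \<omega>)"
  unfolding lin_def supp_app_letter
  by (subst sum.reindex) (auto simp: inj_on_def app_letter_def)

lemma lin_app_letter_Suc:
  "lin h (app_letter x a) (Suc m) \<omega> = lin h (app_letter x a) m \<omega> + lin h x m \<omega> * dW h a m \<omega>"
  unfolding lin_app_letter sig_snoc_Suc by (simp add: lin_def distrib_left sum.distrib sum_distrib_right mult.assoc)

definition perr :: "real \<Rightarrow> nat list \<Rightarrow> nat list \<Rightarrow> nat \<Rightarrow> 'a \<Rightarrow> real" where
  "perr h I J m \<omega> = sig h I m \<omega> * sig h J m \<omega> - lin h (star I J) m \<omega>"

lemma perr_Nil [simp]: "perr h [] J m \<omega> = 0" "perr h I [] m \<omega> = 0"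
  by (simp_all add: perr_def lin_word)

text \<open>The discrete analogue of the product rule for iterated integrals; the last term is a
  martingale increment of order \<open>h\<close> and disappears as the mesh tends to zero.\<close>

lemma perr_Suc:
  assumes "set (I @ [a]) \<subseteq> {0..d}" "set (J @ [b]) \<subseteq> {0..d}"
  defines "r \<equiv> if a = b \<and> a > 0 then 1 else 0"
  shows "perr h (I @ [a]) (J @ [b]) (Suc m) \<omega> = perr h (I @ [a]) (J @ [b]) m \<omega>
     + (perr h I (J @ [b]) m \<omega> * dW h a m \<omega> + perr h (I @ [a]) J m \<omega> * dW h b m \<omega>
     + r * perr h I J m \<omega> * dW h 0 m \<omega>
     + sig h I m \<omega> * sig h J m \<omega> * (dW h a m \<omega> * dW h b m \<omega> - r * h))"
proof -
  have fin: "finite (supp (star I' J'))" if "set I' \<subseteq> {0..d}" "set J' \<subseteq> {0..d}" for I' J'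
    using finite_subset[OF supp_star[OF that] finite_words] .
  have fapp: "finite (supp (app_letter x e))" if "finite (supp x)" for x e
    using that by (simp add: supp_app_letter)
  have sets: "set I \<subseteq> {0..d}" "set J \<subseteq> {0..d}" using assms by auto
  have lin_star: "lin h (star (I @ [a]) (J @ [b])) m' \<omega> = lin h (app_letter (star I (J @ [b])) a) m' \<omega>
     + lin h (app_letter (star (I @ [a]) J) b) m' \<omega> + r * lin h (app_letter (star I J) 0) m' \<omega>" for m'
  proof (cases "a = b \<and> a > 0")
    case True
    have "star (I @ [a]) (J @ [b]) = (\<lambda>K. (app_letter (star I (J @ [b])) a K
       + app_letter (star (I @ [a]) J) b K) + app_letter (star I J) 0 K)"
      using True by (simp add: star_snoc_snoc)
    then show ?thesis
      using True fapp fin assms(1,2) sets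
        finite_subset[OF supp_add_subset[of "app_letter (star I (J @ [b])) a" "supp (app_letter (star I (J @ [b])) a) \<union> supp (app_letter (star (I @ [a]) J) b)" "app_letter (star (I @ [a]) J) b"]]
      by (simp add: lin_add r_def)
  next
    case False
    have "star (I @ [a]) (J @ [b]) = (\<lambda>K. app_letter (star I (J @ [b])) a K + app_letter (star (I @ [a]) J) b K)"
      using False by (auto simp add: star_snoc_snoc)
    moreover have "r = 0" using False by (auto simp: r_def)
    ultimately show ?thesis using fapp fin assms(1,2) sets by (simp add: lin_add)
  qed
  show ?thesis
    unfolding perr_def lin_star lin_app_letter_Suc sig_snoc_Suc
    by (simp add: algebra_simps dW_def[of h 0])
qed

lemma perr_0: "set I \<subseteq> {0..d} \<Longrightarrow> set J \<subseteq> {0..d} \<Longrightarrow> perr h I J 0 \<omega> = 0"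
proof (cases "I = [] \<or> J = []")
  case False
  have "lin h (star I J) 0 \<omega> = 0"
    unfolding lin_def using False star_Nil_at[of I J] by (intro sum.neutral) (auto simp: supp_def, metis sig_0)
  then show ?thesis using False by (simp add: perr_def sig_0)
qed auto

lemma perr_eq_sum:
  assumes "set (I @ [a]) \<subseteq> {0..d}" "set (J @ [b]) \<subseteq> {0..d}"
  defines "r \<equiv> if a = b \<and> a > 0 then 1 else 0"
  shows "perr h (I @ [a]) (J @ [b]) m \<omega> =
     (\<Sum>j<m. perr h I (J @ [b]) j \<omega> * dW h a j \<omega>) + (\<Sum>j<m. perr h (I @ [a]) J j \<omega> * dW h b j \<omega>)
     + (\<Sum>j<m. r * perr h I J j \<omega> * dW h 0 j \<omega>)
     + (\<Sum>j<m. sig h I j \<omega> * sig h J j \<omega> * (dW h a j \<omega> * dW h b j \<omega> - r * h))"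
proof (induction m)
  case 0
  then show ?case using perr_0[OF assms(1,2)] by simp
next
  case (Suc m)
  show ?case unfolding perr_Suc[OF assms(1,2)] Suc.IH r_def[symmetric] by simp
qed

lemma lin_measurable:
  assumes "0 < h" "supp x \<subseteq> words d L"
  shows "lin h x m \<in> borel_measurable (F (real m * h))"
  unfolding lin_def[abs_def] using assms
  by (intro borel_measurable_sum borel_measurable_times sig_measurable) (auto simp: words_def)

lemma perr_measurable:
  assumes "0 < h" "set I \<subseteq> {0..d}" "set J \<subseteq> {0..d}"
  shows "perr h I J m \<in> borel_measurable (F (real m * h))"
  unfolding perr_def[abs_def] using assms
  by (intro borel_measurable_diff borel_measurable_times sig_measurable lin_measurable[OF _ supp_star])

lemma n2_sig_sig:
  assumes N: "N > 0" and t: "0 < t" "t \<le> 1" and IJ: "set I \<subseteq> {0..d}" "set J \<subseteq> {0..d}" and m: "m \<le> N"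
  shows "n2 (\<lambda>\<omega>. sig (t / real N) I m \<omega> * sig (t / real N) J m \<omega>)
     \<le> ennreal (exp (mconst 2) ^ length I + exp (mconst 2) ^ length J)"
proof -
  let ?h = "t / real N"
  have "?h > 0" using N t by simp
  then have [measurable]: "sig ?h I m \<in> borel_measurable Q" "sig ?h J m \<in> borel_measurable Q"
    using IJ by (auto intro: sig_measurable_Q)
  have M: "integrable Q (\<lambda>\<omega>. sig ?h K m \<omega> ^ 4)" "(\<integral>\<omega>. sig ?h K m \<omega> ^ 4 \<partial>Q) \<le> exp (mconst 2) ^ length K"
    if "set K \<subseteq> {0..d}" for K
  proof -
    note sm = sig_moment[OF _ N t refl that m, of 2]
    show "integrable Q (\<lambda>\<omega>. sig ?h K m \<omega> ^ 4)" using sm by simp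
    have "(\<integral>\<omega>. sig ?h K m \<omega> ^ 4 \<partial>Q) \<le> (exp (mconst 2) * t\<^sup>2) ^ length K" using sm by simp
    also have "\<dots> \<le> exp (mconst 2) ^ length K" using t by (intro power_mono) (auto simp: power_le_one mult_left_le)
    finally show "(\<integral>\<omega>. sig ?h K m \<omega> ^ 4 \<partial>Q) \<le> exp (mconst 2) ^ length K" .
  qed
  have "n2 (\<lambda>\<omega>. sig ?h I m \<omega> * sig ?h J m \<omega>) \<le> (\<integral>\<^sup>+\<omega>. ennreal (sig ?h I m \<omega> ^ 4 + sig ?h J m \<omega> ^ 4) \<partial>Q)"
  proof (intro nn_integral_mono ennreal_leI)
    fix \<omega>
    have "2 * (sig ?h I m \<omega> * sig ?h J m \<omega>)\<^sup>2 \<le> sig ?h I m \<omega> ^ 4 + sig ?h J m \<omega> ^ 4"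
      using zero_le_power2[of "(sig ?h I m \<omega>)\<^sup>2 - (sig ?h J m \<omega>)\<^sup>2"]
      by (simp add: power2_eq_square power4_eq_xxxx algebra_simps)
    moreover have "0 \<le> (sig ?h I m \<omega> * sig ?h J m \<omega>)\<^sup>2" by simp
    ultimately show "(sig ?h I m \<omega> * sig ?h J m \<omega>)\<^sup>2 \<le> sig ?h I m \<omega> ^ 4 + sig ?h J m \<omega> ^ 4" by linarith
  qed
  also have "\<dots> = ennreal ((\<integral>\<omega>. sig ?h I m \<omega> ^ 4 \<partial>Q) + (\<integral>\<omega>. sig ?h J m \<omega> ^ 4 \<partial>Q))"
    using M IJ by (subst nn_integral_eq_integral) auto
  also have "\<dots> \<le> ennreal (exp (mconst 2) ^ length I + exp (mconst 2) ^ length J)"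
    using M IJ by (intro ennreal_leI add_mono) auto
  finally show ?thesis .
qed

text \<open>Compensated products of increments are negligible. Two Brownian letters give orthogonal
  terms of variance 8 h^2, hence order m h^2; if a letter is 0, the product is h times a single
  increment.\<close>

lemma n2_dW_dW_sum:
  assumes N: "N > 0" and t: "0 < t" "t \<le> 1" and ab: "a \<le> d" "b \<le> d" and m: "m \<le> N" and c: "0 \<le> c"
    and U: "\<And>j. j < m \<Longrightarrow> U j \<in> borel_measurable (F (real j * (t / real N)))" "\<And>j. j < m \<Longrightarrow> n2 (U j) \<le> ennreal c"
  shows "n2 (\<lambda>\<omega>. \<Sum>j<m. U j \<omega> * (dW (t / real N) a j \<omega> * dW (t / real N) b j \<omega>
      - (if a = b \<and> a > 0 then 1 else 0) * (t / real N))) \<le> ennreal (8 * c / real N)"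
proof -
  let ?h = "t / real N"
  have N1: "1 \<le> real N" using N by simp
  have h0: "?h > 0" using N t by simp
  have hN: "?h \<le> 1 / real N" using N t by (intro divide_right_mono) auto
  have h1: "?h \<le> 1" using hN N1 by (meson divide_le_eq_1 order_trans zero_less_one le_divide_eq_1 order_less_le_trans)
  have mh: "real m * ?h \<le> 1" 
  proof -
    have "real m * ?h \<le> real N * ?h" using m h0 by (intro mult_right_mono) auto
    also have "\<dots> = t" using N by simp
    finally show ?thesis using t by simp
  qed
  have sumU: "(\<Sum>j<m. n2 (U j)) \<le> ennreal (real m * c)"
  proof -
    have "(\<Sum>j<m. n2 (U j)) \<le> (\<Sum>j<m. ennreal c)" using U(2) by (intro sum_mono) auto
    also have "\<dots> = ennreal (real m * c)" using c by (simp add: ennreal_mult ennreal_of_nat_eq_real_of_nat)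
    finally show ?thesis .
  qed
  consider "a = 0 \<or> b = 0" | "a \<in> {1..d}" "b \<in> {1..d}" using ab by fastforce
  then show ?thesis
  proof cases
    case 1
    \<comment> \<open>e is the letter that accompanies a 0; it is itself 0 if both letters
      are.\<close>
    define e where "e = (if a = 0 then b else a)"
    have e: "e \<le> d" using ab by (simp add: e_def)
    have eq: "U j \<omega> * (dW ?h a j \<omega> * dW ?h b j \<omega> - (if a = b \<and> a > 0 then 1 else 0) * ?h) = (?h * U j \<omega>) * dW ?h e j \<omega>" for j \<omega>
      using 1 by (auto simp: e_def dW_def)
    have UQ: "U j \<in> borel_measurable Q" if "j < m" for j by (rule measurable_F_Q[OF U(1)[OF that]])
    have "n2 (\<lambda>\<omega>. \<Sum>j<m. (?h * U j \<omega>) * dW ?h e j \<omega>) \<le> ennreal ?h * (\<Sum>j<m. n2 (\<lambda>\<omega>. ?h * U j \<omega>))"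
      by (rule n2_dW_sum[OF h0 mh e]) (use U(1) in auto)
    also have "\<dots> = ennreal (?h * ?h\<^sup>2) * (\<Sum>j<m. n2 (U j))"
    proof -
      have "(\<Sum>j<m. n2 (\<lambda>\<omega>. ?h * U j \<omega>)) = ennreal (?h\<^sup>2) * (\<Sum>j<m. n2 (U j))"
        unfolding sum_distrib_left using UQ by (intro sum.cong refl n2_cmult) auto
      moreover have "ennreal (?h * ?h\<^sup>2) = ennreal ?h * ennreal (?h\<^sup>2)" using h0 by (intro ennreal_mult) auto
      ultimately show ?thesis by (simp only: mult.assoc)
    qed
    also have "\<dots> \<le> ennreal (?h * ?h\<^sup>2) * ennreal (real m * c)" by (intro mult_left_mono sumU) simp
    also have "\<dots> = ennreal ((real m * ?h) * (?h * ?h) * c)"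
      using h0 c t by (subst ennreal_mult[symmetric]) (auto simp: power2_eq_square algebra_simps)
    also have "\<dots> \<le> ennreal (1 * (?h * 1) * c)"
      using mh h1 h0 c by (intro ennreal_leI mult_right_mono mult_mono) auto
    also have "\<dots> \<le> ennreal (8 * c / real N)"
    proof (rule ennreal_leI)
      have "1 * (?h * 1) * c \<le> (1 / real N) * c" using hN c by (intro mult_right_mono) auto
      also have "\<dots> \<le> 8 * c / real N" using c N1 by (simp add: divide_right_mono)
      finally show "1 * (?h * 1) * c \<le> 8 * c / real N" .
    qed
    finally show ?thesis unfolding eq .
  next
    case 2
    have st: "real (Suc j) * ?h - real j * ?h = ?h" for j by (simp add: algebra_simps add_divide_distrib)
    have "n2 (\<lambda>\<omega>. \<Sum>j<m. U j \<omega> * (dW ?h a j \<omega> * dW ?h b j \<omega> - (if a = b \<and> a > 0 then 1 else 0) * ?h))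
       \<le> (\<Sum>j<m. ennreal (8 * ?h\<^sup>2) * n2 (U j))"
    proof (rule conjunct2[OF n2_orthogonal_sum[where \<sigma>="\<lambda>j. real j * ?h"]])
      fix j assume j: "j < m"
      have "centred (real j * ?h) (8 * (real (Suc j) * ?h - real j * ?h)\<^sup>2) (\<lambda>\<omega>. (W a (real (Suc j) * ?h) \<omega> - W a (real j * ?h) \<omega>)
         * (W b (real (Suc j) * ?h) \<omega> - W b (real j * ?h) \<omega>) - (if a = b then real (Suc j) * ?h - real j * ?h else 0))"
        by (rule centred_WW[OF mult_nonneg_nonneg[OF of_nat_0_le_iff less_imp_le[OF h0]] mult_strict_right_mono[OF _ h0] 2]) simp
      moreover have "(\<lambda>\<omega>. dW ?h a j \<omega> * dW ?h b j \<omega> - (if a = b \<and> a > 0 then 1 else 0) * ?h)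
        = (\<lambda>\<omega>. (W a (real (Suc j) * ?h) \<omega> - W a (real j * ?h) \<omega>)
         * (W b (real (Suc j) * ?h) \<omega> - W b (real j * ?h) \<omega>) - (if a = b then ?h else 0))"
        using 2 by (auto simp: dW_def fun_eq_iff)
      ultimately show "centred (real j * ?h) (8 * ?h\<^sup>2) (\<lambda>\<omega>. dW ?h a j \<omega> * dW ?h b j \<omega> - (if a = b \<and> a > 0 then 1 else 0) * ?h)"
        unfolding st by (simp only:)
      show "(\<lambda>\<omega>. dW ?h a j \<omega> * dW ?h b j \<omega> - (if a = b \<and> a > 0 then 1 else 0) * ?h) \<in> borel_measurable (F (real (Suc j) * ?h))"
        using dW_measurable[OF h0 ab(1)] dW_measurable[OF h0 ab(2)] by (intro borel_measurable_diff borel_measurable_times) auto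
      show "U j \<in> borel_measurable (F (real j * ?h))" by (rule U(1)[OF j])
      show "real j * ?h \<le> real (Suc j) * ?h" using h0 by (intro mult_right_mono) auto
    qed
    also have "\<dots> = ennreal (8 * ?h\<^sup>2) * (\<Sum>j<m. n2 (U j))" by (simp add: sum_distrib_left)
    also have "\<dots> \<le> ennreal (8 * ?h\<^sup>2) * ennreal (real m * c)" by (intro mult_left_mono sumU) simp
    also have "\<dots> = ennreal (8 * ((real m * ?h) * ?h * c))"
      using h0 c by (subst ennreal_mult[symmetric]) (auto simp: power2_eq_square algebra_simps)
    also have "\<dots> \<le> ennreal (8 * (1 * (1 / real N) * c))"
      using mh hN h0 c by (intro ennreal_leI mult_left_mono mult_right_mono mult_mono) auto
    finally show ?thesis by simp
  qed
qed

text \<open>Induction on the total length. \<open>perr_eq_sum\<close> writes the error as sums of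
  three errors of shorter pairs plus a compensated product; summation against increments preserves
  the order 1/N because the total length of the grid is at most 1.\<close>

lemma n2_perr:
  assumes t: "0 < t" "t \<le> 1"
  shows "set I \<subseteq> {0..d} \<Longrightarrow> set J \<subseteq> {0..d} \<Longrightarrow>
    \<exists>C\<ge>0. \<forall>N>0. \<forall>m\<le>N. n2 (perr (t / real N) I J m) \<le> ennreal (C / real N)"
proof (induction "length I + length J" arbitrary: I J rule: less_induct)
  case less
  show ?case
  proof (cases "I = [] \<or> J = []")
    case True
    then show ?thesis by (intro exI[of _ 0]) auto
  next
    case False
    then obtain I' a J' b where I: "I = I' @ [a]" and J: "J = J' @ [b]" by (metis rev_exhaust)
    have s: "set I' \<subseteq> {0..d}" "set J' \<subseteq> {0..d}" "a \<le> d" "b \<le> d" using less.prems I J by auto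
    obtain C1 where C1: "C1 \<ge> 0" "\<And>N m. N > 0 \<Longrightarrow> m \<le> N \<Longrightarrow> n2 (perr (t / real N) I' J m) \<le> ennreal (C1 / real N)"
      using less.hyps[of I' J] s less.prems I by auto
    obtain C2 where C2: "C2 \<ge> 0" "\<And>N m. N > 0 \<Longrightarrow> m \<le> N \<Longrightarrow> n2 (perr (t / real N) I J' m) \<le> ennreal (C2 / real N)"
      using less.hyps[of I J'] s less.prems J by auto
    obtain C3 where C3: "C3 \<ge> 0" "\<And>N m. N > 0 \<Longrightarrow> m \<le> N \<Longrightarrow> n2 (perr (t / real N) I' J' m) \<le> ennreal (C3 / real N)"
      using less.hyps[of I' J'] s I J by auto
    define c where "c = exp (mconst 2) ^ length I' + exp (mconst 2) ^ length J'"
    have c0: "0 \<le> c" by (simp add: c_def)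
    define r :: real where "r = (if a = b \<and> a > 0 then 1 else 0)"
    have "n2 (perr (t / real N) I J m) \<le> ennreal (4 * (C1 + C2 + C3 + 8 * c) / real N)" if N: "N > 0" and m: "m \<le> N" for N m
    proof -
      let ?h = "t / real N"
      have N1: "1 \<le> real N" using N by simp
      have h0: "?h > 0" using N t by simp
      have mh: "real m * ?h \<le> 1"
      proof -
        have "real m * ?h \<le> real N * ?h" using m h0 by (intro mult_right_mono) auto
        also have "\<dots> = t" using N by simp
        finally show ?thesis using t by simp
      qed
      have D: "n2 (\<lambda>\<omega>. \<Sum>j<m. V j \<omega> * dW ?h e j \<omega>) \<le> ennreal (C / real N)"
        if "e \<le> d" and C: "0 \<le> C" and V: "\<And>j. j < m \<Longrightarrow> V j \<in> borel_measurable (F (real j * ?h))"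
          "\<And>j. j < m \<Longrightarrow> n2 (V j) \<le> ennreal (C / real N)" for V e C
      proof -
        have "n2 (\<lambda>\<omega>. \<Sum>j<m. V j \<omega> * dW ?h e j \<omega>) \<le> ennreal ?h * (\<Sum>j<m. n2 (V j))"
          by (rule n2_dW_sum[OF h0 mh that(1) V(1)])
        also have "\<dots> \<le> ennreal ?h * (\<Sum>j<m. ennreal (C / real N))" using V(2) by (intro mult_left_mono sum_mono) auto
        also have "\<dots> = ennreal ((real m * ?h) * (C / real N))"
          using C h0 by (simp add: ennreal_of_nat_eq_real_of_nat flip: ennreal_mult) (simp add: mult_ac)
        also have "\<dots> \<le> ennreal (1 * (C / real N))" using mh C by (intro ennreal_leI mult_right_mono) auto
        finally show ?thesis by simp
      qed
      let ?A1 = "\<lambda>\<omega>. \<Sum>j<m. perr ?h I' J j \<omega> * dW ?h a j \<omega>"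
      let ?A2 = "\<lambda>\<omega>. \<Sum>j<m. perr ?h I J' j \<omega> * dW ?h b j \<omega>"
      let ?A3 = "\<lambda>\<omega>. \<Sum>j<m. r * perr ?h I' J' j \<omega> * dW ?h 0 j \<omega>"
      let ?A4 = "\<lambda>\<omega>. \<Sum>j<m. sig ?h I' j \<omega> * sig ?h J' j \<omega> * (dW ?h a j \<omega> * dW ?h b j \<omega> - r * ?h)"
      have 1: "n2 ?A1 \<le> ennreal (C1 / real N)"
        by (rule D[OF s(3) C1(1) perr_measurable[OF h0 s(1) less.prems(2)] C1(2)[OF N]]) (use m in auto)
      have 2: "n2 ?A2 \<le> ennreal (C2 / real N)"
        by (rule D[OF s(4) C2(1) perr_measurable[OF h0 less.prems(1) s(2)] C2(2)[OF N]]) (use m in auto)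
      have 3: "n2 ?A3 \<le> ennreal (C3 / real N)"
      proof (rule D[OF _ C3(1)])
        fix j assume j: "j < m"
        show "(\<lambda>\<omega>. r * perr ?h I' J' j \<omega>) \<in> borel_measurable (F (real j * ?h))"
          using perr_measurable[OF h0 s(1,2)] by (intro borel_measurable_times) auto
        have "n2 (\<lambda>\<omega>. r * perr ?h I' J' j \<omega>) \<le> n2 (perr ?h I' J' j)"
          by (intro nn_integral_mono ennreal_leI) (auto simp: r_def)
        also have "\<dots> \<le> ennreal (C3 / real N)" using C3(2)[OF N] j m by auto
        finally show "n2 (\<lambda>\<omega>. r * perr ?h I' J' j \<omega>) \<le> ennreal (C3 / real N)" .
      qed simp
      have 4: "n2 ?A4 \<le> ennreal (8 * c / real N)"
        unfolding r_def
      proof (rule n2_dW_dW_sum[OF N t s(3,4) m c0])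
        fix j assume j: "j < m"
        show "(\<lambda>\<omega>. sig ?h I' j \<omega> * sig ?h J' j \<omega>) \<in> borel_measurable (F (real j * ?h))"
          using sig_measurable[OF h0] s by (intro borel_measurable_times) auto
        show "n2 (\<lambda>\<omega>. sig ?h I' j \<omega> * sig ?h J' j \<omega>) \<le> ennreal c"
          unfolding c_def using j m by (intro n2_sig_sig[OF N t s(1,2)]) auto
      qed
      have mQ: "?A1 \<in> borel_measurable Q" "?A2 \<in> borel_measurable Q" "?A3 \<in> borel_measurable Q" "?A4 \<in> borel_measurable Q"
        using s less.prems measurable_F_Q[OF perr_measurable[OF h0]] measurable_F_Q[OF dW_measurable[OF h0]] sig_measurable_Q[OF h0]
        by (auto intro!: borel_measurable_sum borel_measurable_times borel_measurable_diff)
      have eq: "perr ?h I J m \<omega> = ?A1 \<omega> + ?A2 \<omega> + ?A3 \<omega> + ?A4 \<omega>" for \<omega>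
        using perr_eq_sum[of I' a J' b ?h m \<omega>] less.prems unfolding I J r_def by simp
      have pt: "(x1 + x2 + x3 + x4)\<^sup>2 \<le> 4 * (x1\<^sup>2 + x2\<^sup>2 + x3\<^sup>2 + x4\<^sup>2)" for x1 x2 x3 x4 :: real
        using zero_le_power2[of "x1 - x2"] zero_le_power2[of "x1 - x3"] zero_le_power2[of "x1 - x4"]
          zero_le_power2[of "x2 - x3"] zero_le_power2[of "x2 - x4"] zero_le_power2[of "x3 - x4"]
        by (simp add: power2_eq_square algebra_simps)
      have "n2 (perr ?h I J m) \<le> (\<integral>\<^sup>+\<omega>. ennreal 4 * (ennreal ((?A1 \<omega>)\<^sup>2) + ennreal ((?A2 \<omega>)\<^sup>2) + ennreal ((?A3 \<omega>)\<^sup>2) + ennreal ((?A4 \<omega>)\<^sup>2)) \<partial>Q)"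
      proof (intro nn_integral_mono)
        fix \<omega>
        have "ennreal ((perr ?h I J m \<omega>)\<^sup>2) \<le> ennreal (4 * ((?A1 \<omega>)\<^sup>2 + (?A2 \<omega>)\<^sup>2 + (?A3 \<omega>)\<^sup>2 + (?A4 \<omega>)\<^sup>2))"
          unfolding eq by (rule ennreal_leI[OF pt])
        also have "\<dots> = ennreal 4 * (ennreal ((?A1 \<omega>)\<^sup>2) + ennreal ((?A2 \<omega>)\<^sup>2) + ennreal ((?A3 \<omega>)\<^sup>2) + ennreal ((?A4 \<omega>)\<^sup>2))"
          by (subst ennreal_mult) (simp_all add: ennreal_plus)
        finally show "ennreal ((perr ?h I J m \<omega>)\<^sup>2) \<le> ennreal 4 * (ennreal ((?A1 \<omega>)\<^sup>2) + ennreal ((?A2 \<omega>)\<^sup>2) + ennreal ((?A3 \<omega>)\<^sup>2) + ennreal ((?A4 \<omega>)\<^sup>2))" .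
      qed
      also have "\<dots> = ennreal 4 * (n2 ?A1 + n2 ?A2 + n2 ?A3 + n2 ?A4)"
        using mQ by (simp add: nn_integral_cmult nn_integral_add)
      also have "\<dots> \<le> ennreal 4 * (ennreal (C1 / real N) + ennreal (C2 / real N) + ennreal (C3 / real N) + ennreal (8 * c / real N))"
        by (intro mult_left_mono add_mono 1 2 3 4) simp
      also have "\<dots> = ennreal (4 * (C1 / real N + C2 / real N + C3 / real N + 8 * c / real N))"
        using C1(1) C2(1) C3(1) c0 by (subst ennreal_mult) (auto simp: ennreal_plus)
      also have "\<dots> = ennreal (4 * (C1 + C2 + C3 + 8 * c) / real N)" by (simp add: add_divide_distrib)
      finally show ?thesis .
    qed
    then show ?thesis using C1(1) C2(1) C3(1) c0 by (intro exI[of _ "4 * (C1 + C2 + C3 + 8 * c)"]) auto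
  qed
qed

section \<open>Expectations of words\<close>

lemma sig_replicate_0: "sig h (replicate l 0) m \<omega> = real (m choose l) * h ^ l"
proof (induction l arbitrary: m)
  case (Suc l)
  have r: "replicate (Suc l) 0 = replicate l (0::nat) @ [0]" by (simp add: replicate_append_same)
  have "sig h (replicate (Suc l) 0) m \<omega> = (\<Sum>j<m. real (j choose l)) * h ^ Suc l"
    unfolding r sig_snoc Suc by (simp add: dW_def sum_distrib_left mult_ac)
  \<comment> \<open>The hockey-stick identity; the binomial coefficient is the discrete counterpart
    of the iterated time integral.\<close>
  also have "(\<Sum>j<m. real (j choose l)) = real (m choose Suc l)"
    by (induction m) auto
  finally show ?case .
qed simp

text \<open>A final Brownian letter makes every summand centred; a final 0 only multiplies by h and
  passes to the prefix, so any Brownian letter is eventually met. The weight g stands for random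
  coefficients known at time 0.\<close>

lemma expectation_sig_zero:
  assumes N: "N > 0" and t: "0 < t" "t \<le> 1" and h: "h = t / real N"
    and g: "g \<in> borel_measurable (F 0)" "\<And>\<omega>. \<omega> \<in> space Q \<Longrightarrow> \<bar>g \<omega>\<bar> \<le> b"
  shows "set K \<subseteq> {0..d} \<Longrightarrow> m \<le> N \<Longrightarrow> integrable Q (\<lambda>\<omega>. g \<omega> * sig h K m \<omega>) \<and>
     (K \<noteq> replicate (length K) 0 \<longrightarrow> (\<integral>\<omega>. g \<omega> * sig h K m \<omega> \<partial>Q) = 0)"
proof (induction K arbitrary: m rule: rev_induct)
  case Nil
  have "integrable Q g"
    by (rule integrable_const_bound[where B=b]) (use g measurable_F_Q[OF g(1)] in auto)
  then show ?case by simp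
next
  case (snoc a K)
  have h0: "0 < h" using t N h by simp
  have K: "set K \<subseteq> {0..d}" "a \<le> d" using snoc.prems by auto
  have gm: "(\<lambda>\<omega>. g \<omega> * sig h K j \<omega>) \<in> borel_measurable (F (real j * h))" for j
    using measurable_F_mono[OF g(1), of "real j * h"] sig_measurable[OF h0 K(1), of j] h0 by (intro borel_measurable_times) auto
  have eq: "g \<omega> * sig h (K @ [a]) m \<omega> = (\<Sum>j<m. g \<omega> * sig h K j \<omega> * dW h a j \<omega>)" for \<omega>
    by (simp add: sig_snoc sum_distrib_left mult.assoc)
  have IH: "integrable Q (\<lambda>\<omega>. g \<omega> * sig h K j \<omega>)"
     "K \<noteq> replicate (length K) 0 \<Longrightarrow> (\<integral>\<omega>. g \<omega> * sig h K j \<omega> \<partial>Q) = 0" if "j < m" for j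
    using snoc.IH[OF K(1), of j] that snoc.prems by auto
  show ?case
  proof (cases "a = 0")
    case True
    have "K \<noteq> replicate (length K) 0" if "K @ [a] \<noteq> replicate (length (K @ [a])) 0"
      using that True by (metis length_append_singleton replicate_Suc replicate_append_same)
    then show ?thesis unfolding eq using IH True by (auto simp: dW_def)
  next
    case False
    then have a: "a \<in> {1..d}" using K by auto
    have "integrable Q (\<lambda>\<omega>. g \<omega> * sig h K j \<omega> * dW h a j \<omega>) \<and> (\<integral>\<omega>. g \<omega> * sig h K j \<omega> * dW h a j \<omega> \<partial>Q) = 0" if "j < m" for j
      using centred_dW[OF h0 a, of j] gm[of j] IH(1)[OF that] unfolding centred_def by blast
    then show ?thesis unfolding eq by auto
  qed
qed

end

text \<open>The value of the word of l zeros at the last grid point, in the limit of vanishing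
  mesh.\<close>

lemma choose_scaled_tendsto:
  "(\<lambda>N. real (N choose l) * (t / real N) ^ l) \<longlonglongrightarrow> t ^ l / fact l"
proof -
  have "(\<lambda>N. (\<Prod>i<l. (1 - real i / real N) * t) / fact l) \<longlonglongrightarrow> (\<Prod>i<l. (1 - 0) * t) / fact l"
    by (intro tendsto_intros lim_const_over_n) auto
  moreover have "eventually (\<lambda>N. (\<Prod>i<l. (1 - real i / real N) * t) / fact l = real (N choose l) * (t / real N) ^ l) sequentially"
    using eventually_gt_at_top[of 0]
  proof eventually_elim
    case (elim N)
    have "real (N choose l) = (\<Prod>i<l. real N - real i) / fact l"
      by (simp add: binomial_gbinomial gbinomial_prod_rev atLeast0LessThan)
    moreover have "(\<Prod>i<l. (1 - real i / real N) * t) = (\<Prod>i<l. (real N - real i) * (t / real N))"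
      using elim by (intro prod.cong refl) (simp add: field_simps)
    moreover have "\<dots> = (\<Prod>i<l. real N - real i) * (t / real N) ^ l"
      by (simp only: prod.distrib prod_constant card_lessThan)
    ultimately show ?case by simp
  qed
  ultimately show ?thesis by (simp cong: filterlim_cong)
qed

section \<open>Integrated L2-distances\<close>

context brownian begin

definition What :: "nat \<Rightarrow> real \<Rightarrow> 'a \<Rightarrow> real" where
  "What a u \<omega> = (if a = 0 then u else W a u \<omega>)"

lemma dW_What: "dW h a j \<omega> = What a (real (Suc j) * h) \<omega> - What a (real j * h) \<omega>"
  by (simp add: dW_def What_def algebra_simps)

text \<open>Fubini. The bound is required for u > s only, since the intervals of a simple process
  are open on the left and its value at s can be wrong; a single point is negligible.\<close>

lemma l2_dist_integral_le:
  assumes H: "progressive F H" and G: "simple_adapted F m \<sigma> \<xi>" and st: "0 \<le> s" "s \<le> t" and b: "0 \<le> b"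
    and le: "\<And>u. s < u \<Longrightarrow> u \<le> t \<Longrightarrow> n2 (\<lambda>\<omega>. H u \<omega> - simple_val m \<sigma> \<xi> u \<omega>) \<le> ennreal b"
  shows "(\<integral>\<^sup>+\<omega>. l2_dist s t H (simple_val m \<sigma> \<xi>) \<omega> \<partial>Q) \<le> ennreal (b * (t - s))"
proof -
  have t: "0 \<le> t" using st by simp
  interpret P: pair_sigma_finite Q lborel ..
  let ?f = "\<lambda>\<omega> u. ennreal ((H (max 0 (min u t)) \<omega> - simple_val m \<sigma> \<xi> u \<omega>)\<^sup>2) * indicator {s..t} u"
  note [measurable] = progressive_measurable[OF H t] simple_val_measurable[OF G]
  have m: "(\<lambda>p. ?f (fst p) (snd p)) \<in> borel_measurable (Q \<Otimes>\<^sub>M lborel)" by measurable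
  have "(\<integral>\<^sup>+\<omega>. l2_dist s t H (simple_val m \<sigma> \<xi>) \<omega> \<partial>Q) = (\<integral>\<^sup>+\<omega>. \<integral>\<^sup>+u. ?f \<omega> u \<partial>lborel \<partial>Q)"
    using l2_dist_clip[OF st] by simp
  also have "\<dots> = (\<integral>\<^sup>+u. \<integral>\<^sup>+\<omega>. ?f \<omega> u \<partial>Q \<partial>lborel)"
    using P.Fubini[of "\<lambda>p. ?f (fst p) (snd p)"] m by simp
  also have "\<dots> \<le> (\<integral>\<^sup>+u. ennreal b * indicator {s..t} u \<partial>lborel)"
  proof (rule nn_integral_mono_AE)
    show "AE u in lborel. (\<integral>\<^sup>+\<omega>. ?f \<omega> u \<partial>Q) \<le> ennreal b * indicator {s..t} u"
      using AE_lborel_singleton[of s]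
    proof eventually_elim
      case (elim u)
      show ?case
      proof (cases "u \<in> {s..t}")
        case True
        then have "s < u" "u \<le> t" "max 0 (min u t) = u" using elim st by auto
        then show ?thesis using le[of u] True by simp
      qed simp
    qed
  qed
  also have "\<dots> = ennreal (b * (t - s))" using st b by (simp add: nn_integral_cmult ennreal_mult)
  finally show ?thesis .
qed

lemma n2_add_le:
  assumes [measurable]: "f \<in> borel_measurable Q" "g \<in> borel_measurable Q"
  shows "n2 (\<lambda>\<omega>. f \<omega> + g \<omega>) \<le> 2 * n2 f + 2 * n2 g"
proof -
  have "n2 (\<lambda>\<omega>. f \<omega> + g \<omega>) \<le> (\<integral>\<^sup>+\<omega>. 2 * ennreal ((f \<omega>)\<^sup>2) + 2 * ennreal ((g \<omega>)\<^sup>2) \<partial>Q)"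
  proof (rule nn_integral_mono)
    fix \<omega>
    have "(f \<omega> + g \<omega>)\<^sup>2 \<le> 2 * (f \<omega>)\<^sup>2 + 2 * (g \<omega>)\<^sup>2"
      using zero_le_power2[of "f \<omega> - g \<omega>"] by (simp add: power2_eq_square algebra_simps)
    then have "ennreal ((f \<omega> + g \<omega>)\<^sup>2) \<le> ennreal (2 * (f \<omega>)\<^sup>2 + 2 * (g \<omega>)\<^sup>2)" by (rule ennreal_leI)
    then show "ennreal ((f \<omega> + g \<omega>)\<^sup>2) \<le> 2 * ennreal ((f \<omega>)\<^sup>2) + 2 * ennreal ((g \<omega>)\<^sup>2)"
      by (simp add: ennreal_plus ennreal_mult)
  qed
  then show ?thesis by (simp add: nn_integral_add nn_integral_cmult)
qed

end

section \<open>Expansion of the process and of its expectation\<close>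

text \<open>In \<open>incr_c\<close>, \<open>Z a\<close> stands for the integral of \<open>c (a # J)\<close> over \<open>[s, t]\<close>. The only property of
  the stochastic integral ever used is its \<open>L\<^sup>2\<close>-distance to the integrals of simple processes; in this
  form it passes to the conditioned measures.\<close>

locale differentiable_process = brownian Q F W d
  for Q :: "'a measure" and F W d +
  fixes n :: nat and c :: "nat list \<Rightarrow> real \<Rightarrow> 'a \<Rightarrow> real" and \<delta> K :: real
  assumes delta: "0 < \<delta>" "\<delta> \<le> 1" and K: "1 \<le> K"
    and prog: "\<And>a J. length J \<le> n \<Longrightarrow> set J \<subseteq> {0..d} \<Longrightarrow> a \<le> d \<Longrightarrow> progressive F (c (a # J))"
    and X_adapted: "\<And>t. 0 \<le> t \<Longrightarrow> c [] t \<in> borel_measurable (F t)"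
    and incr_c: "\<And>J s t. length J \<le> n \<Longrightarrow> set J \<subseteq> {0..d} \<Longrightarrow> 0 \<le> s \<Longrightarrow> s \<le> t \<Longrightarrow> t \<le> \<delta> \<Longrightarrow>
      \<exists>Z. (\<forall>a\<le>d. Z a \<in> borel_measurable Q \<and> (\<forall>m \<sigma> \<xi>. simple_adapted F m \<sigma> \<xi> \<longrightarrow>
            n2 (\<lambda>\<omega>. Z a \<omega> - (simple_int (What a) m \<sigma> \<xi> t \<omega> - simple_int (What a) m \<sigma> \<xi> s \<omega>))
            \<le> (\<integral>\<^sup>+\<omega>. l2_dist s t (c (a # J)) (simple_val m \<sigma> \<xi>) \<omega> \<partial>Q))) \<and>
        (AE \<omega> in Q. c J t \<omega> - c J s \<omega> = (\<Sum>a\<le>d. Z a \<omega>))"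
    and initial_bound: "\<And>I. length I \<le> n \<Longrightarrow> set I \<subseteq> {0..d} \<Longrightarrow> AE \<omega> in Q. \<bar>c I 0 \<omega>\<bar> \<le> K"
    and top_moment: "\<And>I t. length I = Suc n \<Longrightarrow> set I \<subseteq> {0..d} \<Longrightarrow> 0 \<le> t \<Longrightarrow> t \<le> \<delta> \<Longrightarrow> n2 (c I t) \<le> ennreal K"

\<comment> \<open>Moments and increments of the coefficient processes\<close>
begin

lemma c_adapted:
  assumes "length J \<le> Suc n" "set J \<subseteq> {0..d}" "0 \<le> t"
  shows "c J t \<in> borel_measurable (F t)"
proof (cases J)
  case Nil then show ?thesis using X_adapted assms by simp
next
  case (Cons a J') then show ?thesis using assms by (auto intro!: progressive_section prog)
qed

lemma c_measurable: "length J \<le> Suc n \<Longrightarrow> set J \<subseteq> {0..d} \<Longrightarrow> 0 \<le> t \<Longrightarrow> c J t \<in> borel_measurable Q"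
  by (rule measurable_F_Q[OF c_adapted])

text \<open>Comparison with the zero simple process bounds each integral by b (t - s). Of the two
  factors d + 1, one comes from Cauchy-Schwarz for the sum over letters and one from the number of
  its terms.\<close>

lemma increment_le:
  assumes J: "length J \<le> n" "set J \<subseteq> {0..d}" and st: "0 \<le> s" "s \<le> t" "t \<le> \<delta>" and b: "0 \<le> b"
    and le: "\<And>a u. a \<le> d \<Longrightarrow> 0 \<le> u \<Longrightarrow> u \<le> \<delta> \<Longrightarrow> n2 (c (a # J) u) \<le> ennreal b"
  shows "n2 (\<lambda>\<omega>. c J t \<omega> - c J s \<omega>) \<le> ennreal (real (Suc d) * real (Suc d) * b * (t - s))"
proof -
  obtain Z where Z: "\<And>a. a \<le> d \<Longrightarrow> Z a \<in> borel_measurable Q"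
    "\<And>a m \<sigma> \<xi>. a \<le> d \<Longrightarrow> simple_adapted F m \<sigma> \<xi> \<Longrightarrow>
            n2 (\<lambda>\<omega>. Z a \<omega> - (simple_int (What a) m \<sigma> \<xi> t \<omega> - simple_int (What a) m \<sigma> \<xi> s \<omega>))
            \<le> (\<integral>\<^sup>+\<omega>. l2_dist s t (c (a # J)) (simple_val m \<sigma> \<xi>) \<omega> \<partial>Q)"
    "AE \<omega> in Q. c J t \<omega> - c J s \<omega> = (\<Sum>a\<le>d. Z a \<omega>)"
    using incr_c[OF J st] by blast
  have G: "simple_adapted F 0 (\<lambda>_. 0) \<xi>" for \<xi> by (simp add: simple_adapted_def)
  have Za: "n2 (Z a) \<le> ennreal (b * (t - s))" if a: "a \<le> d" for a
  proof -
    have "n2 (Z a) \<le> (\<integral>\<^sup>+\<omega>. l2_dist s t (c (a # J)) (simple_val 0 (\<lambda>_. 0) (\<lambda>_ _. 0)) \<omega> \<partial>Q)"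
      using Z(2)[OF a G, of "\<lambda>_ _. 0"] by (simp add: simple_int_def)
    also have "\<dots> \<le> ennreal (b * (t - s))"
      by (rule l2_dist_integral_le[OF prog[OF J a] G st(1,2) b]) (use le[OF a] st in \<open>simp add: simple_val_def\<close>)
    finally show ?thesis .
  qed
  have "n2 (\<lambda>\<omega>. c J t \<omega> - c J s \<omega>) = n2 (\<lambda>\<omega>. \<Sum>a\<le>d. Z a \<omega>)"
    using Z(3) by (intro nn_integral_cong_AE) auto
  also have "\<dots> \<le> ennreal (real (card {..d})) * (\<Sum>a\<le>d. n2 (Z a))"
    using Z(1) by (intro n2_sum_le) auto
  also have "\<dots> \<le> ennreal (real (Suc d)) * (\<Sum>a\<le>d. ennreal (b * (t - s)))"
    using Za by (intro mult_mono sum_mono) auto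
  also have "\<dots> = ennreal (real (Suc d)) * ennreal (real (Suc d) * (b * (t - s)))"
    using b st by (subst sum_ennreal) auto
  also have "\<dots> = ennreal (real (Suc d) * (real (Suc d) * (b * (t - s))))"
    using b st by (intro ennreal_mult[symmetric]) auto
  finally show ?thesis by (simp only: mult.assoc)
qed

text \<open>Descent from the top words, the only ones with an assumed moment bound: r is the number
  of letters missing to length n + 1. A shorter word is its initial value, bounded by K, plus
  integrals of words with one more letter.\<close>

lemma second_moment_bound:
  "\<exists>b\<ge>0. \<forall>J t. length J + r = Suc n \<longrightarrow> set J \<subseteq> {0..d} \<longrightarrow> 0 \<le> t \<longrightarrow> t \<le> \<delta> \<longrightarrow> n2 (c J t) \<le> ennreal b"
proof (induction r)
  case 0
  then show ?case using top_moment K by (intro exI[of _ K]) auto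
next
  case (Suc r)
  then obtain b where b: "b \<ge> 0" "\<And>J t. length J + r = Suc n \<Longrightarrow> set J \<subseteq> {0..d} \<Longrightarrow> 0 \<le> t \<Longrightarrow> t \<le> \<delta> \<Longrightarrow> n2 (c J t) \<le> ennreal b"
    by blast
  define b' where "b' = 2 * (real (Suc d) * real (Suc d) * b) + 2 * K\<^sup>2"
  have "n2 (c J t) \<le> ennreal b'" if J: "length J + Suc r = Suc n" "set J \<subseteq> {0..d}" and t: "0 \<le> t" "t \<le> \<delta>" for J t
  proof -
    have J': "length J \<le> n" using J by simp
    have "n2 (\<lambda>\<omega>. c J t \<omega> - c J 0 \<omega>) \<le> ennreal (real (Suc d) * real (Suc d) * b * (t - 0))"
      by (rule increment_le[OF J' J(2)]) (use b t J in auto)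
    also have "\<dots> \<le> ennreal (real (Suc d) * real (Suc d) * b)"
      using t delta b by (intro ennreal_leI mult_left_le) auto
    finally have 1: "n2 (\<lambda>\<omega>. c J t \<omega> - c J 0 \<omega>) \<le> ennreal (real (Suc d) * real (Suc d) * b)" .
    have "n2 (c J 0) \<le> (\<integral>\<^sup>+\<omega>. ennreal (K\<^sup>2) \<partial>Q)"
    proof (rule nn_integral_mono_AE)
      show "AE \<omega> in Q. ennreal ((c J 0 \<omega>)\<^sup>2) \<le> ennreal (K\<^sup>2)"
        using initial_bound[OF J' J(2)]
      proof eventually_elim
        case (elim \<omega>)
        then have "\<bar>c J 0 \<omega>\<bar>\<^sup>2 \<le> K\<^sup>2" by (intro power_mono) auto
        then show ?case by (intro ennreal_leI) simp
      qed
    qed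
    then have 2: "n2 (c J 0) \<le> ennreal (K\<^sup>2)" by (simp add: emeasure_space_1)
    have "n2 (c J t) = n2 (\<lambda>\<omega>. (c J t \<omega> - c J 0 \<omega>) + c J 0 \<omega>)" by simp
    also have "\<dots> \<le> 2 * n2 (\<lambda>\<omega>. c J t \<omega> - c J 0 \<omega>) + 2 * n2 (c J 0)"
      using c_measurable[of J] J J' t by (intro n2_add_le borel_measurable_diff) auto
    also have "\<dots> \<le> 2 * ennreal (real (Suc d) * real (Suc d) * b) + 2 * ennreal (K\<^sup>2)"
      using 1 2 by (intro add_mono mult_left_mono) auto
    also have "\<dots> = ennreal b'"
      unfolding b'_def using b by (subst ennreal_plus) (auto simp: ennreal_mult)
    finally show ?thesis .
  qed
  moreover have "b' \<ge> 0" using b by (simp add: b'_def)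
  ultimately show ?case by blast
qed

lemma hoelder:
  assumes J: "length J \<le> n" "set J \<subseteq> {0..d}"
  shows "\<exists>C\<ge>0. \<forall>s t. 0 \<le> s \<longrightarrow> s \<le> t \<longrightarrow> t \<le> \<delta> \<longrightarrow> n2 (\<lambda>\<omega>. c J t \<omega> - c J s \<omega>) \<le> ennreal (C * (t - s))"
proof -
  have "length J + Suc (n - length J) = Suc n" using J by simp
  then obtain b where b: "b \<ge> 0" "\<And>a t. a \<le> d \<Longrightarrow> 0 \<le> t \<Longrightarrow> t \<le> \<delta> \<Longrightarrow> n2 (c (a # J) t) \<le> ennreal b"
    using second_moment_bound[of "n - length J"] J by fastforce
  then show ?thesis
    using increment_le[OF J _ _ _ b(1) b(2)] by (intro exI[of _ "real (Suc d) * real (Suc d) * b"]) auto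
qed

text \<open>The values of \<open>c (a # J)\<close> at the grid points form a simple process, to
  which the isometry applies directly; its L2-distance to the integrand is of order h. The length of
  J is strictly below n because the increments of \<open>c (a # J)\<close> must be controlled as
  well.\<close>

lemma riemann_error:
  assumes J: "length J < n" "set J \<subseteq> {0..d}" and t: "0 < t" "t \<le> \<delta>"
  shows "\<exists>C\<ge>0. \<forall>N>0. \<forall>k\<le>N. n2 (\<lambda>\<omega>. c J (real k * (t / real N)) \<omega> - c J 0 \<omega>
      - (\<Sum>a\<le>d. \<Sum>j<k. c (a # J) (real j * (t / real N)) \<omega> * dW (t / real N) a j \<omega>)) \<le> ennreal (C / real N)"
proof -
  have "\<forall>a. \<exists>C\<ge>0. a \<le> d \<longrightarrow> (\<forall>s t. 0 \<le> s \<longrightarrow> s \<le> t \<longrightarrow> t \<le> \<delta> \<longrightarrow> n2 (\<lambda>\<omega>. c (a # J) t \<omega> - c (a # J) s \<omega>) \<le> ennreal (C * (t - s)))"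
  proof
    fix a show "\<exists>C\<ge>0. a \<le> d \<longrightarrow> (\<forall>s t. 0 \<le> s \<longrightarrow> s \<le> t \<longrightarrow> t \<le> \<delta> \<longrightarrow> n2 (\<lambda>\<omega>. c (a # J) t \<omega> - c (a # J) s \<omega>) \<le> ennreal (C * (t - s)))"
      using hoelder[of "a # J"] J by (cases "a \<le> d") (auto intro: exI[of _ 0])
  qed
  then obtain C where C: "\<And>a. C a \<ge> 0"
    "\<And>a s t. a \<le> d \<Longrightarrow> 0 \<le> s \<Longrightarrow> s \<le> t \<Longrightarrow> t \<le> \<delta> \<Longrightarrow> n2 (\<lambda>\<omega>. c (a # J) t \<omega> - c (a # J) s \<omega>) \<le> ennreal (C a * (t - s))"
    by metis
  have "n2 (\<lambda>\<omega>. c J (real k * (t / real N)) \<omega> - c J 0 \<omega>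
      - (\<Sum>a\<le>d. \<Sum>j<k. c (a # J) (real j * (t / real N)) \<omega> * dW (t / real N) a j \<omega>)) \<le> ennreal (real (Suc d) * (\<Sum>a\<le>d. C a) / real N)"
    if N: "N > 0" and k: "k \<le> N" for N k
  proof -
    define h where "h = t / real N"
    define \<tau> where "\<tau> = real k * h"
    have h0: "h > 0" using N t by (simp add: h_def)
    have hN: "h \<le> 1 / real N" unfolding h_def using t delta by (intro divide_right_mono) auto
    have "\<tau> \<le> real N * h" unfolding \<tau>_def using k h0 by (intro mult_right_mono) auto
    then have \<tau>: "0 \<le> \<tau>" "\<tau> \<le> t" using N h0 t by (auto simp: \<tau>_def h_def)
    have J': "length J \<le> n" using J by simp
    obtain Z where Z: "\<And>a. a \<le> d \<Longrightarrow> Z a \<in> borel_measurable Q"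
      "\<And>a m \<sigma> \<xi>. a \<le> d \<Longrightarrow> simple_adapted F m \<sigma> \<xi> \<Longrightarrow>
              n2 (\<lambda>\<omega>. Z a \<omega> - (simple_int (What a) m \<sigma> \<xi> \<tau> \<omega> - simple_int (What a) m \<sigma> \<xi> 0 \<omega>))
              \<le> (\<integral>\<^sup>+\<omega>. l2_dist 0 \<tau> (c (a # J)) (simple_val m \<sigma> \<xi>) \<omega> \<partial>Q)"
      "AE \<omega> in Q. c J \<tau> \<omega> - c J 0 \<omega> = (\<Sum>a\<le>d. Z a \<omega>)"
      using incr_c[OF J' J(2) order.refl \<tau>(1)] \<tau> t by force
    define R where "R a \<omega> = Z a \<omega> - (\<Sum>j<k. c (a # J) (real j * h) \<omega> * dW h a j \<omega>)" for a \<omega>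
    have Rm: "R a \<in> borel_measurable Q" if a: "a \<le> d" for a
      unfolding R_def[abs_def] using Z(1)[OF a] c_measurable[of "a # J"] J a h0 measurable_F_Q[OF dW_measurable[OF h0 a]]
      by (intro borel_measurable_diff borel_measurable_sum borel_measurable_times) auto
    have Rn: "n2 (R a) \<le> ennreal (C a / real N)" if a: "a \<le> d" for a
    proof -
      let ?\<sigma> = "\<lambda>j. real j * h" and ?\<xi> = "\<lambda>j. c (a # J) (real j * h)"
      have G: "simple_adapted F k ?\<sigma> ?\<xi>"
        unfolding simple_adapted_def using h0 J a by (auto intro!: c_adapted)
      have i0: "simple_int (What a) k ?\<sigma> ?\<xi> 0 \<omega> = 0" for \<omega>
      proof -
        have "min (real j * h) 0 = 0" for j using h0 by simp
        then show ?thesis unfolding simple_int_def by (simp del: of_nat_Suc)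
      qed
      have i1: "simple_int (What a) k ?\<sigma> ?\<xi> \<tau> \<omega> = (\<Sum>j<k. c (a # J) (real j * h) \<omega> * dW h a j \<omega>)" for \<omega>
        unfolding simple_int_def dW_What
      proof (intro sum.cong refl)
        fix j assume "j \<in> {..<k}"
        then have "real (Suc j) * h \<le> \<tau>" "real j * h \<le> \<tau>" unfolding \<tau>_def using h0 by (auto intro!: mult_right_mono)
        then show "c (a # J) (real j * h) \<omega> * (What a (min (real (Suc j) * h) \<tau>) \<omega> - What a (min (real j * h) \<tau>) \<omega>)
          = c (a # J) (real j * h) \<omega> * (What a (real (Suc j) * h) \<omega> - What a (real j * h) \<omega>)"
          by (simp add: min_absorb1)
      qed
      have "n2 (R a) \<le> (\<integral>\<^sup>+\<omega>. l2_dist 0 \<tau> (c (a # J)) (simple_val k ?\<sigma> ?\<xi>) \<omega> \<partial>Q)"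
        using Z(2)[OF a G] unfolding i0 i1 R_def by simp
      also have "\<dots> \<le> ennreal (C a * h * (\<tau> - 0))"
      proof (rule l2_dist_integral_le[OF prog[OF J' J(2) a] G order.refl \<tau>(1)])
        show "0 \<le> C a * h" using C(1) h0 by simp
        fix u assume u: "0 < u" "u \<le> \<tau>"
        \<comment> \<open>The cell containing u: cells are open on the left, so a grid point belongs
          to the cell ending there, and the ceiling is lowered by one.\<close>
        define j where "j = nat (\<lceil>u / h\<rceil> - 1)"
        have "0 < u / h" using u h0 by simp
        then have ceil: "1 \<le> \<lceil>u / h\<rceil>" by linarith
        have rj: "real j = real_of_int \<lceil>u / h\<rceil> - 1" using ceil by (simp add: j_def)
        have "real j < u / h" "u / h \<le> real (Suc j)" using rj by linarith+
        then have uj: "real j * h < u" "u \<le> real (Suc j) * h" using h0 by (simp_all add: field_simps)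
        have "real j * h < real k * h" using uj(1) u(2) by (simp add: \<tau>_def)
        then have jk: "j < k" using h0 by simp
        have ind: "indicator {real i * h<..real (Suc i) * h} u = (if i = j then 1 else (0::real))" for i
        proof (cases "i = j")
          case True then show ?thesis using uj by simp
        next
          case False
          then consider "Suc i \<le> j" | "Suc j \<le> i" by linarith
          then have "u \<notin> {real i * h<..real (Suc i) * h}"
          proof cases
            case 1
            then have "real (Suc i) * h \<le> real j * h" using h0 by (intro mult_right_mono) auto
            then show ?thesis using uj by auto
          next
            case 2
            then have "real (Suc j) * h \<le> real i * h" using h0 by (intro mult_right_mono) auto
            then show ?thesis using uj by auto
          qed
          then show ?thesis using False by simp
        qed
        have "simple_val k ?\<sigma> ?\<xi> u \<omega> = (\<Sum>i<k. if i = j then c (a # J) (real j * h) \<omega> else 0)" for \<omega>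
          unfolding simple_val_def ind by (intro sum.cong) auto
        then have sv: "simple_val k ?\<sigma> ?\<xi> u \<omega> = c (a # J) (real j * h) \<omega>" for \<omega> using jk by simp
        have "n2 (\<lambda>\<omega>. c (a # J) u \<omega> - c (a # J) (real j * h) \<omega>) \<le> ennreal (C a * (u - real j * h))"
          using uj u \<tau> t h0 by (intro C(2)[OF a]) auto
        also have "\<dots> \<le> ennreal (C a * h)" using uj C(1)[of a] by (intro ennreal_leI mult_left_mono) (auto simp: algebra_simps)
        finally show "n2 (\<lambda>\<omega>. c (a # J) u \<omega> - simple_val k ?\<sigma> ?\<xi> u \<omega>) \<le> ennreal (C a * h)" unfolding sv .
      qed
      also have "\<dots> \<le> ennreal (C a / real N)"
      proof (rule ennreal_leI)
        have "C a * h * (\<tau> - 0) \<le> C a * (1 / real N) * 1"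
          using C(1)[of a] hN h0 \<tau> t delta by (intro mult_mono mult_left_mono) auto
        then show "C a * h * (\<tau> - 0) \<le> C a / real N" by simp
      qed
      finally show ?thesis .
    qed
    have "n2 (\<lambda>\<omega>. c J \<tau> \<omega> - c J 0 \<omega> - (\<Sum>a\<le>d. \<Sum>j<k. c (a # J) (real j * h) \<omega> * dW h a j \<omega>)) = n2 (\<lambda>\<omega>. \<Sum>a\<le>d. R a \<omega>)"
      using Z(3) by (intro nn_integral_cong_AE) (auto simp: R_def sum_subtractf)
    also have "\<dots> \<le> ennreal (real (card {..d})) * (\<Sum>a\<le>d. n2 (R a))" using Rm by (intro n2_sum_le) auto
    also have "\<dots> \<le> ennreal (real (Suc d)) * (\<Sum>a\<le>d. ennreal (C a / real N))"
      using Rn by (intro mult_mono sum_mono) auto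
    also have "\<dots> = ennreal (real (Suc d)) * ennreal ((\<Sum>a\<le>d. C a) / real N)"
      using C(1) by (subst sum_ennreal) (auto simp: sum_divide_distrib)
    also have "\<dots> = ennreal (real (Suc d) * (\<Sum>a\<le>d. C a) / real N)"
      using C(1) by (subst ennreal_mult[symmetric]) (auto intro!: divide_nonneg_nonneg sum_nonneg)
    finally show ?thesis unfolding \<tau>_def h_def .
  qed
  then show ?thesis using C(1) by (intro exI[of _ "real (Suc d) * (\<Sum>a\<le>d. C a)"]) (auto intro!: mult_nonneg_nonneg sum_nonneg)
qed

end

section \<open>Stochastic Taylor expansion on the grid\<close>

lemma sum_words_Suc:
  fixes f :: "nat list \<Rightarrow> real"
  shows "(\<Sum>I\<in>words d (Suc r). f I) = f [] + (\<Sum>a\<le>d. \<Sum>I\<in>words d r. f (I @ [a]))"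
proof -
  let ?g = "\<lambda>(a, I). I @ [a]"
  have W: "words d (Suc r) = insert [] (?g ` ({..d} \<times> words d r))"
  proof (rule set_eqI)
    fix K show "K \<in> words d (Suc r) \<longleftrightarrow> K \<in> insert [] (?g ` ({..d} \<times> words d r))"
      by (cases K rule: rev_cases) (auto simp: words_def image_iff)
  qed
  have "(\<Sum>I\<in>words d (Suc r). f I) = f [] + (\<Sum>I\<in>?g ` ({..d} \<times> words d r). f I)"
    unfolding W by (subst sum.insert) auto
  also have "(\<Sum>I\<in>?g ` ({..d} \<times> words d r). f I) = (\<Sum>p\<in>{..d} \<times> words d r. f (snd p @ [fst p]))"
    by (subst sum.reindex) (auto simp: inj_on_def split_def)
  also have "\<dots> = (\<Sum>a\<le>d. \<Sum>I\<in>words d r. f (I @ [a]))"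
    by (subst sum.cartesian_product) (simp add: split_def)
  finally show ?thesis .
qed

lemma words_0: "words d 0 = {[]}"
  by (auto simp: words_def)

context differentiable_process begin

text \<open>The induction on r starts with (d + 1)^2 K and multiplies by 2 (d + 1)^2 at each step.
  Only d, K and r enter, so the constant is the same for all conditioned measures.\<close>

definition econst :: "nat \<Rightarrow> real" where
  "econst r = (2 * (real (Suc d))\<^sup>2) ^ r * ((real (Suc d))\<^sup>2 * K)"

text \<open>The integrals defining \<open>c J\<close> are replaced by Riemann sums, and the
  integrands \<open>c (a # J)\<close> by their own expansions; summation against the increments
  appends a to each word I, which matches \<open>I @ a # J\<close>. This is why the estimate covers
  all grid points k and not just the last. The remainder has an intrinsic part of order t^(r+1) and
  a discretisation part C/N; the constant C may depend on t because N tends to infinity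
  first.\<close>

lemma taylor_approximation:
  assumes t: "0 < t" "t \<le> \<delta>"
  shows "length J + r = n \<Longrightarrow> set J \<subseteq> {0..d} \<Longrightarrow> \<exists>C\<ge>0. \<forall>N>0. \<forall>k\<le>N.
     n2 (\<lambda>\<omega>. c J (real k * (t / real N)) \<omega> - (\<Sum>I\<in>words d r. c (I @ J) 0 \<omega> * sig (t / real N) I k \<omega>))
       \<le> ennreal (econst r * t ^ Suc r + C / real N)"
proof (induction r arbitrary: J)
  case 0
  have "n2 (\<lambda>\<omega>. c J (real k * (t / real N)) \<omega> - c J 0 \<omega>) \<le> ennreal (econst 0 * t)"
    if N: "N > 0" and k: "k \<le> N" for N k
  proof -
    have h0: "t / real N > 0" using N t by simp
    have "real k * (t / real N) \<le> real N * (t / real N)" using k h0 by (intro mult_right_mono) auto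
    then have \<tau>: "real k * (t / real N) \<le> t" using N by simp
    have \<tau>0: "0 \<le> real k * (t / real N)" using t by simp
    have "n2 (\<lambda>\<omega>. c J (real k * (t / real N)) \<omega> - c J 0 \<omega>) \<le> ennreal (real (Suc d) * real (Suc d) * K * (real k * (t / real N) - 0))"
      by (rule increment_le[OF _ _ order.refl \<tau>0]) (use 0 \<tau> t K in \<open>auto intro!: top_moment\<close>)
    also have "\<dots> \<le> ennreal (real (Suc d) * real (Suc d) * K * t)"
      using \<tau> K by (intro ennreal_leI mult_left_mono) auto
    finally show ?thesis by (simp add: econst_def power2_eq_square)
  qed
  then show ?case by (intro exI[of _ 0]) (simp add: words_0)
next
  case (Suc r)
  have J: "length J < n" "set J \<subseteq> {0..d}" using Suc.prems by auto
  obtain C0 where C0: "C0 \<ge> 0" "\<And>N k. N > 0 \<Longrightarrow> k \<le> N \<Longrightarrow> n2 (\<lambda>\<omega>. c J (real k * (t / real N)) \<omega> - c J 0 \<omega>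
      - (\<Sum>a\<le>d. \<Sum>j<k. c (a # J) (real j * (t / real N)) \<omega> * dW (t / real N) a j \<omega>)) \<le> ennreal (C0 / real N)"
    using riemann_error[OF J t] by blast
  have "\<forall>a. \<exists>C\<ge>0. a \<le> d \<longrightarrow> (\<forall>N>0. \<forall>k\<le>N.
     n2 (\<lambda>\<omega>. c (a # J) (real k * (t / real N)) \<omega> - (\<Sum>I\<in>words d r. c (I @ a # J) 0 \<omega> * sig (t / real N) I k \<omega>))
       \<le> ennreal (econst r * t ^ Suc r + C / real N))"
  proof
    fix a show "\<exists>C\<ge>0. a \<le> d \<longrightarrow> (\<forall>N>0. \<forall>k\<le>N.
     n2 (\<lambda>\<omega>. c (a # J) (real k * (t / real N)) \<omega> - (\<Sum>I\<in>words d r. c (I @ a # J) 0 \<omega> * sig (t / real N) I k \<omega>))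
       \<le> ennreal (econst r * t ^ Suc r + C / real N))"
    proof (cases "a \<le> d")
      case True
      have "length (a # J) + r = n" "set (a # J) \<subseteq> {0..d}" using Suc.prems True by auto
      from Suc.IH[OF this] show ?thesis by blast
    qed auto
  qed
  then have "\<exists>C. \<forall>a. C a \<ge> 0 \<and> (a \<le> d \<longrightarrow> (\<forall>N>0. \<forall>k\<le>N.
     n2 (\<lambda>\<omega>. c (a # J) (real k * (t / real N)) \<omega> - (\<Sum>I\<in>words d r. c (I @ a # J) 0 \<omega> * sig (t / real N) I k \<omega>))
       \<le> ennreal (econst r * t ^ Suc r + C a / real N)))"
    by (rule choice)
  then obtain C where C: "\<And>a. C a \<ge> 0" "\<And>a N k. a \<le> d \<Longrightarrow> N > 0 \<Longrightarrow> k \<le> N \<Longrightarrow>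
     n2 (\<lambda>\<omega>. c (a # J) (real k * (t / real N)) \<omega> - (\<Sum>I\<in>words d r. c (I @ a # J) 0 \<omega> * sig (t / real N) I k \<omega>))
       \<le> ennreal (econst r * t ^ Suc r + C a / real N)" by blast
  define C' where "C' = 2 * C0 + 2 * (real (Suc d) * (\<Sum>a\<le>d. C a))"
  have A0: "0 \<le> econst r" using K by (simp add: econst_def)
  have "n2 (\<lambda>\<omega>. c J (real k * (t / real N)) \<omega> - (\<Sum>I\<in>words d (Suc r). c (I @ J) 0 \<omega> * sig (t / real N) I k \<omega>))
       \<le> ennreal (econst (Suc r) * t ^ Suc (Suc r) + C' / real N)" if N: "N > 0" and k: "k \<le> N" for N k
  proof -
    define h where "h = t / real N"
    have h0: "h > 0" using N t by (simp add: h_def)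
    have "real k * h \<le> real N * h" using k h0 by (intro mult_right_mono) auto
    then have kh: "real k * h \<le> t" using N by (simp add: h_def)
    then have kh1: "real k * h \<le> 1" using t delta by linarith
    note kh = kh kh1
    define E where "E a j \<omega> = c (a # J) (real j * h) \<omega> - (\<Sum>I\<in>words d r. c (I @ a # J) 0 \<omega> * sig h I j \<omega>)" for a j \<omega>
    define Y1 where "Y1 \<omega> = c J (real k * h) \<omega> - c J 0 \<omega> - (\<Sum>a\<le>d. \<Sum>j<k. c (a # J) (real j * h) \<omega> * dW h a j \<omega>)" for \<omega>
    define Y2 where "Y2 a \<omega> = (\<Sum>j<k. E a j \<omega> * dW h a j \<omega>)" for a \<omega>
    have c0m: "c (I @ a # J) 0 \<in> borel_measurable (F 0)" if "I \<in> words d r" "a \<le> d" for I a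
      using that Suc.prems by (intro c_adapted) (auto simp: words_def)
    have Em: "E a j \<in> borel_measurable (F (real j * h))" if a: "a \<le> d" for a j
      unfolding E_def[abs_def]
    proof (intro borel_measurable_diff borel_measurable_sum borel_measurable_times)
      show "c (a # J) (real j * h) \<in> borel_measurable (F (real j * h))" using J a h0 by (intro c_adapted) auto
      fix I assume I: "I \<in> words d r"
      show "c (I @ a # J) 0 \<in> borel_measurable (F (real j * h))"
        by (rule measurable_F_mono[OF c0m[OF I a]]) (use h0 in simp)
      show "sig h I j \<in> borel_measurable (F (real j * h))" using I by (intro sig_measurable[OF h0]) (auto simp: words_def)
    qed
    have En: "n2 (E a j) \<le> ennreal (econst r * t ^ Suc r + C a / real N)" if "a \<le> d" "j < k" for a j
      using C(2)[OF that(1) N, of j] that k unfolding E_def h_def by simp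
    have Y1m: "Y1 \<in> borel_measurable Q"
      unfolding Y1_def[abs_def] using J h0 c_measurable measurable_F_Q[OF dW_measurable[OF h0]]
      by (intro borel_measurable_diff borel_measurable_sum borel_measurable_times) auto
    have Y2m: "Y2 a \<in> borel_measurable Q" if a: "a \<le> d" for a
      unfolding Y2_def[abs_def] using measurable_F_Q[OF Em[OF a]] measurable_F_Q[OF dW_measurable[OF h0 a]]
      by (intro borel_measurable_sum borel_measurable_times)
    have Y1n: "n2 Y1 \<le> ennreal (C0 / real N)" unfolding Y1_def h_def by (rule C0(2)[OF N k])
    have Y2n: "n2 (Y2 a) \<le> ennreal (econst r * t ^ Suc (Suc r) + C a / real N)" if a: "a \<le> d" for a
    proof -
      have "n2 (Y2 a) \<le> ennreal h * (\<Sum>j<k. n2 (E a j))"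
        unfolding Y2_def by (rule n2_dW_sum[OF h0 kh(2) a Em[OF a]])
      also have "\<dots> \<le> ennreal h * (\<Sum>j<k. ennreal (econst r * t ^ Suc r + C a / real N))"
        using En[OF a] by (intro mult_left_mono sum_mono) auto
      also have "\<dots> = ennreal ((real k * h) * (econst r * t ^ Suc r + C a / real N))"
        using A0 C(1)[of a] t h0 by (subst sum_ennreal) (auto simp: ennreal_mult[symmetric] mult_ac)
      also have "\<dots> \<le> ennreal (econst r * t ^ Suc (Suc r) + C a / real N)"
      proof (rule ennreal_leI)
        have "(real k * h) * (econst r * t ^ Suc r) \<le> t * (econst r * t ^ Suc r)"
          using kh A0 t by (intro mult_right_mono) auto
        moreover have "(real k * h) * (C a / real N) \<le> 1 * (C a / real N)"
          using kh C(1)[of a] by (intro mult_right_mono) auto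
        ultimately show "(real k * h) * (econst r * t ^ Suc r + C a / real N) \<le> econst r * t ^ Suc (Suc r) + C a / real N"
          by (simp add: distrib_left mult_ac)
      qed
      finally show ?thesis .
    qed
    have "(\<Sum>I\<in>words d (Suc r). c (I @ J) 0 \<omega> * sig h I k \<omega>)
       = c J 0 \<omega> + (\<Sum>a\<le>d. \<Sum>j<k. (\<Sum>I\<in>words d r. c (I @ a # J) 0 \<omega> * sig h I j \<omega>) * dW h a j \<omega>)" for \<omega>
      unfolding sum_words_Suc sig_snoc sum_distrib_left sum_distrib_right
      by (simp add: mult.assoc, intro sum.cong refl, rule sum.swap)
    then have eq: "c J (real k * h) \<omega> - (\<Sum>I\<in>words d (Suc r). c (I @ J) 0 \<omega> * sig h I k \<omega>) = Y1 \<omega> + (\<Sum>a\<le>d. Y2 a \<omega>)" for \<omega>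
      by (simp add: Y1_def Y2_def E_def left_diff_distrib sum_subtractf)
    have "n2 (\<lambda>\<omega>. \<Sum>a\<le>d. Y2 a \<omega>) \<le> ennreal (real (card {..d})) * (\<Sum>a\<le>d. n2 (Y2 a))"
      using Y2m by (intro n2_sum_le) auto
    also have "\<dots> \<le> ennreal (real (Suc d)) * (\<Sum>a\<le>d. ennreal (econst r * t ^ Suc (Suc r) + C a / real N))"
      using Y2n by (intro mult_mono sum_mono) auto
    also have "\<dots> = ennreal (real (Suc d) * (\<Sum>a\<le>d. econst r * t ^ Suc (Suc r) + C a / real N))"
    proof -
      have nn: "0 \<le> econst r * t ^ Suc (Suc r) + C a / real N" for a using A0 C(1)[of a] t by simp
      have "ennreal (real (Suc d)) * ennreal (\<Sum>a\<le>d. econst r * t ^ Suc (Suc r) + C a / real N)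
         = ennreal (real (Suc d) * (\<Sum>a\<le>d. econst r * t ^ Suc (Suc r) + C a / real N))"
        by (rule ennreal_mult[symmetric]) (use nn in \<open>auto intro!: sum_nonneg\<close>)
      then show ?thesis using sum_ennreal[of "{..d}" "\<lambda>a. econst r * t ^ Suc (Suc r) + C a / real N"] nn by simp
    qed
    finally have b2: "n2 (\<lambda>\<omega>. \<Sum>a\<le>d. Y2 a \<omega>) \<le> ennreal (real (Suc d) * (\<Sum>a\<le>d. econst r * t ^ Suc (Suc r) + C a / real N))" .
    have "n2 (\<lambda>\<omega>. Y1 \<omega> + (\<Sum>a\<le>d. Y2 a \<omega>)) \<le> 2 * n2 Y1 + 2 * n2 (\<lambda>\<omega>. \<Sum>a\<le>d. Y2 a \<omega>)"
      using Y1m Y2m by (intro n2_add_le borel_measurable_sum) auto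
    also have "\<dots> \<le> 2 * ennreal (C0 / real N) + 2 * ennreal (real (Suc d) * (\<Sum>a\<le>d. econst r * t ^ Suc (Suc r) + C a / real N))"
      by (intro add_mono mult_left_mono Y1n b2) auto
    also have "\<dots> = ennreal (2 * (C0 / real N) + 2 * (real (Suc d) * (\<Sum>a\<le>d. econst r * t ^ Suc (Suc r) + C a / real N)))"
    proof -
      have two: "2 * ennreal x + 2 * ennreal y = ennreal (2 * x + 2 * y)" if "0 \<le> x" "0 \<le> y" for x y :: real
        using that by (simp add: ennreal_plus ennreal_mult)
      show ?thesis by (rule two) (use C0(1) A0 C(1) t in \<open>auto intro!: mult_nonneg_nonneg sum_nonneg\<close>)
    qed
    also have "2 * (C0 / real N) + 2 * (real (Suc d) * (\<Sum>a\<le>d. econst r * t ^ Suc (Suc r) + C a / real N))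
       = econst (Suc r) * t ^ Suc (Suc r) + C' / real N"
    proof -
      have "(\<Sum>a\<le>d. econst r * t ^ Suc (Suc r) + C a / real N) = real (Suc d) * (econst r * t ^ Suc (Suc r)) + (\<Sum>a\<le>d. C a) / real N"
        by (simp add: sum.distrib sum_divide_distrib)
      moreover have "econst (Suc r) = 2 * (real (Suc d) * real (Suc d)) * econst r" by (simp add: econst_def power2_eq_square mult_ac)
      ultimately show ?thesis by (simp only: C'_def) (simp add: algebra_simps add_divide_distrib del: of_nat_Suc)
    qed
    finally show ?thesis unfolding eq[symmetric] h_def .
  qed
  moreover have "C' \<ge> 0" using C0(1) C(1) by (auto simp: C'_def intro!: add_nonneg_nonneg mult_nonneg_nonneg sum_nonneg)
  ultimately show ?case by blast
qed

end

section \<open>Bounds uniform over bounded coefficients\<close>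

lemma abs_sum_power_le:
  fixes u :: "'b \<Rightarrow> real"
  assumes "finite A" "r \<ge> 1"
  shows "\<bar>\<Sum>i\<in>A. u i\<bar> ^ r \<le> real (card A) ^ r * (\<Sum>i\<in>A. \<bar>u i\<bar> ^ r)"
proof (cases "A = {}")
  case True then show ?thesis using assms by (simp add: power_0_left)
next
  case False
  define M where "M = Max ((\<lambda>i. \<bar>u i\<bar>) ` A)"
  have M: "\<bar>u i\<bar> \<le> M" if "i \<in> A" for i using assms that by (simp add: M_def)
  have "M \<in> (\<lambda>i. \<bar>u i\<bar>) ` A" unfolding M_def using assms False by (intro Max_in) auto
  then obtain j where j: "j \<in> A" "M = \<bar>u j\<bar>" by auto
  have "\<bar>\<Sum>i\<in>A. u i\<bar> \<le> (\<Sum>i\<in>A. \<bar>u i\<bar>)" by (rule sum_abs)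
  also have "\<dots> \<le> (\<Sum>i\<in>A. M)" using M by (rule sum_mono)
  finally have "\<bar>\<Sum>i\<in>A. u i\<bar> ^ r \<le> (real (card A) * M) ^ r" by (intro power_mono) auto
  also have "\<dots> = real (card A) ^ r * \<bar>u j\<bar> ^ r" by (simp add: power_mult_distrib j)
  also have "\<dots> \<le> real (card A) ^ r * (\<Sum>i\<in>A. \<bar>u i\<bar> ^ r)"
    using assms j by (intro mult_left_mono member_le_sum[of j A "\<lambda>i. \<bar>u i\<bar> ^ r"]) auto
  finally show ?thesis .
qed

text \<open>On words of bounded length the product is a finite bilinear form, so one bound serves
  all coefficient functions within given limits. This uniformity allows random coefficients
  later.\<close>

lemma qs_bounded:
  "\<exists>b\<ge>0. \<forall>x y. supp x \<subseteq> words d L \<longrightarrow> supp y \<subseteq> words d L' \<longrightarrow> (\<forall>K. \<bar>x K\<bar> \<le> b1) \<longrightarrow> (\<forall>K. \<bar>y K\<bar> \<le> b2) \<longrightarrow>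
     (\<forall>K. \<bar>qs d x y K\<bar> \<le> b)"
proof -
  define q where "q K = (\<Sum>I\<in>words d L. \<Sum>J\<in>words d L'. \<bar>qs d (word I) (word J) K\<bar>)" for K
  define b where "b = \<bar>b1\<bar> * \<bar>b2\<bar> * (\<Sum>K\<in>words d (L + L'). q K)"
  have q0: "0 \<le> q K" for K unfolding q_def by (intro sum_nonneg) auto
  have b0: "0 \<le> b" unfolding b_def using q0 by (intro mult_nonneg_nonneg sum_nonneg) auto
  have "\<bar>qs d x y K\<bar> \<le> b" if x: "supp x \<subseteq> words d L" and y: "supp y \<subseteq> words d L'"
    and bx: "\<And>K. \<bar>x K\<bar> \<le> b1" and b_y: "\<And>K. \<bar>y K\<bar> \<le> b2" for x y K
  proof (cases "K \<in> words d (L + L')")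
    case False
    then have "qs d x y K = 0" using supp_qs[OF x y] by (auto simp: supp_def)
    then show ?thesis using b0 by simp
  next
    case True
    have "\<bar>qs d x y K\<bar> \<le> (\<Sum>I\<in>words d L. \<Sum>J\<in>words d L'. \<bar>x I * y J * qs d (word I) (word J) K\<bar>)"
      unfolding qs_eq_sum_words[OF x y] by (intro order_trans[OF sum_abs] sum_mono sum_abs)
    also have "\<dots> \<le> (\<Sum>I\<in>words d L. \<Sum>J\<in>words d L'. \<bar>b1\<bar> * \<bar>b2\<bar> * \<bar>qs d (word I) (word J) K\<bar>)"
    proof (intro sum_mono)
      fix I J
      have "\<bar>x I\<bar> \<le> \<bar>b1\<bar>" "\<bar>y J\<bar> \<le> \<bar>b2\<bar>" using bx[of I] b_y[of J] by linarith+
      then show "\<bar>x I * y J * qs d (word I) (word J) K\<bar> \<le> \<bar>b1\<bar> * \<bar>b2\<bar> * \<bar>qs d (word I) (word J) K\<bar>"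
        unfolding abs_mult by (intro mult_mono) auto
    qed
    also have "\<dots> = \<bar>b1\<bar> * \<bar>b2\<bar> * q K" by (simp add: q_def sum_distrib_left)
    also have "\<dots> \<le> b" unfolding b_def using True q0 by (intro mult_left_mono member_le_sum) auto
    finally show ?thesis .
  qed
  then show ?thesis using b0 by blast
qed

lemma supp_qs_pow: "supp x \<subseteq> words d L \<Longrightarrow> supp (qs_pow d x k) \<subseteq> words d (k * L)"
proof (induction k)
  case 0 then show ?case by (simp add: words_def)
next
  case (Suc k) then show ?case using supp_qs[of x d L "qs_pow d x k" "k * L"] by simp
qed

lemma qs_pow_bounded:
  "\<exists>b\<ge>0. \<forall>x. supp x \<subseteq> words d L \<longrightarrow> (\<forall>K. \<bar>x K\<bar> \<le> B) \<longrightarrow> (\<forall>K. \<bar>qs_pow d x k K\<bar> \<le> b)"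
proof (induction k)
  case 0
  show ?case by (intro exI[of _ 1]) (auto simp: word_def)
next
  case (Suc k)
  then obtain b where b: "b \<ge> 0" "\<And>x K. supp x \<subseteq> words d L \<Longrightarrow> (\<forall>K. \<bar>x K\<bar> \<le> B) \<Longrightarrow> \<bar>qs_pow d x k K\<bar> \<le> b" by blast
  obtain b' where b': "b' \<ge> 0" "\<And>x y. supp x \<subseteq> words d L \<Longrightarrow> supp y \<subseteq> words d (k * L) \<Longrightarrow> (\<forall>K. \<bar>x K\<bar> \<le> B) \<Longrightarrow> (\<forall>K. \<bar>y K\<bar> \<le> b) \<Longrightarrow>
     (\<forall>K. \<bar>qs d x y K\<bar> \<le> b')" using qs_bounded[of d L "k * L" B b] by blast
  show ?case using b' b supp_qs_pow[of _ d L k] by (intro exI[of _ b']) auto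
qed

lemma taylor_lc_bounded:
  "\<exists>b\<ge>0. \<forall>x a. supp x \<subseteq> words d n \<longrightarrow> (\<forall>K. \<bar>x K\<bar> \<le> B) \<longrightarrow> (\<forall>k\<le>L. \<bar>a k\<bar> \<le> A) \<longrightarrow>
     (\<forall>K. \<bar>taylor_lc d L x a (word []) K\<bar> \<le> b)"
proof -
  have "\<forall>k. \<exists>b\<ge>0. \<forall>x. supp x \<subseteq> words d n \<longrightarrow> (\<forall>K. \<bar>x K\<bar> \<le> B) \<longrightarrow> (\<forall>K. \<bar>qs_pow d x k K\<bar> \<le> b)"
    using qs_pow_bounded by blast
  from choice[OF this] obtain b where b: "\<And>k. b k \<ge> 0"
    "\<And>k x K. supp x \<subseteq> words d n \<Longrightarrow> (\<forall>K. \<bar>x K\<bar> \<le> B) \<Longrightarrow> \<bar>qs_pow d x k K\<bar> \<le> b k" by blast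
  have "\<bar>taylor_lc d L x a (word []) K\<bar> \<le> (\<Sum>k\<le>L. \<bar>A\<bar> * b k)"
    if "supp x \<subseteq> words d n" "\<forall>K. \<bar>x K\<bar> \<le> B" and a: "\<forall>k\<le>L. \<bar>a k\<bar> \<le> A" for x a K
  proof -
    have "\<bar>taylor_lc d L x a (word []) K\<bar> \<le> (\<Sum>k\<le>L. \<bar>a k / fact k * qs_pow d x k K\<bar>)"
      unfolding taylor_lc_def by (simp add: order_trans[OF sum_abs])
    also have "\<dots> \<le> (\<Sum>k\<le>L. \<bar>A\<bar> * b k)"
    proof (intro sum_mono)
      fix k assume k: "k \<in> {..L}"
      have "\<bar>a k / fact k\<bar> \<le> \<bar>a k\<bar> / 1" unfolding abs_divide by (intro divide_left_mono) (auto simp: fact_ge_1)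
      also have "\<dots> \<le> \<bar>A\<bar>" using a k by fastforce
      finally show "\<bar>a k / fact k * qs_pow d x k K\<bar> \<le> \<bar>A\<bar> * b k"
        unfolding abs_mult using b(2)[OF that(1,2), of k K] by (intro mult_mono) auto
    qed
    finally show ?thesis .
  qed
  then show ?thesis using b(1) by (intro exI[of _ "\<Sum>k\<le>L. \<bar>A\<bar> * b k"]) (auto intro!: sum_nonneg)
qed

text \<open>The polynomial includes degree n + 1, since the expansion uses derivatives up to order 2
  ceil(n/2), which can be n + 1. With the Lagrange form the error is therefore a difference of two
  values of the top derivative; polynomial growth suffices, as the factor |y|^(n+1) already has the
  right order.\<close>

lemma taylor_remainder_bound:
  assumes f: "Cp (Suc n) f" and B: "0 \<le> B"
  shows "\<exists>C\<ge>0. \<exists>p. \<forall>x y. \<bar>x\<bar> \<le> B \<longrightarrow>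
    \<bar>f (x + y) - (\<Sum>k\<le>Suc n. (deriv ^^ k) f x / fact k * y ^ k)\<bar> \<le> C * (\<bar>y\<bar> ^ Suc n + \<bar>y\<bar> ^ (Suc n + p))"
proof -
  obtain C0 p where C0: "C0 > 0" "\<And>x. \<bar>(deriv ^^ Suc n) f x\<bar> \<le> C0 * (1 + \<bar>x\<bar> ^ p)"
    using f unfolding Cp_def by blast
  define C where "C = C0 * (2 + 2 ^ p * B ^ p + B ^ p) + C0 * 2 ^ p"
  have C: "C \<ge> 0" unfolding C_def using C0 B by (intro add_nonneg_nonneg mult_nonneg_nonneg) auto
  have main: "\<bar>f (x + y) - (\<Sum>k\<le>Suc n. (deriv ^^ k) f x / fact k * y ^ k)\<bar> \<le> C * (\<bar>y\<bar> ^ Suc n + \<bar>y\<bar> ^ (Suc n + p))"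
    if x: "\<bar>x\<bar> \<le> B" for x y
  proof (cases "y = 0")
    case True
    have "(\<Sum>k\<le>Suc n. (deriv ^^ k) f x / fact k * 0 ^ k) = (\<Sum>k\<le>Suc n. if k = 0 then f x else 0)"
      by (intro sum.cong) (auto simp: power_0_left)
    then show ?thesis using True by (simp add: sum.delta)
  next
    case False
    have "\<exists>t. (if x + y < x then x + y < t \<and> t < x else x < t \<and> t < x + y) \<and>
        f (x + y) = (\<Sum>m<Suc n. ((deriv ^^ m) f x / fact m) * (x + y - x) ^ m) + ((deriv ^^ Suc n) f t / fact (Suc n)) * (x + y - x) ^ Suc n"
      by (rule Taylor[where a="min x (x + y)" and b="max x (x + y)"]) (use f False in \<open>auto simp: Cp_def\<close>)
    then obtain t where t: "if x + y < x then x + y < t \<and> t < x else x < t \<and> t < x + y"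
      and e: "f (x + y) = (\<Sum>m<Suc n. ((deriv ^^ m) f x / fact m) * y ^ m) + ((deriv ^^ Suc n) f t / fact (Suc n)) * y ^ Suc n"
      by auto
    have "f (x + y) - (\<Sum>k\<le>Suc n. (deriv ^^ k) f x / fact k * y ^ k)
       = ((deriv ^^ Suc n) f t - (deriv ^^ Suc n) f x) / fact (Suc n) * y ^ Suc n"
      unfolding e by (simp only: sum.atMost_Suc lessThan_Suc_atMost left_diff_distrib diff_divide_distrib add_diff_cancel_left)
    then have "\<bar>f (x + y) - (\<Sum>k\<le>Suc n. (deriv ^^ k) f x / fact k * y ^ k)\<bar>
       = \<bar>(deriv ^^ Suc n) f t - (deriv ^^ Suc n) f x\<bar> / fact (Suc n) * \<bar>y\<bar> ^ Suc n"
      by (simp only: abs_mult abs_divide power_abs) simp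
    also have "\<dots> \<le> \<bar>(deriv ^^ Suc n) f t - (deriv ^^ Suc n) f x\<bar> / 1 * \<bar>y\<bar> ^ Suc n"
      by (intro mult_right_mono divide_left_mono) (auto simp: fact_ge_1 simp del: fact_Suc)
    also have "\<dots> \<le> (C0 * (1 + \<bar>t\<bar> ^ p) + C0 * (1 + \<bar>x\<bar> ^ p)) * \<bar>y\<bar> ^ Suc n"
      using C0(2)[of t] C0(2)[of x] by (intro mult_right_mono) auto
    also have "\<dots> \<le> (C0 * (1 + (2 ^ p * B ^ p + 2 ^ p * \<bar>y\<bar> ^ p)) + C0 * (1 + B ^ p)) * \<bar>y\<bar> ^ Suc n"
    \<comment> \<open>The intermediate point satisfies |t| <= B + |y| <= 2 max(B, |y|), and the p-th
      power of a maximum is at most the sum of the p-th powers.\<close>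
    proof -
      have "\<bar>t\<bar> \<le> B + \<bar>y\<bar>" using t x by (auto split: if_splits)
      also have "\<dots> \<le> 2 * max B \<bar>y\<bar>" by simp
      finally have "\<bar>t\<bar> ^ p \<le> (2 * max B \<bar>y\<bar>) ^ p" by (intro power_mono) auto
      also have "\<dots> \<le> 2 ^ p * B ^ p + 2 ^ p * \<bar>y\<bar> ^ p"
        using B by (cases "B \<le> \<bar>y\<bar>") (auto simp: power_mult_distrib max_def)
      finally have "\<bar>t\<bar> ^ p \<le> 2 ^ p * B ^ p + 2 ^ p * \<bar>y\<bar> ^ p" .
      moreover have "\<bar>x\<bar> ^ p \<le> B ^ p" using x by (intro power_mono) auto
      ultimately show ?thesis using C0(1) by (intro mult_right_mono add_mono mult_left_mono) auto
    qed
    also have "\<dots> = C0 * (2 + 2 ^ p * B ^ p + B ^ p) * \<bar>y\<bar> ^ Suc n + C0 * 2 ^ p * \<bar>y\<bar> ^ (Suc n + p)"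
      by (simp add: algebra_simps power_add)
    also have "\<dots> \<le> C * \<bar>y\<bar> ^ Suc n + C * \<bar>y\<bar> ^ (Suc n + p)"
      unfolding C_def using C0(1) B by (intro add_mono mult_right_mono) (auto intro!: add_nonneg_nonneg mult_nonneg_nonneg)
    finally show ?thesis by (simp add: distrib_left)
  qed
  show ?thesis using C main by blast
qed

section \<open>Random coefficient families and their moments on the grid\<close>

context brownian begin

text \<open>Random linear combinations known at time 0, with length and coefficients bounded
  uniformly in \<omega>. The class is closed under the star product, and for it all grid estimates
  for words extend by linearity.\<close>

definition bfam :: "('a \<Rightarrow> nat list \<Rightarrow> real) \<Rightarrow> bool" where
  "bfam z \<longleftrightarrow> (\<forall>K. (\<lambda>\<omega>. z \<omega> K) \<in> borel_measurable (F 0)) \<and> (\<exists>L. \<forall>\<omega>. supp (z \<omega>) \<subseteq> words d L) \<and> (\<exists>b. \<forall>\<omega> K. \<bar>z \<omega> K\<bar> \<le> b)"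

lemma bfamE:
  assumes "bfam z"
  obtains L b where "\<And>K. (\<lambda>\<omega>. z \<omega> K) \<in> borel_measurable (F 0)" "\<And>\<omega>. supp (z \<omega>) \<subseteq> words d L"
    "0 \<le> b" "\<And>\<omega> K. \<bar>z \<omega> K\<bar> \<le> b"
proof -
  obtain L b where "\<And>K. (\<lambda>\<omega>. z \<omega> K) \<in> borel_measurable (F 0)" "\<And>\<omega>. supp (z \<omega>) \<subseteq> words d L" "\<And>\<omega> K. \<bar>z \<omega> K\<bar> \<le> b"
    using assms unfolding bfam_def by blast
  then show ?thesis using that[of L "max b 0"] by (meson max.coboundedI1 max.cobounded2)
qed

lemma bfam_word: "bfam (\<lambda>\<omega>. word [])"
  unfolding bfam_def
  by (intro conjI allI exI[of _ 0] exI[of _ 1]) (simp_all, simp_all add: words_def word_def)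

lemma bfam_qs:
  assumes x: "bfam x" and z: "bfam z"
  shows "bfam (\<lambda>\<omega>. qs d (x \<omega>) (z \<omega>))"
proof -
  obtain L b where L: "\<And>K. (\<lambda>\<omega>. x \<omega> K) \<in> borel_measurable (F 0)" "\<And>\<omega>. supp (x \<omega>) \<subseteq> words d L" "\<And>\<omega> K. \<bar>x \<omega> K\<bar> \<le> b"
    using bfamE[OF x] by metis
  obtain L' b' where L': "\<And>K. (\<lambda>\<omega>. z \<omega> K) \<in> borel_measurable (F 0)" "\<And>\<omega>. supp (z \<omega>) \<subseteq> words d L'" "\<And>\<omega> K. \<bar>z \<omega> K\<bar> \<le> b'"
    using bfamE[OF z] by metis
  obtain bb where bb: "\<And>x y K. supp x \<subseteq> words d L \<Longrightarrow> supp y \<subseteq> words d L' \<Longrightarrow> (\<forall>K. \<bar>x K\<bar> \<le> b) \<Longrightarrow> (\<forall>K. \<bar>y K\<bar> \<le> b') \<Longrightarrow> \<bar>qs d x y K\<bar> \<le> bb"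
    using qs_bounded[of d L L' b b'] by blast
  show ?thesis
    unfolding bfam_def
  proof (intro conjI allI exI[of _ "L + L'"] exI[of _ bb])
    fix K show "(\<lambda>\<omega>. qs d (x \<omega>) (z \<omega>) K) \<in> borel_measurable (F 0)"
      unfolding qs_eq_sum_words[OF L(2) L'(2)]
      by (intro borel_measurable_sum borel_measurable_times L(1) L'(1) borel_measurable_const)
    fix \<omega> show "supp (qs d (x \<omega>) (z \<omega>)) \<subseteq> words d (L + L')" by (rule supp_qs[OF L(2) L'(2)])
    show "\<bar>qs d (x \<omega>) (z \<omega>) K\<bar> \<le> bb" by (rule bb) (use L L' in auto)
  qed
qed

lemma bfam_qs_pow: "bfam x \<Longrightarrow> bfam (\<lambda>\<omega>. qs_pow d (x \<omega>) k)"
  by (induction k) (simp_all add: bfam_word bfam_qs)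

lemma lin_bfam_measurable:
  assumes "bfam z" "0 < h"
  shows "(\<lambda>\<omega>. lin h (z \<omega>) m \<omega>) \<in> borel_measurable Q"
proof -
  obtain L b where L: "\<And>K. (\<lambda>\<omega>. z \<omega> K) \<in> borel_measurable (F 0)" "\<And>\<omega>. supp (z \<omega>) \<subseteq> words d L"
    using bfamE[OF assms(1)] by metis
  show ?thesis unfolding lin_eq[OF finite_words L(2)]
    by (intro borel_measurable_sum borel_measurable_times measurable_F_Q[OF L(1)] sig_measurable_Q assms(2)) (auto simp: words_def)
qed

text \<open>Expanding both factors over words turns the difference into a finite combination of
  \<open>perr\<close> terms with bounded random coefficients; these coefficients are pulled out by
  their bound.\<close>

lemma lin_product_error:
  assumes x: "bfam x" and z: "bfam z" and t: "0 < t" "t \<le> 1"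
  shows "\<exists>C\<ge>0. \<forall>N>0. n2 (\<lambda>\<omega>. lin (t / real N) (x \<omega>) N \<omega> * lin (t / real N) (z \<omega>) N \<omega> - lin (t / real N) (qs d (x \<omega>) (z \<omega>)) N \<omega>)
      \<le> ennreal (C / real N)"
proof -
  obtain L b where L: "\<And>K. (\<lambda>\<omega>. x \<omega> K) \<in> borel_measurable (F 0)" "\<And>\<omega>. supp (x \<omega>) \<subseteq> words d L" "0 \<le> b" "\<And>\<omega> K. \<bar>x \<omega> K\<bar> \<le> b"
    using bfamE[OF x] by metis
  obtain L' b' where L': "\<And>K. (\<lambda>\<omega>. z \<omega> K) \<in> borel_measurable (F 0)" "\<And>\<omega>. supp (z \<omega>) \<subseteq> words d L'" "0 \<le> b'" "\<And>\<omega> K. \<bar>z \<omega> K\<bar> \<le> b'"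
    using bfamE[OF z] by metis
  let ?P = "words d L \<times> words d L'"
  have "\<forall>p. \<exists>C\<ge>0. p \<in> ?P \<longrightarrow> (\<forall>N>0. \<forall>m\<le>N. n2 (perr (t / real N) (fst p) (snd p) m) \<le> ennreal (C / real N))"
  proof
    fix p show "\<exists>C\<ge>0. p \<in> ?P \<longrightarrow> (\<forall>N>0. \<forall>m\<le>N. n2 (perr (t / real N) (fst p) (snd p) m) \<le> ennreal (C / real N))"
    proof (cases "p \<in> ?P")
      case True
      then have "set (fst p) \<subseteq> {0..d}" "set (snd p) \<subseteq> {0..d}" by (auto simp: words_def)
      from n2_perr[OF t this] show ?thesis by blast
    qed auto
  qed
  from choice[OF this] obtain C where C: "\<And>p. C p \<ge> 0"
    "\<And>p N. p \<in> ?P \<Longrightarrow> N > 0 \<Longrightarrow> n2 (perr (t / real N) (fst p) (snd p) N) \<le> ennreal (C p / real N)" by blast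
  define CC where "CC = real (card ?P) * (\<Sum>p\<in>?P. (b * b')\<^sup>2 * C p)"
  have CC: "CC \<ge> 0" unfolding CC_def using C(1) by (intro mult_nonneg_nonneg sum_nonneg) auto
  have "n2 (\<lambda>\<omega>. lin (t / real N) (x \<omega>) N \<omega> * lin (t / real N) (z \<omega>) N \<omega> - lin (t / real N) (qs d (x \<omega>) (z \<omega>)) N \<omega>)
      \<le> ennreal (CC / real N)" if N: "N > 0" for N
  proof -
    define h where "h = t / real N"
    have h0: "h > 0" using t N by (simp add: h_def)
    have eq: "lin h (x \<omega>) N \<omega> * lin h (z \<omega>) N \<omega> - lin h (qs d (x \<omega>) (z \<omega>)) N \<omega>
       = (\<Sum>p\<in>?P. x \<omega> (fst p) * z \<omega> (snd p) * perr h (fst p) (snd p) N \<omega>)" for \<omega>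
    proof -
      let ?A = "words d (L + L')"
      have "lin h (qs d (x \<omega>) (z \<omega>)) N \<omega> = (\<Sum>K\<in>?A. qs d (x \<omega>) (z \<omega>) K * sig h K N \<omega>)"
        by (rule lin_eq[OF finite_words supp_qs[OF L(2) L'(2)]])
      also have "\<dots> = (\<Sum>K\<in>?A. \<Sum>I\<in>words d L. \<Sum>J\<in>words d L'. x \<omega> I * z \<omega> J * (qs d (word I) (word J) K * sig h K N \<omega>))"
        unfolding qs_eq_sum_words[OF L(2) L'(2)] sum_distrib_right by (simp only: mult.assoc)
      also have "\<dots> = (\<Sum>I\<in>words d L. \<Sum>J\<in>words d L'. x \<omega> I * z \<omega> J * (\<Sum>K\<in>?A. qs d (word I) (word J) K * sig h K N \<omega>))"
        unfolding sum_distrib_left by (rule sum_swap3[symmetric])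
      also have "\<dots> = (\<Sum>I\<in>words d L. \<Sum>J\<in>words d L'. x \<omega> I * z \<omega> J * lin h (star I J) N \<omega>)"
      proof (intro sum.cong refl arg_cong2[where f="(*)"])
        fix I J assume I: "I \<in> words d L" and J: "J \<in> words d L'"
        have "supp (word I) \<subseteq> words d L" "supp (word J) \<subseteq> words d L'" using I J by auto
        from lin_eq[OF finite_words supp_qs[OF this]] star_eq_qs[OF words_letters[OF I] words_letters[OF J]]
        show "(\<Sum>K\<in>?A. qs d (word I) (word J) K * sig h K N \<omega>) = lin h (star I J) N \<omega>" by simp
      qed
      finally have 1: "lin h (qs d (x \<omega>) (z \<omega>)) N \<omega> = (\<Sum>I\<in>words d L. \<Sum>J\<in>words d L'. x \<omega> I * z \<omega> J * lin h (star I J) N \<omega>)" .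
      have 2: "lin h (x \<omega>) N \<omega> * lin h (z \<omega>) N \<omega> = (\<Sum>I\<in>words d L. \<Sum>J\<in>words d L'. x \<omega> I * z \<omega> J * (sig h I N \<omega> * sig h J N \<omega>))"
        unfolding lin_eq[OF finite_words L(2)] lin_eq[OF finite_words L'(2)] sum_product by (simp only: mult_ac)
      show ?thesis unfolding 1 2 perr_def
        by (simp add: sum_subtractf right_diff_distrib sum.cartesian_product split_def)
    qed
    have xm: "(\<lambda>\<omega>. x \<omega> K) \<in> borel_measurable Q" "(\<lambda>\<omega>. z \<omega> K) \<in> borel_measurable Q" for K
      using measurable_F_Q[OF L(1)] measurable_F_Q[OF L'(1)] by auto
    have pm: "perr h (fst p) (snd p) N \<in> borel_measurable Q" if "p \<in> ?P" for p
      by (rule measurable_F_Q[OF perr_measurable[OF h0]]) (use that in \<open>auto simp: words_def\<close>)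
    have "n2 (\<lambda>\<omega>. \<Sum>p\<in>?P. x \<omega> (fst p) * z \<omega> (snd p) * perr h (fst p) (snd p) N \<omega>)
       \<le> ennreal (real (card ?P)) * (\<Sum>p\<in>?P. n2 (\<lambda>\<omega>. x \<omega> (fst p) * z \<omega> (snd p) * perr h (fst p) (snd p) N \<omega>))"
      by (intro n2_sum_le borel_measurable_times xm pm finite_cartesian_product finite_words) auto
    also have "\<dots> \<le> ennreal (real (card ?P)) * (\<Sum>p\<in>?P. ennreal ((b * b')\<^sup>2 * C p / real N))"
    proof (intro mult_left_mono sum_mono)
      fix p assume p: "p \<in> ?P"
      have "n2 (\<lambda>\<omega>. x \<omega> (fst p) * z \<omega> (snd p) * perr h (fst p) (snd p) N \<omega>) \<le> n2 (\<lambda>\<omega>. (b * b') * perr h (fst p) (snd p) N \<omega>)"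
      proof (intro nn_integral_mono ennreal_leI)
        fix \<omega>
        have "\<bar>x \<omega> (fst p) * z \<omega> (snd p) * perr h (fst p) (snd p) N \<omega>\<bar> \<le> \<bar>(b * b') * perr h (fst p) (snd p) N \<omega>\<bar>"
          unfolding abs_mult using L(3,4) L'(3,4) by (intro mult_mono) auto
        then show "(x \<omega> (fst p) * z \<omega> (snd p) * perr h (fst p) (snd p) N \<omega>)\<^sup>2 \<le> ((b * b') * perr h (fst p) (snd p) N \<omega>)\<^sup>2"
          by (rule abs_le_square_iff[THEN iffD1])
      qed
      also have "\<dots> = ennreal ((b * b')\<^sup>2) * n2 (perr h (fst p) (snd p) N)" by (rule n2_cmult[OF pm[OF p]])
      also have "\<dots> \<le> ennreal ((b * b')\<^sup>2) * ennreal (C p / real N)"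
        using C(2)[OF p N] unfolding h_def by (intro mult_left_mono) auto
      also have "\<dots> = ennreal ((b * b')\<^sup>2 * C p / real N)" using C(1)[of p] by (simp add: ennreal_mult[symmetric])
      finally show "n2 (\<lambda>\<omega>. x \<omega> (fst p) * z \<omega> (snd p) * perr h (fst p) (snd p) N \<omega>) \<le> ennreal ((b * b')\<^sup>2 * C p / real N)" .
    qed simp
    also have "\<dots> = ennreal (real (card ?P)) * ennreal ((\<Sum>p\<in>?P. (b * b')\<^sup>2 * C p) / real N)"
      using C(1) by (subst sum_ennreal) (auto simp: sum_divide_distrib)
    also have "\<dots> = ennreal (CC / real N)"
      unfolding CC_def using C(1) by (subst ennreal_mult[symmetric]) (auto intro!: divide_nonneg_nonneg sum_nonneg)
    finally show ?thesis unfolding h_def[symmetric] eq .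
  qed
  then show ?thesis using CC by blast
qed

lemma sig_moment_nn:
  assumes q: "q \<ge> 1" and N: "N > 0" and t: "0 < t" "t \<le> 1" and K: "set K \<subseteq> {0..d}"
  shows "(\<integral>\<^sup>+\<omega>. ennreal (sig (t / real N) K N \<omega> ^ (2 * q)) \<partial>Q) \<le> ennreal ((exp (mconst q) * t ^ q) ^ length K)"
proof -
  note sm = sig_moment[OF q N t refl K order.refl]
  have "(\<integral>\<^sup>+\<omega>. ennreal (sig (t / real N) K N \<omega> ^ (2 * q)) \<partial>Q) = ennreal (\<integral>\<omega>. sig (t / real N) K N \<omega> ^ (2 * q) \<partial>Q)"
    using sm by (intro nn_integral_eq_integral) (auto intro!: zero_le_even_power)
  also have "\<dots> \<le> ennreal ((exp (mconst q) * t ^ q) ^ length K)" using sm by (intro ennreal_leI) simp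
  finally show ?thesis .
qed

lemma lin_power_bound:
  assumes z: "bfam z" and t: "0 < t" "t \<le> 1"
  shows "\<exists>C\<ge>0. \<forall>N>0. (\<integral>\<^sup>+\<omega>. ennreal (lin (t / real N) (z \<omega>) N \<omega> ^ (2 * q)) \<partial>Q) \<le> ennreal C"
proof (cases "q = 0")
  case True
  then show ?thesis by (intro exI[of _ 1]) (simp add: emeasure_space_1)
next
  case False
  then have q: "q \<ge> 1" by simp
  obtain L b where L: "\<And>K. (\<lambda>\<omega>. z \<omega> K) \<in> borel_measurable (F 0)" "\<And>\<omega>. supp (z \<omega>) \<subseteq> words d L" "0 \<le> b" "\<And>\<omega> K. \<bar>z \<omega> K\<bar> \<le> b"
    using bfamE[OF z] by metis
  let ?A = "words d L"
  define a where "a = real (card ?A) ^ (2 * q) * b ^ (2 * q)"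
  define s where "s K = (exp (mconst q) * t ^ q) ^ length K" for K :: "nat list"
  have a0: "0 \<le> a" using L(3) by (simp add: a_def)
  have s0: "0 \<le> s K" for K using t by (simp add: s_def)
  have "(\<integral>\<^sup>+\<omega>. ennreal (lin (t / real N) (z \<omega>) N \<omega> ^ (2 * q)) \<partial>Q) \<le> ennreal (a * (\<Sum>K\<in>?A. s K))" if N: "N > 0" for N
  proof -
    define h where "h = t / real N"
    have h0: "h > 0" using t N by (simp add: h_def)
    have sm: "sig h K N \<in> borel_measurable Q" if "K \<in> ?A" for K using that by (intro sig_measurable_Q[OF h0]) (auto simp: words_def)
    have "(\<integral>\<^sup>+\<omega>. ennreal (lin h (z \<omega>) N \<omega> ^ (2 * q)) \<partial>Q) \<le> (\<integral>\<^sup>+\<omega>. ennreal a * (\<Sum>K\<in>?A. ennreal (sig h K N \<omega> ^ (2 * q))) \<partial>Q)"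
    proof (rule nn_integral_mono)
      fix \<omega>
      have "lin h (z \<omega>) N \<omega> ^ (2 * q) = \<bar>\<Sum>K\<in>?A. z \<omega> K * sig h K N \<omega>\<bar> ^ (2 * q)"
        unfolding lin_eq[OF finite_words L(2)] by (simp add: power_even_abs)
      also have "\<dots> \<le> real (card ?A) ^ (2 * q) * (\<Sum>K\<in>?A. \<bar>z \<omega> K * sig h K N \<omega>\<bar> ^ (2 * q))"
        using q by (intro abs_sum_power_le) auto
      also have "\<dots> \<le> real (card ?A) ^ (2 * q) * (\<Sum>K\<in>?A. b ^ (2 * q) * sig h K N \<omega> ^ (2 * q))"
      proof (intro mult_left_mono sum_mono)
        fix K
        have "\<bar>z \<omega> K * sig h K N \<omega>\<bar> ^ (2 * q) = \<bar>z \<omega> K\<bar> ^ (2 * q) * sig h K N \<omega> ^ (2 * q)"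
          by (simp add: abs_mult power_mult_distrib power_even_abs)
        also have "\<dots> \<le> b ^ (2 * q) * sig h K N \<omega> ^ (2 * q)"
          using L(4)[of \<omega> K] by (intro mult_right_mono power_mono zero_le_even_power) auto
        finally show "\<bar>z \<omega> K * sig h K N \<omega>\<bar> ^ (2 * q) \<le> b ^ (2 * q) * sig h K N \<omega> ^ (2 * q)" .
      qed simp
      also have "\<dots> = a * (\<Sum>K\<in>?A. sig h K N \<omega> ^ (2 * q))" by (simp add: a_def sum_distrib_left mult.assoc)
      finally have "ennreal (lin h (z \<omega>) N \<omega> ^ (2 * q)) \<le> ennreal (a * (\<Sum>K\<in>?A. sig h K N \<omega> ^ (2 * q)))" by (rule ennreal_leI)
      also have "\<dots> = ennreal a * (\<Sum>K\<in>?A. ennreal (sig h K N \<omega> ^ (2 * q)))"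
        using a0 by (subst ennreal_mult) (auto intro!: sum_nonneg zero_le_even_power simp: sum_ennreal[symmetric] simp del: sum_ennreal)
      finally show "ennreal (lin h (z \<omega>) N \<omega> ^ (2 * q)) \<le> ennreal a * (\<Sum>K\<in>?A. ennreal (sig h K N \<omega> ^ (2 * q)))" .
    qed
    also have "\<dots> = ennreal a * (\<Sum>K\<in>?A. (\<integral>\<^sup>+\<omega>. ennreal (sig h K N \<omega> ^ (2 * q)) \<partial>Q))"
      using sm by (subst nn_integral_cmult) (auto simp: nn_integral_sum simp del: sum_ennreal)
    also have "\<dots> \<le> ennreal a * (\<Sum>K\<in>?A. ennreal (s K))"
      unfolding s_def h_def by (intro mult_left_mono sum_mono sig_moment_nn[OF q N t]) (auto simp: words_def)
    also have "\<dots> = ennreal (a * (\<Sum>K\<in>?A. s K))"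
      using a0 s0 by (simp add: ennreal_mult sum_nonneg)
    finally show ?thesis unfolding h_def .
  qed
  moreover have "0 \<le> a * (\<Sum>K\<in>?A. s K)" using a0 s0 by (intro mult_nonneg_nonneg sum_nonneg) auto
  ultimately show ?thesis by blast
qed

text \<open>In the induction one factor x is moved from the power into z, so z has to be arbitrary.
  The new error is Y^k R with E[Y^(2k)] bounded and E[R^2] of order 1/N; weighting the
  arithmetic-geometric inequality by sqrt N balances the two and gives an L1-error of order
  N^(-1/2).\<close>

lemma lin_power_error:
  assumes x: "bfam x" and t: "0 < t" "t \<le> 1"
  shows "bfam z \<Longrightarrow> \<exists>C\<ge>0. \<forall>N>0. (\<integral>\<^sup>+\<omega>. ennreal \<bar>lin (t / real N) (x \<omega>) N \<omega> ^ k * lin (t / real N) (z \<omega>) N \<omega>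
      - lin (t / real N) (qs d (qs_pow d (x \<omega>) k) (z \<omega>)) N \<omega>\<bar> \<partial>Q) \<le> ennreal (C / sqrt (real N))"
proof (induction k arbitrary: z)
  case 0
  then show ?case by (intro exI[of _ 0]) simp
next
  case (Suc k)
  obtain C1 where C1: "C1 \<ge> 0" "\<And>N. N > 0 \<Longrightarrow> (\<integral>\<^sup>+\<omega>. ennreal (lin (t / real N) (x \<omega>) N \<omega> ^ (2 * k)) \<partial>Q) \<le> ennreal C1"
    using lin_power_bound[OF x t, of k] by blast
  obtain C2 where C2: "C2 \<ge> 0" "\<And>N. N > 0 \<Longrightarrow> n2 (\<lambda>\<omega>. lin (t / real N) (x \<omega>) N \<omega> * lin (t / real N) (z \<omega>) N \<omega> - lin (t / real N) (qs d (x \<omega>) (z \<omega>)) N \<omega>)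
      \<le> ennreal (C2 / real N)" using lin_product_error[OF x Suc.prems t] by blast
  obtain C3 where C3: "C3 \<ge> 0" "\<And>N. N > 0 \<Longrightarrow> (\<integral>\<^sup>+\<omega>. ennreal \<bar>lin (t / real N) (x \<omega>) N \<omega> ^ k * lin (t / real N) (qs d (x \<omega>) (z \<omega>)) N \<omega>
      - lin (t / real N) (qs d (qs_pow d (x \<omega>) k) (qs d (x \<omega>) (z \<omega>))) N \<omega>\<bar> \<partial>Q) \<le> ennreal (C3 / sqrt (real N))"
    using Suc.IH[OF bfam_qs[OF x Suc.prems]] by blast
  have "(\<integral>\<^sup>+\<omega>. ennreal \<bar>lin (t / real N) (x \<omega>) N \<omega> ^ Suc k * lin (t / real N) (z \<omega>) N \<omega>
      - lin (t / real N) (qs d (qs_pow d (x \<omega>) (Suc k)) (z \<omega>)) N \<omega>\<bar> \<partial>Q) \<le> ennreal ((C1 + C2 + C3) / sqrt (real N))" if N: "N > 0" for N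
  proof -
    define h where "h = t / real N"
    have h0: "h > 0" using t N by (simp add: h_def)
    let ?s = "sqrt (real N)"
    have s: "?s > 0" using N by simp
    define Y where "Y \<omega> = lin h (x \<omega>) N \<omega>" for \<omega>
    define R where "R \<omega> = Y \<omega> * lin h (z \<omega>) N \<omega> - lin h (qs d (x \<omega>) (z \<omega>)) N \<omega>" for \<omega>
    define V where "V \<omega> = Y \<omega> ^ k * lin h (qs d (x \<omega>) (z \<omega>)) N \<omega> - lin h (qs d (qs_pow d (x \<omega>) k) (qs d (x \<omega>) (z \<omega>))) N \<omega>" for \<omega>
    have [measurable]: "Y \<in> borel_measurable Q" unfolding Y_def[abs_def] by (rule lin_bfam_measurable[OF x h0])
    have [measurable]: "R \<in> borel_measurable Q" unfolding R_def[abs_def]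
      using lin_bfam_measurable[OF Suc.prems h0] lin_bfam_measurable[OF bfam_qs[OF x Suc.prems] h0] by measurable
    have [measurable]: "V \<in> borel_measurable Q" unfolding V_def[abs_def]
      using lin_bfam_measurable[OF bfam_qs[OF bfam_qs_pow[OF x] bfam_qs[OF x Suc.prems]] h0] lin_bfam_measurable[OF bfam_qs[OF x Suc.prems] h0] by measurable
    have le: "\<bar>Y \<omega> ^ Suc k * lin h (z \<omega>) N \<omega> - lin h (qs d (qs_pow d (x \<omega>) (Suc k)) (z \<omega>)) N \<omega>\<bar>
       \<le> (1 / ?s) * Y \<omega> ^ (2 * k) + ?s * (R \<omega>)\<^sup>2 + \<bar>V \<omega>\<bar>" for \<omega>
    proof -
      have q: "qs d (qs_pow d (x \<omega>) (Suc k)) (z \<omega>) = qs d (qs_pow d (x \<omega>) k) (qs d (x \<omega>) (z \<omega>))"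
        by (simp add: qs_assoc qs_left_commute)
      have "Y \<omega> ^ Suc k * lin h (z \<omega>) N \<omega> - lin h (qs d (qs_pow d (x \<omega>) (Suc k)) (z \<omega>)) N \<omega> = Y \<omega> ^ k * R \<omega> + V \<omega>"
        unfolding q by (simp add: R_def V_def algebra_simps)
      also have "\<bar>\<dots>\<bar> \<le> \<bar>Y \<omega> ^ k\<bar> * \<bar>R \<omega>\<bar> + \<bar>V \<omega>\<bar>" by (simp add: abs_mult order_trans[OF abs_triangle_ineq])
      also have "\<bar>Y \<omega> ^ k\<bar> * \<bar>R \<omega>\<bar> \<le> (1 / ?s) * Y \<omega> ^ (2 * k) + ?s * (R \<omega>)\<^sup>2"
      proof -
        have "0 \<le> (\<bar>Y \<omega> ^ k\<bar> / ?s - \<bar>R \<omega>\<bar>)\<^sup>2 * ?s" using s by simp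
        also have "\<dots> = (1 / ?s) * Y \<omega> ^ (2 * k) + ?s * (R \<omega>)\<^sup>2 - 2 * (\<bar>Y \<omega> ^ k\<bar> * \<bar>R \<omega>\<bar>)"
        proof -
          have "(\<bar>Y \<omega> ^ k\<bar> / ?s - \<bar>R \<omega>\<bar>)\<^sup>2 * ?s = \<bar>Y \<omega> ^ k\<bar>\<^sup>2 / ?s + ?s * \<bar>R \<omega>\<bar>\<^sup>2 - 2 * (\<bar>Y \<omega> ^ k\<bar> * \<bar>R \<omega>\<bar>)"
          proof -
            have "(a / s' - r)\<^sup>2 * s' = a\<^sup>2 / s' + s' * r\<^sup>2 - 2 * (a * r)" if "s' > 0" for a r s' :: real
              using that by (simp add: field_simps power2_eq_square)
            from this[OF s] show ?thesis .
          qed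
          moreover have "\<bar>Y \<omega> ^ k\<bar>\<^sup>2 = Y \<omega> ^ (2 * k)" by (simp add: power_mult[symmetric] mult.commute)
          ultimately show ?thesis by simp
        qed
        finally have "2 * (\<bar>Y \<omega> ^ k\<bar> * \<bar>R \<omega>\<bar>) \<le> (1 / ?s) * Y \<omega> ^ (2 * k) + ?s * (R \<omega>)\<^sup>2" by simp
        moreover have "0 \<le> \<bar>Y \<omega> ^ k\<bar> * \<bar>R \<omega>\<bar>" by simp
        ultimately show ?thesis by linarith
      qed
      finally show ?thesis by simp
    qed
    have "(\<integral>\<^sup>+\<omega>. ennreal \<bar>Y \<omega> ^ Suc k * lin h (z \<omega>) N \<omega> - lin h (qs d (qs_pow d (x \<omega>) (Suc k)) (z \<omega>)) N \<omega>\<bar> \<partial>Q)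
       \<le> (\<integral>\<^sup>+\<omega>. ennreal (1 / ?s) * ennreal (Y \<omega> ^ (2 * k)) + ennreal ?s * ennreal ((R \<omega>)\<^sup>2) + ennreal \<bar>V \<omega>\<bar> \<partial>Q)"
    proof (rule nn_integral_mono)
      fix \<omega>
      have y0: "0 \<le> Y \<omega> ^ (2 * k)" by (intro zero_le_even_power) simp
      have "ennreal \<bar>Y \<omega> ^ Suc k * lin h (z \<omega>) N \<omega> - lin h (qs d (qs_pow d (x \<omega>) (Suc k)) (z \<omega>)) N \<omega>\<bar>
         \<le> ennreal ((1 / ?s) * Y \<omega> ^ (2 * k) + ?s * (R \<omega>)\<^sup>2 + \<bar>V \<omega>\<bar>)" by (rule ennreal_leI[OF le])
      also have "\<dots> = ennreal ((1 / ?s) * Y \<omega> ^ (2 * k)) + ennreal (?s * (R \<omega>)\<^sup>2) + ennreal \<bar>V \<omega>\<bar>"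
        using y0 s by (simp add: ennreal_plus)
      also have "ennreal ((1 / ?s) * Y \<omega> ^ (2 * k)) = ennreal (1 / ?s) * ennreal (Y \<omega> ^ (2 * k))"
        using y0 s by (intro ennreal_mult) auto
      also have "ennreal (?s * (R \<omega>)\<^sup>2) = ennreal ?s * ennreal ((R \<omega>)\<^sup>2)" using s by (intro ennreal_mult) auto
      finally show "ennreal \<bar>Y \<omega> ^ Suc k * lin h (z \<omega>) N \<omega> - lin h (qs d (qs_pow d (x \<omega>) (Suc k)) (z \<omega>)) N \<omega>\<bar>
         \<le> ennreal (1 / ?s) * ennreal (Y \<omega> ^ (2 * k)) + ennreal ?s * ennreal ((R \<omega>)\<^sup>2) + ennreal \<bar>V \<omega>\<bar>" .
    qed
    also have "\<dots> = ennreal (1 / ?s) * (\<integral>\<^sup>+\<omega>. ennreal (Y \<omega> ^ (2 * k)) \<partial>Q) + ennreal ?s * n2 R + (\<integral>\<^sup>+\<omega>. ennreal \<bar>V \<omega>\<bar> \<partial>Q)"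
      by (simp add: nn_integral_add nn_integral_cmult)
    also have "\<dots> \<le> ennreal (1 / ?s) * ennreal C1 + ennreal ?s * ennreal (C2 / real N) + ennreal (C3 / ?s)"
      using C1(2)[OF N] C2(2)[OF N] C3(2)[OF N] unfolding R_def V_def Y_def h_def by (intro add_mono mult_left_mono) auto
    also have "\<dots> = ennreal (1 / ?s * C1 + ?s * (C2 / real N) + C3 / ?s)"
    proof -
      have "ennreal p * ennreal q + ennreal r * ennreal u + ennreal w = ennreal (p * q + r * u + w)"
        if "0 \<le> p" "0 \<le> q" "0 \<le> r" "0 \<le> u" "0 \<le> w" for p q r u w
        using that by (simp add: ennreal_mult ennreal_plus)
      then show ?thesis using C1(1) C2(1) C3(1) s by simp
    qed
    also have "1 / ?s * C1 + ?s * (C2 / real N) + C3 / ?s = (C1 + C2 + C3) / ?s"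
    proof -
      have "?s * (C2 / real N) = C2 / ?s" using s by (simp add: field_simps)
      then show ?thesis by (simp add: add_divide_distrib)
    qed
    finally show ?thesis unfolding Y_def h_def .
  qed
  then show ?case using C1(1) C2(1) C3(1) by (intro exI[of _ "C1 + C2 + C3"]) auto
qed

text \<open>Of all words only those consisting of zeros have a nonvanishing weighted expectation,
  and these are deterministic on the grid.\<close>

lemma expectation_lin:
  assumes z: "bfam z" "\<And>\<omega>. supp (z \<omega>) \<subseteq> words d L" and N: "N > 0" and t: "0 < t" "t \<le> 1"
    and g: "g \<in> borel_measurable (F 0)" "\<And>\<omega>. \<bar>g \<omega>\<bar> \<le> b"
  shows "integrable Q (\<lambda>\<omega>. g \<omega> * lin (t / real N) (z \<omega>) N \<omega>)"
    and "(\<integral>\<omega>. g \<omega> * lin (t / real N) (z \<omega>) N \<omega> \<partial>Q)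
      = (\<Sum>l\<le>L. (\<integral>\<omega>. g \<omega> * z \<omega> (replicate l 0) \<partial>Q) * (real (N choose l) * (t / real N) ^ l))"
proof -
  obtain L' bz where z': "\<And>K. (\<lambda>\<omega>. z \<omega> K) \<in> borel_measurable (F 0)" "0 \<le> bz" "\<And>\<omega> K. \<bar>z \<omega> K\<bar> \<le> bz"
    using bfamE[OF z(1)] by metis
  let ?h = "t / real N"
  have eq: "g \<omega> * lin ?h (z \<omega>) N \<omega> = (\<Sum>K\<in>words d L. (g \<omega> * z \<omega> K) * sig ?h K N \<omega>)" for \<omega>
    unfolding lin_eq[OF finite_words z(2)] by (simp add: sum_distrib_left mult.assoc)
  have gz: "(\<lambda>\<omega>. g \<omega> * z \<omega> K) \<in> borel_measurable (F 0)" "\<bar>g \<omega> * z \<omega> K\<bar> \<le> b * bz" for K \<omega>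
  proof -
    show "(\<lambda>\<omega>. g \<omega> * z \<omega> K) \<in> borel_measurable (F 0)" using g z' by measurable
    have "0 \<le> b" using g(2)[of \<omega>] by linarith
    then show "\<bar>g \<omega> * z \<omega> K\<bar> \<le> b * bz" unfolding abs_mult using g z' by (intro mult_mono) auto
  qed
  note ez = expectation_sig_zero[OF N t refl gz words_letters order.refl]
  have I: "integrable Q (\<lambda>\<omega>. (g \<omega> * z \<omega> K) * sig ?h K N \<omega>)" if "K \<in> words d L" for K using ez[OF that] by blast
  show "integrable Q (\<lambda>\<omega>. g \<omega> * lin ?h (z \<omega>) N \<omega>)" unfolding eq using I by (intro Bochner_Integration.integrable_sum)
  have "(\<integral>\<omega>. g \<omega> * lin ?h (z \<omega>) N \<omega> \<partial>Q) = (\<Sum>K\<in>words d L. \<integral>\<omega>. (g \<omega> * z \<omega> K) * sig ?h K N \<omega> \<partial>Q)"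
    unfolding eq using I by (intro Bochner_Integration.integral_sum)
  also have "\<dots> = (\<Sum>K\<in>(\<lambda>l. replicate l 0) ` {..L}. \<integral>\<omega>. (g \<omega> * z \<omega> K) * sig ?h K N \<omega> \<partial>Q)"
  proof (rule sum.mono_neutral_right)
    show "(\<lambda>l. replicate l 0) ` {..L} \<subseteq> words d L" by (auto simp: words_def)
    show "\<forall>K\<in>words d L - (\<lambda>l. replicate l 0) ` {..L}. (\<integral>\<omega>. (g \<omega> * z \<omega> K) * sig ?h K N \<omega> \<partial>Q) = 0"
    proof
      fix K assume K: "K \<in> words d L - (\<lambda>l. replicate l 0) ` {..L}"
      then have "K \<noteq> replicate (length K) 0" by (auto simp: words_def)
      then show "(\<integral>\<omega>. (g \<omega> * z \<omega> K) * sig ?h K N \<omega> \<partial>Q) = 0" using ez[of K L] K by blast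
    qed
  qed simp
  also have "\<dots> = (\<Sum>l\<le>L. \<integral>\<omega>. (g \<omega> * z \<omega> (replicate l 0)) * sig ?h (replicate l 0) N \<omega> \<partial>Q)"
    by (subst sum.reindex) (auto simp: inj_on_def dest: replicate_eq_replicate[THEN iffD1])
  also have "\<dots> = (\<Sum>l\<le>L. (\<integral>\<omega>. g \<omega> * z \<omega> (replicate l 0) \<partial>Q) * (real (N choose l) * ?h ^ l))"
    unfolding sig_replicate_0 by (simp only: integral_mult_left_zero)
  finally show "(\<integral>\<omega>. g \<omega> * lin ?h (z \<omega>) N \<omega> \<partial>Q)
      = (\<Sum>l\<le>L. (\<integral>\<omega>. g \<omega> * z \<omega> (replicate l 0) \<partial>Q) * (real (N choose l) * ?h ^ l))" .
qed

text \<open>The grid power and the star power have the same limiting expectation, and the latter is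
  explicit. The weight g will be a Taylor coefficient of f at the random initial value, which is why
  it must be measurable at time 0 and bounded.\<close>

lemma expectation_power_tendsto:
  assumes x: "bfam x" and L: "\<And>\<omega>. supp (qs_pow d (x \<omega>) k) \<subseteq> words d L" and t: "0 < t" "t \<le> 1"
    and g: "g \<in> borel_measurable (F 0)" "\<And>\<omega>. \<bar>g \<omega>\<bar> \<le> b"
  shows "\<And>N. N > 0 \<Longrightarrow> integrable Q (\<lambda>\<omega>. g \<omega> * lin (t / real N) (x \<omega>) N \<omega> ^ k)"
    and "(\<lambda>N. \<integral>\<omega>. g \<omega> * lin (t / real N) (x \<omega>) N \<omega> ^ k \<partial>Q) \<longlonglongrightarrow>
      (\<Sum>l\<le>L. (\<integral>\<omega>. g \<omega> * qs_pow d (x \<omega>) k (replicate l 0) \<partial>Q) * (t ^ l / fact l))"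
proof -
  note xk = bfam_qs_pow[OF x, of k]
  have b0: "0 \<le> b" using g(2)[of undefined] by linarith
  obtain C where C: "C \<ge> 0" "\<And>N. N > 0 \<Longrightarrow> (\<integral>\<^sup>+\<omega>. ennreal \<bar>lin (t / real N) (x \<omega>) N \<omega> ^ k * lin (t / real N) (word []) N \<omega>
      - lin (t / real N) (qs d (qs_pow d (x \<omega>) k) (word [])) N \<omega>\<bar> \<partial>Q) \<le> ennreal (C / sqrt (real N))"
    using lin_power_error[OF x t bfam_word, of k] by blast
  note [measurable] = measurable_F_Q[OF g(1)]
  have D: "integrable Q (\<lambda>\<omega>. g \<omega> * (lin (t / real N) (x \<omega>) N \<omega> ^ k - lin (t / real N) (qs_pow d (x \<omega>) k) N \<omega>)) \<and>
     \<bar>\<integral>\<omega>. g \<omega> * (lin (t / real N) (x \<omega>) N \<omega> ^ k - lin (t / real N) (qs_pow d (x \<omega>) k) N \<omega>) \<partial>Q\<bar> \<le> b * C / sqrt (real N)" if N: "N > 0" for N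
  proof -
    define h where "h = t / real N"
    have h0: "h > 0" using t N by (simp add: h_def)
    note [measurable] = lin_bfam_measurable[OF x h0, of N] lin_bfam_measurable[OF xk h0, of N]
    define u where "u \<omega> = g \<omega> * (lin h (x \<omega>) N \<omega> ^ k - lin h (qs_pow d (x \<omega>) k) N \<omega>)" for \<omega>
    have [measurable]: "u \<in> borel_measurable Q" unfolding u_def[abs_def] by measurable
    have "(\<integral>\<^sup>+\<omega>. ennreal (norm (u \<omega>)) \<partial>Q) \<le> (\<integral>\<^sup>+\<omega>. ennreal b * ennreal \<bar>lin h (x \<omega>) N \<omega> ^ k - lin h (qs_pow d (x \<omega>) k) N \<omega>\<bar> \<partial>Q)"
      using g(2) b0 by (intro nn_integral_mono) (auto simp: u_def abs_mult ennreal_mult[symmetric] intro!: ennreal_leI mult_right_mono)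
    also have "\<dots> = ennreal b * (\<integral>\<^sup>+\<omega>. ennreal \<bar>lin h (x \<omega>) N \<omega> ^ k - lin h (qs_pow d (x \<omega>) k) N \<omega>\<bar> \<partial>Q)"
      by (rule nn_integral_cmult) measurable
    also have "\<dots> \<le> ennreal b * ennreal (C / sqrt (real N))"
      using C(2)[OF N] unfolding h_def by (intro mult_left_mono) (auto simp: lin_word)
    also have "\<dots> = ennreal (b * C / sqrt (real N))" using b0 C(1) by (simp add: ennreal_mult[symmetric])
    finally have le: "(\<integral>\<^sup>+\<omega>. ennreal (norm (u \<omega>)) \<partial>Q) \<le> ennreal (b * C / sqrt (real N))" .
    then have int: "integrable Q u" by (intro integrableI_bounded) (auto intro: le_less_trans)
    have "ennreal \<bar>\<integral>\<omega>. u \<omega> \<partial>Q\<bar> \<le> ennreal (b * C / sqrt (real N))"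
      using integral_norm_bound_ennreal[OF int] le by (simp add: order_trans)
    then have "\<bar>\<integral>\<omega>. u \<omega> \<partial>Q\<bar> \<le> b * C / sqrt (real N)" using b0 C(1) by (simp add: ennreal_le_iff)
    then show ?thesis using int unfolding u_def h_def by blast
  qed
  note E = expectation_lin[OF xk L _ t g]
  show int: "integrable Q (\<lambda>\<omega>. g \<omega> * lin (t / real N) (x \<omega>) N \<omega> ^ k)" if N: "N > 0" for N
    using Bochner_Integration.integrable_add[OF conjunct1[OF D[OF N]] E(1)[OF N]] by (simp add: algebra_simps)
  have eq: "(\<integral>\<omega>. g \<omega> * lin (t / real N) (x \<omega>) N \<omega> ^ k \<partial>Q) =
     (\<integral>\<omega>. g \<omega> * (lin (t / real N) (x \<omega>) N \<omega> ^ k - lin (t / real N) (qs_pow d (x \<omega>) k) N \<omega>) \<partial>Q)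
     + (\<Sum>l\<le>L. (\<integral>\<omega>. g \<omega> * qs_pow d (x \<omega>) k (replicate l 0) \<partial>Q) * (real (N choose l) * (t / real N) ^ l))" if N: "N > 0" for N
  proof -
    have "(\<integral>\<omega>. g \<omega> * lin (t / real N) (x \<omega>) N \<omega> ^ k \<partial>Q) =
      (\<integral>\<omega>. g \<omega> * (lin (t / real N) (x \<omega>) N \<omega> ^ k - lin (t / real N) (qs_pow d (x \<omega>) k) N \<omega>)
         + g \<omega> * lin (t / real N) (qs_pow d (x \<omega>) k) N \<omega> \<partial>Q)"
      by (intro Bochner_Integration.integral_cong refl) (simp add: algebra_simps)
    then show ?thesis using Bochner_Integration.integral_add[OF conjunct1[OF D[OF N]] E(1)[OF N]] E(2)[OF N] by simp
  qed
  have l1: "(\<lambda>N. \<integral>\<omega>. g \<omega> * (lin (t / real N) (x \<omega>) N \<omega> ^ k - lin (t / real N) (qs_pow d (x \<omega>) k) N \<omega>) \<partial>Q) \<longlonglongrightarrow> 0"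
  proof (rule Lim_null_comparison)
    show "\<forall>\<^sub>F N in sequentially. norm (\<integral>\<omega>. g \<omega> * (lin (t / real N) (x \<omega>) N \<omega> ^ k - lin (t / real N) (qs_pow d (x \<omega>) k) N \<omega>) \<partial>Q) \<le> b * C / sqrt (real N)"
      using eventually_gt_at_top[of 0] by eventually_elim (use D in auto)
    show "(\<lambda>N. b * C / sqrt (real N)) \<longlonglongrightarrow> 0"
      by (intro real_tendsto_divide_at_top[OF tendsto_const] filterlim_compose[OF sqrt_at_top filterlim_real_sequentially])
  qed
  have l2: "(\<lambda>N. \<Sum>l\<le>L. (\<integral>\<omega>. g \<omega> * qs_pow d (x \<omega>) k (replicate l 0) \<partial>Q) * (real (N choose l) * (t / real N) ^ l))
     \<longlonglongrightarrow> (\<Sum>l\<le>L. (\<integral>\<omega>. g \<omega> * qs_pow d (x \<omega>) k (replicate l 0) \<partial>Q) * (t ^ l / fact l))"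
    by (intro tendsto_sum tendsto_mult tendsto_const choose_scaled_tendsto)
  have ev: "\<forall>\<^sub>F N in sequentially. (\<integral>\<omega>. g \<omega> * (lin (t / real N) (x \<omega>) N \<omega> ^ k - lin (t / real N) (qs_pow d (x \<omega>) k) N \<omega>) \<partial>Q)
     + (\<Sum>l\<le>L. (\<integral>\<omega>. g \<omega> * qs_pow d (x \<omega>) k (replicate l 0) \<partial>Q) * (real (N choose l) * (t / real N) ^ l))
     = (\<integral>\<omega>. g \<omega> * lin (t / real N) (x \<omega>) N \<omega> ^ k \<partial>Q)"
    using eventually_gt_at_top[of 0] by eventually_elim (simp add: eq)
  show "(\<lambda>N. \<integral>\<omega>. g \<omega> * lin (t / real N) (x \<omega>) N \<omega> ^ k \<partial>Q) \<longlonglongrightarrow>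
      (\<Sum>l\<le>L. (\<integral>\<omega>. g \<omega> * qs_pow d (x \<omega>) k (replicate l 0) \<partial>Q) * (t ^ l / fact l))"
    using Lim_transform_eventually[OF tendsto_add[OF l1 l2] ev] by simp
qed

end

lemma Cp_measurable:
  assumes f: "Cp m f" and k: "k \<le> m"
  shows "(deriv ^^ k) f \<in> borel_measurable borel"
proof -
  have "continuous_on UNIV ((deriv ^^ k) f)"
  proof (cases "k = m")
    case True then show ?thesis using f by (simp add: Cp_def)
  next
    case False
    then have "k < m" using k by simp
    then have "\<forall>x. ((deriv ^^ k) f has_real_derivative (deriv ^^ Suc k) f x) (at x)" using f unfolding Cp_def by blast
    then show ?thesis by (intro continuous_at_imp_continuous_on ballI) (blast intro: DERIV_isCont)
  qed
  then show ?thesis by (rule borel_measurable_continuous_onI)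
qed

lemma lipschitz_of_deriv:
  assumes f: "Cp (Suc n) f" and B: "\<And>x. \<bar>deriv f x\<bar> \<le> B"
  shows "\<bar>f x - f y\<bar> \<le> B * \<bar>x - y\<bar>"
proof -
  have d: "(f has_real_derivative deriv f x) (at x)" for x
  proof -
    have "((deriv ^^ 0) f has_real_derivative (deriv ^^ Suc 0) f x) (at x)" using f unfolding Cp_def by blast
    then show ?thesis by simp
  qed
  have *: "\<bar>f b - f a\<bar> \<le> B * \<bar>b - a\<bar>" if ab: "a < b" for a b
  proof -
    obtain z where "f b - f a = (b - a) * deriv f z" using MVT2[OF ab, of f "deriv f"] d by auto
    then show ?thesis using B[of z] by (simp add: abs_mult mult.commute mult_right_mono)
  qed
  show ?thesis
  proof (cases x y rule: linorder_cases)
    case less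
    then show ?thesis using *[OF less] by (simp add: abs_minus_commute)
  next
    case greater
    then show ?thesis using *[OF greater] by simp
  qed simp
qed

section \<open>Approximation of the process by its truncated expansion\<close>

context differentiable_process begin

text \<open>The initial coefficients obey the bound K only almost surely; cutting off the
  exceptional values makes it hold for every \<omega>, as \<open>bfam\<close> demands.\<close>

definition cc :: "'a \<Rightarrow> nat list \<Rightarrow> real" where
  "cc \<omega> I = (if I \<in> words d n \<and> \<bar>c I 0 \<omega>\<bar> \<le> K then c I 0 \<omega> else 0)"

lemma supp_cc: "supp (cc \<omega>) \<subseteq> words d n"
  by (auto simp: supp_def cc_def)

lemma abs_cc: "\<bar>cc \<omega> I\<bar> \<le> K"
  using K by (simp add: cc_def)

lemma cc_measurable: "(\<lambda>\<omega>. cc \<omega> I) \<in> borel_measurable (F 0)"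
proof (cases "I \<in> words d n")
  case True
  then have "c I 0 \<in> borel_measurable (F 0)" by (intro c_adapted) (auto simp: words_def)
  then show ?thesis using True unfolding cc_def by simp
qed (simp add: cc_def)

lemma AE_cc: "AE \<omega> in Q. cc \<omega> = coeffs d n c \<omega>"
proof -
  have "AE \<omega> in Q. \<forall>I\<in>words d n. \<bar>c I 0 \<omega>\<bar> \<le> K"
    by (intro AE_finite_allI finite_words initial_bound) (auto simp: words_def)
  then show ?thesis
    by eventually_elim (auto simp: cc_def coeffs_def words_def fun_eq_iff)
qed

text \<open>The combination representing the increment from the initial value: the coefficient of
  the empty word is split off and becomes the base point of the Taylor expansion of f.\<close>

definition ct :: "'a \<Rightarrow> nat list \<Rightarrow> real" where
  "ct \<omega> = (cc \<omega>)([] := 0)"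

lemma supp_ct: "supp (ct \<omega>) \<subseteq> words d n"
  using supp_cc[of \<omega>] by (auto simp: supp_def ct_def split: if_splits)

lemma abs_ct: "\<bar>ct \<omega> I\<bar> \<le> K"
  using abs_cc[of \<omega> I] K by (simp add: ct_def)

lemma bfam_ct: "bfam ct"
  unfolding bfam_def
proof (intro conjI allI exI[of _ n] exI[of _ K])
  fix I show "(\<lambda>\<omega>. ct \<omega> I) \<in> borel_measurable (F 0)" using cc_measurable[of I] by (simp add: ct_def)
qed (simp_all add: supp_ct abs_ct)

text \<open>The first factor comes from the r-th power of a sum with coefficients bounded by K, the
  second from the number of words and the moments of a word of length at most n. Neither N nor t nor
  the measure enters.\<close>

definition ymom :: "nat \<Rightarrow> real" where
  "ymom r = (real (card (words d n)) * K) ^ r * (real (card (words d n)) * exp (mconst r) ^ n)"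

lemma ymom_nonneg: "0 \<le> ymom r"
  using K by (simp add: ymom_def)

text \<open>Odd exponents are reduced to even ones by u <= u^2/(2s) + s/2 with s = t^(r/2), the
  expected size of u. A nonempty word has 2r-th moment of order t^r, which makes both terms of order
  s.\<close>

lemma sig_abs_moment:
  assumes r: "r \<ge> 1" and N: "N > 0" and t: "0 < t" "t \<le> 1" and I: "I \<in> words d n" "I \<noteq> []"
  shows "(\<integral>\<^sup>+\<omega>. ennreal (\<bar>sig (t / real N) I N \<omega>\<bar> ^ r) \<partial>Q) \<le> ennreal (exp (mconst r) ^ n * sqrt t ^ r)"
proof -
  let ?s = "sqrt t ^ r"
  have h0: "t / real N > 0" using t N by simp
  have s0: "?s > 0" using t by simp
  have s2: "?s * ?s = t ^ r" using t by (simp flip: power_mult_distrib)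
  have Iset: "set I \<subseteq> {0..d}" "length I \<le> n" "1 \<le> length I" using I by (auto simp: words_def Suc_le_eq)
  note [measurable] = sig_measurable_Q[OF h0 Iset(1), of N]
  have e1: "1 \<le> exp (mconst r)" using mconst_nonneg[of r] by simp
  have "(\<integral>\<^sup>+\<omega>. ennreal (\<bar>sig (t / real N) I N \<omega>\<bar> ^ r) \<partial>Q)
     \<le> (\<integral>\<^sup>+\<omega>. ennreal (1 / (2 * ?s)) * ennreal (sig (t / real N) I N \<omega> ^ (2 * r)) + ennreal (?s / 2) \<partial>Q)"
  proof (rule nn_integral_mono)
    fix \<omega>
    let ?u = "\<bar>sig (t / real N) I N \<omega>\<bar> ^ r"
    have gen: "u \<le> 1 / (2 * s) * u\<^sup>2 + s / 2" if "s > 0" for u s :: real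
    proof -
      have "0 \<le> (u - s)\<^sup>2 / (2 * s)" using that by simp
      also have "\<dots> = 1 / (2 * s) * u\<^sup>2 + s / 2 - u" using that by (simp add: field_simps power2_eq_square)
      finally show ?thesis by simp
    qed
    have u2: "?u\<^sup>2 = sig (t / real N) I N \<omega> ^ (2 * r)"
      by (simp add: power_even_abs flip: power_mult) (simp add: mult.commute power_even_abs)
    have "ennreal ?u \<le> ennreal (1 / (2 * ?s) * ?u\<^sup>2 + ?s / 2)" by (rule ennreal_leI[OF gen[OF s0]])
    also have "\<dots> = ennreal (1 / (2 * ?s) * ?u\<^sup>2) + ennreal (?s / 2)" using s0 by (intro ennreal_plus) auto
    also have "ennreal (1 / (2 * ?s) * ?u\<^sup>2) = ennreal (1 / (2 * ?s)) * ennreal (?u\<^sup>2)" using s0 by (intro ennreal_mult) auto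
    finally show "ennreal ?u \<le> ennreal (1 / (2 * ?s)) * ennreal (sig (t / real N) I N \<omega> ^ (2 * r)) + ennreal (?s / 2)"
      unfolding u2 .
  qed
  also have "\<dots> = ennreal (1 / (2 * ?s)) * (\<integral>\<^sup>+\<omega>. ennreal (sig (t / real N) I N \<omega> ^ (2 * r)) \<partial>Q) + ennreal (?s / 2)"
    by (simp add: nn_integral_add nn_integral_cmult emeasure_space_1)
  also have "\<dots> \<le> ennreal (1 / (2 * ?s)) * ennreal (exp (mconst r) ^ n * t ^ r) + ennreal (?s / 2)"
  proof (intro add_right_mono mult_left_mono)
    have "(exp (mconst r) * t ^ r) ^ length I = exp (mconst r) ^ length I * (t ^ r) ^ length I" by (rule power_mult_distrib)
    also have "\<dots> \<le> exp (mconst r) ^ n * (t ^ r) ^ 1"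
      using e1 Iset t by (intro mult_mono power_increasing power_decreasing) (auto simp: power_le_one)
    finally have "(exp (mconst r) * t ^ r) ^ length I \<le> exp (mconst r) ^ n * t ^ r" by simp
    then show "(\<integral>\<^sup>+\<omega>. ennreal (sig (t / real N) I N \<omega> ^ (2 * r)) \<partial>Q) \<le> ennreal (exp (mconst r) ^ n * t ^ r)"
      by (rule order_trans[OF sig_moment_nn[OF r N t Iset(1)] ennreal_leI])
  qed simp
  also have "\<dots> = ennreal (1 / (2 * ?s) * (exp (mconst r) ^ n * t ^ r) + ?s / 2)"
  proof -
    have gen: "ennreal p * ennreal q + ennreal w = ennreal (p * q + w)" if "0 \<le> p" "0 \<le> q" "0 \<le> w" for p q w
      using that by (simp add: ennreal_mult ennreal_plus)
    show ?thesis by (rule gen) (use s0 t in auto)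
  qed
  also have "\<dots> \<le> ennreal (exp (mconst r) ^ n * ?s)"
  proof (rule ennreal_leI)
    have "1 / (2 * ?s) * (exp (mconst r) ^ n * t ^ r) = exp (mconst r) ^ n * ?s / 2"
      unfolding s2[symmetric] using s0 by (simp add: field_simps)
    moreover have "1 * ?s \<le> exp (mconst r) ^ n * ?s" using e1 s0 by (intro mult_right_mono one_le_power) auto
    ultimately show "1 / (2 * ?s) * (exp (mconst r) ^ n * t ^ r) + ?s / 2 \<le> exp (mconst r) ^ n * ?s" by simp
  qed
  finally show ?thesis .
qed

lemma Y_moment:
  assumes r: "r \<ge> 1" and N: "N > 0" and t: "0 < t" "t \<le> 1"
  shows "(\<integral>\<^sup>+\<omega>. ennreal (\<bar>lin (t / real N) (ct \<omega>) N \<omega>\<bar> ^ r) \<partial>Q) \<le> ennreal (ymom r * sqrt t ^ r)"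
proof -
  let ?h = "t / real N" and ?A = "words d n"
  have h0: "?h > 0" using t N by simp
  define S where "S I \<omega> = (if I = [] then 0 else \<bar>sig ?h I N \<omega>\<bar> ^ r)" for I \<omega>
  define w where "w = (real (card ?A) * K) ^ r"
  have w0: "0 \<le> w" using K by (simp add: w_def)
  have S0: "0 \<le> S I \<omega>" for I \<omega> by (simp add: S_def)
  have Sm: "S I \<in> borel_measurable Q" if "I \<in> ?A" for I
  proof -
    have "sig ?h I N \<in> borel_measurable Q" using that by (intro sig_measurable_Q[OF h0]) (auto simp: words_def)
    then show ?thesis unfolding S_def[abs_def] by simp
  qed
  have "(\<integral>\<^sup>+\<omega>. ennreal (\<bar>lin ?h (ct \<omega>) N \<omega>\<bar> ^ r) \<partial>Q) \<le> (\<integral>\<^sup>+\<omega>. ennreal w * (\<Sum>I\<in>?A. ennreal (S I \<omega>)) \<partial>Q)"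
  proof (rule nn_integral_mono)
    fix \<omega>
    have "\<bar>lin ?h (ct \<omega>) N \<omega>\<bar> ^ r \<le> real (card ?A) ^ r * (\<Sum>I\<in>?A. \<bar>ct \<omega> I * sig ?h I N \<omega>\<bar> ^ r)"
      unfolding lin_eq[OF finite_words supp_ct] using r by (intro abs_sum_power_le) auto
    also have "\<dots> \<le> real (card ?A) ^ r * (\<Sum>I\<in>?A. K ^ r * S I \<omega>)"
    proof (intro mult_left_mono sum_mono)
      fix I
      show "\<bar>ct \<omega> I * sig ?h I N \<omega>\<bar> ^ r \<le> K ^ r * S I \<omega>"
      proof (cases "I = []")
        case True then show ?thesis using r by (simp add: ct_def S_def power_0_left)
      next
        case False
        have "\<bar>ct \<omega> I\<bar> ^ r \<le> K ^ r" using abs_ct by (intro power_mono) auto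
        then show ?thesis using False by (simp add: S_def abs_mult power_mult_distrib mult_right_mono)
      qed
    qed simp
    also have "\<dots> = w * (\<Sum>I\<in>?A. S I \<omega>)" by (simp add: w_def power_mult_distrib sum_distrib_left mult.assoc)
    finally have "ennreal (\<bar>lin ?h (ct \<omega>) N \<omega>\<bar> ^ r) \<le> ennreal (w * (\<Sum>I\<in>?A. S I \<omega>))" by (rule ennreal_leI)
    also have "\<dots> = ennreal w * (\<Sum>I\<in>?A. ennreal (S I \<omega>))"
      using w0 S0 by (subst ennreal_mult) (auto intro!: sum_nonneg)
    finally show "ennreal (\<bar>lin ?h (ct \<omega>) N \<omega>\<bar> ^ r) \<le> ennreal w * (\<Sum>I\<in>?A. ennreal (S I \<omega>))" .
  qed
  also have "\<dots> = ennreal w * (\<Sum>I\<in>?A. (\<integral>\<^sup>+\<omega>. ennreal (S I \<omega>) \<partial>Q))"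
    using Sm by (subst nn_integral_cmult) (auto simp: nn_integral_sum simp del: sum_ennreal)
  also have "\<dots> \<le> ennreal w * (\<Sum>I\<in>?A. ennreal (exp (mconst r) ^ n * sqrt t ^ r))"
  proof (intro mult_left_mono sum_mono)
    fix I assume I: "I \<in> ?A"
    show "(\<integral>\<^sup>+\<omega>. ennreal (S I \<omega>) \<partial>Q) \<le> ennreal (exp (mconst r) ^ n * sqrt t ^ r)"
      using sig_abs_moment[OF r N t I] by (cases "I = []") (auto simp: S_def)
  qed simp
  also have "\<dots> = ennreal w * ennreal (real (card ?A) * (exp (mconst r) ^ n * sqrt t ^ r))"
    using t by (subst sum_ennreal) auto
  also have "\<dots> = ennreal (ymom r * sqrt t ^ r)"
    using t w0 by (subst ennreal_mult[symmetric]) (auto simp: ymom_def w_def mult_ac)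
  finally show ?thesis .
qed

lemma X_approximation:
  assumes t: "0 < t" "t \<le> \<delta>"
  shows "\<exists>C\<ge>0. \<forall>N>0. n2 (\<lambda>\<omega>. c [] t \<omega> - (cc \<omega> [] + lin (t / real N) (ct \<omega>) N \<omega>)) \<le> ennreal (econst n * t ^ Suc n + C / real N)"
proof -
  obtain C where C: "C \<ge> 0" "\<And>N k. N > 0 \<Longrightarrow> k \<le> N \<Longrightarrow>
     n2 (\<lambda>\<omega>. c [] (real k * (t / real N)) \<omega> - (\<Sum>I\<in>words d n. c (I @ []) 0 \<omega> * sig (t / real N) I k \<omega>))
       \<le> ennreal (econst n * t ^ Suc n + C / real N)"
    using taylor_approximation[OF t, of "[]" n] by auto
  have "n2 (\<lambda>\<omega>. c [] t \<omega> - (cc \<omega> [] + lin (t / real N) (ct \<omega>) N \<omega>)) \<le> ennreal (econst n * t ^ Suc n + C / real N)" if N: "N > 0" for N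
  proof -
    have "n2 (\<lambda>\<omega>. c [] t \<omega> - (cc \<omega> [] + lin (t / real N) (ct \<omega>) N \<omega>))
       = n2 (\<lambda>\<omega>. c [] t \<omega> - (\<Sum>I\<in>words d n. c (I @ []) 0 \<omega> * sig (t / real N) I N \<omega>))"
    proof (rule nn_integral_cong_AE)
      show "AE \<omega> in Q. ennreal ((c [] t \<omega> - (cc \<omega> [] + lin (t / real N) (ct \<omega>) N \<omega>))\<^sup>2)
         = ennreal ((c [] t \<omega> - (\<Sum>I\<in>words d n. c (I @ []) 0 \<omega> * sig (t / real N) I N \<omega>))\<^sup>2)"
        using AE_cc
      proof eventually_elim
        case (elim \<omega>)
        have nil: "[] \<in> words d n" by (simp add: words_def)
        have "(\<Sum>I\<in>words d n. c (I @ []) 0 \<omega> * sig (t / real N) I N \<omega>) = (\<Sum>I\<in>words d n. cc \<omega> I * sig (t / real N) I N \<omega>)"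
          unfolding elim by (intro sum.cong) (auto simp: coeffs_def words_def)
        also have "\<dots> = cc \<omega> [] + (\<Sum>I\<in>words d n - {[]}. cc \<omega> I * sig (t / real N) I N \<omega>)"
          by (subst sum.remove[OF finite_words nil]) simp
        also have "(\<Sum>I\<in>words d n - {[]}. cc \<omega> I * sig (t / real N) I N \<omega>) = (\<Sum>I\<in>words d n - {[]}. ct \<omega> I * sig (t / real N) I N \<omega>)"
          by (intro sum.cong) (auto simp: ct_def)
        also have "\<dots> = lin (t / real N) (ct \<omega>) N \<omega>"
          unfolding lin_eq[OF finite_words supp_ct] by (subst sum.remove[OF finite_words nil, of "\<lambda>I. ct \<omega> I * sig (t / real N) I N \<omega>"]) (simp add: ct_def)
        finally show ?case by simp
      qed
    qed
    also have "\<dots> \<le> ennreal (econst n * t ^ Suc n + C / real N)" using C(2)[OF N order.refl] N by simp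
    finally show ?thesis .
  qed
  then show ?thesis using C(1) by blast
qed

end

section \<open>The expansion as a Taylor series in star powers\<close>

lemma sum_list_le_twice: "set ks \<subseteq> {0, 1, 2} \<Longrightarrow> sum_list ks \<le> 2 * length ks" for ks :: "nat list"
  by (induction ks) auto

text \<open>The derivatives of f at the initial value, cut off above n + 1 so that the shifted
  Taylor sums close. The cut-off does not touch the orders that occur in the expansion.\<close>

definition expansion_coeff :: "(real \<Rightarrow> real) \<Rightarrow> nat \<Rightarrow> (nat list \<Rightarrow> real \<Rightarrow> 'a \<Rightarrow> real) \<Rightarrow> 'a \<Rightarrow> nat \<Rightarrow> real" where
  "expansion_coeff f n c \<omega> k = (if k \<le> Suc n then (deriv ^^ k) f (c [] 0 \<omega>) else 0)"

lemma supp_coeffs: "supp (coeffs d n c \<omega>) \<subseteq> words d n"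
  by (auto simp: supp_def coeffs_def words_def)

text \<open>The derivatives that occur have order at most 2l, and l <= ceil(n/2) gives 2l <= n + 1,
  so the polynomial of degree n + 1 supplies all of them. The leading summand
  \<open>f (c [] 0 \<omega>)\<close> is the term l = 0.\<close>

lemma expansion_eq:
  "expansion f d n c \<omega> t = (\<Sum>l\<le>nat \<lceil>real n / 2\<rceil>.
     taylor_lc d (Suc n) ((coeffs d n c \<omega>)([] := 0)) (expansion_coeff f n c \<omega>) (word []) (replicate l 0) * (t ^ l / fact l))"
proof -
  define m where "m = nat \<lceil>real n / 2\<rceil>"
  have m1: "2 * m \<le> Suc n" unfolding m_def by linarith
  define \<tau> where "\<tau> l = taylor_lc d (Suc n) ((coeffs d n c \<omega>)([] := 0)) (expansion_coeff f n c \<omega>) (word []) (replicate l 0)" for l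
  have \<tau>G: "\<tau> l = (\<Sum>ks\<in>{ks. length ks = l \<and> set ks \<subseteq> {0, 1, 2}}. (deriv ^^ sum_list ks) f (c [] 0 \<omega>) * Gseq (coeffs d n c \<omega>) ks (word []) [])"
    if l: "l \<le> m" for l
  proof -
    have "\<tau> l = (\<Sum>ks\<in>{ks. length ks = l \<and> set ks \<subseteq> {0, 1, 2}}. expansion_coeff f n c \<omega> (sum_list ks) * Gseq (coeffs d n c \<omega>) ks (word []) [])"
      unfolding \<tau>_def
      by (rule taylor_lc_replicate_0[OF supp_coeffs, where ?L2.0=0]) (auto simp: words_def expansion_coeff_def)
    also have "\<dots> = (\<Sum>ks\<in>{ks. length ks = l \<and> set ks \<subseteq> {0, 1, 2}}. (deriv ^^ sum_list ks) f (c [] 0 \<omega>) * Gseq (coeffs d n c \<omega>) ks (word []) [])"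
    proof (rule sum.cong[OF refl])
      fix ks :: "nat list" assume ks: "ks \<in> {ks. length ks = l \<and> set ks \<subseteq> {0, 1, 2}}"
      then have "sum_list ks \<le> 2 * l" using sum_list_le_twice[of ks] by auto
      then have "sum_list ks \<le> Suc n" using l m1 by linarith
      then show "expansion_coeff f n c \<omega> (sum_list ks) * Gseq (coeffs d n c \<omega>) ks (word []) []
         = (deriv ^^ sum_list ks) f (c [] 0 \<omega>) * Gseq (coeffs d n c \<omega>) ks (word []) []"
        by (simp add: expansion_coeff_def)
    qed
    finally show ?thesis .
  qed
  have "{ks :: nat list. length ks = 0 \<and> set ks \<subseteq> {0, 1, 2}} = {[]}" by auto
  then have \<tau>0: "\<tau> 0 = f (c [] 0 \<omega>)" using \<tau>G[of 0] by (simp add: Gseq_def word_def)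
  have "(\<Sum>l\<le>m. \<tau> l * (t ^ l / fact l)) = \<tau> 0 + (\<Sum>l = 1..m. \<tau> l * (t ^ l / fact l))"
    by (simp add: atMost_atLeast0 sum.atLeast_Suc_atMost)
  also have "(\<Sum>l = 1..m. \<tau> l * (t ^ l / fact l)) = (\<Sum>l = 1..m. (1 / fact l) *
      (\<Sum>ks\<in>{ks. length ks = l \<and> set ks \<subseteq> {0, 1, 2}}. (deriv ^^ sum_list ks) f (c [] 0 \<omega>) * Gseq (coeffs d n c \<omega>) ks (word []) []) * t ^ l)"
    by (intro sum.cong refl) (simp add: \<tau>G)
  finally show ?thesis unfolding expansion_def \<tau>0 unfolding m_def \<tau>_def by simp
qed

lemma qs_pow_measurable:
  assumes x: "\<And>K. (\<lambda>\<omega>. x \<omega> K) \<in> borel_measurable G" "\<And>\<omega>. supp (x \<omega>) \<subseteq> words d L"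
  shows "(\<lambda>\<omega>. qs_pow d (x \<omega>) k K) \<in> borel_measurable G"
proof (induction k arbitrary: K)
  case (Suc k)
  show ?case unfolding qs_pow.simps qs_eq_sum_words[OF x(2) supp_qs_pow[OF x(2)]]
    by (intro borel_measurable_sum borel_measurable_times x(1) Suc borel_measurable_const)
qed simp

text \<open>Measurability is read off from the star powers, which are sums over fixed finite sets of
  words; the operators themselves sum over supports that vary with \<omega>.\<close>

lemma expansion_measurable:
  assumes f: "Cp (Suc n) f" and c: "\<And>I. I \<in> words d n \<Longrightarrow> c I 0 \<in> borel_measurable G"
  shows "(\<lambda>\<omega>. expansion f d n c \<omega> t) \<in> borel_measurable G"
proof -
  have x: "(\<lambda>\<omega>. ((coeffs d n c \<omega>)([] := 0)) K) \<in> borel_measurable G" for K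
  proof (cases "K \<in> words d n \<and> K \<noteq> []")
    case True
    then have "(\<lambda>\<omega>. ((coeffs d n c \<omega>)([] := 0)) K) = c K 0" by (auto simp: coeffs_def words_def fun_eq_iff)
    then show ?thesis using c[of K] True by simp
  next
    case False
    then have "(\<lambda>\<omega>. ((coeffs d n c \<omega>)([] := 0)) K) = (\<lambda>\<omega>. 0)" by (auto simp: coeffs_def words_def fun_eq_iff)
    then show ?thesis by simp
  qed
  have s: "supp ((coeffs d n c \<omega>)([] := 0)) \<subseteq> words d n" for \<omega>
    using supp_coeffs[of d n c \<omega>] by (auto simp: supp_def split: if_splits)
  have a: "(\<lambda>\<omega>. expansion_coeff f n c \<omega> k) \<in> borel_measurable G" for k
  proof (cases "k \<le> Suc n")
    case True
    have "c [] 0 \<in> borel_measurable G" by (rule c) (simp add: words_def)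
    from measurable_compose[OF this Cp_measurable[OF f True]] show ?thesis using True by (simp add: expansion_coeff_def)
  qed (simp add: expansion_coeff_def)
  show ?thesis unfolding expansion_eq taylor_lc_def qs_word_Nil_right
    by (intro borel_measurable_sum borel_measurable_times borel_measurable_divide a qs_pow_measurable[OF x s] borel_measurable_const)
qed

section \<open>Expectation of f of the process against its expansion\<close>

context differentiable_process begin

text \<open>Three errors of order t^((n+1)/2) add up: the remainder of X, through the Lipschitz
  bound on f; the Taylor remainder of f, through moments of the increment; and the surplus powers of
  t in the expectation of the Taylor polynomial. All analytic constants are parameters, so that the
  bound does not depend on the measure.\<close>

lemma expectation_expansion:
  assumes f: "Cp (Suc n) f" and B: "\<And>x. \<bar>deriv f x\<bar> \<le> B"
    and A: "\<And>k x. k \<le> Suc n \<Longrightarrow> \<bar>x\<bar> \<le> K \<Longrightarrow> \<bar>(deriv ^^ k) f x\<bar> \<le> A"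
    and Ct: "0 \<le> Ct" "\<And>x y. \<bar>x\<bar> \<le> K \<Longrightarrow>
       \<bar>f (x + y) - (\<Sum>k\<le>Suc n. (deriv ^^ k) f x / fact k * y ^ k)\<bar> \<le> Ct * (\<bar>y\<bar> ^ Suc n + \<bar>y\<bar> ^ (Suc n + p))"
    and bt: "0 \<le> bt" "\<And>x a M. supp x \<subseteq> words d n \<Longrightarrow> (\<forall>M. \<bar>x M\<bar> \<le> K) \<Longrightarrow> (\<forall>k\<le>Suc n. \<bar>a k\<bar> \<le> A) \<Longrightarrow>
       \<bar>taylor_lc d (Suc n) x a (word []) M\<bar> \<le> bt"
    and t: "0 < t" "t \<le> \<delta>"
  shows "integrable Q (\<lambda>\<omega>. f (c [] t \<omega>))" "integrable Q (\<lambda>\<omega>. expansion f d n c \<omega> t)"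
    "\<bar>(\<integral>\<omega>. f (c [] t \<omega>) \<partial>Q) - (\<integral>\<omega>. expansion f d n c \<omega> t \<partial>Q)\<bar>
      \<le> (B * (econst n + 1) + Ct * (ymom (Suc n) + ymom (Suc n + p)) + real (Suc n * Suc n) * bt) * sqrt t ^ Suc n"
proof -
  have t1: "t \<le> 1" using t delta by simp
  \<comment> \<open>s is the target order. It also balances |D| <= D^2/s + s, which turns the
    L2-bound t^(n+1) = s^2 into an L1-bound of order s.\<close>
  define s where "s = sqrt t ^ Suc n"
  have s0: "s > 0" using t by (simp add: s_def)
  have s2: "s * s = t ^ Suc n" using t by (simp add: s_def flip: power_mult_distrib del: power_Suc)
  have B0: "0 \<le> B" using B[of 0] by linarith
  have A0: "0 \<le> A" using A[of 0 0] K by simp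
  have e0: "0 \<le> econst n" using K by (simp add: econst_def)
  define a where "a k \<omega> = (if k \<le> Suc n then (deriv ^^ k) f (cc \<omega> []) else 0)" for k \<omega>
  have am: "a k \<in> borel_measurable (F 0)" for k
  proof (cases "k \<le> Suc n")
    case True
    have "(\<lambda>\<omega>. (deriv ^^ k) f (cc \<omega> [])) \<in> borel_measurable (F 0)"
      by (rule measurable_compose[OF cc_measurable Cp_measurable[OF f True]])
    then show ?thesis using True by (simp add: a_def[abs_def])
  qed (simp add: a_def[abs_def])
  have ab: "\<bar>a k \<omega>\<bar> \<le> A" for k \<omega> using A[of k "cc \<omega> []"] abs_cc A0 by (simp add: a_def)
  define Y where "Y N \<omega> = lin (t / real N) (ct \<omega>) N \<omega>" for N \<omega>
  have Ym: "Y N \<in> borel_measurable Q" if "N > 0" for N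
    unfolding Y_def[abs_def] using that t by (intro lin_bfam_measurable[OF bfam_ct]) simp
  define T where "T N \<omega> = (\<Sum>k\<le>Suc n. a k \<omega> / fact k * Y N \<omega> ^ k)" for N \<omega>
  \<comment> \<open>A star power with k <= n + 1 factors of length at most n has words no longer
    than this.\<close>
  let ?L = "Suc n * Suc n"
  define \<tau> where "\<tau> l \<omega> = taylor_lc d (Suc n) (ct \<omega>) (\<lambda>k. a k \<omega>) (word []) (replicate l 0)" for l \<omega>
  have \<tau>_eq: "\<tau> l \<omega> = (\<Sum>k\<le>Suc n. a k \<omega> / fact k * qs_pow d (ct \<omega>) k (replicate l 0))" for l \<omega>
    by (simp add: \<tau>_def taylor_lc_def)
  have \<tau>b: "\<bar>\<tau> l \<omega>\<bar> \<le> bt" for l \<omega> unfolding \<tau>_def using supp_ct abs_ct ab by (intro bt(2)) auto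
  have gk: "(\<lambda>\<omega>. a k \<omega> / fact k) \<in> borel_measurable (F 0)" "\<bar>a k \<omega> / fact k\<bar> \<le> A" for k \<omega>
  proof -
    show "(\<lambda>\<omega>. a k \<omega> / fact k) \<in> borel_measurable (F 0)" using am by simp
    have "\<bar>a k \<omega> / fact k\<bar> \<le> \<bar>a k \<omega>\<bar> / 1" unfolding abs_divide by (intro divide_left_mono) (auto simp: fact_ge_1)
    then show "\<bar>a k \<omega> / fact k\<bar> \<le> A" using ab[of k \<omega>] by simp
  qed
  have pm: "(\<lambda>\<omega>. qs_pow d (ct \<omega>) k M) \<in> borel_measurable (F 0)" for k M
    using bfam_qs_pow[OF bfam_ct, of k] by (simp add: bfam_def)
  have ipow: "integrable Q (\<lambda>\<omega>. a k \<omega> / fact k * qs_pow d (ct \<omega>) k M)" for k M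
  proof -
    obtain L b where b: "\<And>\<omega> M. \<bar>qs_pow d (ct \<omega>) k M\<bar> \<le> b" using bfamE[OF bfam_qs_pow[OF bfam_ct, of k]] by metis
    show ?thesis
    proof (rule integrable_const_bound[where B="A * b"])
      show "(\<lambda>\<omega>. a k \<omega> / fact k * qs_pow d (ct \<omega>) k M) \<in> borel_measurable Q"
        using measurable_F_Q[OF gk(1)] measurable_F_Q[OF pm] by (intro borel_measurable_times)
      show "AE \<omega> in Q. norm (a k \<omega> / fact k * qs_pow d (ct \<omega>) k M) \<le> A * b"
      proof (rule AE_I2)
        fix \<omega>
        have "\<bar>a k \<omega> / fact k\<bar> * \<bar>qs_pow d (ct \<omega>) k M\<bar> \<le> A * b" using gk(2) b A0 by (intro mult_mono) auto
        then show "norm (a k \<omega> / fact k * qs_pow d (ct \<omega>) k M) \<le> A * b" unfolding real_norm_def abs_mult .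
      qed
    qed
  qed
  have i\<tau>: "integrable Q (\<tau> l)" for l unfolding \<tau>_eq[abs_def] using ipow by (intro Bochner_Integration.integrable_sum)
  have Lk: "supp (qs_pow d (ct \<omega>) k) \<subseteq> words d ?L" if "k \<le> Suc n" for k \<omega>
  proof -
    have "k * n \<le> ?L" using mult_le_mono[OF that, of n "Suc n"] by simp
    then show ?thesis using supp_qs_pow[OF supp_ct, of \<omega> k] words_mono[of "k * n" ?L d] by blast
  qed
  have iTk: "integrable Q (\<lambda>\<omega>. a k \<omega> / fact k * Y N \<omega> ^ k)" if "N > 0" "k \<le> Suc n" for N k
    unfolding Y_def using expectation_power_tendsto(1)[OF bfam_ct Lk[OF that(2)] t(1) t1 gk that(1)] .
  have iT: "integrable Q (T N)" if "N > 0" for N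
    unfolding T_def[abs_def] using iTk[OF that] by (intro Bochner_Integration.integrable_sum) auto
  have lim: "(\<lambda>N. \<integral>\<omega>. T N \<omega> \<partial>Q) \<longlonglongrightarrow> (\<Sum>l\<le>?L. (\<integral>\<omega>. \<tau> l \<omega> \<partial>Q) * (t ^ l / fact l))"
  proof -
    have "(\<lambda>N. \<Sum>k\<le>Suc n. \<integral>\<omega>. a k \<omega> / fact k * Y N \<omega> ^ k \<partial>Q) \<longlonglongrightarrow>
       (\<Sum>k\<le>Suc n. \<Sum>l\<le>?L. (\<integral>\<omega>. a k \<omega> / fact k * qs_pow d (ct \<omega>) k (replicate l 0) \<partial>Q) * (t ^ l / fact l))"
      unfolding Y_def
      by (intro tendsto_sum expectation_power_tendsto(2)[OF bfam_ct Lk t(1) t1 gk]) auto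
    also have "(\<Sum>k\<le>Suc n. \<Sum>l\<le>?L. (\<integral>\<omega>. a k \<omega> / fact k * qs_pow d (ct \<omega>) k (replicate l 0) \<partial>Q) * (t ^ l / fact l))
       = (\<Sum>l\<le>?L. (\<integral>\<omega>. \<tau> l \<omega> \<partial>Q) * (t ^ l / fact l))"
      unfolding \<tau>_eq by (subst sum.swap) (simp only: Bochner_Integration.integral_sum[OF ipow] sum_distrib_right)
    finally have l: "(\<lambda>N. \<Sum>k\<le>Suc n. \<integral>\<omega>. a k \<omega> / fact k * Y N \<omega> ^ k \<partial>Q) \<longlonglongrightarrow> (\<Sum>l\<le>?L. (\<integral>\<omega>. \<tau> l \<omega> \<partial>Q) * (t ^ l / fact l))" .
    have ev: "\<forall>\<^sub>F N in sequentially. (\<Sum>k\<le>Suc n. \<integral>\<omega>. a k \<omega> / fact k * Y N \<omega> ^ k \<partial>Q) = (\<integral>\<omega>. T N \<omega> \<partial>Q)"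
      using eventually_gt_at_top[of 0]
    proof eventually_elim
      case (elim N)
      show ?case unfolding T_def using iTk[OF elim] by (intro Bochner_Integration.integral_sum[symmetric]) auto
    qed
    show ?thesis by (rule Lim_transform_eventually[OF l ev])
  qed
  obtain C where C: "C \<ge> 0" "\<And>N. N > 0 \<Longrightarrow> n2 (\<lambda>\<omega>. c [] t \<omega> - (cc \<omega> [] + Y N \<omega>)) \<le> ennreal (econst n * t ^ Suc n + C / real N)"
    using X_approximation[OF t] unfolding Y_def by blast
  have Xm [measurable]: "c [] t \<in> borel_measurable Q" using t by (intro c_measurable) auto
  have x0m [measurable]: "(\<lambda>\<omega>. cc \<omega> []) \<in> borel_measurable Q" by (rule measurable_F_Q[OF cc_measurable])
  have fm: "f \<in> borel_measurable borel" using Cp_measurable[OF f, of 0] by simp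
  have fX: "(\<lambda>\<omega>. f (c [] t \<omega>)) \<in> borel_measurable Q" by (rule measurable_compose[OF Xm fm])
  define ym where "ym = ymom (Suc n) + ymom (Suc n + p)"
  have ym0: "0 \<le> ym" using ymom_nonneg by (simp add: ym_def)
  \<comment> \<open>The total error at mesh t/N; only the term with C depends on N and disappears in
    the limit.\<close>
  define \<beta> where "\<beta> N = B * ((econst n * t ^ Suc n + C / real N) / s + s) + Ct * (ym * s)" for N
  have \<beta>0: "0 \<le> \<beta> N" for N unfolding \<beta>_def using B0 e0 C(1) s0 t Ct(1) ym0
    by (intro add_nonneg_nonneg mult_nonneg_nonneg divide_nonneg_nonneg) auto
  have diff: "(\<integral>\<^sup>+\<omega>. ennreal (norm (f (c [] t \<omega>) - T N \<omega>)) \<partial>Q) \<le> ennreal (\<beta> N)" if N: "N > 0" for N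
  proof -
    note [measurable] = Ym[OF N]
    define D where "D \<omega> = c [] t \<omega> - (cc \<omega> [] + Y N \<omega>)" for \<omega>
    have [measurable]: "D \<in> borel_measurable Q" unfolding D_def[abs_def] by measurable
    have pt: "norm (f (c [] t \<omega>) - T N \<omega>) \<le> B * ((D \<omega>)\<^sup>2 / s + s) + Ct * (\<bar>Y N \<omega>\<bar> ^ Suc n + \<bar>Y N \<omega>\<bar> ^ (Suc n + p))" for \<omega>
    proof -
      have T: "T N \<omega> = (\<Sum>k\<le>Suc n. (deriv ^^ k) f (cc \<omega> []) / fact k * Y N \<omega> ^ k)"
        unfolding T_def a_def by (intro sum.cong) auto
      have "\<bar>f (c [] t \<omega>) - f (cc \<omega> [] + Y N \<omega>)\<bar> \<le> B * \<bar>D \<omega>\<bar>"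
        unfolding D_def by (rule lipschitz_of_deriv[OF f B])
      also have "\<bar>D \<omega>\<bar> \<le> (D \<omega>)\<^sup>2 / s + s"
      proof -
        have "0 \<le> (\<bar>D \<omega>\<bar> - s)\<^sup>2 / s" using s0 by simp
        also have "\<dots> = (D \<omega>)\<^sup>2 / s + s - 2 * \<bar>D \<omega>\<bar>" using s0 by (simp add: power2_diff field_simps) (simp add: power2_eq_square)
        finally show ?thesis by linarith
      qed
      finally have 1: "\<bar>f (c [] t \<omega>) - f (cc \<omega> [] + Y N \<omega>)\<bar> \<le> B * ((D \<omega>)\<^sup>2 / s + s)" using B0 by (simp add: mult_left_mono)
      have 2: "\<bar>f (cc \<omega> [] + Y N \<omega>) - T N \<omega>\<bar> \<le> Ct * (\<bar>Y N \<omega>\<bar> ^ Suc n + \<bar>Y N \<omega>\<bar> ^ (Suc n + p))"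
        unfolding T by (rule Ct(2)[OF abs_cc])
      show ?thesis using 1 2 unfolding real_norm_def by linarith
    qed
    have "(\<integral>\<^sup>+\<omega>. ennreal (norm (f (c [] t \<omega>) - T N \<omega>)) \<partial>Q)
       \<le> (\<integral>\<^sup>+\<omega>. ennreal B * (ennreal (1 / s) * ennreal ((D \<omega>)\<^sup>2) + ennreal s)
            + ennreal Ct * (ennreal (\<bar>Y N \<omega>\<bar> ^ Suc n) + ennreal (\<bar>Y N \<omega>\<bar> ^ (Suc n + p))) \<partial>Q)"
    proof (rule nn_integral_mono)
      fix \<omega>
      have gen: "ennreal (b * (u / s + s) + k * (v + w)) = ennreal b * (ennreal (1 / s) * ennreal u + ennreal s) + ennreal k * (ennreal v + ennreal w)"
        if "0 \<le> b" "0 \<le> u" "0 \<le> k" "0 \<le> v" "0 \<le> w" for b u k v w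
      proof -
        have "ennreal (1 / s) * ennreal u = ennreal (u / s)" using that s0 by (subst ennreal_mult[symmetric]) auto
        then show ?thesis using that s0 by (simp add: ennreal_plus ennreal_mult)
      qed
      show "ennreal (norm (f (c [] t \<omega>) - T N \<omega>)) \<le> ennreal B * (ennreal (1 / s) * ennreal ((D \<omega>)\<^sup>2) + ennreal s)
            + ennreal Ct * (ennreal (\<bar>Y N \<omega>\<bar> ^ Suc n) + ennreal (\<bar>Y N \<omega>\<bar> ^ (Suc n + p)))"
        using ennreal_leI[OF pt[of \<omega>]] B0 Ct(1) by (subst gen[symmetric]) auto
    qed
    also have "\<dots> = ennreal B * (ennreal (1 / s) * n2 D + ennreal s)
        + ennreal Ct * ((\<integral>\<^sup>+\<omega>. ennreal (\<bar>Y N \<omega>\<bar> ^ Suc n) \<partial>Q) + (\<integral>\<^sup>+\<omega>. ennreal (\<bar>Y N \<omega>\<bar> ^ (Suc n + p)) \<partial>Q))"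
      by (simp add: nn_integral_add nn_integral_cmult emeasure_space_1 del: power_Suc)
    also have "\<dots> \<le> ennreal B * (ennreal (1 / s) * ennreal (econst n * t ^ Suc n + C / real N) + ennreal s)
        + ennreal Ct * (ennreal (ymom (Suc n) * s) + ennreal (ymom (Suc n + p) * s))"
    proof (intro add_mono mult_left_mono order.refl)
      show "n2 D \<le> ennreal (econst n * t ^ Suc n + C / real N)" unfolding D_def by (rule C(2)[OF N])
      show "(\<integral>\<^sup>+\<omega>. ennreal (\<bar>Y N \<omega>\<bar> ^ Suc n) \<partial>Q) \<le> ennreal (ymom (Suc n) * s)"
        unfolding Y_def s_def by (rule Y_moment[OF _ N t(1) t1]) simp
      have "sqrt t ^ (Suc n + p) \<le> s" unfolding s_def using t t1 by (intro power_decreasing) auto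
      then have "ennreal (ymom (Suc n + p) * sqrt t ^ (Suc n + p)) \<le> ennreal (ymom (Suc n + p) * s)"
        using ymom_nonneg by (intro ennreal_leI mult_left_mono) auto
      moreover have "1 \<le> Suc n + p" by simp
      ultimately show "(\<integral>\<^sup>+\<omega>. ennreal (\<bar>Y N \<omega>\<bar> ^ (Suc n + p)) \<partial>Q) \<le> ennreal (ymom (Suc n + p) * s)"
        unfolding Y_def using order_trans[OF Y_moment[OF _ N t(1) t1]] by blast
    qed auto
    also have "\<dots> = ennreal (\<beta> N)"
    proof -
      have gen: "ennreal b * (ennreal (1 / s) * ennreal u + ennreal s) + ennreal k * (ennreal v + ennreal w) = ennreal (b * (u / s + s) + k * (v + w))"
        if "0 \<le> b" "0 \<le> u" "0 \<le> k" "0 \<le> v" "0 \<le> w" for b u k v w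
      proof -
        have "ennreal (1 / s) * ennreal u = ennreal (u / s)" using that s0 by (subst ennreal_mult[symmetric]) auto
        then show ?thesis using that s0 by (simp add: ennreal_plus ennreal_mult)
      qed
      show ?thesis unfolding \<beta>_def ym_def distrib_right
        using B0 Ct(1) e0 C(1) t s0 ymom_nonneg by (subst gen) (auto simp: distrib_right)
    qed
    finally show ?thesis .
  qed
  have iD: "integrable Q (\<lambda>\<omega>. f (c [] t \<omega>) - T N \<omega>)" if N: "N > 0" for N
  proof (rule integrableI_bounded)
    show "(\<lambda>\<omega>. f (c [] t \<omega>) - T N \<omega>) \<in> borel_measurable Q"
      using fX borel_measurable_integrable[OF iT[OF N]] by simp
    show "(\<integral>\<^sup>+\<omega>. ennreal (norm (f (c [] t \<omega>) - T N \<omega>)) \<partial>Q) < \<infinity>"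
      by (rule le_less_trans[OF diff[OF N]]) simp
  qed
  have "integrable Q (\<lambda>\<omega>. (f (c [] t \<omega>) - T 1 \<omega>) + T 1 \<omega>)"
    by (intro Bochner_Integration.integrable_add iD iT) auto
  then show iX: "integrable Q (\<lambda>\<omega>. f (c [] t \<omega>))" by simp
  have le\<beta>: "\<bar>(\<integral>\<omega>. f (c [] t \<omega>) \<partial>Q) - (\<integral>\<omega>. T N \<omega> \<partial>Q)\<bar> \<le> \<beta> N" if N: "N > 0" for N
  proof -
    have "ennreal \<bar>\<integral>\<omega>. f (c [] t \<omega>) - T N \<omega> \<partial>Q\<bar> \<le> ennreal (\<beta> N)"
      using order_trans[OF integral_norm_bound_ennreal[OF iD[OF N]] diff[OF N]] by simp
    then have "\<bar>\<integral>\<omega>. f (c [] t \<omega>) - T N \<omega> \<partial>Q\<bar> \<le> \<beta> N" using \<beta>0 by (simp add: ennreal_le_iff)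
    then show ?thesis using iX iT[OF N] by simp
  qed
  have \<beta>lim: "\<beta> \<longlonglongrightarrow> B * ((econst n * t ^ Suc n + 0) / s + s) + Ct * (ym * s)"
    unfolding \<beta>_def[abs_def] using s0 by (intro tendsto_intros lim_const_over_n) auto
  have main: "\<bar>(\<integral>\<omega>. f (c [] t \<omega>) \<partial>Q) - (\<Sum>l\<le>?L. (\<integral>\<omega>. \<tau> l \<omega> \<partial>Q) * (t ^ l / fact l))\<bar> \<le> B * (econst n + 1) * s + Ct * ym * s"
  proof -
    have "\<bar>(\<integral>\<omega>. f (c [] t \<omega>) \<partial>Q) - (\<Sum>l\<le>?L. (\<integral>\<omega>. \<tau> l \<omega> \<partial>Q) * (t ^ l / fact l))\<bar> \<le> B * ((econst n * t ^ Suc n + 0) / s + s) + Ct * (ym * s)"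
      by (rule LIMSEQ_le[OF tendsto_rabs[OF tendsto_diff[OF tendsto_const lim]] \<beta>lim]) (use le\<beta> in \<open>auto intro!: exI[of _ 1]\<close>)
    also have "(econst n * t ^ Suc n + 0) / s = econst n * s" unfolding s2[symmetric] using s0 by simp
    finally show ?thesis by (simp add: algebra_simps)
  qed
  define m where "m = nat \<lceil>real n / 2\<rceil>"
  have m1: "2 * m \<le> Suc n" "n \<le> 2 * m" unfolding m_def by linarith+
  have mL: "m \<le> ?L" using m1 by simp
  \<comment> \<open>Equality holds almost surely because the cut-off coefficients \<open>cc\<close>
    agree with the initial ones only outside a null set.\<close>
  have ex: "AE \<omega> in Q. expansion f d n c \<omega> t = (\<Sum>l\<le>m. \<tau> l \<omega> * (t ^ l / fact l))"
    using AE_cc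
  proof eventually_elim
    case (elim \<omega>)
    have c0: "cc \<omega> [] = c [] 0 \<omega>" unfolding elim by (simp add: coeffs_def)
    have "a k \<omega> = expansion_coeff f n c \<omega> k" for k by (simp add: a_def expansion_coeff_def c0)
    then show ?case unfolding expansion_eq m_def \<tau>_def ct_def elim[symmetric] by simp
  qed
  have iE: "integrable Q (\<lambda>\<omega>. \<Sum>l\<le>m. \<tau> l \<omega> * (t ^ l / fact l))" using i\<tau> by (intro Bochner_Integration.integrable_sum integrable_mult_left) auto
  have em: "(\<lambda>\<omega>. expansion f d n c \<omega> t) \<in> borel_measurable Q"
    by (rule measurable_F_Q[OF expansion_measurable[OF f]]) (auto intro!: c_adapted simp: words_def)
  show iE': "integrable Q (\<lambda>\<omega>. expansion f d n c \<omega> t)"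
    using em iE ex by (subst integrable_cong_AE) auto
  have Eex: "(\<integral>\<omega>. expansion f d n c \<omega> t \<partial>Q) = (\<Sum>l\<le>m. (\<integral>\<omega>. \<tau> l \<omega> \<partial>Q) * (t ^ l / fact l))"
  proof -
    have "(\<integral>\<omega>. expansion f d n c \<omega> t \<partial>Q) = (\<integral>\<omega>. (\<Sum>l\<le>m. \<tau> l \<omega> * (t ^ l / fact l)) \<partial>Q)"
      using em iE by (intro integral_cong_AE ex) auto
    also have "\<dots> = (\<Sum>l\<le>m. (\<integral>\<omega>. \<tau> l \<omega> \<partial>Q) * (t ^ l / fact l))"
      using i\<tau> by (subst Bochner_Integration.integral_sum) auto
    finally show ?thesis .
  qed
  have tail: "\<bar>(\<Sum>l\<le>?L. (\<integral>\<omega>. \<tau> l \<omega> \<partial>Q) * (t ^ l / fact l)) - (\<Sum>l\<le>m. (\<integral>\<omega>. \<tau> l \<omega> \<partial>Q) * (t ^ l / fact l))\<bar> \<le> real ?L * bt * s"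
  proof -
    have E\<tau>: "\<bar>\<integral>\<omega>. \<tau> l \<omega> \<partial>Q\<bar> \<le> bt" for l
    proof -
      have "\<bar>\<integral>\<omega>. \<tau> l \<omega> \<partial>Q\<bar> \<le> (\<integral>\<omega>. \<bar>\<tau> l \<omega>\<bar> \<partial>Q)" by (rule integral_abs_bound)
      also have "\<dots> \<le> (\<integral>\<omega>. bt \<partial>Q)" using i\<tau> \<tau>b by (intro integral_mono) auto
      finally show ?thesis by (simp add: prob_space)
    qed
    have "{..?L} = {..m} \<union> {m<..?L}" using mL by auto
    then have "(\<Sum>l\<le>?L. (\<integral>\<omega>. \<tau> l \<omega> \<partial>Q) * (t ^ l / fact l)) = (\<Sum>l\<le>m. (\<integral>\<omega>. \<tau> l \<omega> \<partial>Q) * (t ^ l / fact l)) + (\<Sum>l\<in>{m<..?L}. (\<integral>\<omega>. \<tau> l \<omega> \<partial>Q) * (t ^ l / fact l))"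
      by (simp only:) (subst sum.union_disjoint, auto)
    then have "\<bar>(\<Sum>l\<le>?L. (\<integral>\<omega>. \<tau> l \<omega> \<partial>Q) * (t ^ l / fact l)) - (\<Sum>l\<le>m. (\<integral>\<omega>. \<tau> l \<omega> \<partial>Q) * (t ^ l / fact l))\<bar>
       \<le> (\<Sum>l\<in>{m<..?L}. \<bar>(\<integral>\<omega>. \<tau> l \<omega> \<partial>Q) * (t ^ l / fact l)\<bar>)"
      by (simp only: add_diff_cancel_left' sum_abs)
    also have "\<dots> \<le> (\<Sum>l\<in>{m<..?L}. bt * s)"
    proof (rule sum_mono)
      \<comment> \<open>From l > m and n <= 2m it follows that 2l >= n + 1, so t^l is at most s for
        t <= 1.\<close>
      fix l assume l: "l \<in> {m<..?L}"
      have "t ^ l = sqrt t ^ (2 * l)" using t by (simp add: power_mult)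
      also have "\<dots> \<le> s" unfolding s_def using t t1 l m1 by (intro power_decreasing) auto
      finally have "t ^ l \<le> s" .
      moreover have "t ^ l / fact l \<le> t ^ l / 1" using t by (intro divide_left_mono) (auto simp: fact_ge_1)
      ultimately have "\<bar>t ^ l / fact l\<bar> \<le> s" using t by simp
      then show "\<bar>(\<integral>\<omega>. \<tau> l \<omega> \<partial>Q) * (t ^ l / fact l)\<bar> \<le> bt * s"
        unfolding abs_mult using E\<tau> bt(1) by (intro mult_mono) auto
    qed
    also have "\<dots> = real (card {m<..?L}) * (bt * s)" by (simp only: sum_constant)
    also have "\<dots> \<le> real ?L * (bt * s)"
    proof (rule mult_right_mono)
      have "card {m<..?L} \<le> ?L" by (simp only: card_greaterThanAtMost diff_le_self)
      then show "real (card {m<..?L}) \<le> real ?L" by (rule of_nat_mono)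
    qed (use bt(1) s0 in simp)
    finally show ?thesis by (simp only: mult.assoc)
  qed
  show "\<bar>(\<integral>\<omega>. f (c [] t \<omega>) \<partial>Q) - (\<integral>\<omega>. expansion f d n c \<omega> t \<partial>Q)\<bar>
      \<le> (B * (econst n + 1) + Ct * (ymom (Suc n) + ymom (Suc n + p)) + real ?L * bt) * sqrt t ^ Suc n"
  proof -
    have "\<bar>(\<integral>\<omega>. f (c [] t \<omega>) \<partial>Q) - (\<integral>\<omega>. expansion f d n c \<omega> t \<partial>Q)\<bar>
       \<le> (B * (econst n + 1) * s + Ct * ym * s) + real ?L * bt * s"
      using main tail unfolding Eex by linarith
    then show ?thesis unfolding s_def ym_def by (simp only: distrib_right)
  qed
qed

end

section \<open>Conditioning on the initial information\<close>

text \<open>The density of the conditioned measure is at most 1 / \<open>measure M A\<close>. Sets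
  outside the sigma-algebra have measure 0 on both sides by convention, so convergence in
  probability is transferred without a measurability check.\<close>

lemma measure_uniform_measure_le:
  assumes "finite_measure M" "A \<in> sets M" "0 < measure M A"
  shows "measure (uniform_measure M A) S \<le> measure M S / measure M A"
proof (cases "S \<in> sets M")
  case True
  interpret finite_measure M by fact
  have "measure (uniform_measure M A) S = measure M (A \<inter> S) / measure M A"
    using assms True by (intro measure_uniform_measure) (auto simp: emeasure_eq_measure)
  also have "\<dots> \<le> measure M S / measure M A"
    using assms True by (intro divide_right_mono finite_measure_mono) auto
  finally show ?thesis .
next
  case False
  then show ?thesis using assms by (simp add: measure_notin_sets)
qed

lemma uniform_measure_tendsto_0:
  assumes "finite_measure M" "A \<in> sets M" "0 < measure M A" "(\<lambda>k. measure M (S k)) \<longlonglongrightarrow> 0"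
  shows "(\<lambda>k. measure (uniform_measure M A) (S k)) \<longlonglongrightarrow> 0"
proof (rule Lim_null_comparison)
  show "\<forall>\<^sub>F k in sequentially. norm (measure (uniform_measure M A) (S k)) \<le> measure M (S k) / measure M A"
    using measure_uniform_measure_le[OF assms(1-3)] by (intro always_eventually) simp
  show "(\<lambda>k. measure M (S k) / measure M A) \<longlonglongrightarrow> 0" using tendsto_divide[OF assms(4) tendsto_const[of "measure M A"]] assms(3) by simp
qed

lemma AE_uniform_measure_of_AE:
  assumes "A \<in> sets M" "AE x in M. P x"
  shows "AE x in uniform_measure M A. P x"
  using assms by (intro AE_uniform_measureI) auto

lemma uniform_measure_integral:
  fixes g :: "'a \<Rightarrow> real"
  assumes "finite_measure M" "A \<in> sets M" "0 < measure M A" and g: "g \<in> borel_measurable M"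
  shows "integrable (uniform_measure M A) g \<longleftrightarrow> integrable M (\<lambda>x. indicator A x * g x)"
    and "(\<integral>x. g x \<partial>uniform_measure M A) = (\<integral>x. indicator A x * g x \<partial>M) / measure M A"
proof -
  interpret finite_measure M by fact
  have U: "uniform_measure M A = density M (\<lambda>x. ennreal (indicator A x / measure M A))"
    unfolding uniform_measure_def
    by (intro density_cong)
       (use assms divide_ennreal[of 1 "measure M A"] in \<open>auto simp: indicator_def emeasure_eq_measure\<close>)
  have e: "(\<lambda>x. (indicator A x / measure M A) *\<^sub>R g x) = (\<lambda>x. (1 / measure M A) * (indicator A x * g x))" by auto
  show "integrable (uniform_measure M A) g \<longleftrightarrow> integrable M (\<lambda>x. indicator A x * g x)"
  proof -
    have m: "(\<lambda>x. indicator A x / measure M A) \<in> borel_measurable M" using assms by simp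
    have nn: "AE x in M. 0 \<le> indicator A x / measure M A" by simp
    show ?thesis unfolding U integrable_density[OF g m nn] e
      using assms by (subst integrable_mult_left_iff) auto
  qed
  show "(\<integral>x. g x \<partial>uniform_measure M A) = (\<integral>x. indicator A x * g x \<partial>M) / measure M A"
    unfolding U by (subst integral_density[OF g]) (use assms in \<open>auto simp: e\<close>)
qed

context brownian begin

text \<open>Conditioning on \<open>A\<close> keeps increments independent of the past, because
  \<open>A\<close> belongs to \<open>F 0\<close> and hence to every \<open>F s\<close> with s >= 0:
  the product formula for the intersection of \<open>A\<close> and \<open>A'\<close>, divided by the
  probability of \<open>A\<close>, is the one for \<open>A'\<close>.\<close>

lemma brownian_uniform_measure:
  assumes A: "A \<in> sets (F 0)" "0 < prob A"
  shows "brownian (uniform_measure Q A) F W d"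
proof -
  have AQ: "A \<in> sets Q" using A subalg[of 0] by (auto simp: subalgebra_def)
  have ne: "emeasure Q A \<noteq> 0" "emeasure Q A \<noteq> \<infinity>" using A by (auto simp: emeasure_eq_measure)
  show ?thesis
  proof (intro brownian.intro brownian_axioms.intro)
    show "prob_space (uniform_measure Q A)" by (rule prob_space_uniform_measure[OF ne])
    show "filtration (space (uniform_measure Q A)) F" using filt by simp
    fix r :: real show "subalgebra (uniform_measure Q A) (F r)" using subalg[of r] by (simp add: subalgebra_def)
  next
    show "std_BM (uniform_measure Q A) F d W"
      unfolding std_BM_def
    proof (intro conjI allI impI ballI)
      fix s t A' and B :: "(nat \<Rightarrow> real) set"
      assume st: "0 \<le> s" "s < t" and A': "A' \<in> sets (F s)" and B: "B \<in> sets (Pi\<^sub>M {1..d} (\<lambda>_. borel))"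
      let ?D = "{\<omega> \<in> space Q. (\<lambda>i\<in>{1..d}. W i t \<omega> - W i s \<omega>) \<in> B}"
      have "?D = incr s t -` B \<inter> space Q" by (auto simp: incr_def)
      then have D: "?D \<in> sets Q" using measurable_sets[OF incr_measurable, of s t B] st B by (simp add: Pd_def)
      have As: "A \<inter> A' \<in> sets (F s)" using A A' filtration.sets_F_mono[OF filt, of 0 s] st by auto
      have A'Q: "A' \<in> sets Q" using A' subalg[of s] by (auto simp: subalgebra_def)
      have "measure (uniform_measure Q A) (A' \<inter> ?D) = prob ((A \<inter> A') \<inter> ?D) / prob A"
        using ne D A'Q by (subst measure_uniform_measure) (auto simp: Int_assoc)
      also have "prob ((A \<inter> A') \<inter> ?D) = prob (A \<inter> A') * measure (Pi\<^sub>M {1..d} (\<lambda>_. density lborel (normal_density 0 (sqrt (t - s))))) B"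
        using BM As B st unfolding std_BM_def by blast
      also have "\<dots> / prob A = measure (uniform_measure Q A) A' * measure (Pi\<^sub>M {1..d} (\<lambda>_. density lborel (normal_density 0 (sqrt (t - s))))) B"
        using ne A'Q by (subst measure_uniform_measure) auto
      finally show "measure (uniform_measure Q A) (A' \<inter> {\<omega> \<in> space (uniform_measure Q A). (\<lambda>i\<in>{1..d}. W i t \<omega> - W i s \<omega>) \<in> B})
         = measure (uniform_measure Q A) A' * measure (Pi\<^sub>M {1..d} (\<lambda>_. density lborel (normal_density 0 (sqrt (t - s))))) B" unfolding space_uniform_measure .
    qed (use BM in \<open>auto simp: std_BM_def\<close>)
  qed
qed

lemma conv_in_prob_diff:
  assumes [measurable]: "\<And>k. U k \<in> borel_measurable Q" "\<And>k. V k \<in> borel_measurable Q" "Y \<in> borel_measurable Q" "Z \<in> borel_measurable Q"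
    and U: "conv_in_prob Q U Y" and V: "conv_in_prob Q V Z"
  shows "conv_in_prob Q (\<lambda>k \<omega>. U k \<omega> - V k \<omega>) (\<lambda>\<omega>. Y \<omega> - Z \<omega>)"
  unfolding conv_in_prob_def
proof (intro allI impI)
  fix e :: real assume e: "e > 0"
  let ?a = "\<lambda>k. prob {\<omega>\<in>space Q. e / 2 < \<bar>U k \<omega> - Y \<omega>\<bar>}" and ?b = "\<lambda>k. prob {\<omega>\<in>space Q. e / 2 < \<bar>V k \<omega> - Z \<omega>\<bar>}"
  show "(\<lambda>k. prob {\<omega>\<in>space Q. e < \<bar>U k \<omega> - V k \<omega> - (Y \<omega> - Z \<omega>)\<bar>}) \<longlonglongrightarrow> 0"
  proof (rule Lim_null_comparison)
    have "e / 2 > 0" using e by simp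
    then have "?a \<longlonglongrightarrow> 0" "?b \<longlonglongrightarrow> 0" using U V unfolding conv_in_prob_def by blast+
    from tendsto_add[OF this] show "(\<lambda>k. ?a k + ?b k) \<longlonglongrightarrow> 0" by simp
    show "\<forall>\<^sub>F k in sequentially. norm (prob {\<omega>\<in>space Q. e < \<bar>U k \<omega> - V k \<omega> - (Y \<omega> - Z \<omega>)\<bar>}) \<le> ?a k + ?b k"
    proof (intro always_eventually allI)
      fix k
      have "prob {\<omega>\<in>space Q. e < \<bar>U k \<omega> - V k \<omega> - (Y \<omega> - Z \<omega>)\<bar>}
         \<le> prob ({\<omega>\<in>space Q. e / 2 < \<bar>U k \<omega> - Y \<omega>\<bar>} \<union> {\<omega>\<in>space Q. e / 2 < \<bar>V k \<omega> - Z \<omega>\<bar>})"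
      proof (intro finite_measure_mono subsetI)
        fix \<omega> assume \<omega>: "\<omega> \<in> {\<omega>\<in>space Q. e < \<bar>U k \<omega> - V k \<omega> - (Y \<omega> - Z \<omega>)\<bar>}"
        then have "e < \<bar>(U k \<omega> - Y \<omega>) - (V k \<omega> - Z \<omega>)\<bar>" by (simp add: algebra_simps)
        also have "\<dots> \<le> \<bar>U k \<omega> - Y \<omega>\<bar> + \<bar>V k \<omega> - Z \<omega>\<bar>" by (rule abs_triangle_ineq4)
        finally have "e / 2 < \<bar>U k \<omega> - Y \<omega>\<bar> \<or> e / 2 < \<bar>V k \<omega> - Z \<omega>\<bar>" by linarith
        then show "\<omega> \<in> {\<omega>\<in>space Q. e / 2 < \<bar>U k \<omega> - Y \<omega>\<bar>} \<union> {\<omega>\<in>space Q. e / 2 < \<bar>V k \<omega> - Z \<omega>\<bar>}" using \<omega> by blast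
      qed simp
      also have "\<dots> \<le> ?a k + ?b k" by (rule measure_Un_le) measurable
      finally show "norm (prob {\<omega>\<in>space Q. e < \<bar>U k \<omega> - V k \<omega> - (Y \<omega> - Z \<omega>)\<bar>}) \<le> ?a k + ?b k" by simp
    qed
  qed
qed

text \<open>The integrals up to s and up to t are given separately. A single approximating sequence
  must serve both, so that their difference is the limit of increments of the same simple
  integrals.\<close>

lemma approx_seq_earlier:
  assumes H: "progressive F H" and ap: "approx_seq Q F H t m \<sigma> \<xi>" and st: "0 \<le> s" "s \<le> t"
  shows "approx_seq Q F H s m \<sigma> \<xi>"
  unfolding approx_seq_def
proof (intro conjI allI impI)
  have G: "simple_adapted F (m k) (\<sigma> k) (\<xi> k)" for k using ap by (simp add: approx_seq_def)
  then show "simple_adapted F (m k) (\<sigma> k) (\<xi> k)" for k .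
  fix e :: real assume e: "e > 0"
  let ?l = "\<lambda>r k \<omega>. \<integral>\<^sup>+u. ennreal ((simple_val (m k) (\<sigma> k) (\<xi> k) u \<omega> - H u \<omega>)\<^sup>2) * indicator {0..r} u \<partial>lborel"
  have lm: "?l r k \<in> borel_measurable Q" if "0 \<le> r" for r k
    using l2_dist_measurable[OF H G[of k] order.refl that] l2_dist_commute[of 0 r H] by (simp add: l2_dist_def[abs_def])
  have t: "0 \<le> t" using st by simp
  have mono: "?l s k \<omega> \<le> ?l t k \<omega>" for k \<omega> using st by (intro nn_integral_mono) (auto simp: indicator_def)
  have lim: "(\<lambda>k. prob {\<omega>\<in>space Q. ennreal e < ?l t k \<omega>}) \<longlonglongrightarrow> 0" using ap e by (simp add: approx_seq_def)
  show "(\<lambda>k. prob {\<omega>\<in>space Q. ennreal e < ?l s k \<omega>}) \<longlonglongrightarrow> 0"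
  proof (rule Lim_null_comparison[OF _ lim])
    show "\<forall>\<^sub>F k in sequentially. norm (prob {\<omega>\<in>space Q. ennreal e < ?l s k \<omega>}) \<le> prob {\<omega>\<in>space Q. ennreal e < ?l t k \<omega>}"
    proof (intro always_eventually allI)
      fix k
      have "{\<omega>\<in>space Q. ennreal e < ?l t k \<omega>} \<in> sets Q" using lm[OF t, of k] by simp
      moreover have "{\<omega>\<in>space Q. ennreal e < ?l s k \<omega>} \<subseteq> {\<omega>\<in>space Q. ennreal e < ?l t k \<omega>}"
        using mono[of k] by (auto intro: less_le_trans)
      ultimately show "norm (prob {\<omega>\<in>space Q. ennreal e < ?l s k \<omega>}) \<le> prob {\<omega>\<in>space Q. ennreal e < ?l t k \<omega>}"
        by (simp add: finite_measure_mono)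
    qed
  qed
qed

end

section \<open>The process under the conditioned measures\<close>

lemma Wt_differentiable_progressive:
  assumes "Wt_differentiable M F W d T n X c" "0 < T" "length J \<le> n" "set J \<subseteq> {0..d}" "a \<le> d"
  shows "progressive F (c (a # J))"
proof -
  obtain Y where "\<forall>i\<le>d. dW_integral M F W i (c (i # J)) 0 (Y i)"
    using assms unfolding Wt_differentiable_def by (metis atLeastAtMost_iff less_eq_real_def)
  then have "dW_integral M F W a (c (a # J)) 0 (Y a)" using assms by blast
  then show ?thesis by (cases "a = 0") (simp_all add: dW_integral_def time_integral_def ito_integral_def)
qed

text \<open>Almost sure statements and limits in probability pass to the conditioned measure, whose
  density is bounded. The isometry inequalities are then derived inside that measure, since they
  would not survive a change of measure with the same constant.\<close>

lemma differentiable_process_uniform_measure: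
  assumes M: "brownian M F W d" and T: "0 < T" and X: "\<And>t. X t \<in> borel_measurable (F t)"
    and D: "Wt_differentiable M F W d T n X c" and \<delta>: "0 < \<delta>" "\<delta> \<le> 1" "\<delta> \<le> T" and K: "1 \<le> K"
    and A: "A \<in> sets (F 0)" "0 < measure M A"
    and ib: "\<And>I \<omega>. I \<in> words d n \<Longrightarrow> \<omega> \<in> A \<Longrightarrow> \<bar>c I 0 \<omega>\<bar> \<le> K"
    and tm: "\<And>I t. length I = Suc n \<Longrightarrow> set I \<subseteq> {0..d} \<Longrightarrow> 0 \<le> t \<Longrightarrow> t \<le> \<delta> \<Longrightarrow>
       (\<integral>\<^sup>+\<omega>. ennreal ((c I t \<omega>)\<^sup>2) * indicator A \<omega> \<partial>M) \<le> ennreal K * emeasure M A"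
  shows "differentiable_process (uniform_measure M A) F W d n c \<delta> K"
proof -
  interpret M: brownian M F W d by fact
  let ?Q = "uniform_measure M A"
  interpret Q: brownian ?Q F W d by (rule M.brownian_uniform_measure[OF A])
  have AM: "A \<in> sets M" using A M.subalg[of 0] by (auto simp: subalgebra_def)
  have prog: "progressive F (c (a # J))" if "length J \<le> n" "set J \<subseteq> {0..d}" "a \<le> d" for a J
    by (rule Wt_differentiable_progressive[OF D T that])
  have c0: "c [] = X" using D by (simp add: Wt_differentiable_def)
  have c_adapted: "c J t \<in> borel_measurable (F t)" if "length J \<le> n" "set J \<subseteq> {0..d}" "0 \<le> t" for J t
  proof (cases J)
    case Nil then show ?thesis using X c0 by simp
  next
    case (Cons a J') then show ?thesis using that by (auto intro!: M.progressive_section prog)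
  qed
  show ?thesis
  proof
    show "0 < \<delta>" "\<delta> \<le> 1" "1 \<le> K" by fact+
    show "progressive F (c (a # J))" if "length J \<le> n" "set J \<subseteq> {0..d}" "a \<le> d" for a J using prog that .
    show "c [] t \<in> borel_measurable (F t)" if "0 \<le> t" for t using X c0 by simp
    show "AE \<omega> in ?Q. \<bar>c I 0 \<omega>\<bar> \<le> K" if "length I \<le> n" "set I \<subseteq> {0..d}" for I
      using ib[of I] that AM by (intro AE_uniform_measureI) (auto simp: words_def)
    show "(\<integral>\<^sup>+\<omega>. ennreal ((c I t \<omega>)\<^sup>2) \<partial>?Q) \<le> ennreal K" if I: "length I = Suc n" "set I \<subseteq> {0..d}" and t: "0 \<le> t" "t \<le> \<delta>" for I t
    proof -
      obtain a J where aJ: "I = a # J" using I by (cases I) auto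
      have "c I t \<in> borel_measurable (F t)" unfolding aJ using I t aJ by (intro M.progressive_section prog) auto
      then have cm: "c I t \<in> borel_measurable M" by (rule M.measurable_F_Q)
      have eA: "emeasure M A = ennreal (measure M A)" by (rule M.emeasure_eq_measure)
      have "(\<integral>\<^sup>+\<omega>. ennreal ((c I t \<omega>)\<^sup>2) \<partial>?Q) = (\<integral>\<^sup>+\<omega>. ennreal ((c I t \<omega>)\<^sup>2) * indicator A \<omega> \<partial>M) / emeasure M A"
        using cm AM by (intro nn_integral_uniform_measure) auto
      also have "\<dots> \<le> ennreal K * emeasure M A / emeasure M A" using tm[OF I t] by (rule divide_right_mono_ennreal)
      also have "\<dots> = ennreal K" unfolding eA using A(2) K by (simp add: ennreal_mult[symmetric] divide_ennreal)
      finally show ?thesis .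
    qed
    fix J s t assume J: "length J \<le> n" "set J \<subseteq> {0..d}" and st: "0 \<le> s" "s \<le> t" "t \<le> \<delta>"
    obtain Yt where Yt: "\<And>i. i \<le> d \<Longrightarrow> dW_integral M F W i (c (i # J)) t (Yt i)" "AE \<omega> in M. c J t \<omega> = c J 0 \<omega> + (\<Sum>i\<le>d. Yt i \<omega>)"
      using D J st \<delta> unfolding Wt_differentiable_def by (meson atLeastAtMost_iff order_trans)
    have "s \<in> {0..T}" using st \<delta> by auto
    then obtain Ys where Ys: "\<And>i. i \<le> d \<Longrightarrow> dW_integral M F W i (c (i # J)) s (Ys i)" "AE \<omega> in M. c J s \<omega> = c J 0 \<omega> + (\<Sum>i\<le>d. Ys i \<omega>)"
      using D J unfolding Wt_differentiable_def by blast
    have ito: "ito_integral M F (W a) (c (a # J)) t (Yt a)" "ito_integral M F (W a) (c (a # J)) s (Ys a)" if "a \<in> {1..d}" for a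
      using Yt(1)[of a] Ys(1)[of a] that by (auto simp: dW_integral_def)
    have Ym: "Yt a \<in> borel_measurable M" "Ys a \<in> borel_measurable M" if "a \<in> {1..d}" for a
      using ito[OF that] by (auto simp: ito_integral_def)
    have cJm: "c J t \<in> borel_measurable M" "c J s \<in> borel_measurable M"
      using c_adapted[OF J] st M.measurable_F_Q by (meson order_trans)+
    \<comment> \<open>\<open>Z 0\<close> is defined as what the Brownian letters leave over. This
      agrees almost surely with the time integral and is measurable, which
      \<open>time_integral\<close> does not assert of \<open>Yt 0\<close>; it also makes the
      decomposition hold for every \<omega>.\<close>
    define Z where "Z a \<omega> = (if a = 0 then c J t \<omega> - c J s \<omega> - (\<Sum>i=1..d. Yt i \<omega> - Ys i \<omega>) else Yt a \<omega> - Ys a \<omega>)" for a \<omega>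
    have Zm: "Z a \<in> borel_measurable ?Q" if "a \<le> d" for a
    proof (cases "a = 0")
      case True
      have "(\<lambda>\<omega>. c J t \<omega> - c J s \<omega> - (\<Sum>i=1..d. Yt i \<omega> - Ys i \<omega>)) \<in> borel_measurable M"
        using cJm Ym by (intro borel_measurable_diff borel_measurable_sum) auto
      then show ?thesis using True by (simp add: Z_def[abs_def])
    next
      case False
      then show ?thesis using Ym[of a] that by (simp add: Z_def[abs_def])
    qed
    have sum0: "(\<Sum>a\<le>d. g a) = g 0 + (\<Sum>a=1..d. g a)" for g :: "nat \<Rightarrow> real"
      by (simp add: atMost_atLeast0 sum.atLeast_Suc_atMost)
    have iso: "(\<integral>\<^sup>+\<omega>. ennreal ((Z a \<omega> - (simple_int (Q.What a) m \<sigma> \<xi> t \<omega> - simple_int (Q.What a) m \<sigma> \<xi> s \<omega>))\<^sup>2) \<partial>?Q)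
       \<le> (\<integral>\<^sup>+\<omega>. Q.l2_dist s t (c (a # J)) (simple_val m \<sigma> \<xi>) \<omega> \<partial>?Q)" if a: "a \<le> d" and G: "simple_adapted F m \<sigma> \<xi>" for a m \<sigma> \<xi>
    proof (cases "a = 0")
      case True
      have ti: "time_integral M F (c (0 # J)) t (Yt 0)" "time_integral M F (c (0 # J)) s (Ys 0)"
        using Yt(1)[of 0] Ys(1)[of 0] by (auto simp: dW_integral_def)
      have tiQ: "time_integral ?Q F (c (0 # J)) t (Yt 0)" "time_integral ?Q F (c (0 # J)) s (Ys 0)"
        using ti AE_uniform_measure_of_AE[OF AM] unfolding time_integral_def by blast+
      have What0: "Q.What 0 = (\<lambda>u \<omega>. u)" by (simp add: Q.What_def fun_eq_iff)
      have "AE \<omega> in M. Z 0 \<omega> = Yt 0 \<omega> - Ys 0 \<omega>"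
        using Yt(2) Ys(2)
      proof eventually_elim
        case (elim \<omega>)
        have "c J t \<omega> - c J s \<omega> = (\<Sum>i\<le>d. Yt i \<omega> - Ys i \<omega>)" using elim by (simp add: sum_subtractf)
        then show ?case using sum0[of "\<lambda>i. Yt i \<omega> - Ys i \<omega>"] by (simp add: Z_def)
      qed
      then have "AE \<omega> in ?Q. Z 0 \<omega> = Yt 0 \<omega> - Ys 0 \<omega>" by (rule AE_uniform_measure_of_AE[OF AM])
      then have "(\<integral>\<^sup>+\<omega>. ennreal ((Z 0 \<omega> - (simple_int (Q.What 0) m \<sigma> \<xi> t \<omega> - simple_int (Q.What 0) m \<sigma> \<xi> s \<omega>))\<^sup>2) \<partial>?Q)
         = (\<integral>\<^sup>+\<omega>. ennreal (((Yt 0 \<omega> - Ys 0 \<omega>) - (simple_int (\<lambda>u \<omega>. u) m \<sigma> \<xi> t \<omega> - simple_int (\<lambda>u \<omega>. u) m \<sigma> \<xi> s \<omega>))\<^sup>2) \<partial>?Q)"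
        unfolding What0 by (intro nn_integral_cong_AE) auto
      also have "\<dots> \<le> (\<integral>\<^sup>+\<omega>. Q.l2_dist s t (c (0 # J)) (simple_val m \<sigma> \<xi>) \<omega> \<partial>?Q)"
        by (rule Q.time_isometry_le[OF st(1,2) _ G tiQ(2,1)]) (use st \<delta> in simp)
      finally show ?thesis using True by simp
    next
      case False
      then have a1: "a \<in> {1..d}" using a by auto
      have H: "progressive F (c (a # J))" by (rule prog[OF J a])
      obtain m' \<sigma>' \<xi>' where ap: "approx_seq M F (c (a # J)) t m' \<sigma>' \<xi>'" using ito(1)[OF a1] by (auto simp: ito_integral_def)
      have ap': "approx_seq M F (c (a # J)) s m' \<sigma>' \<xi>'" by (rule M.approx_seq_earlier[OF H ap st(1,2)])
      have cv: "conv_in_prob M (\<lambda>k. simple_int (W a) (m' k) (\<sigma>' k) (\<xi>' k) t) (Yt a)" "conv_in_prob M (\<lambda>k. simple_int (W a) (m' k) (\<sigma>' k) (\<xi>' k) s) (Ys a)"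
        using ito[OF a1] ap ap' by (auto simp: ito_integral_def)
      have Gk: "simple_adapted F (m' k) (\<sigma>' k) (\<xi>' k)" for k using ap by (simp add: approx_seq_def)
      have "conv_in_prob M (\<lambda>k \<omega>. simple_int (W a) (m' k) (\<sigma>' k) (\<xi>' k) t \<omega> - simple_int (W a) (m' k) (\<sigma>' k) (\<xi>' k) s \<omega>) (\<lambda>\<omega>. Yt a \<omega> - Ys a \<omega>)"
        using M.simple_int_measurable[OF a1 Gk] st Ym[OF a1] cv by (intro M.conv_in_prob_diff) auto
      then have cvQ: "conv_in_prob ?Q (\<lambda>k \<omega>. simple_int (W a) (m' k) (\<sigma>' k) (\<xi>' k) t \<omega> - simple_int (W a) (m' k) (\<sigma>' k) (\<xi>' k) s \<omega>) (\<lambda>\<omega>. Yt a \<omega> - Ys a \<omega>)"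
        unfolding conv_in_prob_def
        using uniform_measure_tendsto_0[OF M.finite_measure_axioms AM A(2)] by simp
      have apQ: "approx_seq ?Q F (c (a # J)) t m' \<sigma>' \<xi>'"
        using ap uniform_measure_tendsto_0[OF M.finite_measure_axioms AM A(2)] unfolding approx_seq_def by simp
      have Ymq: "(\<lambda>\<omega>. Yt a \<omega> - Ys a \<omega>) \<in> borel_measurable ?Q" using Ym[OF a1] by simp
      have WhW: "Q.What a = W a" using False by (simp add: Q.What_def fun_eq_iff)
      show ?thesis using Q.ito_isometry_le[OF a1 st(1,2) H apQ cvQ Ymq G] False unfolding WhW by (simp add: Z_def)
    qed
    have AEQ: "AE \<omega> in ?Q. c J t \<omega> - c J s \<omega> = (\<Sum>a\<le>d. Z a \<omega>)"
      by (rule AE_I2) (simp add: sum0 Z_def)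
    show "\<exists>Z. (\<forall>a\<le>d. Z a \<in> borel_measurable ?Q \<and> (\<forall>m \<sigma> \<xi>. simple_adapted F m \<sigma> \<xi> \<longrightarrow>
            (\<integral>\<^sup>+\<omega>. ennreal ((Z a \<omega> - (simple_int (Q.What a) m \<sigma> \<xi> t \<omega> - simple_int (Q.What a) m \<sigma> \<xi> s \<omega>))\<^sup>2) \<partial>?Q)
            \<le> (\<integral>\<^sup>+\<omega>. Q.l2_dist s t (c (a # J)) (simple_val m \<sigma> \<xi>) \<omega> \<partial>?Q))) \<and>
        (AE \<omega> in ?Q. c J t \<omega> - c J s \<omega> = (\<Sum>a\<le>d. Z a \<omega>))"
      using Zm iso AEQ by (intro exI[of _ Z]) blast
  qed
qed

text \<open>The order of quantifiers is the content: C is chosen before the set \<open>A\<close> and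
  the time t. This is possible because every constant depends only on d, n, K and f; the conditioned
  expectation is then rescaled by \<open>measure M A\<close>.\<close>

lemma uniform_expansion_bound:
  assumes M: "brownian M F W d" and T: "0 < T" and X: "\<And>t. X t \<in> borel_measurable (F t)"
    and D: "Wt_differentiable M F W d T n X c" and \<delta>: "0 < \<delta>" "\<delta> \<le> 1" "\<delta> \<le> T" and K: "1 \<le> K"
    and f: "Cp (Suc n) f" and B: "\<And>x. \<bar>deriv f x\<bar> \<le> B"
  shows "\<exists>C\<ge>0. \<forall>A\<in>sets (F 0). 0 < measure M A \<longrightarrow> (\<forall>I\<in>words d n. \<forall>\<omega>\<in>A. \<bar>c I 0 \<omega>\<bar> \<le> K) \<longrightarrow>
     (\<forall>I t. length I = Suc n \<longrightarrow> set I \<subseteq> {0..d} \<longrightarrow> 0 \<le> t \<longrightarrow> t \<le> \<delta> \<longrightarrow>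
       (\<integral>\<^sup>+\<omega>. ennreal ((c I t \<omega>)\<^sup>2) * indicator A \<omega> \<partial>M) \<le> ennreal K * emeasure M A) \<longrightarrow>
     (\<forall>t. 0 < t \<longrightarrow> t \<le> \<delta> \<longrightarrow> integrable M (\<lambda>\<omega>. indicator A \<omega> * f (X t \<omega>)) \<and>
        integrable M (\<lambda>\<omega>. indicator A \<omega> * expansion f d n c \<omega> t) \<and>
        \<bar>(\<integral>\<omega>. indicator A \<omega> * f (X t \<omega>) \<partial>M) - (\<integral>\<omega>. indicator A \<omega> * expansion f d n c \<omega> t \<partial>M)\<bar> \<le> C * sqrt t ^ Suc n * measure M A)"
proof -
  interpret M: brownian M F W d by fact
  have c0: "c [] = X" using D by (simp add: Wt_differentiable_def)
  obtain C0 p0 where C0: "C0 > 0" "\<And>j x. j \<le> Suc n \<Longrightarrow> \<bar>(deriv ^^ j) f x\<bar> \<le> C0 * (1 + \<bar>x\<bar> ^ p0)"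
    using f unfolding Cp_def by blast
  define A0 where "A0 = C0 * (1 + K ^ p0)"
  have A0: "\<bar>(deriv ^^ j) f x\<bar> \<le> A0" if "j \<le> Suc n" "\<bar>x\<bar> \<le> K" for j x
  proof -
    have "\<bar>x\<bar> ^ p0 \<le> K ^ p0" using that by (intro power_mono) auto
    then have "C0 * (1 + \<bar>x\<bar> ^ p0) \<le> A0" unfolding A0_def using C0(1) by (intro mult_left_mono) auto
    then show ?thesis using C0(2)[OF that(1), of x] by linarith
  qed
  have K0: "0 \<le> K" using K by simp
  obtain Ct p where Ct: "Ct \<ge> 0" "\<And>x y. \<bar>x\<bar> \<le> K \<Longrightarrow>
    \<bar>f (x + y) - (\<Sum>k\<le>Suc n. (deriv ^^ k) f x / fact k * y ^ k)\<bar> \<le> Ct * (\<bar>y\<bar> ^ Suc n + \<bar>y\<bar> ^ (Suc n + p))"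
    using taylor_remainder_bound[OF f K0] by blast
  obtain bt where bt: "bt \<ge> 0" "\<And>x a M. supp x \<subseteq> words d n \<Longrightarrow> (\<forall>K'. \<bar>x K'\<bar> \<le> K) \<Longrightarrow> (\<forall>k\<le>Suc n. \<bar>a k\<bar> \<le> A0) \<Longrightarrow>
     \<bar>taylor_lc d (Suc n) x a (word []) M\<bar> \<le> bt"
    using taylor_lc_bounded[of d n K "Suc n" A0] by blast
  define C where "C = B * (differentiable_process.econst d K n + 1)
     + Ct * (differentiable_process.ymom d n K (Suc n) + differentiable_process.ymom d n K (Suc n + p)) + real (Suc n * Suc n) * bt"
  show ?thesis
  proof (intro exI[of _ "\<bar>C\<bar>"] conjI ballI allI impI)
    fix A t assume A: "A \<in> sets (F 0)" "0 < measure M A" and ib: "\<forall>I\<in>words d n. \<forall>\<omega>\<in>A. \<bar>c I 0 \<omega>\<bar> \<le> K"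
      and tm: "\<forall>I t. length I = Suc n \<longrightarrow> set I \<subseteq> {0..d} \<longrightarrow> 0 \<le> t \<longrightarrow> t \<le> \<delta> \<longrightarrow>
       (\<integral>\<^sup>+\<omega>. ennreal ((c I t \<omega>)\<^sup>2) * indicator A \<omega> \<partial>M) \<le> ennreal K * emeasure M A"
      and t: "0 < t" "t \<le> \<delta>"
    have AM: "A \<in> sets M" using A M.subalg[of 0] by (auto simp: subalgebra_def)
    interpret P: differentiable_process "uniform_measure M A" F W d n c \<delta> K
      by (rule differentiable_process_uniform_measure[OF M T X D \<delta> K A]) (use ib tm in auto)
    note E = P.expectation_expansion[OF f B A0 Ct bt t, folded C_def]
    have fm: "f \<in> borel_measurable borel" using Cp_measurable[OF f, of 0] by simp
    have fX: "(\<lambda>\<omega>. f (X t \<omega>)) \<in> borel_measurable M" by (rule measurable_compose[OF M.measurable_F_Q[OF X] fm])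
    have ex: "(\<lambda>\<omega>. expansion f d n c \<omega> t) \<in> borel_measurable M"
      by (rule M.measurable_F_Q[OF expansion_measurable[OF f]]) (auto intro!: P.c_adapted simp: words_def)
    note u = uniform_measure_integral[OF M.finite_measure_axioms AM A(2)]
    show "integrable M (\<lambda>\<omega>. indicator A \<omega> * f (X t \<omega>))" using E(1) unfolding c0 u(1)[OF fX] .
    show "integrable M (\<lambda>\<omega>. indicator A \<omega> * expansion f d n c \<omega> t)" using E(2) unfolding u(1)[OF ex] .
    have "\<bar>(\<integral>\<omega>. indicator A \<omega> * f (X t \<omega>) \<partial>M) / measure M A - (\<integral>\<omega>. indicator A \<omega> * expansion f d n c \<omega> t \<partial>M) / measure M A\<bar> \<le> C * sqrt t ^ Suc n"
      using E(3) unfolding c0 u(2)[OF fX] u(2)[OF ex] .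
    also have "\<dots> \<le> \<bar>C\<bar> * sqrt t ^ Suc n" using t by (intro mult_right_mono) auto
    finally have "\<bar>((\<integral>\<omega>. indicator A \<omega> * f (X t \<omega>) \<partial>M) - (\<integral>\<omega>. indicator A \<omega> * expansion f d n c \<omega> t \<partial>M)) / measure M A\<bar> \<le> \<bar>C\<bar> * sqrt t ^ Suc n"
      by (simp only: diff_divide_distrib)
    then show "\<bar>(\<integral>\<omega>. indicator A \<omega> * f (X t \<omega>) \<partial>M) - (\<integral>\<omega>. indicator A \<omega> * expansion f d n c \<omega> t \<partial>M)\<bar> \<le> \<bar>C\<bar> * sqrt t ^ Suc n * measure M A"
      using A(2) by (simp add: abs_divide divide_le_eq del: power_Suc)
  qed simp
qed

section \<open>From integrals over sets to conditional expectations\<close>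

lemma (in finite_measure_subalgebra) real_cond_exp_diff_le:
  assumes Z: "integrable M Z" and e: "integrable M e" "e \<in> borel_measurable F"
    and le: "\<And>A. A \<in> sets F \<Longrightarrow> (\<integral>\<omega>. indicator A \<omega> * Z \<omega> \<partial>M) - (\<integral>\<omega>. indicator A \<omega> * e \<omega> \<partial>M) \<le> b * measure M A"
  shows "AE \<omega> in M. real_cond_exp M F Z \<omega> - e \<omega> \<le> b"
proof -
  define D where "D \<omega> = real_cond_exp M F Z \<omega> - e \<omega> - b" for \<omega>
  have DF: "D \<in> borel_measurable F" unfolding D_def[abs_def] using e by simp
  have ic: "integrable M (real_cond_exp M F Z)" by (rule real_cond_exp_int(1)[OF Z])
  have iD: "integrable M D" unfolding D_def[abs_def] using ic e by simp
  \<comment> \<open>The set where the claimed bound fails is itself a test set; the integral of the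
    positive quantity D over it turns out to be at most 0.\<close>
  define A where "A = {\<omega>\<in>space M. D \<omega> > 0}"
  have "space F = space M" using subalg by (simp add: subalgebra_def)
  then have AF: "A \<in> sets F" using DF measurable_sets[OF DF, of "{0<..}"] by (auto simp: A_def vimage_def Int_def conj_commute)
  then have AM: "A \<in> sets M" using subalg by (auto simp: subalgebra_def)
  have iA: "integrable M (\<lambda>\<omega>. indicator A \<omega> * g \<omega>)" if "integrable M g" for g :: "'a \<Rightarrow> real"
    using integrable_mult_indicator[OF AM that] by simp
  have "(\<integral>\<omega>. indicator A \<omega> * D \<omega> \<partial>M) = (\<integral>\<omega>. indicator A \<omega> * real_cond_exp M F Z \<omega> \<partial>M) - (\<integral>\<omega>. indicator A \<omega> * e \<omega> \<partial>M) - (\<integral>\<omega>. indicator A \<omega> * b \<partial>M)"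
    unfolding D_def using iA[OF ic] iA[OF e(1)] iA[of "\<lambda>_. b"] by (simp add: right_diff_distrib)
  also have "(\<integral>\<omega>. indicator A \<omega> * real_cond_exp M F Z \<omega> \<partial>M) = (\<integral>\<omega>. indicator A \<omega> * Z \<omega> \<partial>M)"
    using real_cond_exp_intA[OF Z AF] by (simp add: set_lebesgue_integral_def)
  also have "(\<integral>\<omega>. indicator A \<omega> * b \<partial>M) = b * measure M A" using AM by simp
  finally have "(\<integral>\<omega>. indicator A \<omega> * D \<omega> \<partial>M) \<le> 0" using le[OF AF] by simp
  moreover have nn: "0 \<le> indicator A \<omega> * D \<omega>" for \<omega> by (auto simp: A_def indicator_def)
  then have "0 \<le> (\<integral>\<omega>. indicator A \<omega> * D \<omega> \<partial>M)" by (intro integral_nonneg_AE) simp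
  ultimately have "(\<integral>\<omega>. indicator A \<omega> * D \<omega> \<partial>M) = 0" by simp
  then have "AE \<omega> in M. indicator A \<omega> * D \<omega> = 0"
    using integral_nonneg_eq_0_iff_AE[OF iA[OF iD]] nn by simp
  then show ?thesis
    using AE_space by eventually_elim (auto simp: A_def D_def indicator_def split: if_splits)
qed

lemma smallo_of_sqrt_power_bound:
  assumes "0 < \<delta>" "\<And>t. 0 < t \<Longrightarrow> t \<le> \<delta> \<Longrightarrow> \<bar>g t\<bar> \<le> C * sqrt t ^ Suc n"
  shows "g \<in> o[at_right 0](\<lambda>t. t powr (real n / 2))"
proof (rule landau_o.smallI)
  fix e :: real assume e: "e > 0"
  have "((\<lambda>t. C * sqrt t) \<longlongrightarrow> C * sqrt 0) (at_right 0)"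
    by (intro tendsto_intros)
  then have "\<forall>\<^sub>F t in at_right 0. C * sqrt t < e" by (rule order_tendstoD(2)) (use e in simp)
  moreover have "\<forall>\<^sub>F t in at_right 0. t \<in> {0<..<\<delta>}" using assms(1) by (intro eventually_at_right_real)
  ultimately show "\<forall>\<^sub>F t in at_right 0. norm (g t) \<le> e * norm (t powr (real n / 2))"
  proof eventually_elim
    case (elim t)
    have p: "t powr (real n / 2) = sqrt t ^ n" using elim by (simp add: powr_half_sqrt[symmetric] powr_powr flip: powr_realpow)
    have "\<bar>g t\<bar> \<le> C * sqrt t ^ Suc n" using assms(2)[of t] elim by simp
    also have "\<dots> = (C * sqrt t) * sqrt t ^ n" by simp
    also have "\<dots> \<le> e * sqrt t ^ n" using elim by (intro mult_right_mono) auto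
    finally show ?case unfolding p using elim by simp
  qed
qed

theorem theorem2:
  fixes M :: "'a measure" and F :: "real \<Rightarrow> 'a measure"
    and W :: "nat \<Rightarrow> real \<Rightarrow> 'a \<Rightarrow> real" and d n :: nat and T :: real
    and X :: "real \<Rightarrow> 'a \<Rightarrow> real" and c :: "nat list \<Rightarrow> real \<Rightarrow> 'a \<Rightarrow> real"
    and f :: "real \<Rightarrow> real"
  assumes "prob_space M"
    and "filtration (space M) F"
    and "\<forall>t. subalgebra M (F t)"
    and "std_BM M F d W"
    and "T > 0"
    and "\<forall>t. X t \<in> borel_measurable (F t)"
    and "Wt_differentiable M F W d T n X c"
    and "moment_condition M F d n c"
    and "Cp (Suc n) f"
    and "\<exists>B. \<forall>x. \<bar>deriv f x\<bar> \<le> B"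
  shows "\<exists>E :: real \<Rightarrow> 'a \<Rightarrow> real.
           (\<forall>t\<in>{0<..T}. cond_exp_version M (F 0) (\<lambda>\<omega>. f (X t \<omega>)) (E t)) \<and>
           (AE \<omega> in M. (\<lambda>t. E t \<omega> - expansion f d n c \<omega> t)
                         \<in> o[at_right 0](\<lambda>t. t powr (real n / 2)))"
proof -
  interpret prob_space M by fact
  have BM: "brownian M F W d" using assms(1-4) by (intro brownian.intro brownian_axioms.intro) auto
  interpret M: brownian M F W d by fact
  have X: "X t \<in> borel_measurable (F t)" for t using assms(6) by simp
  note D = assms(7) and f = assms(9)
  have c0: "c [] = X" using D by (simp add: Wt_differentiable_def)
  obtain B where B: "\<And>x. \<bar>deriv f x\<bar> \<le> B" using assms(10) by blast
  have prog: "progressive F (c (a # J))" if "length J \<le> n" "set J \<subseteq> {0..d}" "a \<le> d" for a J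
    by (rule Wt_differentiable_progressive[OF D assms(5) that])
  have c_adapted: "c J t \<in> borel_measurable (F t)" if "length J \<le> Suc n" "set J \<subseteq> {0..d}" "0 \<le> t" for J t
  proof (cases J)
    case Nil then show ?thesis using X c0 by simp
  next
    case (Cons a J') then show ?thesis using that by (auto intro!: M.progressive_section prog)
  qed
  interpret S: finite_measure_subalgebra M "F 0" using M.subalg by unfold_locales
  let ?W1 = "{I. length I = Suc n \<and> set I \<subseteq> {0..d}}"
  have finW1: "finite ?W1" using finite_lists_length_eq[of "{0..d}" "Suc n"] by (simp add: conj_commute)
  obtain \<delta>0 q where \<delta>0: "\<delta>0 > 0" "q \<ge> 1" and mc: "\<forall>I\<in>?W1. \<exists>k\<in>borel_measurable (F 0). \<forall>t\<in>{0..\<delta>0}.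
             AE \<omega> in M. nn_cond_exp M (F 0) (\<lambda>x. ennreal (c I t x ^ (2 * q))) \<omega> \<le> ennreal (k \<omega>)"
    using assms(8) unfolding moment_condition_def by blast
  then have "\<forall>I\<in>?W1. \<exists>k. k \<in> borel_measurable (F 0) \<and> (\<forall>t\<in>{0..\<delta>0}.
             AE \<omega> in M. nn_cond_exp M (F 0) (\<lambda>x. ennreal (c I t x ^ (2 * q))) \<omega> \<le> ennreal (k \<omega>))" by blast
  from bchoice[OF this] obtain k where k: "\<And>I. I \<in> ?W1 \<Longrightarrow> k I \<in> borel_measurable (F 0)"
    "\<And>I t. I \<in> ?W1 \<Longrightarrow> t \<in> {0..\<delta>0} \<Longrightarrow> AE \<omega> in M. nn_cond_exp M (F 0) (\<lambda>x. ennreal (c I t x ^ (2 * q))) \<omega> \<le> ennreal (k I \<omega>)"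
    by blast
  \<comment> \<open>The moment bound holds up to \<delta>0, the integral decomposition up to T, and
    the moment estimates on the grid use t <= 1.\<close>
  define \<delta> where "\<delta> = min \<delta>0 (min T 1)"
  have \<delta>: "0 < \<delta>" "\<delta> \<le> 1" "\<delta> \<le> T" "\<delta> \<le> \<delta>0" using \<delta>0 assms(5) by (auto simp: \<delta>_def)
  \<comment> \<open>These sets are known at time 0 and exhaust the space, because finitely many
    coefficients and bounds are involved and each is finite at every \<omega>.\<close>
  define A where "A m = {\<omega>\<in>space M. (\<forall>I\<in>words d n. \<bar>c I 0 \<omega>\<bar> \<le> real m) \<and> (\<forall>I\<in>?W1. k I \<omega> \<le> real m)}" for m :: nat
  have spF: "space (F 0) = space M" by simp
  have pA: "Measurable.pred (F 0) (\<lambda>\<omega>. (\<forall>I\<in>words d n. \<bar>c I 0 \<omega>\<bar> \<le> real m) \<and> (\<forall>I\<in>?W1. k I \<omega> \<le> real m))" for m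
  proof (intro pred_intros_logic(3) pred_intros_finite(3) finite_words finW1)
    fix I assume "I \<in> words d n"
    then have [measurable]: "c I 0 \<in> borel_measurable (F 0)" by (intro c_adapted) (auto simp: words_def)
    show "Measurable.pred (F 0) (\<lambda>\<omega>. \<bar>c I 0 \<omega>\<bar> \<le> real m)" by measurable
  next
    fix I assume "I \<in> ?W1"
    then have [measurable]: "k I \<in> borel_measurable (F 0)" by (rule k(1))
    show "Measurable.pred (F 0) (\<lambda>\<omega>. k I \<omega> \<le> real m)" by measurable
  qed
  have AF: "A m \<in> sets (F 0)" for m using pA[of m] unfolding A_def pred_def spF .
  have AM: "A m \<in> sets M" for m using AF[of m] M.subalg[of 0] by (auto simp: subalgebra_def)
  have exA: "\<exists>m. \<omega> \<in> A m" if \<omega>: "\<omega> \<in> space M" for \<omega>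
  proof -
    define v where "v = (\<Sum>I\<in>words d n. \<bar>c I 0 \<omega>\<bar>) + (\<Sum>I\<in>?W1. \<bar>k I \<omega>\<bar>)"
    obtain m :: nat where m: "v \<le> real m" using real_arch_simple by blast
    have "\<bar>c I 0 \<omega>\<bar> \<le> v" if "I \<in> words d n" for I
    proof -
      have "\<bar>c I 0 \<omega>\<bar> \<le> (\<Sum>I\<in>words d n. \<bar>c I 0 \<omega>\<bar>)" using that by (intro member_le_sum) auto
      moreover have "0 \<le> (\<Sum>I\<in>?W1. \<bar>k I \<omega>\<bar>)" by (intro sum_nonneg) auto
      ultimately show ?thesis unfolding v_def by linarith
    qed
    moreover have "k I \<omega> \<le> v" if "I \<in> ?W1" for I
    proof -
      have "\<bar>k I \<omega>\<bar> \<le> (\<Sum>I\<in>?W1. \<bar>k I \<omega>\<bar>)" using that finW1 by (intro member_le_sum) auto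
      moreover have "0 \<le> (\<Sum>I\<in>words d n. \<bar>c I 0 \<omega>\<bar>)" by (intro sum_nonneg) auto
      ultimately show ?thesis unfolding v_def by linarith
    qed
    ultimately have "\<omega> \<in> A m" using m \<omega> unfolding A_def by (auto intro: order_trans)
    then show ?thesis ..
  qed
  have bound: "\<exists>C\<ge>0. \<forall>A'\<in>sets (F 0). A' \<subseteq> A m \<longrightarrow> (\<forall>t. 0 < t \<longrightarrow> t \<le> \<delta> \<longrightarrow>
        integrable M (\<lambda>\<omega>. indicator A' \<omega> * f (X t \<omega>)) \<and> integrable M (\<lambda>\<omega>. indicator A' \<omega> * expansion f d n c \<omega> t) \<and>
        \<bar>(\<integral>\<omega>. indicator A' \<omega> * f (X t \<omega>) \<partial>M) - (\<integral>\<omega>. indicator A' \<omega> * expansion f d n c \<omega> t \<partial>M)\<bar> \<le> C * sqrt t ^ Suc n * measure M A')" for m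
  proof -
    \<comment> \<open>The summand 1 guarantees K >= 1 and absorbs the constant in c^2 <= 1 +
      c^(2q).\<close>
    have K1: "1 \<le> real m + 1" by simp
    from uniform_expansion_bound[OF BM assms(5) X D \<delta>(1,2,3) K1 f B]
    obtain C where C0: "C \<ge> 0" and C1: "\<forall>A\<in>sets (F 0). 0 < measure M A \<longrightarrow> (\<forall>I\<in>words d n. \<forall>\<omega>\<in>A. \<bar>c I 0 \<omega>\<bar> \<le> real m + 1) \<longrightarrow>
       (\<forall>I t. length I = Suc n \<longrightarrow> set I \<subseteq> {0..d} \<longrightarrow> 0 \<le> t \<longrightarrow> t \<le> \<delta> \<longrightarrow>
         (\<integral>\<^sup>+\<omega>. ennreal ((c I t \<omega>)\<^sup>2) * indicator A \<omega> \<partial>M) \<le> ennreal (real m + 1) * emeasure M A) \<longrightarrow>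
       (\<forall>t. 0 < t \<longrightarrow> t \<le> \<delta> \<longrightarrow> integrable M (\<lambda>\<omega>. indicator A \<omega> * f (X t \<omega>)) \<and>
        integrable M (\<lambda>\<omega>. indicator A \<omega> * expansion f d n c \<omega> t) \<and>
        \<bar>(\<integral>\<omega>. indicator A \<omega> * f (X t \<omega>) \<partial>M) - (\<integral>\<omega>. indicator A \<omega> * expansion f d n c \<omega> t \<partial>M)\<bar> \<le> C * sqrt t ^ Suc n * measure M A)"
      by (elim exE conjE) (rule that)
    note C2 = C1[THEN bspec, THEN mp, THEN mp, THEN mp, THEN spec, THEN mp, THEN mp]
    have "integrable M (\<lambda>\<omega>. indicator A' \<omega> * f (X t \<omega>)) \<and> integrable M (\<lambda>\<omega>. indicator A' \<omega> * expansion f d n c \<omega> t) \<and>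
        \<bar>(\<integral>\<omega>. indicator A' \<omega> * f (X t \<omega>) \<partial>M) - (\<integral>\<omega>. indicator A' \<omega> * expansion f d n c \<omega> t \<partial>M)\<bar> \<le> C * sqrt t ^ Suc n * measure M A'"
      if A': "A' \<in> sets (F 0)" "A' \<subseteq> A m" and t: "0 < t" "t \<le> \<delta>" for A' t
    proof (cases "0 < measure M A'")
      case True
      have A'M: "A' \<in> sets M" using A'(1) M.subalg[of 0] by (auto simp: subalgebra_def)
      show ?thesis
      proof (rule C2[OF A'(1) True _ _ t])
        show "\<forall>I\<in>words d n. \<forall>\<omega>\<in>A'. \<bar>c I 0 \<omega>\<bar> \<le> real m + 1"
        proof (intro ballI)
          fix I \<omega> assume "I \<in> words d n" "\<omega> \<in> A'"
          then have "\<bar>c I 0 \<omega>\<bar> \<le> real m" using A'(2) unfolding A_def by auto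
          then show "\<bar>c I 0 \<omega>\<bar> \<le> real m + 1" by simp
        qed
        show "\<forall>I t. length I = Suc n \<longrightarrow> set I \<subseteq> {0..d} \<longrightarrow> 0 \<le> t \<longrightarrow> t \<le> \<delta> \<longrightarrow>
         (\<integral>\<^sup>+\<omega>. ennreal ((c I t \<omega>)\<^sup>2) * indicator A' \<omega> \<partial>M) \<le> ennreal (real m + 1) * emeasure M A'"
        proof (intro allI impI)
          fix I r assume I': "length I = Suc n" "set I \<subseteq> {0..d}" and r: "0 \<le> r" "r \<le> \<delta>"
          then have I: "I \<in> ?W1" by simp
          have cm [measurable]: "c I r \<in> borel_measurable M" using I' r by (intro M.measurable_F_Q[OF c_adapted]) auto
          \<comment> \<open>The hypothesis bounds a conditional moment of some even order 2q; the
            second moment, the only one used for the top coefficients, follows from it.\<close>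
          have le1: "(c I r \<omega>)\<^sup>2 \<le> 1 + c I r \<omega> ^ (2 * q)" for \<omega>
          proof (cases "(c I r \<omega>)\<^sup>2 \<le> 1")
            case True
            have "0 \<le> c I r \<omega> ^ (2 * q)" by (intro zero_le_even_power) simp
            then show ?thesis using True by linarith
          next
            case False
            then have "(c I r \<omega>)\<^sup>2 \<le> ((c I r \<omega>)\<^sup>2) ^ q" using \<delta>0(2) by (intro self_le_power) auto
            then show ?thesis by (simp add: power_mult)
          qed
          have "(\<integral>\<^sup>+\<omega>. ennreal ((c I r \<omega>)\<^sup>2) * indicator A' \<omega> \<partial>M)
             \<le> (\<integral>\<^sup>+\<omega>. indicator A' \<omega> + indicator A' \<omega> * ennreal (c I r \<omega> ^ (2 * q)) \<partial>M)"
          proof (rule nn_integral_mono)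
            fix \<omega>
            have "ennreal ((c I r \<omega>)\<^sup>2) \<le> ennreal (1 + c I r \<omega> ^ (2 * q))" by (rule ennreal_leI[OF le1])
            also have "\<dots> = 1 + ennreal (c I r \<omega> ^ (2 * q))" by (subst ennreal_plus) (auto intro!: zero_le_even_power)
            finally show "ennreal ((c I r \<omega>)\<^sup>2) * indicator A' \<omega> \<le> indicator A' \<omega> + indicator A' \<omega> * ennreal (c I r \<omega> ^ (2 * q))"
              by (auto simp: indicator_def)
          qed
          also have "\<dots> = emeasure M A' + (\<integral>\<^sup>+\<omega>. indicator A' \<omega> * ennreal (c I r \<omega> ^ (2 * q)) \<partial>M)"
            using A'M by (subst nn_integral_add) auto
          also have "(\<integral>\<^sup>+\<omega>. indicator A' \<omega> * ennreal (c I r \<omega> ^ (2 * q)) \<partial>M)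
             = (\<integral>\<^sup>+\<omega>. indicator A' \<omega> * nn_cond_exp M (F 0) (\<lambda>x. ennreal (c I r x ^ (2 * q))) \<omega> \<partial>M)"
            using A'(1) by (intro S.nn_cond_exp_intg[symmetric]) auto
          also have "\<dots> \<le> (\<integral>\<^sup>+\<omega>. ennreal (real m) * indicator A' \<omega> \<partial>M)"
          proof (rule nn_integral_mono_AE)
            have "AE \<omega> in M. nn_cond_exp M (F 0) (\<lambda>x. ennreal (c I r x ^ (2 * q))) \<omega> \<le> ennreal (k I \<omega>)"
              by (rule k(2)[OF I]) (use r \<delta> in auto)
            then show "AE \<omega> in M. indicator A' \<omega> * nn_cond_exp M (F 0) (\<lambda>x. ennreal (c I r x ^ (2 * q))) \<omega> \<le> ennreal (real m) * indicator A' \<omega>"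
            proof eventually_elim
              case (elim \<omega>)
              show ?case
              proof (cases "\<omega> \<in> A'")
                case True
                then have "k I \<omega> \<le> real m" using A'(2) I unfolding A_def by auto
                then have "ennreal (k I \<omega>) \<le> ennreal (real m)" by (rule ennreal_leI)
                then show ?thesis using True order_trans[OF elim] by simp
              qed simp
            qed
          qed
          also have "\<dots> = ennreal (real m) * emeasure M A'" using A'M by (rule nn_integral_cmult_indicator)
          finally have "(\<integral>\<^sup>+\<omega>. ennreal ((c I r \<omega>)\<^sup>2) * indicator A' \<omega> \<partial>M) \<le> emeasure M A' + ennreal (real m) * emeasure M A'"
            by (simp add: add_left_mono)
          also have "\<dots> = ennreal (real m + 1) * emeasure M A'" by (simp add: ennreal_plus distrib_right add.commute)
          finally show "(\<integral>\<^sup>+\<omega>. ennreal ((c I r \<omega>)\<^sup>2) * indicator A' \<omega> \<partial>M) \<le> ennreal (real m + 1) * emeasure M A'" .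
        qed
      qed
    next
      \<comment> \<open>On a null set there is nothing to condition on, but both integrals
        vanish.\<close>
      case False
      have A'M: "A' \<in> sets M" using A'(1) M.subalg[of 0] by (auto simp: subalgebra_def)
      have "measure M A' = 0" using False measure_nonneg[of M A'] by linarith
      then have null: "AE \<omega> in M. \<omega> \<notin> A'"
        using A'M by (intro AE_not_in) (simp add: null_sets_def emeasure_eq_measure)
      have z: "AE \<omega> in M. indicator A' \<omega> * g \<omega> = (0::real)" for g :: "'a \<Rightarrow> real" using null by eventually_elim simp
      have fm: "f \<in> borel_measurable borel" using Cp_measurable[OF f, of 0] by simp
      have fX [measurable]: "(\<lambda>\<omega>. f (X t \<omega>)) \<in> borel_measurable M" by (rule measurable_compose[OF M.measurable_F_Q[OF X] fm])
      have ex [measurable]: "(\<lambda>\<omega>. expansion f d n c \<omega> t) \<in> borel_measurable M"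
        by (rule M.measurable_F_Q[OF expansion_measurable[OF f]]) (auto intro!: c_adapted simp: words_def)
      have ii: "integrable M (\<lambda>\<omega>. indicator A' \<omega> * g \<omega>) \<and> (\<integral>\<omega>. indicator A' \<omega> * g \<omega> \<partial>M) = 0"
        if [measurable]: "g \<in> borel_measurable M" for g :: "'a \<Rightarrow> real"
      proof
        have m: "(\<lambda>\<omega>. indicator A' \<omega> * g \<omega>) \<in> borel_measurable M" using A'M by measurable
        show "integrable M (\<lambda>\<omega>. indicator A' \<omega> * g \<omega>)"
          using integrable_cong_AE[OF m, of "\<lambda>_. 0"] z[of g] by simp
        show "(\<integral>\<omega>. indicator A' \<omega> * g \<omega> \<partial>M) = 0" using z[of g] by (rule integral_eq_zero_AE)
      qed
      show ?thesis using ii[OF fX] ii[OF ex] C0 t by simp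
    qed
    then show ?thesis using C0 by blast
  qed
  then have "\<forall>m. \<exists>C\<ge>0. \<forall>A'\<in>sets (F 0). A' \<subseteq> A m \<longrightarrow> (\<forall>t. 0 < t \<longrightarrow> t \<le> \<delta> \<longrightarrow>
        integrable M (\<lambda>\<omega>. indicator A' \<omega> * f (X t \<omega>)) \<and> integrable M (\<lambda>\<omega>. indicator A' \<omega> * expansion f d n c \<omega> t) \<and>
        \<bar>(\<integral>\<omega>. indicator A' \<omega> * f (X t \<omega>) \<partial>M) - (\<integral>\<omega>. indicator A' \<omega> * expansion f d n c \<omega> t \<partial>M)\<bar> \<le> C * sqrt t ^ Suc n * measure M A')"
    by blast
  from choice[OF this] obtain C where C: "\<And>m. C m \<ge> 0"
    "\<And>m A' t. A' \<in> sets (F 0) \<Longrightarrow> A' \<subseteq> A m \<Longrightarrow> 0 < t \<Longrightarrow> t \<le> \<delta> \<Longrightarrow>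
        integrable M (\<lambda>\<omega>. indicator A' \<omega> * f (X t \<omega>)) \<and> integrable M (\<lambda>\<omega>. indicator A' \<omega> * expansion f d n c \<omega> t) \<and>
        \<bar>(\<integral>\<omega>. indicator A' \<omega> * f (X t \<omega>) \<partial>M) - (\<integral>\<omega>. indicator A' \<omega> * expansion f d n c \<omega> t \<partial>M)\<bar> \<le> C m * sqrt t ^ Suc n * measure M A'"
    by blast
  \<comment> \<open>Positive and negative parts are conditioned separately because
    \<open>f (X t)\<close> need not be integrable; only its restriction to each \<open>A m\<close>
    is.\<close>
  define Ec where "Ec t \<omega> = enn2real (nn_cond_exp M (F 0) (\<lambda>x. ennreal (f (X t x))) \<omega>)
                     - enn2real (nn_cond_exp M (F 0) (\<lambda>x. ennreal (- f (X t x))) \<omega>)" for t \<omega>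
  have Ecm: "Ec t \<in> borel_measurable (F 0)" for t unfolding Ec_def[abs_def] by measurable
  have exm: "(\<lambda>\<omega>. expansion f d n c \<omega> t) \<in> borel_measurable (F 0)" for t
    by (rule expansion_measurable[OF f]) (auto intro!: c_adapted simp: words_def)
  have fm: "f \<in> borel_measurable borel" using Cp_measurable[OF f, of 0] by simp
  have fXm: "(\<lambda>\<omega>. f (X t \<omega>)) \<in> borel_measurable M" for t by (rule measurable_compose[OF M.measurable_F_Q[OF X] fm])
  have close: "AE \<omega> in M. \<omega> \<in> A m \<longrightarrow> \<bar>Ec t \<omega> - expansion f d n c \<omega> t\<bar> \<le> C m * sqrt t ^ Suc n" if t: "0 < t" "t \<le> \<delta>" for m t
  proof -
    define Z where "Z \<omega> = indicator (A m) \<omega> * f (X t \<omega>)" for \<omega>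
    define e where "e \<omega> = indicator (A m) \<omega> * expansion f d n c \<omega> t" for \<omega>
    note [measurable] = fXm[of t] AM[of m]
    have Ze: "integrable M Z" "integrable M e" using C(2)[OF AF order.refl t] unfolding Z_def e_def by auto
    have em: "e \<in> borel_measurable (F 0)" unfolding e_def[abs_def] using exm AF[of m] by simp
    have sub: "\<bar>(\<integral>\<omega>. indicator A' \<omega> * Z \<omega> \<partial>M) - (\<integral>\<omega>. indicator A' \<omega> * e \<omega> \<partial>M)\<bar> \<le> C m * sqrt t ^ Suc n * measure M A'" if A': "A' \<in> sets (F 0)" for A'
    proof -
      have A'M: "A' \<in> sets M" using A' M.subalg[of 0] by (auto simp: subalgebra_def)
      have i: "indicator A' \<omega> * Z \<omega> = indicator (A' \<inter> A m) \<omega> * f (X t \<omega>)" "indicator A' \<omega> * e \<omega> = indicator (A' \<inter> A m) \<omega> * expansion f d n c \<omega> t" for \<omega>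
        by (auto simp: Z_def e_def indicator_def)
      have "\<bar>(\<integral>\<omega>. indicator A' \<omega> * Z \<omega> \<partial>M) - (\<integral>\<omega>. indicator A' \<omega> * e \<omega> \<partial>M)\<bar> \<le> C m * sqrt t ^ Suc n * measure M (A' \<inter> A m)"
        unfolding i using C(2)[of "A' \<inter> A m" m t] A' AF t by auto
      also have "\<dots> \<le> C m * sqrt t ^ Suc n * measure M A'"
        using C(1)[of m] t A'M by (intro mult_left_mono finite_measure_mono mult_nonneg_nonneg) auto
      finally show ?thesis .
    qed
    have u: "AE \<omega> in M. real_cond_exp M (F 0) Z \<omega> - e \<omega> \<le> C m * sqrt t ^ Suc n"
      by (rule S.real_cond_exp_diff_le[OF Ze em]) (use sub in \<open>auto dest: abs_le_D1\<close>)
    have nZ: "integrable M (\<lambda>\<omega>. - Z \<omega>)" "integrable M (\<lambda>\<omega>. - e \<omega>)" "(\<lambda>\<omega>. - e \<omega>) \<in> borel_measurable (F 0)" using Ze em by auto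
    \<comment> \<open>The one-sided comparison, applied to the negatives, gives the lower
      bound.\<close>
    have l: "AE \<omega> in M. real_cond_exp M (F 0) (\<lambda>\<omega>. - Z \<omega>) \<omega> - (- e \<omega>) \<le> C m * sqrt t ^ Suc n"
    proof (rule S.real_cond_exp_diff_le[OF nZ])
      fix A' assume "A' \<in> sets (F 0)"
      from sub[OF this] show "(\<integral>\<omega>. indicator A' \<omega> * - Z \<omega> \<partial>M) - (\<integral>\<omega>. indicator A' \<omega> * - e \<omega> \<partial>M) \<le> C m * sqrt t ^ Suc n * measure M A'"
        by (simp only: mult_minus_right Bochner_Integration.integral_minus)
    qed
    have neg: "AE \<omega> in M. real_cond_exp M (F 0) (\<lambda>\<omega>. - Z \<omega>) \<omega> = - real_cond_exp M (F 0) Z \<omega>"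
      using S.real_cond_exp_cmult[OF Ze(1), of "-1"] by simp
    \<comment> \<open>The indicator of \<open>A m\<close> is known at time 0 and can be pulled out
      of each part; on \<open>A m\<close> the generalised conditional expectation thus equals the
      ordinary one of the localised variable Z.\<close>
    have ind: "(\<lambda>\<omega>. indicator (A m) \<omega> :: ennreal) \<in> borel_measurable (F 0)" using AF[of m] by simp
    have pos: "AE \<omega> in M. indicator (A m) \<omega> * nn_cond_exp M (F 0) (\<lambda>x. ennreal (f (X t x))) \<omega> = nn_cond_exp M (F 0) (\<lambda>x. indicator (A m) x * ennreal (f (X t x))) \<omega>"
      "AE \<omega> in M. indicator (A m) \<omega> * nn_cond_exp M (F 0) (\<lambda>x. ennreal (- f (X t x))) \<omega> = nn_cond_exp M (F 0) (\<lambda>x. indicator (A m) x * ennreal (- f (X t x))) \<omega>"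
      by (intro S.nn_cond_exp_prod ind; simp)+
    have zz: "(\<lambda>x. indicator (A m) x * ennreal (f (X t x))) = (\<lambda>x. ennreal (Z x))" "(\<lambda>x. indicator (A m) x * ennreal (- f (X t x))) = (\<lambda>x. ennreal (- Z x))"
      by (auto simp: Z_def indicator_def fun_eq_iff)
    have "AE \<omega> in M. \<omega> \<in> A m \<longrightarrow> Ec t \<omega> = real_cond_exp M (F 0) Z \<omega>"
      using pos unfolding zz
    proof eventually_elim
      case (elim \<omega>)
      then show ?case by (auto simp: Ec_def real_cond_exp_def)
    qed
    then show ?thesis using u l neg
    proof eventually_elim
      case (elim \<omega>)
      show ?case
      proof
        assume "\<omega> \<in> A m"
        then have "Ec t \<omega> = real_cond_exp M (F 0) Z \<omega>" "e \<omega> = expansion f d n c \<omega> t" using elim(1) by (auto simp: e_def)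
        then show "\<bar>Ec t \<omega> - expansion f d n c \<omega> t\<bar> \<le> C m * sqrt t ^ Suc n" using elim(2,3,4) by linarith
      qed
    qed
  qed
  \<comment> \<open>The first level whose set contains \<omega>. It provides a finite random
    constant \<open>C (lev \<omega>)\<close>, known at time 0, in place of one constant per level,
    so that the exceptional set for the new version of the conditional expectation is
    measurable.\<close>
  define lev where "lev \<omega> = (LEAST m. (\<forall>I\<in>words d n. \<bar>c I 0 \<omega>\<bar> \<le> real m) \<and> (\<forall>I\<in>?W1. k I \<omega> \<le> real m))" for \<omega>
  have lev_m: "lev \<in> measurable (F 0) (count_space UNIV)"
    unfolding lev_def[abs_def] by (rule measurable_Least) (rule pA)
  have lev: "\<omega> \<in> A (lev \<omega>)" if \<omega>: "\<omega> \<in> space M" for \<omega>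
  proof -
    obtain m where "\<omega> \<in> A m" using exA[OF \<omega>] by blast
    then have "(\<forall>I\<in>words d n. \<bar>c I 0 \<omega>\<bar> \<le> real m) \<and> (\<forall>I\<in>?W1. k I \<omega> \<le> real m)" unfolding A_def by blast
    then have "(\<forall>I\<in>words d n. \<bar>c I 0 \<omega>\<bar> \<le> real (lev \<omega>)) \<and> (\<forall>I\<in>?W1. k I \<omega> \<le> real (lev \<omega>))"
      unfolding lev_def by (rule LeastI)
    then show ?thesis using \<omega> unfolding A_def by blast
  qed
  have Clev: "(\<lambda>\<omega>. C (lev \<omega>)) \<in> borel_measurable (F 0)" by (rule measurable_compose[OF lev_m]) simp
  \<comment> \<open>The estimate holds almost surely for each \<open>t\<close> only; changing the version on these null sets
    makes it hold for all \<open>t\<close> simultaneously.\<close>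
  define E where "E t \<omega> = (if t \<le> \<delta> \<and> \<not> \<bar>Ec t \<omega> - expansion f d n c \<omega> t\<bar> \<le> C (lev \<omega>) * sqrt t ^ Suc n
      then expansion f d n c \<omega> t else Ec t \<omega>)" for t \<omega>
  have Em: "E t \<in> borel_measurable (F 0)" for t
  proof -
    note [measurable] = Ecm[of t] exm[of t] Clev
    show ?thesis unfolding E_def[abs_def] by measurable
  qed
  have EEc: "AE \<omega> in M. E t \<omega> = Ec t \<omega>" if "0 < t" for t
  proof (cases "t \<le> \<delta>")
    case True
    have "AE \<omega> in M. \<forall>m. \<omega> \<in> A m \<longrightarrow> \<bar>Ec t \<omega> - expansion f d n c \<omega> t\<bar> \<le> C m * sqrt t ^ Suc n"
      using close[OF that True] by (subst AE_all_countable) blast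
    then show ?thesis using AE_space
    proof eventually_elim
      case (elim \<omega>)
      then show ?case using lev[of \<omega>] by (auto simp: E_def)
    qed
  qed (simp add: E_def)
  show ?thesis
  proof (intro exI[of _ E] conjI ballI)
    fix t assume "t \<in> {0<..T}"
    then have "AE \<omega> in M. E t \<omega> = Ec t \<omega>" by (intro EEc) simp
    then show "cond_exp_version M (F 0) (\<lambda>\<omega>. f (X t \<omega>)) (E t)"
      unfolding cond_exp_version_def using Em Ec_def by simp
  next
    show "AE \<omega> in M. (\<lambda>t. E t \<omega> - expansion f d n c \<omega> t) \<in> o[at_right 0](\<lambda>t. t powr (real n / 2))"
    proof (rule AE_I2)
      fix \<omega> assume "\<omega> \<in> space M"
      show "(\<lambda>t. E t \<omega> - expansion f d n c \<omega> t) \<in> o[at_right 0](\<lambda>t. t powr (real n / 2))"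
        by (rule smallo_of_sqrt_power_bound[OF \<delta>(1), where C="C (lev \<omega>)"])
           (use C(1)[of "lev \<omega>"] in \<open>auto simp: E_def\<close>)
    qed
  qed
qed

end
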